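(* Let $M,N,q$ be positive integers, $A=\mathbb{C}[t_1^{\pm1},\dots,t_q^{\pm1}]$, and let $T$ (a Lie superalgebra isomorphic to $\mathfrak{gl}(M|N)$, with basis $T_{ij}$, $1\le i,j\le M+N$), the toroidal superalgebra $\tau=T\otimes A\oplus \Omega_A/d_A$, the space $V[\overline\Gamma]\otimes\mathfrak F$ and the operators $X_n(\alpha)$, $T^{\alpha}_n(\delta_{\underline m})$, $S^{\underline m}_{ij}(n)$ on it be as defined in the context. For $\overline m=(\underline m,m_q)$, $\overline n=(\underline n,n_q)\in\mathbb{Z}^{q}=\mathbb{Z}^{q-1}\times\mathbb{Z}$, the assignments $$T_{ij}\otimes t^{\overline m}\mapsto X_{m_q}(\alpha_{ij}+\delta_{\underline m})\quad(1\le i\ne j\le M),$$ $$T_{ii}\otimes t^{\overline m}\mapsto T^{e_i}_{m_q}(\delta_{\underline m})\quad(1\le i\le M),$$ $$T_{ij}\otimes t^{\overline m}\mapsto S^{\underline m}_{ij}(m_q)\quad(\text{if at least one of } i,j \text{ is } >M),$$ $$d(t^{\overline m})t^{\overline n}\mapsto m_q\,X_{m_q+n_q}(\delta_{\underline m+\underline n})+T^{\delta_{\underline m}}_{m_q+n_q}(\delta_{\underline m+\underline n})$$ define (by linear extension) a representation of the Lie superalgebra $\tau$ on $V[\overline\Gamma]\otimes\mathfrak F$.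
   Context: **Lattices and cocycle.** $\overline\Gamma$ is the free $\mathbb Z$-module on $e_1,\dots,e_M,\delta_1,\dots,\delta_{q-1},d_1,\dots,d_{q-1}$ with symmetric bilinear form $(e_i,e_j)=\delta_{ij}$, $(\delta_i,d_j)=\delta_{ij}$, and $(e_i,\delta_j)=(e_i,d_j)=(\delta_i,\delta_j)=(d_i,d_j)=0$ (here $\delta_{ij}$ with two indices is the Kronecker delta). $\Gamma=\oplus_{i=1}^M\mathbb Ze_i$; $Q$ is the sublattice spanned by $e_1,\dots,e_M,\delta_1,\dots,\delta_{q-1}$. Put $\alpha_{ij}=e_i-e_j$ and, for $\underline m=(m_1,\dots,m_{q-1})\in\mathbb Z^{q-1}$, $\delta_{\underline m}=\sum_{i=1}^{q-1}m_i\delta_i$. $F:\Gamma\times\Gamma\to\{\pm1\}$ is the bimultiplicative map with $F(e_i,e_j)=1$ if $i\le j$ and $-1$ if $i>j$. It is extended to $Q\times Q$ bimultiplicatively by $F(e_i,\delta_k)=F(\delta_k,e_i)=F(\delta_k,\delta_l)=1$, and then in any way to a bimultiplicative map $F:Q\times\overline\Gamma\to\{\pm1\}$. **The Lie superalgebra $T$.** $T$ has basis $T_{ij}$, $1\le i,j\le M+N$; $T_{ij}$ is even if $i,j\le M$ or $i,j>M$, and odd otherwise. The superbracket satisfies $[Y,X]=-(-1)^{|X||Y|}[X,Y]$ and is given as follows. (T1) For $1\le i,j,k,l\le M$: if $i\ne j$, $k\neq l$, then $[T_{ij},T_{kl}]$ equals $0$ if $(\alpha_{ij},\alpha_{kl})\ge0$;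 $F(\alpha_{ij},\alpha_{kl})T_{il}$ if $j=k$, $l\ne i$; $F(\alpha_{ij},\alpha_{kl})T_{kj}$ if $l=i$, $j\ne k$; $F(\alpha_{ij},\alpha_{kl})(T_{ii}-T_{jj})$ if $l=i$, $j=k$. Moreover $[T_{ii},T_{kl}]=(e_i,\alpha_{kl})T_{kl}$ for $k\ne l$, and $[T_{ii},T_{kk}]=0$. (T2) For $1\le i,j,k,l\le N$: $[T_{i+M,j+M},T_{k+M,l+M}]=\delta_{jk}T_{i+M,l+M}-\delta_{il}T_{k+M,j+M}$. (T3) For $1\le i,j,l\le M$, $1\le k\le N$: $[T_{ij},T_{k+M,l}]=\delta_{il}F(e_j,e_i)T_{k+M,j}$ if $i\neq j$, and $[T_{ii},T_{k+M,l}]=-\delta_{il}T_{k+M,l}$. (T4) For $1\le i,j,k\le M$, $1\le l\le N$: $[T_{ij},T_{k,l+M}]=\delta_{jk}F(e_i,e_j)T_{i,l+M}$. (T5) For $1\le i,j,k\le N$, $1\le l\le M$: $[T_{i+M,j+M},T_{k+M,l}]=\delta_{jk}T_{i+M,l}$. (T6) For $1\le i,j,l\le N$, $1\le k\le M$: $[T_{i+M,j+M},T_{k,l+M}]=-\delta_{li}T_{k,j+M}$. (T7) For $1\le i,l\le N$, $1\le j,k\le M$: $[T_{i+M,j},T_{k,l+M}]=\delta_{jk}T_{i+M,l+M}+F(e_k,e_j)\delta_{li}T_{kj}$. (T8)–(T10) The brackets $[T_{ij},T_{k+M,l+M}]$ ($i,j\le M$; $k,l\le N$), $[T_{i+M,j},T_{k+M,l}]$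 ($i,k\le N$; $j,l\le M$) and $[T_{i,j+M},T_{k,l+M}]$ ($i,k\le M$; $j,l\le N$) are $0$. ($T\cong\mathfrak{gl}(M|N)$.) The bilinear form $(\,,)_T$ (supersymmetric, invariant, even) is: $(T_{ij},T_{kl})_T=F(\alpha_{ij},\alpha_{kl})\delta_{jk}\delta_{li}$ for $i,j,k,l\le M$ (with $\alpha_{ii}=0$); $(T_{i+M,j},T_{k,l+M})_T=-\delta_{jk}\delta_{li}$ and $(T_{k,l+M},T_{i+M,j})_T=\delta_{jk}\delta_{li}$ for $j,k\le M$, $i,l\le N$; $(T_{i+M,j+M},T_{k+M,l+M})_T=-\delta_{jk}\delta_{li}$ for $i,j,k,l\le N$; all other pairings of basis vectors are $0$. **The toroidal superalgebra $\tau$.** For $\overline m\in\mathbb Z^q$, $t^{\overline m}=t_1^{m_1}\cdots t_q^{m_q}$. $\Omega_A$ is the vector space with basis the symbols $t^{\overline m}K_i$ ($\overline m\in\mathbb Z^q$, $1\le i\le q$), and $d_A$ is the subspace spanned by all $\sum_i m_it^{\overline m}K_i$. Put $d(t^{\overline m})t^{\overline n}=\sum_{i=1}^q m_it^{\overline m+\overline n}K_i\in\Omega_A/d_A$; such elements span $\Omega_A/d_A$. Then $\tau=T\otimes A\oplus\Omega_A/d_A$ with $\Omega_A/d_A$ even and central and $[X\otimes t^{\overline m},Y\otimes t^{\overline n}]=[X,Y]\otimes t^{\overline m+\overline n}+(X,Y)_T\,d(t^{\overline m})t^{\overline n}$. **Fock space $V[\overline\Gamma]$.** Let $\overline{\mathfrak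 h}=\mathbb C\otimes_{\mathbb Z}\overline\Gamma$; the Heisenberg algebra is $\oplus_{k\in\mathbb Z}\overline{\mathfrak h}(k)\oplus\mathbb CK$, each $\overline{\mathfrak h}(k)$ a copy of $\overline{\mathfrak h}$ via $\alpha\mapsto\alpha(k)$, with $[\alpha(k),\beta(m)]=k(\alpha,\beta)\delta_{k+m,0}K$ and $K$ central. Let $\overline{\mathfrak h}_-=\oplus_{k<0}\overline{\mathfrak h}(k)$ and $V[\overline\Gamma]=\mathbb C[\overline\Gamma]\otimes S(\overline{\mathfrak h}_-)$, where $\mathbb C[\overline\Gamma]$ has basis $e^\gamma$, $\gamma\in\overline\Gamma$. For $m>0$, $\alpha(-m)$ acts on $S(\overline{\mathfrak h}_-)$ by multiplication and $\alpha(m)$ as the derivation with $\beta(-n)\mapsto\delta_{m,n}m(\alpha,\beta)$; $\alpha(0)(e^\gamma\otimes u)=(\alpha,\gamma)e^\gamma\otimes u$; $K=1$. For $\alpha\in Q$, $e^\alpha(e^\gamma\otimes u)=F(\alpha,\gamma)e^{\alpha+\gamma}\otimes u$, and $z^{\alpha(0)}(e^\gamma\otimes u)=z^{(\alpha,\gamma)}e^\gamma\otimes u$. **Vertex operators.** $T_\pm(\alpha,z)=-\sum_{n\in\mathbb Z,\,\pm n>0}\frac1n\alpha(n)z^{-n}$, and for $\alpha\in Q$, $Y(\alpha,z)=e^\alpha z^{\alpha(0)}\exp T_-(\alpha,z)\exp T_+(\alpha,z)$. If $(\alpha,\alpha)$ is even, $X(\alpha,z)=z^{(\alpha,\alpha)/2}Y(\alpha,z)=\sum_{n\in\mathbb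 Z}X_n(\alpha)z^{-n}$; if $(\alpha,\alpha)$ is odd, $X(\alpha,z)=Y(\alpha,z)=\sum_{n\in\mathbb Z}X_{n-\frac12}(\alpha)z^{-n}$. Put $\alpha(z)=\sum_n\alpha(n)z^{-n-1}$ and $\alpha(z)X(\delta_{\underline m},z)=\sum_nT^\alpha_n(\delta_{\underline m})z^{-n-1}$, i.e. $T^\alpha_n(\delta_{\underline m})=\sum_{k}\alpha(k)X_{n-k}(\delta_{\underline m})$ (used for $\alpha\in Q$). **Bosons.** $\mathfrak F$ is the Fock space with vacuum $|0\rangle$ for operators $\varphi^j_{r-\frac12},\varphi^{j*}_{r-\frac12}$ ($1\le j\le N$, $r\in\mathbb Z$) such that the $\varphi$'s commute among themselves, the $\varphi^*$'s commute among themselves, $\varphi^i_{r-\frac12}\varphi^{j*}_{s-\frac12}-\varphi^{j*}_{s-\frac12}\varphi^i_{r-\frac12}=-\delta_{r+s-1,0}\delta_{ij}$, those with $r,s>0$ annihilate $|0\rangle$, and those with $r,s\le0$ act freely and generate $\mathfrak F$ from $|0\rangle$. Let $\varphi^j(z)=\sum_r\varphi^j_{r-\frac12}z^{-r}$, $\varphi^{j*}(z)=\sum_r\varphi^{j*}_{r-\frac12}z^{-r}$; $:\varphi^i_{r-\frac12}\varphi^{j*}_{s-\frac12}:$ is $\varphi^i_{r-\frac12}\varphi^{j*}_{s-\frac12}$ if $r\le s$ and $\varphi^{j*}_{s-\frac12}\varphi^i_{r-\frac12}$ if $r>s$. **Operators on $V[\overline\Gamma]\otimes\mathfrak F$.**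 Vertex operators act on the first factor, bosons on the second. The $\mathbb Z_2$-grading: $e^\gamma\otimes u\otimes v$ has parity $(\gamma,\gamma)$ mod $2$. For $1\le i\le M$, $1\le j\le N$: $S_{i,j+M}(z)=X(e_i,z)\varphi^{j*}(z)$, $S_{j+M,i}(z)=X(-e_i,z)\varphi^j(z)$; for $1\le i,j\le N$: $S_{i+M,j+M}(z)=:\varphi^i(z)\varphi^{j*}(z):$. Put $S^{\underline m}_{ij}(z)=S_{ij}(z)X(\delta_{\underline m},z)=\sum_{n\in\mathbb Z}S^{\underline m}_{ij}(n)z^{-n-1}$. A representation of a Lie superalgebra is a parity-preserving linear map to endomorphisms taking the superbracket to the supercommutator $[X,Y]=XY-(-1)^{|X||Y|}YX$. *)

theory Defs
  imports Complex_Main "HOL-Library.Poly_Mapping"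
begin

section \<open>Free complex vector spaces\<close>

text \<open>
  The complex vector space with basis \<open>'b\<close> is the type of finitely supported functions;
  the basis vector of \<open>b\<close> is \<open>single b 1\<close>. Spaces whose basis depends on the numbers
  \<open>M\<close>, \<open>N\<close>, \<open>q\<close> are subspaces \<open>spanned_by B\<close> of such a type.
\<close>

abbreviation "single \<equiv> Poly_Mapping.single"
abbreviation "lookup \<equiv> Poly_Mapping.lookup"
abbreviation "keys \<equiv> Poly_Mapping.keys"

type_synonym 'b cvec = "'b \<Rightarrow>\<^sub>0 complex"

definition scale :: "complex \<Rightarrow> 'b cvec \<Rightarrow> 'b cvec" (infixr "\<cdot>" 75) where
  "c \<cdot> v = Poly_Mapping.map ((*) c) v"

lemma lookup_scale [simp]: "lookup (c \<cdot> v) b = c * lookup v b"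
  unfolding scale_def by transfer (simp add: when_def)

interpretation cvec: vector_space "scale :: complex \<Rightarrow> 'b cvec \<Rightarrow> 'b cvec"
  by unfold_locales (auto intro!: poly_mapping_eqI simp: lookup_add algebra_simps)

definition spanned_by :: "'b set \<Rightarrow> 'b cvec set" where
  "spanned_by B = {v. keys v \<subseteq> B}"

definition lin_ext :: "('a \<Rightarrow> 'b cvec) \<Rightarrow> 'a cvec \<Rightarrow> 'b cvec" where
  "lin_ext f v = (\<Sum>a\<in>keys v. lookup v a \<cdot> f a)"

definition bilin_ext :: "('a \<Rightarrow> 'a \<Rightarrow> 'b cvec) \<Rightarrow> 'a cvec \<Rightarrow> 'a cvec \<Rightarrow> 'b cvec" where
  "bilin_ext f x y = (\<Sum>a\<in>keys x. \<Sum>b\<in>keys y. (lookup x a * lookup y b) \<cdot> f a b)"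

definition tensor :: "'a cvec \<Rightarrow> 'b cvec \<Rightarrow> ('a \<times> 'b) cvec" where
  "tensor v w = (\<Sum>a\<in>keys v. \<Sum>b\<in>keys w. single (a, b) (lookup v a * lookup w b))"

definition op_tensor ::
  "('a cvec \<Rightarrow> 'a cvec) \<Rightarrow> ('b cvec \<Rightarrow> 'b cvec) \<Rightarrow> ('a \<times> 'b) cvec \<Rightarrow> ('a \<times> 'b) cvec" where
  "op_tensor A B = lin_ext (\<lambda>(a, b). tensor (A (single a 1)) (B (single b 1)))"

text \<open>
  The symmetric algebra on a space with basis \<open>'v\<close> is the polynomial ring in the variables
  \<open>'v\<close>: its basis consists of the monomials \<open>'v \<Rightarrow>\<^sub>0 nat\<close>, and its product is the one of the
  library on \<open>('v \<Rightarrow>\<^sub>0 nat) \<Rightarrow>\<^sub>0 complex\<close>. \<open>derivation c\<close> is the derivation sending each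
  variable \<open>v\<close> to the constant \<open>c v\<close>.
\<close>

type_synonym 'v sym_alg = "('v \<Rightarrow>\<^sub>0 nat) cvec"

definition variable :: "'v \<Rightarrow> 'v sym_alg" where
  "variable v = single (single v 1) 1"

definition derivation :: "('v \<Rightarrow> complex) \<Rightarrow> 'v sym_alg \<Rightarrow> 'v sym_alg" where
  "derivation c = lin_ext (\<lambda>\<mu>. \<Sum>v\<in>keys \<mu>. single (\<mu> - single v 1) (of_nat (lookup \<mu> v) * c v))"

section \<open>Formal series of operators\<close>

text \<open>
  A series \<open>\<Sum>\<^sub>n A\<^sub>n z\<^sup>n\<close> of operators is the function \<open>n \<mapsto> A\<^sub>n\<close>, with \<open>n\<close> the exponent of \<open>z\<close>
  (modes are indexed by the negative of the exponent, up to a shift). The infinite sums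
  of operators are pointwise: on each vector only finitely many terms are nonzero,
  and \<open>Sum_any\<close> adds those.
\<close>

type_synonym 'b op_series = "int \<Rightarrow> 'b cvec \<Rightarrow> 'b cvec"

definition ser_const :: "('b cvec \<Rightarrow> 'b cvec) \<Rightarrow> 'b op_series" where
  "ser_const A = (\<lambda>n v. if n = 0 then A v else 0)"

definition ser_mult :: "'b op_series \<Rightarrow> 'b op_series \<Rightarrow> 'b op_series" (infixr "\<star>" 70) where
  "A \<star> B = (\<lambda>n v. Sum_any (\<lambda>k. A k (B (n - k) v)))"

primrec ser_power :: "'b op_series \<Rightarrow> nat \<Rightarrow> 'b op_series" where
  "ser_power A 0 = ser_const id"
| "ser_power A (Suc k) = A \<star> ser_power A k"

definition ser_exp :: "'b op_series \<Rightarrow> 'b op_series" where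
  "ser_exp A = (\<lambda>n v. Sum_any (\<lambda>k. (1 / fact k) \<cdot> ser_power A k n v))"

definition ser_shift :: "int \<Rightarrow> 'b op_series \<Rightarrow> 'b op_series" where
  "ser_shift s A = (\<lambda>n. A (n - s))"

definition on_first :: "'a op_series \<Rightarrow> ('a \<times> 'b) op_series" where
  "on_first A = (\<lambda>n. op_tensor (A n) id)"

definition on_second :: "'b op_series \<Rightarrow> ('a \<times> 'b) op_series" where
  "on_second A = (\<lambda>n. op_tensor id (A n))"

section \<open>Lattices and cocycle\<close>

datatype gen = Gen_e nat | Gen_delta nat | Gen_d nat

type_synonym lat = "gen \<Rightarrow>\<^sub>0 int"

fun gen_form :: "gen \<Rightarrow> gen \<Rightarrow> int" where
  "gen_form (Gen_e i) (Gen_e j) = of_bool (i = j)"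
| "gen_form (Gen_delta i) (Gen_d j) = of_bool (i = j)"
| "gen_form (Gen_d i) (Gen_delta j) = of_bool (i = j)"
| "gen_form _ _ = 0"

definition lat_form :: "lat \<Rightarrow> lat \<Rightarrow> int" where
  "lat_form \<alpha> \<beta> = (\<Sum>g\<in>keys \<alpha>. \<Sum>h\<in>keys \<beta>. lookup \<alpha> g * lookup \<beta> h * gen_form g h)"

definition gens_Q :: "nat \<Rightarrow> nat \<Rightarrow> gen set" where
  "gens_Q M q = Gen_e ` {1..M} \<union> Gen_delta ` {1..q-1}"

definition gens :: "nat \<Rightarrow> nat \<Rightarrow> gen set" where
  "gens M q = gens_Q M q \<union> Gen_d ` {1..q-1}"

definition Q_lat :: "nat \<Rightarrow> nat \<Rightarrow> lat set" where
  "Q_lat M q = {\<alpha>. keys \<alpha> \<subseteq> gens_Q M q}"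

definition Gamma_bar :: "nat \<Rightarrow> nat \<Rightarrow> lat set" where
  "Gamma_bar M q = {\<gamma>. keys \<gamma> \<subseteq> gens M q}"

definition e_vec :: "nat \<Rightarrow> lat" where
  "e_vec i = single (Gen_e i) 1"

definition delta_vec :: "nat \<Rightarrow> lat" where
  "delta_vec i = single (Gen_delta i) 1"

definition alpha :: "nat \<Rightarrow> nat \<Rightarrow> lat" where
  "alpha i j = e_vec i - e_vec j"

definition cocycle :: "nat \<Rightarrow> nat \<Rightarrow> (lat \<Rightarrow> lat \<Rightarrow> int) \<Rightarrow> bool" where
  "cocycle M q F \<longleftrightarrow>
     (\<forall>\<alpha>\<in>Q_lat M q. \<forall>\<gamma>\<in>Gamma_bar M q. F \<alpha> \<gamma> \<in> {1, -1}) \<and>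
     (\<forall>\<alpha>\<in>Q_lat M q. \<forall>\<beta>\<in>Q_lat M q. \<forall>\<gamma>\<in>Gamma_bar M q. F (\<alpha> + \<beta>) \<gamma> = F \<alpha> \<gamma> * F \<beta> \<gamma>) \<and>
     (\<forall>\<alpha>\<in>Q_lat M q. \<forall>\<beta>\<in>Gamma_bar M q. \<forall>\<gamma>\<in>Gamma_bar M q. F \<alpha> (\<beta> + \<gamma>) = F \<alpha> \<beta> * F \<alpha> \<gamma>) \<and>
     (\<forall>i\<in>{1..M}. \<forall>j\<in>{1..M}. F (e_vec i) (e_vec j) = (if i \<le> j then 1 else -1)) \<and>
     (\<forall>i\<in>{1..M}. \<forall>k\<in>{1..q-1}. F (e_vec i) (delta_vec k) = 1 \<and> F (delta_vec k) (e_vec i) = 1) \<and>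
     (\<forall>k\<in>{1..q-1}. \<forall>l\<in>{1..q-1}. F (delta_vec k) (delta_vec l) = 1)"

section \<open>The Lie superalgebra \<open>T\<close>\<close>

text \<open>The pair \<open>(i, j)\<close> stands for the basis element \<open>T\<^sub>i\<^sub>j\<close>, with \<open>1 \<le> i, j \<le> M + N\<close>.\<close>

type_synonym T_index = "nat \<times> nat"

definition T_indices :: "nat \<Rightarrow> nat \<Rightarrow> T_index set" where
  "T_indices M N = {1..M+N} \<times> {1..M+N}"

definition T_parity :: "nat \<Rightarrow> T_index \<Rightarrow> nat" where
  "T_parity M = (\<lambda>(i, j). if (i \<le> M) = (j \<le> M) then 0 else 1)"

definition T_basis :: "nat \<Rightarrow> nat \<Rightarrow> T_index cvec" where
  "T_basis i j = single (i, j) 1"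

text \<open>
  The brackets of basis elements, for one order of the arguments; \<open>None\<close> marks the orders
  left to super skew-symmetry. Indices greater than \<open>M\<close> are not shifted by \<open>M\<close>,
  which does not affect the Kronecker deltas.
\<close>

definition T_listed ::
  "nat \<Rightarrow> (lat \<Rightarrow> lat \<Rightarrow> int) \<Rightarrow> T_index \<Rightarrow> T_index \<Rightarrow> T_index cvec option" where
  "T_listed M F = (\<lambda>(i, j) (k, l).
     if i \<le> M \<and> j \<le> M \<and> k \<le> M \<and> l \<le> M then
       (if i \<noteq> j \<and> k \<noteq> l then Some (
          if lat_form (alpha i j) (alpha k l) \<ge> 0 then 0
          else if j = k \<and> l \<noteq> i then of_int (F (alpha i j) (alpha k l)) \<cdot> T_basis i l
          else if l = i \<and> j \<noteq> k then of_int (F (alpha i j) (alpha k l)) \<cdot> T_basis k j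
          else of_int (F (alpha i j) (alpha k l)) \<cdot> (T_basis i i - T_basis j j))
        else if i = j \<and> k \<noteq> l then Some (of_int (lat_form (e_vec i) (alpha k l)) \<cdot> T_basis k l)
        else if i = j \<and> k = l then Some 0
        else None)
     else if i > M \<and> j > M \<and> k > M \<and> l > M then
       Some (of_bool (j = k) \<cdot> T_basis i l - of_bool (i = l) \<cdot> T_basis k j)
     else if i \<le> M \<and> j \<le> M \<and> k > M \<and> l \<le> M then
       Some (if i \<noteq> j then (of_bool (i = l) * of_int (F (e_vec j) (e_vec i))) \<cdot> T_basis k j
             else - (of_bool (i = l) \<cdot> T_basis k l))
     else if i \<le> M \<and> j \<le> M \<and> k \<le> M \<and> l > M then
       Some ((of_bool (j = k) * of_int (F (e_vec i) (e_vec j))) \<cdot> T_basis i l)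
     else if i > M \<and> j > M \<and> k > M \<and> l \<le> M then
       Some (of_bool (j = k) \<cdot> T_basis i l)
     else if i > M \<and> j > M \<and> k \<le> M \<and> l > M then
       Some (- (of_bool (l = i) \<cdot> T_basis k j))
     else if i > M \<and> j \<le> M \<and> k \<le> M \<and> l > M then
       Some (of_bool (j = k) \<cdot> T_basis i l
             + (of_int (F (e_vec k) (e_vec j)) * of_bool (l = i)) \<cdot> T_basis k j)
     else if i \<le> M \<and> j \<le> M \<and> k > M \<and> l > M then Some 0
     else if i > M \<and> j \<le> M \<and> k > M \<and> l \<le> M then Some 0
     else if i \<le> M \<and> j > M \<and> k \<le> M \<and> l > M then Some 0
     else None)"

definition T_bracket ::
  "nat \<Rightarrow> (lat \<Rightarrow> lat \<Rightarrow> int) \<Rightarrow> T_index \<Rightarrow> T_index \<Rightarrow> T_index cvec" where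
  "T_bracket M F x y =
     (case T_listed M F x y of
        Some v \<Rightarrow> v
      | None \<Rightarrow> (- ((-1) ^ (T_parity M x * T_parity M y))) \<cdot> the (T_listed M F y x))"

definition T_form :: "nat \<Rightarrow> (lat \<Rightarrow> lat \<Rightarrow> int) \<Rightarrow> T_index \<Rightarrow> T_index \<Rightarrow> complex" where
  "T_form M F = (\<lambda>(i, j) (k, l).
     if i \<le> M \<and> j \<le> M \<and> k \<le> M \<and> l \<le> M then
       of_int (F (alpha i j) (alpha k l)) * of_bool (j = k \<and> l = i)
     else if i > M \<and> j \<le> M \<and> k \<le> M \<and> l > M then - of_bool (j = k \<and> l = i)
     else if i \<le> M \<and> j > M \<and> k > M \<and> l \<le> M then of_bool (j = k \<and> l = i)
     else if i > M \<and> j > M \<and> k > M \<and> l > M then - of_bool (j = k \<and> l = i)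
     else 0)"

section \<open>The toroidal superalgebra\<close>

text \<open>
  Exponents \<open>m \<in> \<int>\<^sup>q\<close> are finitely supported functions on \<open>{1..q}\<close>. The basis element
  \<open>T\<^sub>i\<^sub>j \<otimes> t\<^sup>m\<close> of \<open>T \<otimes> A\<close> is indexed by \<open>((i, j), m)\<close>, the symbol \<open>t\<^sup>m K\<^sub>i\<close> by \<open>(m, i)\<close>.
\<close>

type_synonym expo = "nat \<Rightarrow>\<^sub>0 int"

definition expos :: "nat \<Rightarrow> expo set" where
  "expos q = {m. keys m \<subseteq> {1..q}}"

type_synonym TA = "(T_index \<times> expo) cvec"
type_synonym Omega = "(expo \<times> nat) cvec"

definition TA_space :: "nat \<Rightarrow> nat \<Rightarrow> nat \<Rightarrow> TA set" where
  "TA_space M N q = spanned_by (T_indices M N \<times> expos q)"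

definition Omega_space :: "nat \<Rightarrow> Omega set" where
  "Omega_space q = spanned_by (expos q \<times> {1..q})"

definition dtt_rep :: "nat \<Rightarrow> expo \<Rightarrow> expo \<Rightarrow> Omega" where
  "dtt_rep q m n = (\<Sum>i\<in>{1..q}. single (m + n, i) (of_int (lookup m i)))"

definition d_A :: "nat \<Rightarrow> Omega set" where
  "d_A q = cvec.span ((\<lambda>m. dtt_rep q m 0) ` expos q)"

text \<open>The quotient by a subspace \<open>D\<close> consists of cosets.\<close>

definition coset :: "'b cvec set \<Rightarrow> 'b cvec \<Rightarrow> 'b cvec set" where
  "coset D x = {y. y - x \<in> D}"

definition coset_add :: "'b cvec set \<Rightarrow> 'b cvec set \<Rightarrow> 'b cvec set \<Rightarrow> 'b cvec set" where
  "coset_add D X Y = (\<Union>x\<in>X. \<Union>y\<in>Y. coset D (x + y))"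

definition coset_scale :: "'b cvec set \<Rightarrow> complex \<Rightarrow> 'b cvec set \<Rightarrow> 'b cvec set" where
  "coset_scale D c X = (\<Union>x\<in>X. coset D (c \<cdot> x))"

record 'a super_bracket_space =
  carrier :: "'a set"
  add :: "'a \<Rightarrow> 'a \<Rightarrow> 'a"
  smult :: "complex \<Rightarrow> 'a \<Rightarrow> 'a"
  bracket :: "'a \<Rightarrow> 'a \<Rightarrow> 'a"
  homogeneous :: "nat \<Rightarrow> 'a set" \<comment> \<open>component of parity 0 or 1\<close>

type_synonym tau = "TA \<times> Omega set"

definition tau_bracket :: "nat \<Rightarrow> nat \<Rightarrow> (lat \<Rightarrow> lat \<Rightarrow> int) \<Rightarrow> tau \<Rightarrow> tau \<Rightarrow> tau" where
  "tau_bracket M q F = (\<lambda>(x, _) (y, _).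
     (bilin_ext (\<lambda>(a, m) (b, n). tensor (T_bracket M F a b) (single (m + n) 1)) x y,
      coset (d_A q) (bilin_ext (\<lambda>(a, m) (b, n). T_form M F a b \<cdot> dtt_rep q m n) x y)))"

definition toroidal ::
  "nat \<Rightarrow> nat \<Rightarrow> nat \<Rightarrow> (lat \<Rightarrow> lat \<Rightarrow> int) \<Rightarrow> tau super_bracket_space" where
  "toroidal M N q F = \<lparr>
     carrier = TA_space M N q \<times> coset (d_A q) ` Omega_space q,
     add = (\<lambda>(x, X) (y, Y). (x + y, coset_add (d_A q) X Y)),
     smult = (\<lambda>c (x, X). (c \<cdot> x, coset_scale (d_A q) c X)),
     bracket = tau_bracket M q F,
     homogeneous = (\<lambda>p.
       {x \<in> TA_space M N q. \<forall>(a, m)\<in>keys x. T_parity M a = p} \<times>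
       (if p = 0 then coset (d_A q) ` Omega_space q else {coset (d_A q) 0}))\<rparr>"

definition tau_T :: "nat \<Rightarrow> nat \<Rightarrow> nat \<Rightarrow> expo \<Rightarrow> tau" where
  "tau_T q i j m = (tensor (T_basis i j) (single m 1), coset (d_A q) 0)"

definition tau_dtt :: "nat \<Rightarrow> expo \<Rightarrow> expo \<Rightarrow> tau" where
  "tau_dtt q m n = (0, coset (d_A q) (dtt_rep q m n))"

section \<open>The Fock space of the lattice and vertex operators\<close>

text \<open>
  The variable \<open>(g, k)\<close> with \<open>k < 0\<close> stands for \<open>g(k)\<close>, where \<open>g\<close> runs through the generators of
  the lattice; these variables form a basis of the negative part of the Heisenberg algebra.
  The pair \<open>(\<gamma>, \<mu>)\<close> indexes the basis element \<open>e\<^sup>\<gamma> \<otimes> \<mu>\<close> with \<open>\<mu>\<close> a monomial.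
\<close>

type_synonym heis_mono = "(gen \<times> int) \<Rightarrow>\<^sub>0 nat"
type_synonym V_index = "lat \<times> heis_mono"

definition V_indices :: "nat \<Rightarrow> nat \<Rightarrow> V_index set" where
  "V_indices M q = Gamma_bar M q \<times> {\<mu>. keys \<mu> \<subseteq> gens M q \<times> {..<0}}"

definition heis :: "lat \<Rightarrow> int \<Rightarrow> V_index cvec \<Rightarrow> V_index cvec" where
  "heis \<alpha> k =
     (if k < 0 then
        op_tensor id (\<lambda>u. (\<Sum>g\<in>keys \<alpha>. of_int (lookup \<alpha> g) \<cdot> variable (g, k)) * u)
      else if k = 0 then
        lin_ext (\<lambda>(\<gamma>, \<mu>). of_int (lat_form \<alpha> \<gamma>) \<cdot> single (\<gamma>, \<mu>) 1)
      else
        op_tensor id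
          (derivation (\<lambda>(g, n). if n = - k then of_int (k * lat_form \<alpha> (single g 1)) else 0)))"

definition e_op :: "(lat \<Rightarrow> lat \<Rightarrow> int) \<Rightarrow> lat \<Rightarrow> V_index cvec \<Rightarrow> V_index cvec" where
  "e_op F \<alpha> = lin_ext (\<lambda>(\<gamma>, \<mu>). of_int (F \<alpha> \<gamma>) \<cdot> single (\<alpha> + \<gamma>, \<mu>) 1)"

definition z_op :: "lat \<Rightarrow> V_index op_series" where
  "z_op \<alpha> n = lin_ext (\<lambda>(\<gamma>, \<mu>). if lat_form \<alpha> \<gamma> = n then single (\<gamma>, \<mu>) 1 else 0)"

definition T_minus :: "lat \<Rightarrow> V_index op_series" where
  "T_minus \<alpha> = (\<lambda>k v. let n = - k in if n < 0 then - ((1 / of_int n) \<cdot> heis \<alpha> n v) else 0)"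

definition T_plus :: "lat \<Rightarrow> V_index op_series" where
  "T_plus \<alpha> = (\<lambda>k v. let n = - k in if n > 0 then - ((1 / of_int n) \<cdot> heis \<alpha> n v) else 0)"

definition Y_series :: "(lat \<Rightarrow> lat \<Rightarrow> int) \<Rightarrow> lat \<Rightarrow> V_index op_series" where
  "Y_series F \<alpha> =
     ser_const (e_op F \<alpha>) \<star> z_op \<alpha> \<star> ser_exp (T_minus \<alpha>) \<star> ser_exp (T_plus \<alpha>)"

definition X_series :: "(lat \<Rightarrow> lat \<Rightarrow> int) \<Rightarrow> lat \<Rightarrow> V_index op_series" where
  "X_series F \<alpha> =
     (if even (lat_form \<alpha> \<alpha>) then ser_shift (lat_form \<alpha> \<alpha> div 2) (Y_series F \<alpha>)
      else Y_series F \<alpha>)"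

definition heis_field :: "lat \<Rightarrow> V_index op_series" where
  "heis_field \<alpha> = (\<lambda>k. heis \<alpha> (- k - 1))"

section \<open>Bosons\<close>

text \<open>
  The bosonic Fock space is the polynomial ring in the creation operators:
  \<open>Phi j r\<close> and \<open>Phi_star j r\<close> with \<open>r \<le> 0\<close> stand for those with index \<open>r - 1/2\<close>. The vacuum
  is \<open>1\<close>, and the annihilation operators are the derivations that the commutation
  relations prescribe.
\<close>

datatype bos_var = Phi nat int | Phi_star nat int

type_synonym bos_mono = "bos_var \<Rightarrow>\<^sub>0 nat"

definition bos_vars :: "nat \<Rightarrow> bos_var set" where
  "bos_vars N = {Phi j r |j r. j \<in> {1..N} \<and> r \<le> 0} \<union> {Phi_star j r |j r. j \<in> {1..N} \<and> r \<le> 0}"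

definition phi :: "nat \<Rightarrow> int \<Rightarrow> bos_mono cvec \<Rightarrow> bos_mono cvec" where
  "phi j r u = (if r \<le> 0 then variable (Phi j r) * u
                else - derivation (\<lambda>v. of_bool (v = Phi_star j (1 - r))) u)"

definition phi_star :: "nat \<Rightarrow> int \<Rightarrow> bos_mono cvec \<Rightarrow> bos_mono cvec" where
  "phi_star j s u = (if s \<le> 0 then variable (Phi_star j s) * u
                     else derivation (\<lambda>v. of_bool (v = Phi j (1 - s))) u)"

definition phi_field :: "nat \<Rightarrow> bos_mono op_series" where
  "phi_field j = (\<lambda>k. phi j (- k))"

definition phi_star_field :: "nat \<Rightarrow> bos_mono op_series" where
  "phi_star_field j = (\<lambda>k. phi_star j (- k))"

definition normal_ordered :: "nat \<Rightarrow> nat \<Rightarrow> int \<Rightarrow> int \<Rightarrow> bos_mono cvec \<Rightarrow> bos_mono cvec" where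
  "normal_ordered i j r s = (if r \<le> s then phi i r \<circ> phi_star j s else phi_star j s \<circ> phi i r)"

definition normal_ordered_field :: "nat \<Rightarrow> nat \<Rightarrow> bos_mono op_series" where
  "normal_ordered_field i j = (\<lambda>k v. Sum_any (\<lambda>r. normal_ordered i j r (- k - r) v))"

section \<open>Operators on the tensor product\<close>

type_synonym W_index = "V_index \<times> bos_mono"

definition W_space :: "nat \<Rightarrow> nat \<Rightarrow> nat \<Rightarrow> W_index cvec set" where
  "W_space M N q = spanned_by (V_indices M q \<times> {\<nu>. keys \<nu> \<subseteq> bos_vars N})"

definition W_homogeneous :: "nat \<Rightarrow> nat \<Rightarrow> nat \<Rightarrow> nat \<Rightarrow> W_index cvec set" where
  "W_homogeneous M N q p =
     {w \<in> W_space M N q. \<forall>((\<gamma>, \<mu>), \<nu>)\<in>keys w. lat_form \<gamma> \<gamma> mod 2 = int p}"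

definition delta_of :: "nat \<Rightarrow> expo \<Rightarrow> lat" where
  "delta_of q m = (\<Sum>i\<in>{1..q-1}. single (Gen_delta i) (lookup m i))"

text \<open>
  \<open>X_mode\<close> is used for \<open>(\<alpha>, \<alpha>)\<close> even only, where the modes have integer indices.
\<close>

definition X_mode :: "(lat \<Rightarrow> lat \<Rightarrow> int) \<Rightarrow> lat \<Rightarrow> int \<Rightarrow> W_index cvec \<Rightarrow> W_index cvec" where
  "X_mode F \<alpha> n = on_first (X_series F \<alpha>) (- n)"

definition T_mode ::
  "(lat \<Rightarrow> lat \<Rightarrow> int) \<Rightarrow> lat \<Rightarrow> lat \<Rightarrow> int \<Rightarrow> W_index cvec \<Rightarrow> W_index cvec" where
  "T_mode F \<alpha> \<delta> n = on_first (heis_field \<alpha> \<star> X_series F \<delta>) (- n - 1)"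

definition S_series :: "nat \<Rightarrow> (lat \<Rightarrow> lat \<Rightarrow> int) \<Rightarrow> nat \<Rightarrow> nat \<Rightarrow> W_index op_series" where
  "S_series M F i j =
     (if i \<le> M \<and> j > M then on_first (X_series F (e_vec i)) \<star> on_second (phi_star_field (j - M))
      else if i > M \<and> j \<le> M then on_first (X_series F (- e_vec j)) \<star> on_second (phi_field (i - M))
      else on_second (normal_ordered_field (i - M) (j - M)))"

definition S_mode ::
  "nat \<Rightarrow> (lat \<Rightarrow> lat \<Rightarrow> int) \<Rightarrow> lat \<Rightarrow> nat \<Rightarrow> nat \<Rightarrow> int \<Rightarrow> W_index cvec \<Rightarrow> W_index cvec" where
  "S_mode M F \<delta> i j n = (S_series M F i j \<star> on_first (X_series F \<delta>)) (- n - 1)"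

section \<open>Representations\<close>

definition linear_to_End ::
  "'a super_bracket_space \<Rightarrow> 'b cvec set \<Rightarrow> ('a \<Rightarrow> 'b cvec \<Rightarrow> 'b cvec) \<Rightarrow> bool" where
  "linear_to_End L W \<rho> \<longleftrightarrow>
     (\<forall>x\<in>carrier L. (\<forall>v\<in>W. \<rho> x v \<in> W) \<and>
        (\<forall>v\<in>W. \<forall>w\<in>W. \<rho> x (v + w) = \<rho> x v + \<rho> x w) \<and>
        (\<forall>c. \<forall>v\<in>W. \<rho> x (c \<cdot> v) = c \<cdot> \<rho> x v)) \<and>
     (\<forall>x\<in>carrier L. \<forall>y\<in>carrier L. \<forall>v\<in>W. \<rho> (add L x y) v = \<rho> x v + \<rho> y v) \<and>
     (\<forall>c. \<forall>x\<in>carrier L. \<forall>v\<in>W. \<rho> (smult L c x) v = c \<cdot> \<rho> x v)"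

definition superrepresentation ::
  "'a super_bracket_space \<Rightarrow> 'b cvec set \<Rightarrow> (nat \<Rightarrow> 'b cvec set) \<Rightarrow>
    ('a \<Rightarrow> 'b cvec \<Rightarrow> 'b cvec) \<Rightarrow> bool" where
  "superrepresentation L W Wh \<rho> \<longleftrightarrow>
     linear_to_End L W \<rho> \<and>
     (\<forall>p\<in>{0, 1}. \<forall>r\<in>{0, 1}. \<forall>x\<in>homogeneous L p. \<forall>v\<in>Wh r. \<rho> x v \<in> Wh ((p + r) mod 2)) \<and>
     (\<forall>p\<in>{0, 1}. \<forall>r\<in>{0, 1}. \<forall>x\<in>homogeneous L p. \<forall>y\<in>homogeneous L r. \<forall>v\<in>W.
        \<rho> (bracket L x y) v = \<rho> x (\<rho> y v) - ((-1) ^ (p * r)) \<cdot> \<rho> y (\<rho> x v))"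

definition assignments ::
  "nat \<Rightarrow> nat \<Rightarrow> nat \<Rightarrow> (lat \<Rightarrow> lat \<Rightarrow> int) \<Rightarrow> (tau \<Rightarrow> W_index cvec \<Rightarrow> W_index cvec) \<Rightarrow> bool" where
  "assignments M N q F \<rho> \<longleftrightarrow> (\<forall>v\<in>W_space M N q. \<forall>m\<in>expos q.
     (\<forall>i\<in>{1..M}. \<forall>j\<in>{1..M}. i \<noteq> j \<longrightarrow>
        \<rho> (tau_T q i j m) v = X_mode F (alpha i j + delta_of q m) (lookup m q) v) \<and>
     (\<forall>i\<in>{1..M}.
        \<rho> (tau_T q i i m) v = T_mode F (e_vec i) (delta_of q m) (lookup m q) v) \<and>
     (\<forall>i\<in>{1..M+N}. \<forall>j\<in>{1..M+N}. i > M \<or> j > M \<longrightarrow>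
        \<rho> (tau_T q i j m) v = S_mode M F (delta_of q m) i j (lookup m q) v) \<and>
     (\<forall>n\<in>expos q.
        \<rho> (tau_dtt q m n) v =
          of_int (lookup m q) \<cdot> X_mode F (delta_of q (m + n)) (lookup m q + lookup n q) v
          + T_mode F (delta_of q m) (delta_of q (m + n)) (lookup m q + lookup n q) v))"

end

theory Submission
  imports Defs
begin

text \<open>
  The operators come from a free-field realisation of the affine superalgebra of \<open>gl(M|N)\<close>.
  For \<open>a \<le> M\<close> let \<open>c\<^sub>a(z) = X(e\<^sub>a,z)\<close> and \<open>c\<^sub>a\<^sup>*(z) = X(-e\<^sub>a,z)\<close>; for \<open>a > M\<close> let \<open>c\<^sub>a\<close> and
  \<open>c\<^sub>a\<^sup>*\<close> be the bosons \<open>\<phi>\<close> and \<open>\<phi>\<^sup>*\<close>. The former are free fermions (\<open>Y_e_commute\<close>, \<open>Y_e_dual\<close>), the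
  latter free bosons, the two families commute, and the only nontrivial relation is
  \<open>c\<^sub>a\<^sup>*(w) c\<^sub>a(z) = \<plusminus> c\<^sub>a(z) c\<^sub>a\<^sup>*(w) + \<delta>(z-w)\<close>. From such relations alone, the normally ordered
  products \<open>J\<^sub>a\<^sub>b = :c\<^sub>a c\<^sub>b\<^sup>*:\<close> have the supercommutators of the affine superalgebra of
  \<open>gl(M|N)\<close> at level one (\<open>J_J\<close>).

  These products are the given operators. The boson-fermion correspondence \<open>:X(e\<^sub>a,z) X(-e\<^sub>a,z): = e\<^sub>a(z)\<close>
  (\<open>bosonization\<close>) gives \<open>J\<^sub>a\<^sub>a\<close> (\<open>J_heis\<close>); for \<open>a \<noteq> b\<close> both \<open>\<le> M\<close> the product \<open>J\<^sub>a\<^sub>b\<close>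
  is \<open>X(\<alpha>\<^sub>a\<^sub>b,z)\<close> up to the sign \<open>F(e\<^sub>a,e\<^sub>b)\<close> (\<open>J_Y\<close>); otherwise it is \<open>S\<^sub>a\<^sub>b(z)\<close>
  (\<open>S_series_J\<close>). The same signs turn the brackets of \<open>T\<close> into matrix supercommutators
  (\<open>T_bracket_matrix\<close>), and the form of \<open>T\<close> into the supertrace form (\<open>T_form_matrix\<close>).

  The lattice vectors \<open>\<delta>\<^sub>m\<close> are isotropic and orthogonal to each other and to the \<open>e\<^sub>a\<close>. So the series
  \<open>X(\<delta>\<^sub>m,z)\<close> commute with each other and with all \<open>J\<^sub>a\<^sub>b\<close>, and are multiplicative in \<open>m\<close>
  (\<open>X_X_diagonal\<close>), like the monomials \<open>t\<^sup>m\<close>. With \<open>f = z\<^sup>p X(\<delta>\<^sub>m,z)\<close>, \<open>p\<close> the last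
  component of \<open>m\<close>, the element \<open>T\<^sub>a\<^sub>b \<otimes> t\<^sup>m\<close> acts as the residue of \<open>J\<^sub>a\<^sub>b(z) f(z)\<close>, called
  \<open>current\<close> below, up to the sign. The brackets of the \<open>J\<^sub>a\<^sub>b\<close>, taken termwise, give those of the
  currents (\<open>current_current\<close>). The level contributes the residue of \<open>f' g\<close>, the operator \<open>central\<close>,
  for \<open>f\<close>, \<open>g\<close> belonging to \<open>t\<^sup>m\<close>, \<open>t\<^sup>n\<close>; the identity
  \<open>z d/dz X(\<delta>,z) = z \<delta>(z) X(\<delta>,z)\<close> for isotropic \<open>\<delta>\<close> (\<open>Y_Y_euler\<close>) shows that it is the
  operator prescribed for \<open>d(t\<^sup>m) t\<^sup>n\<close> (\<open>central_modes\<close>). It vanishes for \<open>n = 0\<close>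
  (\<open>central_closed\<close>), since \<open>X(0,z) = 1\<close> and a derivative has no residue; hence it is defined on the
  quotient by \<open>d\<^sub>A\<close>.

  All statements on vertex operators rest on one computation in the symmetric algebra. The exponential
  of a series is determined by the recursion that \<open>z d/dz\<close> gives (\<open>ser_exp_euler\<close>, \<open>ser_exp_unique\<close>).
  This proves the exchange relation of two exponentials, which produces the factor \<open>(1 - w/z)\<^sup>a\<close> with
  \<open>a = (\<alpha>,\<beta>)\<close> (\<open>exp_plus_exp_minus\<close>). So \<open>Y(\<alpha>,z) Y(\<beta>,w)\<close> is that factor times an expression
  \<open>vertex_pair\<close> which is symmetric under exchange of \<open>(\<alpha>,z)\<close> and \<open>(\<beta>,w)\<close>, and which can be
  evaluated at \<open>w = z\<close> (\<open>vertex_pair_diagonal\<close>) and differentiated (\<open>vertex_pair_diagonal_euler\<close>). Only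
  \<open>a \<in> {0, 1, -1}\<close> occurs.

  The cocycle is given on \<open>Q \<times> L\<close> only, where \<open>L\<close> is the whole lattice. Composed with projections to
  these sublattices (\<open>restrict\<close>) it becomes bimultiplicative on the group of all finitely supported
  functions, so that the identities above hold on the ambient vector space of
  the representation, without membership conditions. That the operators preserve the subspace and have the
  right parity is seen from the weights by which they shift \<open>\<gamma>\<close> in \<open>e\<^sup>\<gamma>\<close> (\<open>weight_Gamma_bar\<close>,
  \<open>weight_parity\<close>).
\<close>

section \<open>Linear maps and locally finite sums\<close>

definition lin :: "('a cvec \<Rightarrow> 'b cvec) \<Rightarrow> bool" where
  "lin f \<longleftrightarrow> (\<forall>x y. f (x + y) = f x + f y) \<and> (\<forall>c x. f (c \<cdot> x) = c \<cdot> f x)"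

lemma linI: "(\<And>x y. f (x + y) = f x + f y) \<Longrightarrow> (\<And>c x. f (c \<cdot> x) = c \<cdot> f x) \<Longrightarrow> lin f"
  by (simp add: lin_def)

lemma lin_add: "lin f \<Longrightarrow> f (x + y) = f x + f y"
  and lin_scale: "lin f \<Longrightarrow> f (c \<cdot> x) = c \<cdot> f x"
  by (simp_all add: lin_def)

lemma lin_zero: "lin f \<Longrightarrow> f 0 = 0"
  using lin_scale[of f 0 0] by simp

lemma lin_uminus: "lin f \<Longrightarrow> f (- x) = - f x"
  using lin_scale[of f "-1" x] by simp

lemma lin_diff: "lin f \<Longrightarrow> f (x - y) = f x - f y"
  using lin_add[of f x "- y"] lin_uminus[of f y] by simp

lemma lin_sum: "lin f \<Longrightarrow> f (\<Sum>i\<in>I. g i) = (\<Sum>i\<in>I. f (g i))"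
  by (induction I rule: infinite_finite_induct) (simp_all add: lin_zero lin_add)

lemmas lin_rules = lin_add lin_scale lin_zero lin_uminus lin_diff lin_sum

lemma lin_id: "lin id" "lin (\<lambda>x. x)" and lin_0: "lin (\<lambda>x. 0)"
  by (auto intro: linI)

lemma lin_compose: "lin f \<Longrightarrow> lin g \<Longrightarrow> lin (\<lambda>x. f (g x))"
  by (simp add: lin_def)

lemma lin_plus: "lin f \<Longrightarrow> lin g \<Longrightarrow> lin (\<lambda>x. f x + g x)"
  by (simp add: lin_def cvec.scale_right_distrib)

lemma lin_if: "lin f \<Longrightarrow> lin g \<Longrightarrow> lin (\<lambda>x. if P then f x else g x)"
  by (cases P) simp_all

lemma lin_minus: "lin f \<Longrightarrow> lin (\<lambda>x. - f x)"
  by (simp add: lin_def)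

lemma scale_sum: "c \<cdot> (\<Sum>i\<in>I. g i) = (\<Sum>i\<in>I. c \<cdot> g i)"
  by (rule cvec.scale_sum_right)

lemma lin_smult: "lin f \<Longrightarrow> lin (\<lambda>x. c \<cdot> f x)"
  by (simp add: lin_def cvec.scale_right_distrib mult.commute)

lemma lin_Sum: "(\<And>i. i \<in> I \<Longrightarrow> lin (f i)) \<Longrightarrow> lin (\<lambda>x. \<Sum>i\<in>I. f i x)"
  by (induction I rule: infinite_finite_induct) (auto simp: lin_0 intro: lin_plus)

lemma scale_single [simp]: "c \<cdot> single a d = single a (c * d)"
  by (rule poly_mapping_eqI) (simp add: lookup_single when_def)

lemma cvec_expand: "v = (\<Sum>a\<in>keys v. lookup v a \<cdot> single a 1)"
  by (rule poly_mapping_eqI)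
    (auto simp: lookup_sum lookup_single when_def sum.delta in_keys_iff if_distrib cong: if_cong)

lemma lin_eqI:
  assumes "lin f" "lin g" "\<And>a. f (single a 1) = g (single a 1)"
  shows "f v = g v"
proof -
  have "f v = (\<Sum>a\<in>keys v. lookup v a \<cdot> f (single a 1))"
    using assms(1) by (subst cvec_expand) (simp add: lin_sum lin_scale del: scale_single)
  also have "\<dots> = (\<Sum>a\<in>keys v. lookup v a \<cdot> g (single a 1))" using assms(3) by simp
  also have "\<dots> = g v"
    using assms(2) by (subst (3) cvec_expand) (simp add: lin_sum lin_scale del: scale_single)
  finally show ?thesis .
qed

lemma lin_ext_superset:
  assumes "finite A" "keys v \<subseteq> A"
  shows "lin_ext f v = (\<Sum>a\<in>A. lookup v a \<cdot> f a)"
  unfolding lin_ext_def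
  by (rule sum.mono_neutral_left) (use assms in \<open>auto simp: in_keys_iff\<close>)

lemma lin_lin_ext: "lin (lin_ext f)"
proof (rule linI)
  fix x y :: "'a cvec"
  let ?A = "keys x \<union> keys y"
  have "keys (x + y) \<subseteq> ?A" by (rule keys_add)
  then show "lin_ext f (x + y) = lin_ext f x + lin_ext f y"
    by (simp add: lin_ext_superset[of ?A] lookup_add cvec.scale_left_distrib sum.distrib)
next
  fix c and x :: "'a cvec"
  have "keys (c \<cdot> x) \<subseteq> keys x" by (auto simp: in_keys_iff)
  then show "lin_ext f (c \<cdot> x) = c \<cdot> lin_ext f x"
    by (simp add: lin_ext_superset[of "keys x"] scale_sum)
qed

lemma lin_ext_single [simp]: "lin_ext f (single a c) = c \<cdot> f a"
  by (cases "c = 0") (simp_all add: lin_ext_def)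

lemma tensor_superset:
  assumes "finite A" "keys v \<subseteq> A" "finite B" "keys w \<subseteq> B"
  shows "tensor v w = (\<Sum>a\<in>A. \<Sum>b\<in>B. single (a, b) (lookup v a * lookup w b))"
proof -
  have "tensor v w = (\<Sum>a\<in>keys v. \<Sum>b\<in>B. single (a, b) (lookup v a * lookup w b))"
    unfolding tensor_def
    by (intro sum.cong refl sum.mono_neutral_left) (use assms in \<open>auto simp: in_keys_iff\<close>)
  also have "\<dots> = (\<Sum>a\<in>A. \<Sum>b\<in>B. single (a, b) (lookup v a * lookup w b))"
    by (intro sum.mono_neutral_left) (use assms in \<open>auto simp: in_keys_iff\<close>)
  finally show ?thesis .
qed

lemma lin_tensor_left: "lin (\<lambda>v. tensor v w)"
proof (rule linI)
  fix x y :: "'a cvec"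
  let ?A = "keys x \<union> keys y"
  have "keys (x + y) \<subseteq> ?A" by (rule keys_add)
  then show "tensor (x + y) w = tensor x w + tensor y w"
    by (simp add: tensor_superset[of ?A _ "keys w"] lookup_add sum.distrib distrib_right
        single_add)
next
  fix c and x :: "'a cvec"
  have "keys (c \<cdot> x) \<subseteq> keys x" by (auto simp: in_keys_iff)
  then show "tensor (c \<cdot> x) w = c \<cdot> tensor x w"
    by (simp add: tensor_superset[of "keys x" _ "keys w"] scale_sum mult.assoc)
qed

lemma lin_tensor_right: "lin (\<lambda>w. tensor v w)"
proof (rule linI)
  fix x y :: "'a cvec"
  let ?A = "keys x \<union> keys y"
  have "keys (x + y) \<subseteq> ?A" by (rule keys_add)
  then show "tensor v (x + y) = tensor v x + tensor v y"
    by (simp add: tensor_superset[of "keys v" _ ?A] lookup_add sum.distrib distrib_left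
        single_add)
next
  fix c and x :: "'a cvec"
  have "keys (c \<cdot> x) \<subseteq> keys x" by (auto simp: in_keys_iff)
  then show "tensor v (c \<cdot> x) = c \<cdot> tensor v x"
    by (simp add: tensor_superset[of "keys v" _ "keys x"] scale_sum mult.left_commute)
qed

lemmas tensor_rules = lin_rules[OF lin_tensor_left] lin_rules[OF lin_tensor_right]

lemma tensor_single [simp]: "tensor (single a c) (single b d) = single (a, b) (c * d)"
  by (cases "c = 0"; cases "d = 0") (simp_all add: tensor_def)

lemma lin_op_tensor: "lin (op_tensor A B)"
  unfolding op_tensor_def by (rule lin_lin_ext)

lemma op_tensor_tensor:
  assumes "lin A" "lin B"
  shows "op_tensor A B (tensor v w) = tensor (A v) (B w)"
proof (rule lin_eqI[where v = v])
  show "lin (\<lambda>v. op_tensor A B (tensor v w))"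
    by (rule lin_compose[OF lin_op_tensor lin_tensor_left])
  show "lin (\<lambda>v. tensor (A v) (B w))"
    by (rule lin_compose[OF lin_tensor_left assms(1)])
  fix a
  show "op_tensor A B (tensor (single a 1) w) = tensor (A (single a 1)) (B w)"
  proof (rule lin_eqI[where v = w])
    show "lin (\<lambda>w. op_tensor A B (tensor (single a 1) w))"
      by (rule lin_compose[OF lin_op_tensor lin_tensor_right])
    show "lin (\<lambda>w. tensor (A (single a 1)) (B w))"
      by (rule lin_compose[OF lin_tensor_right assms(2)])
  qed (simp add: op_tensor_def)
qed

lemma lin_eq_tensorI:
  assumes "lin f" "lin g" "\<And>a w. f (tensor (single a 1) w) = g (tensor (single a 1) w)"
  shows "f v = g v"
proof (rule lin_eqI[OF assms(1,2)])
  fix p :: "'a \<times> 'b"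
  show "f (single p 1) = g (single p 1)"
    using assms(3)[of "fst p" "single (snd p) 1"] by simp
qed

lemma op_tensor_compose:
  assumes "lin A" "lin B" "lin A'" "lin B'"
  shows "op_tensor A B (op_tensor A' B' v) = op_tensor (\<lambda>x. A (A' x)) (\<lambda>x. B (B' x)) v"
proof (rule lin_eq_tensorI[where v = v])
  show "lin (\<lambda>v. op_tensor A B (op_tensor A' B' v))"
    by (rule lin_compose[OF lin_op_tensor lin_op_tensor])
qed (use assms in \<open>simp_all add: lin_op_tensor op_tensor_tensor lin_compose\<close>)

lemma op_tensor_id [simp]: "op_tensor id id v = v"
  by (rule lin_eqI[where v = v]) (simp_all add: lin_op_tensor lin_id, simp add: op_tensor_def split: prod.splits)

lemma op_tensor_first_plus: "op_tensor (\<lambda>x. A x + A' x) B v = op_tensor A B v + op_tensor A' B v"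
  by (rule lin_eqI[where v = v])
    (simp_all add: lin_op_tensor lin_plus, simp add: op_tensor_def tensor_rules split: prod.splits)

lemma op_tensor_first_scale: "op_tensor (\<lambda>x. c \<cdot> A x) B v = c \<cdot> op_tensor A B v"
  by (rule lin_eqI[where v = v])
    (simp_all add: lin_op_tensor lin_smult, simp add: op_tensor_def tensor_rules split: prod.splits)

lemma op_tensor_zero_first: "op_tensor (\<lambda>x. 0) B v = 0"
  by (rule lin_eqI[where v = v])
    (simp_all add: lin_op_tensor lin_0, simp add: op_tensor_def tensor_rules split: prod.splits)

lemma op_tensor_second_plus: "op_tensor A (\<lambda>x. B x + B' x) v = op_tensor A B v + op_tensor A B' v"
  by (rule lin_eqI[where v = v])
    (simp_all add: lin_op_tensor lin_plus, simp add: op_tensor_def tensor_rules split: prod.splits)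

lemma op_tensor_zero_second: "op_tensor A (\<lambda>x. 0) v = 0"
  by (rule lin_eqI[where v = v])
    (simp_all add: lin_op_tensor lin_0, simp add: op_tensor_def tensor_rules split: prod.splits)

lemma op_tensor_if:
  "op_tensor (\<lambda>x. if P then x else 0) id v = (if P then v else 0)"
  "op_tensor id (\<lambda>x. if P then x else 0) v = (if P then v else 0)"
  using op_tensor_id[of v] by (auto simp: op_tensor_zero_first op_tensor_zero_second id_def)

lemma op_tensor_first_sum:
  "op_tensor (\<lambda>x. \<Sum>i\<in>I. c i \<cdot> A i x) B v = (\<Sum>i\<in>I. c i \<cdot> op_tensor (A i) B v)"
  by (induction I rule: infinite_finite_induct)
    (simp_all add: op_tensor_zero_first op_tensor_first_plus op_tensor_first_scale)

subsection \<open>Sums with finite support\<close>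

lemma Sum_any_lin:
  assumes "lin f" "finite {k. g k \<noteq> 0}"
  shows "f (Sum_any g) = Sum_any (\<lambda>k. f (g k))"
proof -
  have "{k. f (g k) \<noteq> 0} \<subseteq> {k. g k \<noteq> 0}" using lin_zero[OF assms(1)] by auto
  then show ?thesis
    using assms by (simp add: Sum_any.expand_superset[of "{k. g k \<noteq> 0}"] lin_sum)
qed

lemma Sum_any_scale: "finite {k. g k \<noteq> 0} \<Longrightarrow> c \<cdot> Sum_any g = Sum_any (\<lambda>k. c \<cdot> g k)"
  by (rule Sum_any_lin[where f = "\<lambda>x. c \<cdot> x"]) (simp_all add: lin_smult lin_id)

lemma Sum_any_uminus: "Sum_any (\<lambda>k. - g k) = - Sum_any (g :: _ \<Rightarrow> 'a::ab_group_add)"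
  by (simp add: Sum_any.expand_set sum_negf)

lemma Sum_any_diff:
  assumes "finite {k. g k \<noteq> 0}" "finite {k. h k \<noteq> 0}"
  shows "Sum_any (\<lambda>k. g k - h k) = Sum_any g - Sum_any (h :: _ \<Rightarrow> 'a::ab_group_add)"
proof -
  have "finite {k. - h k \<noteq> 0}" using assms(2) by simp
  then have "Sum_any (\<lambda>k. g k + - h k) = Sum_any g + Sum_any (\<lambda>k. - h k)"
    by (rule Sum_any.distrib[OF assms(1)])
  then show ?thesis by (simp add: Sum_any_uminus)
qed

lemma Sum_any_shift: "Sum_any (\<lambda>k. g (k + c)) = Sum_any (g :: int \<Rightarrow> 'a::comm_monoid_add)"
proof (rule sym, rule Sum_any.reindex_cong)
  show "bij (\<lambda>k :: int. k + c)" by (rule bijI, simp add: inj_def) (metis diff_add_cancel surj_def)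
qed auto

lemma Sum_any_reflect: "Sum_any (\<lambda>k. g (c - k)) = Sum_any (g :: int \<Rightarrow> 'a::comm_monoid_add)"
proof (rule sym, rule Sum_any.reindex_cong)
  show "bij (\<lambda>k :: int. c - k)" by (rule bijI, simp add: inj_def) (metis diff_diff_eq2 add_diff_cancel_left' surj_def)
qed auto

lemma Sum_any_single: "(\<And>k. k \<noteq> a \<Longrightarrow> g k = 0) \<Longrightarrow> Sum_any g = g a"
  by (subst Sum_any.expand_superset[of "{a}"]) auto

lemma finite_pairsI:
  assumes "finite B" "\<And>a b. f a b \<noteq> 0 \<Longrightarrow> b \<in> B" "\<And>b. finite {a. f a b \<noteq> 0}"
  shows "finite {(a, b). f a b \<noteq> 0}"
proof (rule finite_subset)
  show "{(a, b). f a b \<noteq> 0} \<subseteq> (\<Union>b\<in>B. (\<lambda>a. (a, b)) ` {a. f a b \<noteq> 0})"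
    using assms(2) by auto
  show "finite (\<Union>b\<in>B. (\<lambda>a. (a, b)) ` {a. f a b \<noteq> 0})"
    using assms by auto
qed

lemma Sum_any_swap:
  assumes "finite {(a, b). f a b \<noteq> 0}"
  shows "Sum_any (\<lambda>a. Sum_any (f a)) = Sum_any (\<lambda>b. Sum_any (\<lambda>a. f a b))"
  by (rule Sum_any.swap[of "fst ` {(a, b). f a b \<noteq> 0} \<times> snd ` {(a, b). f a b \<noteq> 0}"])
    (use assms in \<open>force+\<close>)

lemma finite_support_inner:
  assumes "finite {(a, b). f a b \<noteq> 0}"
  shows "finite {b. f a b \<noteq> 0}" "finite {a. f a b \<noteq> 0}" "finite {a. Sum_any (f a) \<noteq> 0}"
proof -
  show "finite {b. f a b \<noteq> 0}"
    by (rule finite_subset[OF _ finite_imageI[OF assms, of snd]]) force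
  show "finite {a. f a b \<noteq> 0}"
    by (rule finite_subset[OF _ finite_imageI[OF assms, of fst]]) force
  have "\<exists>b. f a b \<noteq> 0" if "Sum_any (f a) \<noteq> 0" for a
  proof (rule ccontr)
    assume "\<nexists>b. f a b \<noteq> 0"
    then have "f a = (\<lambda>_. 0)" by auto
    then show False using that by simp
  qed
  then have "{a. Sum_any (f a) \<noteq> 0} \<subseteq> fst ` {(a, b). f a b \<noteq> 0}"
    by force
  then show "finite {a. Sum_any (f a) \<noteq> 0}"
    by (rule finite_subset) (rule finite_imageI[OF assms])
qed

lemma lin_Sum_any:
  assumes "\<And>k. lin (f k)" "\<And>v. finite {k. f k v \<noteq> 0}"
  shows "lin (\<lambda>v. Sum_any (\<lambda>k. f k v))"
  using assms
  by (intro linI) (simp_all add: lin_add lin_scale Sum_any.distrib Sum_any_scale)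

lemma finite_support_int:
  assumes "\<And>k. k < a \<Longrightarrow> f k = 0" "\<And>k. b < k \<Longrightarrow> f k = 0"
  shows "finite {k :: int. f k \<noteq> 0}"
proof (rule finite_subset)
  show "{k. f k \<noteq> 0} \<subseteq> {a..b}" proof (clarsimp, intro conjI; rule ccontr)
  qed (use assms not_le in blast)+
qed simp

lemma finite_support_box:
  assumes "\<And>a b. a < a1 \<Longrightarrow> f a b = 0" "\<And>a b. a2 < a \<Longrightarrow> f a b = 0"
    and "\<And>a b. b < b1 \<Longrightarrow> f a b = 0" "\<And>a b. b2 < b \<Longrightarrow> f a b = 0"
  shows "finite {(a :: int, b :: int). f a b \<noteq> 0}"
proof (rule finite_subset)
  show "{(a, b). f a b \<noteq> 0} \<subseteq> {a1..a2} \<times> {b1..b2}"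
    proof (clarsimp, intro conjI; rule ccontr)
  qed (use assms not_le in blast)+
qed simp

lemma Sum_any_interval:
  assumes "\<And>k. k < a \<Longrightarrow> f k = 0" "\<And>k. b < k \<Longrightarrow> f k = 0"
  shows "Sum_any f = (\<Sum>k\<in>{a..b :: int}. f k)"
proof (rule Sum_any.expand_superset)
  show "{k. f k \<noteq> 0} \<subseteq> {a..b}"
  proof (clarsimp, intro conjI; rule ccontr)
  qed (use assms not_le in blast)+
qed simp

lemma Sum_any_zero: "(\<And>k. f k = 0) \<Longrightarrow> Sum_any f = 0"
  by (simp add: Sum_any.expand_set)

lemma Sum_any_nonzero: "Sum_any f \<noteq> 0 \<Longrightarrow> \<exists>k. f k \<noteq> 0"
  by (rule ccontr) (simp add: Sum_any_zero)

text \<open>Used where \<open>a\<close> and \<open>b\<close> are internal to a product of exponentials and \<open>j\<close>, an exponent of the variable, has to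
  become the outermost index.\<close>

lemma Sum_any_rotate:
  assumes "finite A" "finite B" "finite J"
    and supp: "\<And>a b j. f a b j \<noteq> 0 \<Longrightarrow> a \<in> A \<and> b \<in> B \<and> j \<in> J"
  shows "Sum_any (\<lambda>a. Sum_any (\<lambda>b. Sum_any (\<lambda>j. f a b j))) =
    Sum_any (\<lambda>j. Sum_any (\<lambda>a. Sum_any (\<lambda>b. f a b j)))"
proof -
  have fin1: "finite {(b, j). f a b j \<noteq> 0}" for a
  proof (rule finite_subset)
    show "{(b, j). f a b j \<noteq> 0} \<subseteq> B \<times> J" using supp by blast
  qed (use assms(1-3) in simp)
  have fin2: "finite {(a, j). Sum_any (\<lambda>b. f a b j) \<noteq> 0}"
  proof (rule finite_subset)
    show "{(a, j). Sum_any (\<lambda>b. f a b j) \<noteq> 0} \<subseteq> A \<times> J"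
      using supp Sum_any_nonzero by blast
  qed (use assms(1-3) in simp)
  show ?thesis
    by (simp only: Sum_any_swap[OF fin1] Sum_any_swap[OF fin2])
qed

lemma Sum_any_sum:
  assumes "\<And>i. i \<in> I \<Longrightarrow> finite {k. g i k \<noteq> 0}"
  shows "Sum_any (\<lambda>k. \<Sum>i\<in>I. g i k) = (\<Sum>i\<in>I. Sum_any (g i))"
    and "finite {k. (\<Sum>i\<in>I. g i k) \<noteq> 0}"
proof -
  have "Sum_any (\<lambda>k. \<Sum>i\<in>I. g i k) = (\<Sum>i\<in>I. Sum_any (g i)) \<and> finite {k. (\<Sum>i\<in>I. g i k) \<noteq> 0}"
    using assms
  proof (induction I rule: infinite_finite_induct)
    case (insert i I)
    then have fi: "finite {k. g i k \<noteq> 0}" and fI: "finite {k. (\<Sum>i\<in>I. g i k) \<noteq> 0}"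
      and IH: "Sum_any (\<lambda>k. \<Sum>i\<in>I. g i k) = (\<Sum>i\<in>I. Sum_any (g i))" by auto
    have "finite {k. g i k + (\<Sum>i\<in>I. g i k) \<noteq> 0}"
      by (rule finite_subset[OF _ finite_UnI[OF fi fI]]) auto
    with insert.hyps show ?case by (simp add: Sum_any.distrib[OF fi fI] IH)
  qed simp_all
  then show "Sum_any (\<lambda>k. \<Sum>i\<in>I. g i k) = (\<Sum>i\<in>I. Sum_any (g i))"
    and "finite {k. (\<Sum>i\<in>I. g i k) \<noteq> 0}" by auto
qed

text \<open>For operator-valued summands it is enough to bound the support on basis vectors, as a vector involves
  only finitely many of them.\<close>

lemma finite_support_basis:
  assumes "\<And>k. lin (f k)" "\<And>b. finite {k. f k (single b 1) \<noteq> 0}"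
  shows "finite {k. f k v \<noteq> 0}"
proof (rule finite_subset)
  show "{k. f k v \<noteq> 0} \<subseteq> (\<Union>b\<in>keys v. {k. f k (single b 1) \<noteq> 0})"
  proof
    fix k assume "k \<in> {k. f k v \<noteq> 0}"
    moreover have "f k v = (\<Sum>b\<in>keys v. lookup v b \<cdot> f k (single b 1))"
      using assms(1)[of k] by (subst cvec_expand) (simp add: lin_sum lin_scale del: scale_single)
    ultimately have "(\<Sum>b\<in>keys v. lookup v b \<cdot> f k (single b 1)) \<noteq> 0" by simp
    then have "\<exists>b\<in>keys v. f k (single b 1) \<noteq> 0" by (rule contrapos_np) simp
    then show "k \<in> (\<Union>b\<in>keys v. {k. f k (single b 1) \<noteq> 0})" by blast
  qed
qed (use assms(2) in simp)

lemma op_tensor_Sum_any_support: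
  assumes "\<And>k. lin (A k)" "\<And>x. finite {k. A k x \<noteq> 0}"
  shows "finite {k. op_tensor (A k) id v \<noteq> 0}" "finite {k. op_tensor id (A k) w \<noteq> 0}"
proof -
  show "finite {k. op_tensor (A k) id v \<noteq> 0}"
  proof (rule finite_support_basis[OF lin_op_tensor])
    fix b :: "'b \<times> 'c"
    show "finite {k. op_tensor (A k) id (single b 1) \<noteq> 0}"
      by (rule finite_subset[OF _ assms(2)[of "single (fst b) 1"]])
        (cases b, auto simp: op_tensor_def tensor_rules)
  qed
  show "finite {k. op_tensor id (A k) w \<noteq> 0}"
  proof (rule finite_support_basis[OF lin_op_tensor])
    fix b :: "'d \<times> 'b"
    show "finite {k. op_tensor id (A k) (single b 1) \<noteq> 0}"
      by (rule finite_subset[OF _ assms(2)[of "single (snd b) 1"]])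
        (cases b, auto simp: op_tensor_def tensor_rules)
  qed
qed

lemma op_tensor_Sum_any:
  assumes A: "\<And>k. lin (A k)" "\<And>x. finite {k. A k x \<noteq> 0}"
  shows "Sum_any (\<lambda>k. op_tensor (A k) id v) = op_tensor (\<lambda>x. Sum_any (\<lambda>k. A k x)) id v"
    and "Sum_any (\<lambda>k. op_tensor id (A k) w) = op_tensor id (\<lambda>x. Sum_any (\<lambda>k. A k x)) w"
proof -
  note l = lin_Sum_any[OF lin_op_tensor op_tensor_Sum_any_support(1)[OF A]]
    lin_Sum_any[OF lin_op_tensor op_tensor_Sum_any_support(2)[OF A]] lin_Sum_any[OF A]
  show "Sum_any (\<lambda>k. op_tensor (A k) id v) = op_tensor (\<lambda>x. Sum_any (\<lambda>k. A k x)) id v"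
    by (rule lin_eq_tensorI[where v = v, OF l(1) lin_op_tensor])
      (simp add: op_tensor_tensor A(1) l(3) lin_id Sum_any_lin[OF lin_tensor_left A(2)])
  show "Sum_any (\<lambda>k. op_tensor id (A k) w) = op_tensor id (\<lambda>x. Sum_any (\<lambda>k. A k x)) w"
    by (rule lin_eq_tensorI[where v = w, OF l(2) lin_op_tensor])
      (simp add: op_tensor_tensor A(1) l(3) lin_id Sum_any_lin[OF lin_tensor_right A(2)])
qed

subsection \<open>Series that are bounded below on each vector\<close>

text \<open>A field in the sense of vertex algebras: on each vector, a Laurent series. Products of two such series
  in the same variable are defined only after normal ordering.\<close>

definition field :: "'b op_series \<Rightarrow> bool" where
  "field A \<longleftrightarrow> (\<forall>k. lin (A k)) \<and> (\<forall>v. \<exists>K. \<forall>k<K. A k v = 0)"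

lemma field_lin: "field A \<Longrightarrow> lin (A k)"
  by (simp add: field_def)

lemma field_bound: "field A \<Longrightarrow> \<exists>K. \<forall>k<K. A k v = 0"
  by (simp add: field_def)

lemma fieldI:
  assumes "\<And>k. lin (A k)" "\<And>b. \<exists>K. \<forall>k<K. A k (single b 1) = 0"
  shows "field A"
  unfolding field_def
proof (intro conjI allI)
  fix v :: "'a cvec"
  obtain K where K: "\<And>b k. k < K b \<Longrightarrow> A k (single b 1) = 0" using assms(2) by metis
  have "A k v = 0" if "k < Min (insert 0 (K ` keys v))" for k
  proof -
    have *: "A k (single b 1) = 0" if "b \<in> keys v" for b
      by (rule K) (use that \<open>k < _\<close> in auto)
    have "A k v = (\<Sum>a\<in>keys v. lookup v a \<cdot> A k (single a 1))"
      using assms(1)[of k] by (subst cvec_expand) (simp add: lin_sum lin_scale del: scale_single)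
    also have "\<dots> = 0" using * by simp
    finally show ?thesis .
  qed
  then show "\<exists>K. \<forall>k<K. A k v = 0" by blast
qed (rule assms)

lemma field_on_first: "field A \<Longrightarrow> field (on_first A)"
proof (rule fieldI)
  fix b :: "'a \<times> 'b" assume A: "field A"
  obtain K where "\<forall>k<K. A k (single (fst b) 1) = 0" using field_bound[OF A] by blast
  then show "\<exists>K. \<forall>k<K. on_first A k (single b 1) = 0"
    by (intro exI[of _ K]) (auto simp: on_first_def op_tensor_def tensor_rules split: prod.splits)
qed (simp add: on_first_def lin_op_tensor)

lemma field_on_second: "field A \<Longrightarrow> field (on_second A)"
proof (rule fieldI)
  fix b :: "'b \<times> 'a" assume A: "field A"
  obtain K where "\<forall>k<K. A k (single (snd b) 1) = 0" using field_bound[OF A] by blast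
  then show "\<exists>K. \<forall>k<K. on_second A k (single b 1) = 0"
    by (intro exI[of _ K]) (auto simp: on_second_def op_tensor_def tensor_rules split: prod.splits)
qed (simp add: on_second_def lin_op_tensor)

section \<open>Spans of sets of basis vectors\<close>

lemma spanned_by_zero: "0 \<in> spanned_by B"
  and spanned_by_add: "v \<in> spanned_by B \<Longrightarrow> w \<in> spanned_by B \<Longrightarrow> v + w \<in> spanned_by B"
  and spanned_by_scale: "v \<in> spanned_by B \<Longrightarrow> c \<cdot> v \<in> spanned_by B"
  and spanned_by_uminus: "v \<in> spanned_by B \<Longrightarrow> - v \<in> spanned_by B"
  using keys_add[of v w] by (auto simp: spanned_by_def in_keys_iff)

lemma spanned_by_single: "b \<in> B \<Longrightarrow> single b c \<in> spanned_by B"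
  by (simp add: spanned_by_def)

lemma spanned_by_sum: "(\<And>i. i \<in> I \<Longrightarrow> f i \<in> spanned_by B) \<Longrightarrow> (\<Sum>i\<in>I. f i) \<in> spanned_by B"
  by (induction I rule: infinite_finite_induct) (auto simp: spanned_by_zero intro: spanned_by_add)

lemma spanned_by_Sum_any: "(\<And>i. f i \<in> spanned_by B) \<Longrightarrow> Sum_any f \<in> spanned_by B"
  by (simp add: Sum_any.expand_set spanned_by_sum)

lemma spanned_by_mono: "v \<in> spanned_by B \<Longrightarrow> B \<subseteq> C \<Longrightarrow> v \<in> spanned_by C"
  by (auto simp: spanned_by_def)

lemma lin_spanned_by:
  assumes "lin f" "\<And>b. b \<in> B \<Longrightarrow> f (single b 1) \<in> spanned_by C" "v \<in> spanned_by B"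
  shows "f v \<in> spanned_by C"
proof -
  have "f v = (\<Sum>a\<in>keys v. lookup v a \<cdot> f (single a 1))"
    using assms(1) by (subst cvec_expand) (simp add: lin_sum lin_scale del: scale_single)
  then show ?thesis
    using assms(2,3) by (auto simp: spanned_by_def[of B] intro!: spanned_by_sum spanned_by_scale)
qed

lemma lin_eq_on_spanned_by:
  assumes "lin f" "lin g" "\<And>b. b \<in> B \<Longrightarrow> f (single b 1) = g (single b 1)" "v \<in> spanned_by B"
  shows "f v = g v"
proof -
  have "f v = (\<Sum>a\<in>keys v. lookup v a \<cdot> f (single a 1))"
    using assms(1) by (subst cvec_expand) (simp add: lin_sum lin_scale del: scale_single)
  also have "\<dots> = (\<Sum>a\<in>keys v. lookup v a \<cdot> g (single a 1))"
    using assms(3,4) by (intro sum.cong refl arg_cong[where f = "\<lambda>x. _ \<cdot> x"]) (auto simp: spanned_by_def)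
  also have "\<dots> = g v"
    using assms(2) by (subst (3) cvec_expand) (simp add: lin_sum lin_scale del: scale_single)
  finally show ?thesis .
qed

lemma spanned_by_tensor:
  assumes "v \<in> spanned_by B" "w \<in> spanned_by C"
  shows "tensor v w \<in> spanned_by (B \<times> C)"
  using assms unfolding tensor_def
  by (intro spanned_by_sum spanned_by_single) (auto simp: spanned_by_def)

section \<open>Multiplication and derivations on the symmetric algebra\<close>

lemma sym_mult_scale: "u * (c \<cdot> w) = c \<cdot> (u * w)" "(c \<cdot> u) * w = c \<cdot> (u * w)"
  for u w :: "'v sym_alg"
  by (simp_all add: scale_def mult_map_scale_conv_mult ac_simps)

lemma lin_mult: "lin (\<lambda>u. w * u)" for w :: "'v sym_alg"
  by (rule linI) (simp_all add: distrib_left sym_mult_scale)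

lemma lin_derivation: "lin (derivation c)"
  unfolding derivation_def by (rule lin_lin_ext)

lemma derivation_single:
  assumes "finite K" "keys \<mu> \<subseteq> K"
  shows "derivation c (single \<mu> 1) =
    (\<Sum>v\<in>K. single (\<mu> - single v 1) (of_nat (lookup \<mu> v) * c v))"
  unfolding derivation_def
  by (simp, rule sum.mono_neutral_left) (use assms in \<open>auto simp: in_keys_iff\<close>)

lemma derivation_one [simp]: "derivation c 1 = 0"
  by (simp add: derivation_def flip: single_one)

lemma variable_mult_single: "variable v * single \<mu> c = single (single v 1 + \<mu>) c"
  by (simp add: variable_def mult_single)

text \<open>The Leibniz rule against a variable determines a derivation, and is the source of all commutation
  relations of the Heisenberg algebra and of the bosons.\<close>

lemma derivation_variable_mult:
  "derivation c (variable v * u) = c v \<cdot> u + variable v * derivation c u"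
proof (rule lin_eqI[where v = u])
  show "lin (\<lambda>u. derivation c (variable v * u))"
    by (rule lin_compose[OF lin_derivation lin_mult])
  show "lin (\<lambda>u. c v \<cdot> u + variable v * derivation c u)"
    by (intro lin_plus lin_smult lin_id lin_compose[OF lin_mult lin_derivation])
  fix \<mu> :: "'a \<Rightarrow>\<^sub>0 nat"
  let ?K = "insert v (keys \<mu>)"
  have K: "keys (single v 1 + \<mu>) \<subseteq> ?K" using keys_add[of "single v 1" \<mu>] by auto
  have *: "single (single v 1 + \<mu> - single w 1) (of_nat (lookup (single v 1 + \<mu>) w) * c w) =
    (if w = v then c v \<cdot> single \<mu> 1 else 0)
      + variable v * single (\<mu> - single w 1) (of_nat (lookup \<mu> w) * c w)" for w
  proof (cases "lookup \<mu> w = 0")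
    case True
    then show ?thesis by (auto simp: lookup_add lookup_single when_def)
  next
    case False
    have "single v 1 + \<mu> - single w 1 = single v 1 + (\<mu> - single w 1)"
      using False by (auto intro!: poly_mapping_eqI simp: lookup_add lookup_minus lookup_single when_def)
    moreover have "single w 1 + (\<mu> - single w 1) = \<mu>"
      using False by (auto intro!: poly_mapping_eqI simp: lookup_add lookup_minus lookup_single when_def)
    ultimately show ?thesis
      by (auto simp: variable_mult_single lookup_add lookup_single when_def algebra_simps
          simp flip: single_add)
  qed
  show "derivation c (variable v * single \<mu> 1) =
      c v \<cdot> single \<mu> 1 + variable v * derivation c (single \<mu> 1)"
    unfolding variable_mult_single
    by (subst derivation_single[OF _ K], simp, subst derivation_single[of ?K], simp, blast)
      (simp add: * sum.distrib sum_distrib_left del: scale_single One_nat_def)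
qed

lemma monomial_induct:
  assumes "P 0" "\<And>v \<mu>. P \<mu> \<Longrightarrow> P (single v 1 + \<mu>)"
  shows "P (\<mu> :: 'v \<Rightarrow>\<^sub>0 nat)"
proof (induction "\<Sum>v\<in>keys \<mu>. lookup \<mu> v" arbitrary: \<mu> rule: less_induct)
  case less
  show ?case
  proof (cases "\<mu> = 0")
    case True
    then show ?thesis using assms(1) by simp
  next
    case False
    then obtain v where v: "v \<in> keys \<mu>" by (metis keys_eq_empty ex_in_conv)
    define \<nu> where "\<nu> = \<mu> - single v 1"
    have \<mu>: "\<mu> = single v 1 + \<nu>"
      using v by (auto intro!: poly_mapping_eqI
          simp: \<nu>_def lookup_add lookup_minus lookup_single when_def in_keys_iff)
    have sub: "keys \<nu> \<subseteq> keys \<mu>" by (auto simp: \<nu>_def in_keys_iff lookup_minus)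
    have "(\<Sum>w\<in>keys \<nu>. lookup \<nu> w) = (\<Sum>w\<in>keys \<mu>. lookup \<nu> w)"
      using sub by (intro sum.mono_neutral_left) (auto simp: in_keys_iff)
    also have "\<dots> < (\<Sum>w\<in>keys \<mu>. lookup \<mu> w)"
      by (rule sum_strict_mono_ex1)
        (use v in \<open>auto simp: \<nu>_def lookup_minus lookup_single when_def in_keys_iff intro!: bexI[of _ v]\<close>)
    finally have "P \<nu>" using less by blast
    then show ?thesis using assms(2) \<mu> by metis
  qed
qed

text \<open>Monomials are reached from \<open>1\<close> by multiplication with variables.\<close>

lemma sym_lin_eqI:
  assumes "lin f" "lin g" "f 1 = g 1"
    and "\<And>v u. f u = g u \<Longrightarrow> f (variable v * u) = g (variable v * u)"
  shows "f u = g u"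
proof (rule lin_eqI[OF assms(1,2)])
  fix \<mu> show "f (single \<mu> 1) = g (single \<mu> 1)"
  proof (induction \<mu> rule: monomial_induct)
    case 1
    show ?case using assms(3) by simp
  next
    case (2 v \<mu>)
    then show ?case using assms(4)[of "single \<mu> 1" v] by (simp add: variable_mult_single)
  qed
qed

lemma derivation_commute: "derivation c (derivation d u) = derivation d (derivation c u)"
proof (rule sym_lin_eqI[where u = u])
  fix v u
  assume "derivation c (derivation d u) = derivation d (derivation c u)"
  then show "derivation c (derivation d (variable v * u)) = derivation d (derivation c (variable v * u))"
    by (simp add: derivation_variable_mult lin_rules[OF lin_derivation])
qed (simp_all add: lin_compose lin_derivation lin_zero[OF lin_derivation])

lemma derivation_linear_coeffs:
  "derivation (\<lambda>v. a * c v + b * d v) u = a \<cdot> derivation c u + b \<cdot> derivation d u"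
proof (rule sym_lin_eqI[where u = u])
  fix v u
  assume "derivation (\<lambda>v. a * c v + b * d v) u = a \<cdot> derivation c u + b \<cdot> derivation d u"
  then show "derivation (\<lambda>v. a * c v + b * d v) (variable v * u) =
      a \<cdot> derivation c (variable v * u) + b \<cdot> derivation d (variable v * u)"
    by (simp add: derivation_variable_mult sym_mult_scale cvec.scale_left_distrib
        cvec.scale_right_distrib distrib_left)
qed (simp_all add: lin_derivation lin_plus lin_smult)

section \<open>The lattice form\<close>

lemma lat_form_superset:
  assumes "finite A" "keys \<alpha> \<subseteq> A" "finite B" "keys \<beta> \<subseteq> B"
  shows "lat_form \<alpha> \<beta> = (\<Sum>g\<in>A. \<Sum>h\<in>B. lookup \<alpha> g * lookup \<beta> h * gen_form g h)"
proof -
  have "lat_form \<alpha> \<beta> = (\<Sum>g\<in>keys \<alpha>. \<Sum>h\<in>B. lookup \<alpha> g * lookup \<beta> h * gen_form g h)"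
    unfolding lat_form_def
    by (intro sum.cong refl sum.mono_neutral_left) (use assms in \<open>auto simp: in_keys_iff\<close>)
  also have "\<dots> = (\<Sum>g\<in>A. \<Sum>h\<in>B. lookup \<alpha> g * lookup \<beta> h * gen_form g h)"
    by (intro sum.mono_neutral_left) (use assms in \<open>auto simp: in_keys_iff\<close>)
  finally show ?thesis .
qed

lemma gen_form_commute: "gen_form g h = gen_form h g"
  by (cases g; cases h) auto

lemma lat_form_commute: "lat_form \<alpha> \<beta> = lat_form \<beta> \<alpha>"
  unfolding lat_form_def by (subst sum.swap) (simp add: gen_form_commute mult.commute)

lemma lat_form_add_left [simp]: "lat_form (\<alpha> + \<beta>) \<gamma> = lat_form \<alpha> \<gamma> + lat_form \<beta> \<gamma>"
proof -
  let ?A = "keys \<alpha> \<union> keys \<beta>"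
  have "keys (\<alpha> + \<beta>) \<subseteq> ?A" by (rule keys_add)
  then show ?thesis
    by (simp add: lat_form_superset[of ?A _ "keys \<gamma>"] lookup_add distrib_right sum.distrib)
qed

lemma lat_form_add_right [simp]: "lat_form \<gamma> (\<alpha> + \<beta>) = lat_form \<gamma> \<alpha> + lat_form \<gamma> \<beta>"
  by (metis lat_form_add_left lat_form_commute)

lemma lat_form_zero [simp]: "lat_form 0 \<gamma> = 0" "lat_form \<gamma> 0 = 0"
  by (simp_all add: lat_form_def)

lemma lat_form_uminus [simp]: "lat_form (- \<alpha>) \<gamma> = - lat_form \<alpha> \<gamma>" "lat_form \<gamma> (- \<alpha>) = - lat_form \<gamma> \<alpha>"
  by (simp_all add: lat_form_def sum_negf)

lemma lat_form_minus [simp]: "lat_form (\<alpha> - \<beta>) \<gamma> = lat_form \<alpha> \<gamma> - lat_form \<beta> \<gamma>"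
    "lat_form \<gamma> (\<alpha> - \<beta>) = lat_form \<gamma> \<alpha> - lat_form \<gamma> \<beta>"
  using lat_form_add_left[of \<alpha> "- \<beta>"] lat_form_add_right[of \<gamma> \<alpha> "- \<beta>"] by simp_all

lemma lat_form_sum: "lat_form (\<Sum>i\<in>I. f i) \<gamma> = (\<Sum>i\<in>I. lat_form (f i) \<gamma>)"
  by (induction I rule: infinite_finite_induct) auto

lemma lat_form_single: "lat_form (single g a) (single h b) = a * b * gen_form g h"
  by (cases "a = 0"; cases "b = 0") (simp_all add: lat_form_def)

text \<open>The commutator of a derivation and a multiplication by a linear form is computed generator by
  generator; this sum is what results.\<close>

lemma lat_form_right_expand:
  "lat_form \<alpha> \<beta> = (\<Sum>g\<in>keys \<beta>. lookup \<beta> g * lat_form \<alpha> (single g 1))"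
proof -
  have "lat_form \<alpha> (single g 1) = (\<Sum>h\<in>keys \<alpha>. lookup \<alpha> h * gen_form h g)" for g
    by (simp add: lat_form_def)
  then show ?thesis
    by (simp add: lat_form_def sum_distrib_left mult_ac) (rule sum.swap)
qed

section \<open>The Heisenberg operators on the symmetric algebra\<close>

text \<open>On each summand \<open>e\<^sup>\<gamma> \<otimes> S\<close> of the Fock space the mode \<open>\<alpha>(n)\<close>, \<open>n \<noteq> 0\<close>, acts in the same way; the
  mode \<open>\<alpha>(0)\<close>, a scalar depending on \<open>\<gamma>\<close>, is replaced by \<open>0\<close>, so that the Heisenberg relations hold
  for all indices.\<close>

definition heis_sym :: "lat \<Rightarrow> int \<Rightarrow> (gen \<times> int) sym_alg \<Rightarrow> (gen \<times> int) sym_alg" where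
  "heis_sym \<alpha> n =
     (if n < 0 then (\<lambda>u. (\<Sum>g\<in>keys \<alpha>. of_int (lookup \<alpha> g) \<cdot> variable (g, n)) * u)
      else if n = 0 then (\<lambda>u. 0)
      else derivation (\<lambda>(g, k). if k = - n then of_int (n * lat_form \<alpha> (single g 1)) else 0))"

lemma heis_sym_pos:
  "n > 0 \<Longrightarrow> heis_sym \<alpha> n =
    derivation (\<lambda>(g, k). if k = - n then of_int (n * lat_form \<alpha> (single g 1)) else 0)"
  unfolding heis_sym_def by (subst if_not_P, simp, subst if_not_P, simp, rule refl)

lemma lin_heis_sym: "lin (heis_sym \<alpha> n)"
  by (simp add: heis_sym_def lin_mult lin_0 lin_derivation)

lemma derivation_linear_form_mult:
  "derivation c ((\<Sum>g\<in>A. a g \<cdot> variable (v g)) * u) =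
     (\<Sum>g\<in>A. a g * c (v g)) \<cdot> u + (\<Sum>g\<in>A. a g \<cdot> variable (v g)) * derivation c u"
  by (induction A rule: infinite_finite_induct)
    (simp_all add: distrib_right lin_rules[OF lin_derivation] sym_mult_scale
      derivation_variable_mult cvec.scale_right_distrib cvec.scale_left_distrib)

lemma heis_sym_commute_pos_neg:
  assumes "m > 0" "n < 0"
  shows "heis_sym \<alpha> m (heis_sym \<beta> n u) =
    heis_sym \<beta> n (heis_sym \<alpha> m u) + (if m + n = 0 then of_int (m * lat_form \<alpha> \<beta>) \<cdot> u else 0)"
proof -
  have "(\<Sum>g\<in>keys \<beta>. of_int (lookup \<beta> g) * (if n = - m then of_int (m * lat_form \<alpha> (single g 1)) else 0)) =
      (if m + n = 0 then of_int (m * lat_form \<alpha> \<beta>) else 0 :: complex)"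
    by (auto simp: lat_form_right_expand[of \<alpha> \<beta>] sum_distrib_left mult_ac)
  then show ?thesis
    using assms by (simp add: heis_sym_def derivation_linear_form_mult)
qed

lemma heis_sym_commute:
  "heis_sym \<alpha> m (heis_sym \<beta> n u) =
    heis_sym \<beta> n (heis_sym \<alpha> m u) + (if m + n = 0 then of_int (m * lat_form \<alpha> \<beta>) \<cdot> u else 0)"
proof -
  consider "m = 0 \<or> n = 0" | "m > 0" "n < 0" | "m < 0" "n > 0" | "m > 0" "n > 0" | "m < 0" "n < 0"
    by linarith
  then show ?thesis
  proof cases
    case 1
    then show ?thesis by (auto simp: heis_sym_def lin_zero[OF lin_derivation])
  next
    case 2
    then show ?thesis by (rule heis_sym_commute_pos_neg)
  next
    case 3
    have *: "heis_sym \<beta> n (heis_sym \<alpha> m u) =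
        heis_sym \<alpha> m (heis_sym \<beta> n u) + (if n + m = 0 then of_int (n * lat_form \<beta> \<alpha>) \<cdot> u else 0)"
      using 3 by (intro heis_sym_commute_pos_neg)
    show ?thesis
    proof (cases "m + n = 0")
      case True
      then have "n = - m" by simp
      with * show ?thesis by (simp add: lat_form_commute[of \<alpha> \<beta>])
    next
      case False
      with * show ?thesis by (simp add: add.commute)
    qed
  next
    case 4
    then show ?thesis by (simp add: heis_sym_def derivation_commute)
  next
    case 5
    then show ?thesis by (simp add: heis_sym_def mult.left_commute)
  qed
qed

lemma heis_sym_add: "heis_sym (\<alpha> + \<beta>) n u = heis_sym \<alpha> n u + heis_sym \<beta> n u"
proof -
  consider "n < 0" | "n = 0" | "n > 0" by linarith
  then show ?thesis
  proof cases
    case 1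
    let ?A = "keys \<alpha> \<union> keys \<beta>"
    have *: "(\<Sum>g\<in>keys \<gamma>. of_int (lookup \<gamma> g) \<cdot> variable (g, n)) =
       (\<Sum>g\<in>?A. of_int (lookup \<gamma> g) \<cdot> variable (g, n))" if "keys \<gamma> \<subseteq> ?A" for \<gamma>
      by (rule sum.mono_neutral_left) (use that in \<open>auto simp: in_keys_iff\<close>)
    have "keys (\<alpha> + \<beta>) \<subseteq> ?A" by (rule keys_add)
    with 1 show ?thesis
      by (simp add: heis_sym_def *)
        (simp add: lookup_add cvec.scale_left_distrib sum.distrib distrib_right)
  next
    case 3
    have "(\<lambda>(g, k). if k = - n then of_int (n * lat_form (\<alpha> + \<beta>) (single g 1)) else 0) =
      (\<lambda>v. 1 * (case v of (g, k) \<Rightarrow> if k = - n then of_int (n * lat_form \<alpha> (single g 1)) else 0) +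
        1 * (case v of (g, k) \<Rightarrow> if k = - n then of_int (n * lat_form \<beta> (single g 1)) else (0::complex)))"
      by (auto simp: fun_eq_iff distrib_left)
    with 3 show ?thesis by (simp add: heis_sym_def derivation_linear_coeffs del: mult_1_left)
  qed (simp add: heis_sym_def)
qed

lemma heis_sym_0 [simp]: "heis_sym 0 n u = 0"
  using heis_sym_add[of 0 0 n u] by simp

subsection \<open>The degree\<close>

text \<open>The variable \<open>g(-n)\<close> has degree \<open>n\<close>. The type also contains variables \<open>g(n)\<close> with \<open>n \<ge> 0\<close>, which
  count as \<open>0\<close> to keep the degree nonnegative.\<close>

definition mono_deg :: "heis_mono \<Rightarrow> int" where
  "mono_deg \<mu> = (\<Sum>p\<in>keys \<mu>. int (lookup \<mu> p) * max 0 (- snd p))"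

definition deg_le :: "int \<Rightarrow> (gen \<times> int) sym_alg set" where
  "deg_le d = spanned_by {\<mu>. mono_deg \<mu> \<le> d}"

lemma mono_deg_add: "mono_deg (\<mu> + \<nu>) = mono_deg \<mu> + mono_deg \<nu>"
proof -
  let ?A = "keys \<mu> \<union> keys \<nu>"
  have *: "mono_deg \<kappa> = (\<Sum>p\<in>?A. int (lookup \<kappa> p) * max 0 (- snd p))" if "keys \<kappa> \<subseteq> ?A" for \<kappa>
    unfolding mono_deg_def by (rule sum.mono_neutral_left) (use that in \<open>auto simp: in_keys_iff\<close>)
  have "keys (\<mu> + \<nu>) \<subseteq> ?A" by (rule keys_add)
  then show ?thesis by (simp add: * lookup_add distrib_right sum.distrib)
qed

lemma mono_deg_nonneg: "mono_deg \<mu> \<ge> 0"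
  unfolding mono_deg_def by (intro sum_nonneg) auto

lemma deg_le_negative:
  assumes "u \<in> deg_le d" "d < 0"
  shows "u = 0"
proof -
  have "\<mu> \<notin> keys u" for \<mu>
    using assms mono_deg_nonneg[of \<mu>] by (auto simp: deg_le_def spanned_by_def)
  then show ?thesis by (intro poly_mapping_eqI) (simp add: in_keys_iff)
qed

lemma deg_le_exists: "\<exists>d\<ge>0. u \<in> deg_le d"
proof (intro exI conjI)
  show "u \<in> deg_le (\<Sum>\<mu>\<in>keys u. mono_deg \<mu>)"
    by (auto simp: deg_le_def spanned_by_def intro: member_le_sum mono_deg_nonneg)
qed (simp add: sum_nonneg mono_deg_nonneg)

text \<open>Annihilation operators lower the degree: this makes all sums below locally finite.\<close>

lemma heis_sym_deg:
  assumes "u \<in> deg_le d"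
  shows "heis_sym \<alpha> n u \<in> deg_le (d - n)"
proof -
  have "heis_sym \<alpha> n (single \<mu> 1) \<in> deg_le (d - n)" if \<mu>: "mono_deg \<mu> \<le> d" for \<mu>
  proof -
    consider "n < 0" | "n = 0" | "n > 0" by linarith
    then show ?thesis
    proof cases
      case 1
      then have "mono_deg (single (g, n) 1 + \<mu>) \<le> d - n" for g
        using \<mu> by (simp add: mono_deg_add) (simp add: mono_deg_def)
      with 1 show ?thesis
        by (auto simp: heis_sym_def deg_le_def sum_distrib_right sym_mult_scale variable_mult_single
            simp del: scale_single intro!: spanned_by_sum spanned_by_scale spanned_by_single)
    next
      case 3
      let ?c = "\<lambda>(g, k). if k = - n then of_int (n * lat_form \<alpha> (single g 1)) else (0::complex)"
      have "single (\<mu> - single v 1) (of_nat (lookup \<mu> v) * ?c v) \<in> deg_le (d - n)" if "v \<in> keys \<mu>" for v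
      proof (cases "snd v = - n")
        case True
        have "\<mu> = single v 1 + (\<mu> - single v 1)"
          using that by (auto intro!: poly_mapping_eqI
              simp: lookup_add lookup_minus lookup_single when_def in_keys_iff)
        then have "mono_deg \<mu> = mono_deg (single v 1) + mono_deg (\<mu> - single v 1)"
          using mono_deg_add by metis
        moreover have "mono_deg (single v 1) = n" using True 3 by (simp add: mono_deg_def)
        ultimately show ?thesis using \<mu> by (simp add: deg_le_def spanned_by_single)
      next
        case False
        then have "?c v = 0" by (cases v) simp
        then show ?thesis by (simp only: mult_zero_right single_zero deg_le_def spanned_by_zero)
      qed
      then have "(\<Sum>v\<in>keys \<mu>. single (\<mu> - single v 1) (of_nat (lookup \<mu> v) * ?c v)) \<in> deg_le (d - n)"
        unfolding deg_le_def by (rule spanned_by_sum)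
      then have der: "derivation ?c (single \<mu> 1) \<in> deg_le (d - n)"
        by (subst derivation_single[OF finite_keys subset_refl])
      show ?thesis unfolding heis_sym_pos[OF 3] by (rule der)
    next
      case 2
      then have "heis_sym \<alpha> n = (\<lambda>u. 0)" by (simp add: heis_sym_def)
      then show ?thesis unfolding deg_le_def by (simp only: spanned_by_zero)
    qed
  qed
  then show ?thesis
    using assms unfolding deg_le_def
    by (rule lin_spanned_by[OF lin_heis_sym, of "{\<mu>. mono_deg \<mu> \<le> d}"]) (auto simp: deg_le_def)
qed

section \<open>Exponentials of commuting series\<close>

lemma scale_split: "of_int n \<cdot> w = of_int k \<cdot> w + of_int (n - k) \<cdot> w"
  by (simp flip: cvec.scale_left_distrib)

text \<open>The conditions under which \<open>exp A\<close> makes sense and behaves as for commuting numbers: only positive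
  powers of the variable, and commuting coefficients.\<close>

definition exponent :: "'b op_series \<Rightarrow> bool" where
  "exponent A \<longleftrightarrow> (\<forall>k. lin (A k)) \<and> (\<forall>k\<le>0. \<forall>v. A k v = 0) \<and>
     (\<forall>k l v. A k (A l v) = A l (A k v))"

lemma exponent_lin: "exponent A \<Longrightarrow> lin (A k)"
  and exponent_nonpos: "exponent A \<Longrightarrow> k \<le> 0 \<Longrightarrow> A k v = 0"
  and exponent_commute: "exponent A \<Longrightarrow> A k (A l v) = A l (A k v)"
  by (auto simp: exponent_def)

lemma ser_power_zero: "exponent A \<Longrightarrow> n < int j \<Longrightarrow> ser_power A j n v = 0"
proof (induction j arbitrary: n)
  case (Suc j)
  have "A k (ser_power A j (n - k) v) = 0" for k
  proof (cases "k \<le> 0")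
    case False
    then have "ser_power A j (n - k) v = 0" using Suc by simp
    then show ?thesis using lin_zero exponent_lin Suc.prems(1) by metis
  qed (use exponent_nonpos Suc.prems(1) in blast)
  then show ?case by (simp add: ser_mult_def)
qed (simp add: ser_const_def)

lemma ser_power_Suc_support:
  assumes "exponent A"
  shows "finite {k. A k (ser_power A j (n - k) v) \<noteq> 0}"
  by (rule finite_support_int[of 0 _ n])
    (simp_all add: assms exponent_nonpos ser_power_zero lin_zero[OF exponent_lin])

lemma lin_ser_power: "exponent A \<Longrightarrow> lin (ser_power A j n)"
proof (induction j arbitrary: n)
  case 0
  then show ?case by (cases "n = 0") (simp_all add: ser_const_def lin_id lin_0)
next
  case (Suc j)
  show ?case
    unfolding ser_power.simps ser_mult_def
    by (rule lin_Sum_any, rule lin_compose[OF exponent_lin[OF Suc.prems] Suc.IH[OF Suc.prems]],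
        rule ser_power_Suc_support[OF Suc.prems])
qed

text \<open>The rule \<open>z d/dz A\<^sup>j\<^sup>+\<^sup>1 = (j + 1) (z d/dz A) A\<^sup>j\<close>. This is where the coefficients of \<open>A\<close> have
  to commute.\<close>

lemma ser_power_euler:
  assumes A: "exponent A"
  shows "of_int n \<cdot> ser_power A (Suc j) n v =
    of_nat (Suc j) \<cdot> Sum_any (\<lambda>k. of_int k \<cdot> A k (ser_power A j (n - k) v))"
proof (induction j arbitrary: n)
  have supp: "finite {k. of_int k \<cdot> A k (ser_power A j (n - k) v) \<noteq> 0}" for n j
    by (rule finite_subset[OF _ ser_power_Suc_support[OF A, of j n v]]) auto
  have split: "of_int n \<cdot> ser_power A (Suc j) n v =
      Sum_any (\<lambda>k. of_int k \<cdot> A k (ser_power A j (n - k) v)) +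
      Sum_any (\<lambda>k. A k (of_int (n - k) \<cdot> ser_power A j (n - k) v))" for n j
  proof -
    have "of_int n \<cdot> ser_power A (Suc j) n v =
        Sum_any (\<lambda>k. of_int n \<cdot> A k (ser_power A j (n - k) v))"
      by (simp add: ser_mult_def Sum_any_scale ser_power_Suc_support A)
    also have "\<dots> = Sum_any (\<lambda>k. of_int k \<cdot> A k (ser_power A j (n - k) v) +
        A k (of_int (n - k) \<cdot> ser_power A j (n - k) v))"
      by (rule arg_cong[where f = Sum_any], rule ext)
        (simp only: lin_scale[OF exponent_lin[OF A]], rule scale_split)
    also have "\<dots> = Sum_any (\<lambda>k. of_int k \<cdot> A k (ser_power A j (n - k) v)) +
        Sum_any (\<lambda>k. A k (of_int (n - k) \<cdot> ser_power A j (n - k) v))"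
      by (rule Sum_any.distrib[OF supp])
        (rule finite_subset[OF _ ser_power_Suc_support[OF A, of j n v]],
          auto simp: lin_scale[OF exponent_lin[OF A]])
    finally show ?thesis .
  qed
  {
    case 0
    have "A k (of_int (n - k) \<cdot> ser_power A 0 (n - k) v) = 0" for k
      by (simp add: ser_const_def lin_zero[OF exponent_lin[OF A]])
    then show ?case using split[of n 0] by simp
  next
    case (Suc j)
    let ?pw = "ser_power A"
    have fin: "finite {(k, l). of_int l \<cdot> A k (A l (?pw j (n - k - l) v)) \<noteq> 0}"
    proof (rule finite_support_box[of 1 _ n 1 n])
      fix k l :: int
      show "of_int l \<cdot> A k (A l (?pw j (n - k - l) v)) = 0" if "n < k"
        using that by (cases "l \<le> 0") (simp_all add: A exponent_nonpos ser_power_zero lin_zero[OF exponent_lin])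
      show "of_int l \<cdot> A k (A l (?pw j (n - k - l) v)) = 0" if "n < l"
        using that by (cases "k \<le> 0") (simp_all add: A exponent_nonpos ser_power_zero lin_zero[OF exponent_lin])
    qed (simp_all add: A exponent_nonpos lin_zero[OF exponent_lin])
    have "Sum_any (\<lambda>k. A k (of_int (n - k) \<cdot> ?pw (Suc j) (n - k) v)) =
        Sum_any (\<lambda>k. A k (of_nat (Suc j) \<cdot> Sum_any (\<lambda>l. of_int l \<cdot> A l (?pw j (n - k - l) v))))"
      by (simp only: Suc)
    also have "\<dots> = Sum_any (\<lambda>k. of_nat (Suc j) \<cdot> Sum_any (\<lambda>l. of_int l \<cdot> A k (A l (?pw j (n - k - l) v))))"
      by (simp add: lin_scale[OF exponent_lin[OF A]] Sum_any_lin[OF exponent_lin[OF A] supp] del: of_nat_Suc)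
    also have "\<dots> = of_nat (Suc j) \<cdot> Sum_any (\<lambda>k. Sum_any (\<lambda>l. of_int l \<cdot> A k (A l (?pw j (n - k - l) v))))"
      by (rule Sum_any_scale[symmetric, OF finite_support_inner(3)[OF fin]])
    also have "\<dots> = of_nat (Suc j) \<cdot> Sum_any (\<lambda>l. Sum_any (\<lambda>k. of_int l \<cdot> A k (A l (?pw j (n - k - l) v))))"
      by (simp only: Sum_any_swap[OF fin])
    also have "\<dots> = of_nat (Suc j) \<cdot> Sum_any (\<lambda>l. of_int l \<cdot> A l (?pw (Suc j) (n - l) v))"
    proof -
      have "of_int l \<cdot> A l (?pw (Suc j) (n - l) v) = Sum_any (\<lambda>k. of_int l \<cdot> A l (A k (?pw j (n - l - k) v)))" for l
        unfolding ser_power.simps ser_mult_def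
        by (rule Sum_any_lin[OF lin_smult[OF exponent_lin[OF A]] ser_power_Suc_support[OF A]])
      then have "of_int l \<cdot> A l (?pw (Suc j) (n - l) v) = Sum_any (\<lambda>k. of_int l \<cdot> A k (A l (?pw j (n - k - l) v)))" for l
        by (simp only: exponent_commute[OF A, of l] diff_right_commute[of n l])
      then show ?thesis by simp
    qed
    finally show ?case
      unfolding split[of n "Suc j"] of_nat_Suc[of "Suc j"] cvec.scale_left_distrib cvec.scale_one
      by simp
  }
qed

text \<open>Since \<open>A\<close> has no constant term, \<open>A\<^sup>j\<close> contributes to the coefficient of \<open>z\<^sup>n\<close> only for \<open>j \<le> n\<close>.\<close>

lemma ser_exp_finite_sum:
  assumes "exponent A" "n \<le> int N"
  shows "ser_exp A n v = (\<Sum>j\<le>N. (1 / fact j) \<cdot> ser_power A j n v)"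
  unfolding ser_exp_def
  by (rule Sum_any.expand_superset)
    (use ser_power_zero[OF assms(1)] assms(2) in \<open>auto simp: not_le[symmetric] intro: ccontr\<close>)

lemma ser_exp_negative: "exponent A \<Longrightarrow> n < 0 \<Longrightarrow> ser_exp A n v = 0"
  by (simp add: ser_exp_finite_sum[of A n 0] ser_const_def)

lemma ser_exp_zero: "exponent A \<Longrightarrow> ser_exp A 0 v = v"
  by (simp add: ser_exp_finite_sum[of A 0 0] ser_const_def)

lemma lin_ser_exp:
  assumes "exponent A"
  shows "lin (ser_exp A n)"
proof -
  have "ser_exp A n = (\<lambda>v. \<Sum>j\<le>nat n. (1 / fact j) \<cdot> ser_power A j n v)"
    by (rule ext, rule ser_exp_finite_sum[OF assms]) simp
  then show ?thesis by (simp add: lin_Sum lin_smult lin_ser_power[OF assms])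
qed

lemma exponent_ser_exp_support:
  assumes "exponent A"
  shows "finite {k. of_int k \<cdot> A k (ser_exp A (n - k) v) \<noteq> 0}"
  by (rule finite_support_int[of 0 _ n])
    (simp_all add: assms exponent_nonpos ser_exp_negative lin_zero[OF exponent_lin])

text \<open>The equation \<open>z d/dz exp A = (z d/dz A) exp A\<close> as a recursion for the coefficients. It replaces the
  definition by powers from here on.\<close>

lemma ser_exp_euler:
  assumes A: "exponent A"
  shows "of_int n \<cdot> ser_exp A n v = Sum_any (\<lambda>k. of_int k \<cdot> A k (ser_exp A (n - k) v))"
proof -
  define N where "N = nat n"
  have N: "n \<le> int N" by (simp add: N_def)
  have supp: "finite {k. of_int k \<cdot> A k (ser_power A j (n - k) v) \<noteq> 0}" for j
    by (rule finite_subset[OF _ ser_power_Suc_support[OF A, of j n v]]) auto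
  have "of_int n \<cdot> ser_exp A n v = (\<Sum>j\<le>Suc N. (1 / fact j) \<cdot> of_int n \<cdot> ser_power A j n v)"
    using N by (subst ser_exp_finite_sum[OF A, of n "Suc N"]) (simp_all add: scale_sum mult.commute del: sum.atMost_Suc)
  also have "\<dots> = (\<Sum>j\<le>N. (1 / fact (Suc j)) \<cdot> of_int n \<cdot> ser_power A (Suc j) n v)"
    by (subst sum.atMost_Suc_shift) (simp add: ser_const_def)
  also have "\<dots> = (\<Sum>j\<le>N. (1 / fact j) \<cdot> Sum_any (\<lambda>k. of_int k \<cdot> A k (ser_power A j (n - k) v)))"
  proof (rule sum.cong[OF refl])
    fix j
    have "(1 / fact (Suc j)) * of_nat (Suc j) = (1 / fact j :: complex)"
      by (simp add: fact_Suc del: of_nat_Suc)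
    then show "(1 / fact (Suc j)) \<cdot> of_int n \<cdot> ser_power A (Suc j) n v =
        (1 / fact j) \<cdot> Sum_any (\<lambda>k. of_int k \<cdot> A k (ser_power A j (n - k) v))"
      unfolding ser_power_euler[OF A] cvec.scale_scale by simp
  qed
  also have "\<dots> = (\<Sum>j\<le>N. Sum_any (\<lambda>k. (1 / fact j) \<cdot> of_int k \<cdot> A k (ser_power A j (n - k) v)))"
    by (simp only: Sum_any_scale[OF supp])
  also have "\<dots> = (\<Sum>j\<le>N. \<Sum>k\<in>{1..n}. (1 / fact j) \<cdot> of_int k \<cdot> A k (ser_power A j (n - k) v))"
    by (intro sum.cong refl Sum_any_interval)
      (simp_all add: exponent_nonpos[OF A] ser_power_zero[OF A] lin_zero[OF exponent_lin[OF A]])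
  also have "\<dots> = (\<Sum>k\<in>{1..n}. \<Sum>j\<le>N. (1 / fact j) \<cdot> of_int k \<cdot> A k (ser_power A j (n - k) v))"
    by (rule sum.swap)
  also have "\<dots> = (\<Sum>k\<in>{1..n}. of_int k \<cdot> A k (ser_exp A (n - k) v))"
  proof (intro sum.cong refl)
    fix k assume "k \<in> {1..n}"
    then have "ser_exp A (n - k) v = (\<Sum>j\<le>N. (1 / fact j) \<cdot> ser_power A j (n - k) v)"
      using N by (intro ser_exp_finite_sum[OF A]) auto
    then show "(\<Sum>j\<le>N. (1 / fact j) \<cdot> of_int k \<cdot> A k (ser_power A j (n - k) v)) =
        of_int k \<cdot> A k (ser_exp A (n - k) v)"
      by (simp add: lin_sum[OF exponent_lin[OF A]] lin_scale[OF exponent_lin[OF A]] scale_sum mult.commute)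
  qed
  also have "\<dots> = Sum_any (\<lambda>k. of_int k \<cdot> A k (ser_exp A (n - k) v))"
    by (intro sym[OF Sum_any_interval])
      (simp_all add: exponent_nonpos[OF A] ser_exp_negative[OF A] lin_zero[OF exponent_lin[OF A]])
  finally show ?thesis .
qed

text \<open>The recursion expresses the coefficient of \<open>z\<^sup>n\<close>, \<open>n > 0\<close>, by earlier ones.\<close>

lemma ser_exp_unique:
  assumes A: "exponent A"
    and neg: "\<And>n. n < 0 \<Longrightarrow> x n = 0"
    and rec: "\<And>n. of_int n \<cdot> x n = Sum_any (\<lambda>k. of_int k \<cdot> A k (x (n - k)))"
  shows "x n = ser_exp A n (x 0)"
proof (induction "nat n" arbitrary: n rule: less_induct)
  case less
  consider "n < 0" | "n = 0" | "n > 0" by linarith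
  then show ?case
  proof cases
    case 3
    have eq: "of_int k \<cdot> A k (x (n - k)) = of_int k \<cdot> A k (ser_exp A (n - k) (x 0))" for k
      using less[of "n - k"] 3 by (cases "k \<le> 0") (simp_all add: exponent_nonpos[OF A])
    then have "of_int n \<cdot> x n = of_int n \<cdot> ser_exp A n (x 0)"
      by (simp only: rec[of n] ser_exp_euler[OF A, of n] eq)
    then show ?thesis using 3 by simp
  qed (simp_all add: neg ser_exp_negative[OF A] ser_exp_zero[OF A])
qed

lemma ser_exp_intertwine:
  assumes A: "exponent A" "exponent A'" and f: "lin f" and fA: "\<And>k v. f (A k v) = A' k (f v)"
  shows "f (ser_exp A n v) = ser_exp A' n (f v)"
proof -
  have "of_int n \<cdot> f (ser_exp A n v) = Sum_any (\<lambda>k. of_int k \<cdot> A' k (f (ser_exp A (n - k) v)))" for n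
    by (simp add: lin_scale[OF f, symmetric] ser_exp_euler[OF A(1)]
        Sum_any_lin[OF f exponent_ser_exp_support[OF A(1)]])
      (simp add: lin_scale[OF f] fA)
  from ser_exp_unique[OF A(2) _ this, of n] show ?thesis
    by (simp add: ser_exp_negative[OF A(1)] ser_exp_zero[OF A(1)] lin_zero[OF f])
qed

lemmas ser_exp_commute = ser_exp_intertwine[of A A for A]

lemma ser_exp_ser_exp_commute:
  assumes "exponent A" "exponent B" "\<And>k l v. A k (B l v) = B l (A k v)"
  shows "ser_exp A m (ser_exp B n v) = ser_exp B n (ser_exp A m v)"
  using assms by (intro ser_exp_commute lin_ser_exp) (metis ser_exp_commute exponent_lin)+

text \<open>The product of the two exponentials satisfies the recursion of the exponential of the sum, by the
  Leibniz rule for \<open>z d/dz\<close>.\<close>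

lemma ser_exp_add:
  assumes A: "exponent A" and B: "exponent B" and AB: "\<And>k l v. A k (B l v) = B l (A k v)"
  shows "ser_exp (\<lambda>k v. A k v + B k v) n v = Sum_any (\<lambda>i. ser_exp A i (ser_exp B (n - i) v))"
proof -
  let ?E = "ser_exp A" and ?E' = "ser_exp B"
  note linA = exponent_lin[OF A] and linB = exponent_lin[OF B]
    and linE = lin_ser_exp[OF A] and linE' = lin_ser_exp[OF B]
  note zeros = exponent_nonpos[OF A] exponent_nonpos[OF B] ser_exp_negative[OF A] ser_exp_negative[OF B]
    lin_zero[OF linA] lin_zero[OF linB] lin_zero[OF linE] lin_zero[OF linE']
  have EB: "?E i (B k w) = B k (?E i w)" for i k w
    using ser_exp_commute[OF A A linB, of k] AB by metis
  define x where "x n = Sum_any (\<lambda>i. ?E i (?E' (n - i) v))" for n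
  have AplusB: "exponent (\<lambda>k v. A k v + B k v)"
    unfolding exponent_def
  proof (intro conjI allI impI)
    fix k l w
    show "A k (A l w + B l w) + B k (A l w + B l w) = A l (A k w + B k w) + B l (A k w + B k w)"
      using exponent_commute[OF A, of k l w] exponent_commute[OF B, of k l w] AB[of k l w] AB[of l k w]
      by (simp add: lin_add[OF linA] lin_add[OF linB] ac_simps)
  qed (simp_all add: lin_plus linA linB zeros)
  have "x n = ser_exp (\<lambda>k v. A k v + B k v) n (x 0)"
  proof (rule ser_exp_unique[OF AplusB])
    fix n
    show "x n = 0" if "n < 0"
    proof -
      have "?E i (?E' (n - i) v) = 0" for i using that by (cases "i < 0") (simp_all add: zeros)
      then show ?thesis by (simp add: x_def)
    qed
    have supp: "finite {i. ?E i (?E' (n - i) v) \<noteq> 0}" for n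
      by (rule finite_support_int[of 0 _ n]) (simp_all add: zeros)
    have fin1: "finite {(i, k). of_int k \<cdot> A k (?E (i - k) (?E' (n - i) v)) \<noteq> 0}"
    proof (rule finite_support_box[of 0 _ n 0 n])
      fix i k :: int
      show "of_int k \<cdot> A k (?E (i - k) (?E' (n - i) v)) = 0" if "n < k"
        using that by (cases "i - k < 0") (simp_all add: zeros)
      show "of_int k \<cdot> A k (?E (i - k) (?E' (n - i) v)) = 0" if "i < 0"
        using that by (cases "k \<le> 0") (simp_all add: zeros)
    qed (auto simp: zeros intro: zeros)
    have fin2: "finite {(i, k). of_int k \<cdot> B k (?E i (?E' (n - i - k) v)) \<noteq> 0}"
    proof (rule finite_support_box[of 0 _ n 0 n])
      fix i k :: int
      show "of_int k \<cdot> B k (?E i (?E' (n - i - k) v)) = 0" if "n < k"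
        using that by (cases "i < 0") (simp_all add: zeros)
      show "of_int k \<cdot> B k (?E i (?E' (n - i - k) v)) = 0" if "n < i"
        using that by (cases "k \<le> 0") (simp_all add: zeros)
    qed (simp_all add: zeros)
    have "of_int n \<cdot> x n = Sum_any (\<lambda>i. of_int n \<cdot> ?E i (?E' (n - i) v))"
      unfolding x_def by (rule Sum_any_scale[OF supp])
    also have "\<dots> = Sum_any (\<lambda>i. of_int i \<cdot> ?E i (?E' (n - i) v) + ?E i (of_int (n - i) \<cdot> ?E' (n - i) v))"
      by (rule arg_cong[where f = Sum_any], rule ext)
        (simp only: lin_scale[OF linE], rule scale_split)
    also have "\<dots> = Sum_any (\<lambda>i. Sum_any (\<lambda>k. of_int k \<cdot> A k (?E (i - k) (?E' (n - i) v))) +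
        Sum_any (\<lambda>k. of_int k \<cdot> B k (?E i (?E' (n - i - k) v))))"
      by (simp only: ser_exp_euler[OF A] ser_exp_euler[OF B]
        Sum_any_lin[OF linE exponent_ser_exp_support[OF B]] lin_scale[OF linE] EB)
    also have "\<dots> = Sum_any (\<lambda>i. Sum_any (\<lambda>k. of_int k \<cdot> A k (?E (i - k) (?E' (n - i) v)))) +
        Sum_any (\<lambda>i. Sum_any (\<lambda>k. of_int k \<cdot> B k (?E i (?E' (n - i - k) v))))"
      by (intro Sum_any.distrib finite_support_inner(3) fin1 fin2)
    also have "\<dots> = Sum_any (\<lambda>k. Sum_any (\<lambda>i. of_int k \<cdot> A k (?E (i - k) (?E' (n - i) v)))) +
        Sum_any (\<lambda>k. Sum_any (\<lambda>i. of_int k \<cdot> B k (?E i (?E' (n - i - k) v))))"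
      by (simp only: Sum_any_swap[OF fin1] Sum_any_swap[OF fin2])
    also have "(\<lambda>k. Sum_any (\<lambda>i. of_int k \<cdot> A k (?E (i - k) (?E' (n - i) v)))) = (\<lambda>k. of_int k \<cdot> A k (x (n - k)))"
    proof
      fix k
      have "Sum_any (\<lambda>i. of_int k \<cdot> A k (?E (i - k) (?E' (n - i) v))) =
          Sum_any (\<lambda>i. of_int k \<cdot> A k (?E i (?E' (n - k - i) v)))"
        by (subst Sum_any_shift[of _ k, symmetric]) (simp add: algebra_simps)
      then show "Sum_any (\<lambda>i. of_int k \<cdot> A k (?E (i - k) (?E' (n - i) v))) = of_int k \<cdot> A k (x (n - k))"
        unfolding x_def by (simp add: Sum_any_lin[OF lin_smult[OF linA] supp])
    qed
    also have "(\<lambda>k. Sum_any (\<lambda>i. of_int k \<cdot> B k (?E i (?E' (n - i - k) v)))) = (\<lambda>k. of_int k \<cdot> B k (x (n - k)))"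
      unfolding x_def by (simp add: Sum_any_lin[OF lin_smult[OF linB] supp] diff_right_commute)
    also have "Sum_any (\<lambda>k. of_int k \<cdot> A k (x (n - k))) + Sum_any (\<lambda>k. of_int k \<cdot> B k (x (n - k))) =
        Sum_any (\<lambda>k. of_int k \<cdot> A k (x (n - k)) + of_int k \<cdot> B k (x (n - k)))"
    proof -
      have "x m = 0" if "m < 0" for m
      proof -
        have "?E i (?E' (m - i) v) = 0" for i using that by (cases "i < 0") (simp_all add: zeros)
        then show ?thesis by (simp add: x_def)
      qed
      then show ?thesis
        by (intro Sum_any.distrib[symmetric] finite_support_int[of 0 _ n]) (simp_all add: zeros)
    qed
    finally show "of_int n \<cdot> x n = Sum_any (\<lambda>k. of_int k \<cdot> (A k (x (n - k)) + B k (x (n - k))))"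
      by (simp add: cvec.scale_right_distrib)
  qed
  moreover have "x 0 = v"
    unfolding x_def by (subst Sum_any_single[of 0]) (auto simp: zeros ser_exp_zero A B neq_iff)
  ultimately show ?thesis by (simp add: x_def)
qed

text \<open>If \<open>[B, A] = c z\<^sup>m\<close> then \<open>[B, exp A] = c z\<^sup>m exp A\<close>: the difference
  \<open>B exp A - c z\<^sup>m exp A\<close> satisfies the recursion of \<open>exp A\<close>.\<close>

lemma ser_exp_commutator:
  assumes A: "exponent A" and B: "lin B" and m: "m > 0"
    and BA: "\<And>k v. B (A k v) = A k (B v) + (if k = m then c \<cdot> v else 0)"
  shows "B (ser_exp A n v) = ser_exp A n (B v) + c \<cdot> ser_exp A (n - m) v"
proof -
  let ?E = "ser_exp A"
  note linA = exponent_lin[OF A]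
  note zeros = exponent_nonpos[OF A] ser_exp_negative[OF A] lin_zero[OF linA] lin_zero[OF B]
  define x where "x n = B (?E n v) - c \<cdot> ?E (n - m) v" for n
  have "x n = ?E n (x 0)"
  proof (rule ser_exp_unique[OF A])
    fix n
    show "x n = 0" if "n < 0" using that m by (simp add: x_def zeros)
    have supp1: "finite {k. of_int k \<cdot> A k (B (?E (n - k) v)) \<noteq> 0}"
      by (rule finite_support_int[of 0 _ n]) (simp_all add: zeros)
    have supp2: "finite {k. (if k = m then (of_int m * c) \<cdot> ?E (n - m) v else 0) \<noteq> 0}"
      by (rule finite_support_int[of m _ m]) simp_all
    have "of_int n \<cdot> B (?E n v) = Sum_any (\<lambda>k. of_int k \<cdot> B (A k (?E (n - k) v)))"
      by (simp add: lin_scale[OF B, symmetric] ser_exp_euler[OF A]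
        Sum_any_lin[OF B exponent_ser_exp_support[OF A]] del: cvec.scale_scale)
    also have "\<dots> = Sum_any (\<lambda>k. of_int k \<cdot> A k (B (?E (n - k) v)) +
        (if k = m then (of_int m * c) \<cdot> ?E (n - m) v else 0))"
      by (rule arg_cong[where f = Sum_any]) (auto simp: fun_eq_iff BA cvec.scale_right_distrib)
    also have "\<dots> = Sum_any (\<lambda>k. of_int k \<cdot> A k (B (?E (n - k) v))) + (of_int m * c) \<cdot> ?E (n - m) v"
      by (subst Sum_any.distrib[OF supp1 supp2]) simp
    finally have 1: "of_int n \<cdot> B (?E n v) =
        Sum_any (\<lambda>k. of_int k \<cdot> A k (B (?E (n - k) v))) + (of_int m * c) \<cdot> ?E (n - m) v" .
    have supp3: "finite {k. c \<cdot> of_int k \<cdot> A k (?E (n - m - k) v) \<noteq> 0}"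
      by (rule finite_support_int[of 0 _ "n - m"]) (simp_all add: zeros)
    have "of_int n \<cdot> c \<cdot> ?E (n - m) v =
        c \<cdot> (of_int (n - m) \<cdot> ?E (n - m) v) + (of_int m * c) \<cdot> ?E (n - m) v"
      by (subst scale_split[of n _ "n - m"]) (simp add: mult.commute)
    also have "c \<cdot> (of_int (n - m) \<cdot> ?E (n - m) v) =
        Sum_any (\<lambda>k. c \<cdot> of_int k \<cdot> A k (?E (n - m - k) v))"
      by (simp only: ser_exp_euler[OF A] Sum_any_scale[OF exponent_ser_exp_support[OF A]])
    finally have 2: "of_int n \<cdot> c \<cdot> ?E (n - m) v =
        Sum_any (\<lambda>k. c \<cdot> of_int k \<cdot> A k (?E (n - m - k) v)) + (of_int m * c) \<cdot> ?E (n - m) v" .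
    have "of_int n \<cdot> x n = Sum_any (\<lambda>k. of_int k \<cdot> A k (B (?E (n - k) v)))
        - Sum_any (\<lambda>k. c \<cdot> of_int k \<cdot> A k (?E (n - m - k) v))"
      unfolding x_def cvec.scale_right_diff_distrib 1 2 by simp
    also have "\<dots> = Sum_any (\<lambda>k. of_int k \<cdot> A k (B (?E (n - k) v)) -
        c \<cdot> of_int k \<cdot> A k (?E (n - m - k) v))"
      by (rule Sum_any_diff[OF supp1 supp3, symmetric])
    also have "\<dots> = Sum_any (\<lambda>k. of_int k \<cdot> A k (x (n - k)))"
      by (simp add: x_def lin_diff[OF linA] lin_scale[OF linA] cvec.scale_right_diff_distrib
          mult.commute diff_right_commute)
    finally show "of_int n \<cdot> x n = Sum_any (\<lambda>k. of_int k \<cdot> A k (x (n - k)))" .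
  qed
  moreover have "x 0 = B v" using m by (simp add: x_def zeros ser_exp_zero[OF A])
  ultimately show ?thesis by (simp add: x_def algebra_simps)
qed

section \<open>The exponentials of a vertex operator on the symmetric algebra\<close>

text \<open>For a grading by subspaces \<open>spanned_by (B d)\<close> that the coefficient of \<open>z\<^sup>k\<close> raises by \<open>k\<close>; used with the
  degree (negatively) and with constant \<open>B\<close>, that is, for invariant subspaces.\<close>

lemma ser_exp_spanned_by:
  assumes A: "exponent A"
    and AB: "\<And>k d u. k > 0 \<Longrightarrow> u \<in> spanned_by (B d) \<Longrightarrow> A k u \<in> spanned_by (B (d + k))"
    and u: "u \<in> spanned_by (B d)"
  shows "ser_exp A n u \<in> spanned_by (B (d + n))"
proof -
  have AB': "A k u \<in> spanned_by (B (d + k))" if "u \<in> spanned_by (B d)" for k d u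
    using AB[of k u d] that by (cases "k > 0") (simp_all add: exponent_nonpos[OF A] spanned_by_zero)
  have "ser_power A j n u \<in> spanned_by (B (d + n))" for j n
  proof (induction j arbitrary: n)
    case 0
    then show ?case using u by (cases "n = 0") (simp_all add: ser_const_def spanned_by_zero)
  next
    case (Suc j)
    have "A k (ser_power A j (n - k) u) \<in> spanned_by (B (d + n))" for k
      using AB'[OF Suc, of k "n - k"] by simp
    then show ?case by (simp add: ser_mult_def spanned_by_Sum_any)
  qed
  then show ?thesis
    unfolding ser_exp_def by (intro spanned_by_Sum_any spanned_by_scale)
qed

text \<open>\<open>T\<^sub>-\<close> and \<open>T\<^sub>+\<close> on \<open>S\<close>. The second is indexed by the negative of the exponent of \<open>z\<close>, so that both are
  exponents in the sense above; the same holds for the exponentials.\<close>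

definition creation :: "lat \<Rightarrow> (gen \<times> int \<Rightarrow>\<^sub>0 nat) op_series" where
  "creation \<alpha> k u = (if k > 0 then (1 / of_int k) \<cdot> heis_sym \<alpha> (- k) u else 0)"

definition annihilation :: "lat \<Rightarrow> (gen \<times> int \<Rightarrow>\<^sub>0 nat) op_series" where
  "annihilation \<alpha> k u = (if k > 0 then - ((1 / of_int k) \<cdot> heis_sym \<alpha> k u) else 0)"

lemma exponent_creation: "exponent (creation \<alpha>)"
  unfolding exponent_def
proof (intro conjI allI impI)
  fix k l v
  show "creation \<alpha> k (creation \<alpha> l v) = creation \<alpha> l (creation \<alpha> k v)"
    using heis_sym_commute[of \<alpha> "- k" \<alpha> "- l" v]
    by (simp add: creation_def lin_rules[OF lin_heis_sym] mult.commute)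
qed (simp_all add: creation_def[abs_def] lin_if lin_smult lin_heis_sym lin_0)

lemma exponent_annihilation: "exponent (annihilation \<alpha>)"
  unfolding exponent_def
proof (intro conjI allI impI)
  fix k l v
  show "annihilation \<alpha> k (annihilation \<alpha> l v) = annihilation \<alpha> l (annihilation \<alpha> k v)"
    using heis_sym_commute[of \<alpha> k \<alpha> l v]
    by (simp add: annihilation_def lin_rules[OF lin_heis_sym] mult.commute)
qed (simp_all add: annihilation_def[abs_def] lin_if lin_minus lin_smult lin_heis_sym lin_0)

definition exp_minus :: "lat \<Rightarrow> (gen \<times> int \<Rightarrow>\<^sub>0 nat) op_series" where
  "exp_minus \<alpha> = ser_exp (creation \<alpha>)"

definition exp_plus :: "lat \<Rightarrow> (gen \<times> int \<Rightarrow>\<^sub>0 nat) op_series" where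
  "exp_plus \<alpha> = ser_exp (annihilation \<alpha>)"

lemma lin_exp_minus: "lin (exp_minus \<alpha> n)" and lin_exp_plus: "lin (exp_plus \<alpha> n)"
  by (simp_all add: exp_minus_def exp_plus_def lin_ser_exp exponent_creation exponent_annihilation)

lemma exp_minus_negative: "n < 0 \<Longrightarrow> exp_minus \<alpha> n u = 0"
  and exp_plus_negative: "n < 0 \<Longrightarrow> exp_plus \<alpha> n u = 0"
  by (simp_all add: exp_minus_def exp_plus_def ser_exp_negative exponent_creation exponent_annihilation)

lemma exp_minus_zero: "exp_minus \<alpha> 0 u = u" and exp_plus_zero: "exp_plus \<alpha> 0 u = u"
  by (simp_all add: exp_minus_def exp_plus_def ser_exp_zero exponent_creation exponent_annihilation)

lemma creation_commute: "creation \<alpha> k (creation \<beta> l v) = creation \<beta> l (creation \<alpha> k v)"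
  using heis_sym_commute[of \<alpha> "- k" \<beta> "- l" v]
  by (simp add: creation_def lin_rules[OF lin_heis_sym] mult.commute)

lemma annihilation_commute: "annihilation \<alpha> k (annihilation \<beta> l v) = annihilation \<beta> l (annihilation \<alpha> k v)"
  using heis_sym_commute[of \<alpha> k \<beta> l v]
  by (simp add: annihilation_def lin_rules[OF lin_heis_sym] mult.commute)

lemma exp_minus_commute: "exp_minus \<alpha> m (exp_minus \<beta> n u) = exp_minus \<beta> n (exp_minus \<alpha> m u)"
  unfolding exp_minus_def
  by (rule ser_exp_ser_exp_commute[OF exponent_creation exponent_creation creation_commute])

lemma exp_plus_commute: "exp_plus \<alpha> m (exp_plus \<beta> n u) = exp_plus \<beta> n (exp_plus \<alpha> m u)"
  unfolding exp_plus_def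
  by (rule ser_exp_ser_exp_commute[OF exponent_annihilation exponent_annihilation annihilation_commute])

lemma exp_minus_add:
  "exp_minus (\<alpha> + \<beta>) n u = Sum_any (\<lambda>i. exp_minus \<alpha> i (exp_minus \<beta> (n - i) u))"
proof -
  have "creation (\<alpha> + \<beta>) = (\<lambda>k v. creation \<alpha> k v + creation \<beta> k v)"
    by (simp add: fun_eq_iff creation_def heis_sym_add cvec.scale_right_distrib)
  then show ?thesis
    by (simp add: exp_minus_def ser_exp_add exponent_creation creation_commute)
qed

lemma exp_plus_add:
  "exp_plus (\<alpha> + \<beta>) n u = Sum_any (\<lambda>i. exp_plus \<alpha> i (exp_plus \<beta> (n - i) u))"
proof -
  have "annihilation (\<alpha> + \<beta>) = (\<lambda>k v. annihilation \<alpha> k v + annihilation \<beta> k v)"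
    by (simp add: fun_eq_iff annihilation_def heis_sym_add cvec.scale_right_distrib)
  then show ?thesis
    by (simp add: exp_plus_def ser_exp_add exponent_annihilation annihilation_commute)
qed

lemma exp_minus_euler:
  "of_int n \<cdot> exp_minus \<alpha> n u =
     Sum_any (\<lambda>k. if k > 0 then heis_sym \<alpha> (- k) (exp_minus \<alpha> (n - k) u) else 0)"
  unfolding exp_minus_def ser_exp_euler[OF exponent_creation]
  by (rule arg_cong[where f = Sum_any]) (auto simp: fun_eq_iff creation_def)

lemma exp_plus_euler:
  "of_int n \<cdot> exp_plus \<alpha> n u =
     - Sum_any (\<lambda>k. if k > 0 then heis_sym \<alpha> k (exp_plus \<alpha> (n - k) u) else 0)"
  unfolding exp_plus_def ser_exp_euler[OF exponent_annihilation] Sum_any_uminus[symmetric]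
  by (rule arg_cong[where f = Sum_any]) (auto simp: fun_eq_iff annihilation_def)

lemma exp_minus_of_0: "exp_minus 0 n u = (if n = 0 then u else 0)"
  using exp_minus_euler[of n 0 u] by (auto simp: exp_minus_zero cong: if_cong)

lemma exp_plus_of_0: "exp_plus 0 n u = (if n = 0 then u else 0)"
  using exp_plus_euler[of n 0 u] by (auto simp: exp_plus_zero cong: if_cong)

lemma heis_sym_exp_plus: "k > 0 \<Longrightarrow> heis_sym \<beta> k (exp_plus \<alpha> n u) = exp_plus \<alpha> n (heis_sym \<beta> k u)"
  unfolding exp_plus_def
  by (rule ser_exp_commute[OF exponent_annihilation exponent_annihilation lin_heis_sym])
    (use heis_sym_commute[of \<beta> k \<alpha>] in \<open>simp add: annihilation_def lin_rules[OF lin_heis_sym]\<close>)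

text \<open>The commutator \<open>[\<alpha>(-k), exp T\<^sub>+(\<beta>,z)]\<close>, up to normalisation, with the roles of the two lattice vectors
  exchanged.\<close>

lemma creation_exp_plus:
  assumes "k > 0"
  shows "creation \<beta> k (exp_plus \<alpha> n u) =
    exp_plus \<alpha> n (creation \<beta> k u) + (of_int (lat_form \<alpha> \<beta>) / of_int k) \<cdot> exp_plus \<alpha> (n - k) u"
  unfolding exp_plus_def
proof (rule ser_exp_commutator[OF exponent_annihilation exponent_lin[OF exponent_creation] assms])
  fix l v
  show "creation \<beta> k (annihilation \<alpha> l v) = annihilation \<alpha> l (creation \<beta> k v) +
      (if l = k then (of_int (lat_form \<alpha> \<beta>) / of_int k) \<cdot> v else 0)"
    using assms heis_sym_commute[of \<beta> "- k" \<alpha> l v]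
    by (auto simp: creation_def annihilation_def lin_rules[OF lin_heis_sym] lat_form_commute[of \<beta> \<alpha>]
        cvec.scale_right_distrib cvec.scale_right_diff_distrib mult.commute)
qed

lemma exp_plus_deg:
  assumes "u \<in> deg_le d"
  shows "exp_plus \<alpha> n u \<in> deg_le (d - n)"
proof -
  have "exp_plus \<alpha> n u \<in> spanned_by {\<mu>. mono_deg \<mu> \<le> - (- d + n)}"
    unfolding exp_plus_def
  proof (rule ser_exp_spanned_by[OF exponent_annihilation, where B = "\<lambda>d. {\<mu>. mono_deg \<mu> \<le> - d}"])
    fix k d :: int and u
    assume "k > 0" "u \<in> spanned_by {\<mu>. mono_deg \<mu> \<le> - d}"
    then show "annihilation \<alpha> k u \<in> spanned_by {\<mu>. mono_deg \<mu> \<le> - (d + k)}"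
      using heis_sym_deg[of u "- d" \<alpha> k]
      by (simp add: annihilation_def deg_le_def spanned_by_scale spanned_by_uminus)
  qed (use assms in \<open>simp add: deg_le_def\<close>)
  then show ?thesis by (simp add: deg_le_def)
qed

lemma exp_plus_large: "u \<in> deg_le d \<Longrightarrow> d < n \<Longrightarrow> exp_plus \<alpha> n u = 0"
  by (rule deg_le_negative[OF exp_plus_deg]) auto

lemmas exp_zeros = exp_minus_negative exp_plus_negative lin_zero[OF lin_exp_minus] lin_zero[OF lin_exp_plus]
  lin_zero[OF lin_heis_sym]

text \<open>The coefficients of \<open>(1 - x)\<^sup>a\<close>, characterised by the recursion coming from
  \<open>x d/dx (1 - x)\<^sup>a = - a (x + x\<^sup>2 + \<dots>) (1 - x)\<^sup>a\<close>. This is the form in which they arise in the exchange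
  relation.\<close>

definition binomial_coeffs :: "int \<Rightarrow> (int \<Rightarrow> complex) \<Rightarrow> bool" where
  "binomial_coeffs a c \<longleftrightarrow> (\<forall>j<0. c j = 0) \<and> c 0 = 1 \<and>
     (\<forall>j. of_int j * c j = - of_int a * Sum_any (\<lambda>k. if k > 0 then c (j - k) else 0))"

lemma binomial_coeffs_0: "binomial_coeffs 0 (\<lambda>j. if j = 0 then 1 else 0)"
  by (simp add: binomial_coeffs_def)

lemma binomial_coeffs_1: "binomial_coeffs 1 (\<lambda>j. if j = 0 then 1 else if j = 1 then -1 else 0)"
  unfolding binomial_coeffs_def
proof (intro conjI allI impI)
  fix j :: int
  let ?c = "\<lambda>j :: int. if j = 0 then 1 else if j = 1 then -1 else 0 :: complex"
  have "Sum_any (\<lambda>k. if k > 0 then ?c (j - k) else 0) =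
      (\<Sum>k\<in>{j-1, j}. if k > 0 then ?c (j - k) else 0)"
    by (rule Sum_any.expand_superset) auto
  also have "\<dots> = (if j = 1 then 1 else 0)" by auto
  finally show "of_int j * ?c j = - of_int 1 * Sum_any (\<lambda>k. if k > 0 then ?c (j - k) else 0)"
    by auto
qed auto

lemma binomial_coeffs_minus_1: "binomial_coeffs (-1) (\<lambda>j. if j \<ge> 0 then 1 else 0)"
  unfolding binomial_coeffs_def
proof (intro conjI allI impI)
  fix j :: int
  let ?c = "\<lambda>j :: int. if j \<ge> 0 then 1 else 0 :: complex"
  have "Sum_any (\<lambda>k. if k > 0 then ?c (j - k) else 0) =
      (\<Sum>k\<in>{1..j}. if k > 0 then ?c (j - k) else 0)"
    by (rule Sum_any_interval) auto
  also have "\<dots> = (if j \<ge> 0 then of_int j else 0)" by simp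
  finally show "of_int j * ?c j = - of_int (-1) * Sum_any (\<lambda>k. if k > 0 then ?c (j - k) else 0)"
    by auto
qed auto

text \<open>The exchange relation
  \<open>exp T\<^sub>+(\<alpha>,z) exp T\<^sub>-(\<beta>,w) = (1 - w/z)\<^sup>a exp T\<^sub>-(\<beta>,w) exp T\<^sub>+(\<alpha>,z)\<close> with \<open>a = (\<alpha>,\<beta>)\<close>. Apply
  \<open>w d/dw\<close> to the left-hand side and move the mode \<open>\<beta>(-k)\<close> that appears to the left of \<open>exp T\<^sub>+\<close>. The
  main terms and the commutators form the same recursion in \<open>l\<close> that the right-hand side satisfies, the
  commutators accounting for the derivative of the binomial factor.\<close>

lemma exp_plus_exp_minus:
  assumes c: "binomial_coeffs (lat_form \<alpha> \<beta>) c"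
  shows "exp_plus \<alpha> a (exp_minus \<beta> l u) = Sum_any (\<lambda>j. c j \<cdot> exp_minus \<beta> (l - j) (exp_plus \<alpha> (a - j) u))"
proof (induction "nat l" arbitrary: a l rule: less_induct)
  case less
  let ?P = "exp_minus \<beta>" and ?Q = "exp_plus \<alpha>" and ?x = "of_int (lat_form \<alpha> \<beta>) :: complex"
  have c0: "c j = 0" if "j < 0" for j using that c by (simp add: binomial_coeffs_def)
  consider "l < 0" | "l = 0" | "l > 0" by linarith
  then show ?case
  proof cases
    case 1
    have "c j \<cdot> ?P (l - j) (?Q (a - j) u) = 0" for j
      using 1 c0 by (cases "j < 0") (simp_all add: exp_zeros)
    then have "Sum_any (\<lambda>j. c j \<cdot> ?P (l - j) (?Q (a - j) u)) = 0" by (rule Sum_any_zero)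
    then show ?thesis using 1 by (simp add: exp_zeros)
  next
    case 2
    have "c j \<cdot> ?P (l - j) (?Q (a - j) u) = 0" if "j \<noteq> 0" for j
      using 2 c0 that by (cases "j < 0") (simp_all add: exp_zeros)
    then have "Sum_any (\<lambda>j. c j \<cdot> ?P (l - j) (?Q (a - j) u)) = c 0 \<cdot> ?P l (?Q a u)"
      by (subst Sum_any_single[of 0]) auto
    then show ?thesis using 2 c by (simp add: exp_minus_zero binomial_coeffs_def)
  next
    case 3
    let ?h = "\<lambda>k. heis_sym \<beta> (- k)"
    \<comment> \<open>\<open>w d/dw\<close> brings down \<open>\<beta>(-k)\<close>; this moves it past the annihilation part\<close>
    have hQ: "?Q a (?h k v) = ?h k (?Q a v) - ?x \<cdot> ?Q (a - k) v" if "k > 0" for k v a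
    proof -
      have "of_int k \<cdot> creation \<beta> k (?Q a v) = of_int k \<cdot> (?Q a (creation \<beta> k v) + (?x / of_int k) \<cdot> ?Q (a - k) v)"
        by (simp only: creation_exp_plus[OF that])
      then show ?thesis
        using that by (simp add: creation_def lin_scale[OF lin_exp_plus] cvec.scale_right_distrib)
    qed
    have supp0: "finite {k. (if k > 0 then ?h k (?P (l - k) v) else 0) \<noteq> 0}" for v l
      by (rule finite_support_int[of 0 _ l]) (auto simp: exp_zeros)
    have suppj: "finite {j. c j \<cdot> ?P (m - j) (?Q (b - j) u) \<noteq> 0}" for m b
      by (rule finite_support_int[of 0 _ m]) (auto simp: exp_zeros c0)
    define f where "f j = ?P (l - j) (?Q (a - j) u)" for j
    have f0: "f j = 0" if "j > l" for j using that by (simp add: f_def exp_zeros)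
    have fin1: "finite {(k, j). (if k > 0 then c j \<cdot> ?h k (?P (l - k - j) (?Q (a - j) u)) else 0) \<noteq> 0}"
    proof (rule finite_support_box[of 0 _ l 0 l])
      fix k j :: int
      show "(if k > 0 then c j \<cdot> ?h k (?P (l - k - j) (?Q (a - j) u)) else 0) = 0" if "l < k"
        using that by (cases "j < 0") (simp_all add: exp_zeros c0)
      show "(if k > 0 then c j \<cdot> ?h k (?P (l - k - j) (?Q (a - j) u)) else 0) = 0" if "l < j"
        using that by (simp add: exp_zeros)
    qed (auto simp: c0)
    have fin2: "finite {(k, j). (if k > 0 then c (j - k) \<cdot> f j else 0) \<noteq> 0}"
    proof (rule finite_support_box[of 0 _ l 0 l])
      fix k j :: int
      show "(if k > 0 then c (j - k) \<cdot> f j else 0) = 0" if "l < k"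
        using that by (cases "j - k < 0") (simp_all add: c0 f0)
    qed (auto simp: c0 f0)
    have "of_int l \<cdot> ?Q a (?P l u) = Sum_any (\<lambda>k. if k > 0 then ?Q a (?h k (?P (l - k) u)) else 0)"
      unfolding lin_scale[OF lin_exp_plus, symmetric] exp_minus_euler
      by (subst Sum_any_lin[OF lin_exp_plus supp0], rule arg_cong[where f = Sum_any])
        (auto simp: fun_eq_iff exp_zeros)
    also have "\<dots> = Sum_any (\<lambda>k. (if k > 0 then Sum_any (\<lambda>j. c j \<cdot> ?h k (?P (l - k - j) (?Q (a - j) u))) else 0)
        - ?x \<cdot> (if k > 0 then Sum_any (\<lambda>j. c (j - k) \<cdot> f j) else 0))"
    proof (rule arg_cong[where f = Sum_any], rule ext)
      fix k
      show "(if k > 0 then ?Q a (?h k (?P (l - k) u)) else 0) =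
        (if k > 0 then Sum_any (\<lambda>j. c j \<cdot> ?h k (?P (l - k - j) (?Q (a - j) u))) else 0)
        - ?x \<cdot> (if k > 0 then Sum_any (\<lambda>j. c (j - k) \<cdot> f j) else 0)"
      proof (cases "k > 0")
        case True
        then have IH: "?Q b (?P (l - k) u) = Sum_any (\<lambda>j. c j \<cdot> ?P (l - k - j) (?Q (b - j) u))" for b
          using 3 by (intro less) auto
        have "?h k (?Q a (?P (l - k) u)) = Sum_any (\<lambda>j. c j \<cdot> ?h k (?P (l - k - j) (?Q (a - j) u)))"
          unfolding IH Sum_any_lin[OF lin_heis_sym suppj] lin_scale[OF lin_heis_sym] ..
        moreover have "?Q (a - k) (?P (l - k) u) = Sum_any (\<lambda>j. c (j - k) \<cdot> f j)"
          unfolding IH by (subst Sum_any_shift[of _ "- k", symmetric]) (simp add: f_def)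
        ultimately show ?thesis using True by (simp add: hQ)
      qed simp
    qed
    also have "\<dots> = Sum_any (\<lambda>k. Sum_any (\<lambda>j. if k > 0 then c j \<cdot> ?h k (?P (l - k - j) (?Q (a - j) u)) else 0))
        - ?x \<cdot> Sum_any (\<lambda>k. Sum_any (\<lambda>j. if k > 0 then c (j - k) \<cdot> f j else 0))"
    proof -
      have e1: "(\<lambda>k. if k > 0 then Sum_any (\<lambda>j. c j \<cdot> ?h k (?P (l - k - j) (?Q (a - j) u))) else 0) =
          (\<lambda>k. Sum_any (\<lambda>j. if k > 0 then c j \<cdot> ?h k (?P (l - k - j) (?Q (a - j) u)) else 0))"
        and e2: "(\<lambda>k. if k > 0 then Sum_any (\<lambda>j. c (j - k) \<cdot> f j) else 0) =
          (\<lambda>k. Sum_any (\<lambda>j. if k > 0 then c (j - k) \<cdot> f j else 0))"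
        by (auto simp: fun_eq_iff)
      have fin3: "finite {k. ?x \<cdot> Sum_any (\<lambda>j. if k > 0 then c (j - k) \<cdot> f j else 0) \<noteq> 0}"
        by (rule finite_subset[OF _ finite_support_inner(3)[OF fin2]]) auto
      show ?thesis
        unfolding fun_cong[OF e1] fun_cong[OF e2]
        by (simp only: Sum_any_diff[OF finite_support_inner(3)[OF fin1] fin3]
            Sum_any_scale[OF finite_support_inner(3)[OF fin2]])
    qed
    also have "\<dots> = Sum_any (\<lambda>j. Sum_any (\<lambda>k. if k > 0 then c j \<cdot> ?h k (?P (l - k - j) (?Q (a - j) u)) else 0))
        - ?x \<cdot> Sum_any (\<lambda>j. Sum_any (\<lambda>k. if k > 0 then c (j - k) \<cdot> f j else 0))"
      by (simp only: Sum_any_swap[OF fin1] Sum_any_swap[OF fin2])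
    also have "(\<lambda>j. Sum_any (\<lambda>k. if k > 0 then c j \<cdot> ?h k (?P (l - k - j) (?Q (a - j) u)) else 0)) =
        (\<lambda>j. (of_int (l - j) * c j) \<cdot> f j)"
    proof
      fix j
      have "(of_int (l - j) * c j) \<cdot> f j = c j \<cdot> of_int (l - j) \<cdot> ?P (l - j) (?Q (a - j) u)"
        by (simp add: f_def mult.commute)
      also have "\<dots> = Sum_any (\<lambda>k. c j \<cdot> (if k > 0 then ?h k (?P (l - j - k) (?Q (a - j) u)) else 0))"
        by (simp only: exp_minus_euler Sum_any_scale[OF supp0])
      also have "\<dots> = Sum_any (\<lambda>k. if k > 0 then c j \<cdot> ?h k (?P (l - k - j) (?Q (a - j) u)) else 0)"
        by (rule arg_cong[where f = Sum_any]) (auto simp: fun_eq_iff diff_right_commute)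
      finally show "Sum_any (\<lambda>k. if k > 0 then c j \<cdot> ?h k (?P (l - k - j) (?Q (a - j) u)) else 0) =
          (of_int (l - j) * c j) \<cdot> f j" ..
    qed
    also have "?x \<cdot> Sum_any (\<lambda>j. Sum_any (\<lambda>k. if k > 0 then c (j - k) \<cdot> f j else 0)) =
        - Sum_any (\<lambda>j. (of_int j * c j) \<cdot> f j)"
    proof -
      have suppc: "finite {k. (if k > 0 then c (j - k) else 0) \<noteq> 0}" for j
        by (rule finite_support_int[of 0 _ j]) (auto simp: c0)
      have fin2': "finite {(j, k). (if k > 0 then c (j - k) \<cdot> f j else 0) \<noteq> 0}"
        by (rule finite_subset[OF _ finite_imageI[OF fin2, of prod.swap]]) force
      have "Sum_any (\<lambda>k. if k > 0 then c (j - k) \<cdot> f j else 0) =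
          Sum_any (\<lambda>k. if k > 0 then c (j - k) else 0) \<cdot> f j" for j
      proof -
        have "Sum_any (\<lambda>k. if k > 0 then c (j - k) \<cdot> f j else 0) =
            (\<Sum>k\<in>{1..j}. (if k > 0 then c (j - k) else 0) \<cdot> f j)"
          by (subst Sum_any_interval[of 1 _ j]) (auto simp: c0)
        also have "\<dots> = (\<Sum>k\<in>{1..j}. (if k > 0 then c (j - k) else 0)) \<cdot> f j"
          by (rule cvec.scale_sum_left[symmetric])
        also have "(\<Sum>k\<in>{1..j}. (if k > 0 then c (j - k) else 0)) = Sum_any (\<lambda>k. if k > 0 then c (j - k) else 0)"
          by (subst Sum_any_interval[of 1 _ j]) (auto simp: c0)
        finally show ?thesis .
      qed
      then have "?x \<cdot> Sum_any (\<lambda>j. Sum_any (\<lambda>k. if k > 0 then c (j - k) \<cdot> f j else 0)) =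
          Sum_any (\<lambda>j. ?x \<cdot> Sum_any (\<lambda>k. if k > 0 then c (j - k) else 0) \<cdot> f j)"
        using Sum_any_scale[OF finite_support_inner(3)[OF fin2'], of ?x] by (simp only:)
      also have "\<dots> = Sum_any (\<lambda>j. - ((of_int j * c j) \<cdot> f j))"
        using c by (simp add: binomial_coeffs_def)
      finally show ?thesis by (simp add: Sum_any_uminus)
    qed
    also have "Sum_any (\<lambda>j. (of_int (l - j) * c j) \<cdot> f j) - - Sum_any (\<lambda>j. (of_int j * c j) \<cdot> f j) =
        Sum_any (\<lambda>j. (of_int (l - j) * c j) \<cdot> f j + (of_int j * c j) \<cdot> f j)"
      unfolding diff_minus_eq_add
      by (intro Sum_any.distrib[symmetric] finite_support_int[of 0 _ l]) (simp_all add: c0 f0)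
    also have "\<dots> = Sum_any (\<lambda>j. of_int l \<cdot> c j \<cdot> f j)"
      by (simp add: algebra_simps)
    also have "\<dots> = of_int l \<cdot> Sum_any (\<lambda>j. c j \<cdot> f j)"
      by (rule Sum_any_scale[symmetric]) (rule finite_support_int[of 0 _ l], simp_all add: c0 f0)
    finally show ?thesis using 3 by (simp add: f_def)
  qed
qed

section \<open>Vertex operators on the symmetric algebra\<close>

text \<open>The coefficient of \<open>z\<^sup>k\<close> in \<open>exp T\<^sub>-(\<alpha>,z) exp T\<^sub>+(\<alpha>,z)\<close>.\<close>

definition vertex_sym :: "lat \<Rightarrow> (gen \<times> int \<Rightarrow>\<^sub>0 nat) op_series" where
  "vertex_sym \<alpha> k u = Sum_any (\<lambda>a. exp_minus \<alpha> (k + a) (exp_plus \<alpha> a u))"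

text \<open>The coefficient of \<open>z\<^sup>k w\<^sup>l\<close> in the normally ordered product
  \<open>exp T\<^sub>-(\<alpha>,z) exp T\<^sub>-(\<beta>,w) exp T\<^sub>+(\<alpha>,z) exp T\<^sub>+(\<beta>,w)\<close>. It is symmetric, and on each vector only
  finitely many coefficients with \<open>k + l\<close> fixed are nonzero, so that \<open>w = z\<close> can be substituted.\<close>

definition vertex_pair :: "lat \<Rightarrow> lat \<Rightarrow> int \<Rightarrow> int \<Rightarrow> (gen \<times> int) sym_alg \<Rightarrow> (gen \<times> int) sym_alg" where
  "vertex_pair \<alpha> \<beta> k l u = Sum_any (\<lambda>a. Sum_any (\<lambda>b.
     exp_minus \<alpha> (k + a) (exp_minus \<beta> (l + b) (exp_plus \<alpha> a (exp_plus \<beta> b u)))))"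

lemma vertex_sym_support: "finite {a. exp_minus \<alpha> (k + a) (exp_plus \<alpha> a u) \<noteq> 0}"
proof -
  obtain d where "u \<in> deg_le d" using deg_le_exists by blast
  then show ?thesis
    by (intro finite_support_int[of 0 _ d]) (simp_all add: exp_zeros exp_plus_large)
qed

lemma lin_vertex_sym: "lin (vertex_sym \<alpha> k)"
proof -
  have "vertex_sym \<alpha> k = (\<lambda>u. Sum_any (\<lambda>a. exp_minus \<alpha> (k + a) (exp_plus \<alpha> a u)))"
    by (simp add: fun_eq_iff vertex_sym_def)
  then show ?thesis
    by (simp only:) (rule lin_Sum_any[OF lin_compose[OF lin_exp_minus lin_exp_plus] vertex_sym_support])
qed

lemma exp_plus_plus_support:
  assumes "u \<in> deg_le d" "exp_plus \<alpha> a (exp_plus \<beta> b u) \<noteq> 0"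
  shows "0 \<le> a \<and> a \<le> d \<and> 0 \<le> b \<and> b \<le> d"
proof -
  have "0 \<le> a" using assms(2) by (metis exp_plus_negative not_le)
  moreover have "0 \<le> b" using assms(2) exp_zeros by (metis not_le)
  moreover have "exp_plus \<alpha> a (exp_plus \<beta> b u) \<in> deg_le (d - b - a)"
    by (intro exp_plus_deg assms)
  then have "\<not> d - b - a < 0" using assms(2) deg_le_negative by blast
  ultimately show ?thesis by auto
qed

lemma vertex_pair_term_support:
  assumes "u \<in> deg_le d"
    and "exp_minus \<alpha> k' (exp_minus \<beta> l' (exp_plus \<alpha> a (exp_plus \<beta> b u))) \<noteq> 0"
  shows "0 \<le> k' \<and> 0 \<le> l' \<and> 0 \<le> a \<and> a \<le> d \<and> 0 \<le> b \<and> b \<le> d"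
proof -
  have "exp_plus \<alpha> a (exp_plus \<beta> b u) \<noteq> 0" using assms(2) by (auto simp: exp_zeros)
  moreover have "0 \<le> k'" using assms(2) by (metis exp_minus_negative not_le)
  moreover have "0 \<le> l'" using assms(2) exp_zeros by (metis not_le)
  ultimately show ?thesis using exp_plus_plus_support[OF assms(1)] by blast
qed

lemma vertex_pair_support:
  "finite {(a, b). exp_minus \<alpha> (k + a) (exp_minus \<beta> (l + b) (exp_plus \<alpha> a (exp_plus \<beta> b u))) \<noteq> 0}"
proof -
  obtain d where d: "u \<in> deg_le d" using deg_le_exists by blast
  show ?thesis
  proof (rule finite_subset)
    show "{(a, b). exp_minus \<alpha> (k + a) (exp_minus \<beta> (l + b) (exp_plus \<alpha> a (exp_plus \<beta> b u))) \<noteq> 0}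
        \<subseteq> {0..d} \<times> {0..d}"
      by (auto dest: vertex_pair_term_support[OF d])
  qed simp
qed

lemma lin_vertex_pair: "lin (vertex_pair \<alpha> \<beta> k l)"
proof -
  have "vertex_pair \<alpha> \<beta> k l = (\<lambda>u. Sum_any (\<lambda>a. Sum_any (\<lambda>b.
     exp_minus \<alpha> (k + a) (exp_minus \<beta> (l + b) (exp_plus \<alpha> a (exp_plus \<beta> b u))))))"
    by (simp add: fun_eq_iff vertex_pair_def)
  then show ?thesis
    by (simp only:) (rule lin_Sum_any[OF lin_Sum_any],
      rule lin_compose[OF lin_exp_minus lin_compose[OF lin_exp_minus lin_compose[OF lin_exp_plus lin_exp_plus]]],
      rule finite_support_inner(1)[OF vertex_pair_support], rule finite_support_inner(3)[OF vertex_pair_support])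
qed

lemma vertex_pair_large:
  assumes "u \<in> deg_le d" "k < - d \<or> l < - d"
  shows "vertex_pair \<alpha> \<beta> k l u = 0"
  unfolding vertex_pair_def
proof (intro Sum_any_zero, rule ccontr)
  fix a b
  assume "exp_minus \<alpha> (k + a) (exp_minus \<beta> (l + b) (exp_plus \<alpha> a (exp_plus \<beta> b u))) \<noteq> 0"
  from vertex_pair_term_support[OF assms(1) this] assms(2) show False by linarith
qed

lemma vertex_sym_large:
  assumes "u \<in> deg_le d" "k < - d"
  shows "vertex_sym \<alpha> k u = 0"
  unfolding vertex_sym_def
proof (rule Sum_any_zero)
  fix a show "exp_minus \<alpha> (k + a) (exp_plus \<alpha> a u) = 0"
    using assms by (cases "a > d") (simp_all add: exp_plus_large exp_zeros)
qed

lemma vertex_pair_commute: "vertex_pair \<alpha> \<beta> k l u = vertex_pair \<beta> \<alpha> l k u"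
  unfolding vertex_pair_def
  by (subst Sum_any_swap[OF vertex_pair_support])
    (simp only: exp_minus_commute[of \<alpha>] exp_plus_commute[of \<alpha>])

text \<open>Moving the annihilation part of the first factor past the creation part of the second gives the
  factor \<open>(1 - w/z)\<^sup>a\<close>, whose term \<open>(w/z)\<^sup>j\<close> shifts \<open>(k, l)\<close>.\<close>

lemma vertex_sym_vertex_sym:
  assumes c: "binomial_coeffs (lat_form \<alpha> \<beta>) c"
  shows "vertex_sym \<alpha> k (vertex_sym \<beta> l u) = Sum_any (\<lambda>j. c j \<cdot> vertex_pair \<alpha> \<beta> (k + j) (l - j) u)"
proof -
  obtain d where d: "d \<ge> 0" "u \<in> deg_le d" using deg_le_exists by blast
  have c0: "c j = 0" if "j < 0" for j using that c by (simp add: binomial_coeffs_def)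
  let ?f = "\<lambda>a b j. c j \<cdot> exp_minus \<alpha> (k + a) (exp_minus \<beta> (l + b - j) (exp_plus \<alpha> (a - j) (exp_plus \<beta> b u)))"
  have supp: "a \<in> {0..d + d + \<bar>l\<bar>} \<and> b \<in> {0..d} \<and> j \<in> {0..d + \<bar>l\<bar>}" if "?f a b j \<noteq> 0" for a b j
  proof -
    have "c j \<noteq> 0" using that by auto
    then have "j \<ge> 0" using c0 not_le by blast
    moreover have "exp_minus \<alpha> (k + a) (exp_minus \<beta> (l + b - j) (exp_plus \<alpha> (a - j) (exp_plus \<beta> b u))) \<noteq> 0"
      using that by auto
    from vertex_pair_term_support[OF d(2) this]
    have "0 \<le> l + b - j \<and> 0 \<le> a - j \<and> a - j \<le> d \<and> 0 \<le> b \<and> b \<le> d" by blast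
    ultimately show ?thesis by auto
  qed
  have supp2: "finite {j. c j \<cdot> exp_minus \<beta> (m - j) (exp_plus \<alpha> (a - j) v) \<noteq> 0}" for m a v
    by (rule finite_support_int[of 0 _ m]) (simp_all add: c0 exp_zeros)
  have "vertex_sym \<alpha> k (vertex_sym \<beta> l u) = Sum_any (\<lambda>a. Sum_any (\<lambda>b. Sum_any (\<lambda>j. ?f a b j)))"
    unfolding vertex_sym_def
  proof (rule arg_cong[where f = Sum_any], rule ext)
    fix a
    have "exp_minus \<alpha> (k + a) (exp_plus \<alpha> a (exp_minus \<beta> (l + b) (exp_plus \<beta> b u))) = Sum_any (\<lambda>j. ?f a b j)" for b
      by (simp only: exp_plus_exp_minus[OF c] Sum_any_lin[OF lin_exp_minus supp2] lin_scale[OF lin_exp_minus])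
    then show "exp_minus \<alpha> (k + a) (exp_plus \<alpha> a (Sum_any (\<lambda>b. exp_minus \<beta> (l + b) (exp_plus \<beta> b u)))) =
        Sum_any (\<lambda>b. Sum_any (\<lambda>j. ?f a b j))"
      by (simp only: Sum_any_lin[OF lin_compose[OF lin_exp_minus lin_exp_plus] vertex_sym_support])
  qed
  also have "\<dots> = Sum_any (\<lambda>j. Sum_any (\<lambda>a. Sum_any (\<lambda>b. ?f a b j)))"
    by (rule Sum_any_rotate[OF _ _ _ supp]) simp_all
  also have "\<dots> = Sum_any (\<lambda>j. c j \<cdot> vertex_pair \<alpha> \<beta> (k + j) (l - j) u)"
  proof (rule arg_cong[where f = Sum_any], rule ext)
    fix j
    have "Sum_any (\<lambda>a. Sum_any (\<lambda>b. ?f a b j)) = Sum_any (\<lambda>a. Sum_any (\<lambda>b. ?f (a + j) b j))"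
      by (rule Sum_any_shift[symmetric])
    also have "\<dots> = Sum_any (\<lambda>a. Sum_any (\<lambda>b. c j \<cdot>
        exp_minus \<alpha> (k + j + a) (exp_minus \<beta> (l - j + b) (exp_plus \<alpha> a (exp_plus \<beta> b u)))))"
      by (simp add: algebra_simps)
    also have "\<dots> = c j \<cdot> vertex_pair \<alpha> \<beta> (k + j) (l - j) u"
      unfolding vertex_pair_def
      by (simp only: Sum_any_scale[OF finite_support_inner(1)[OF vertex_pair_support]]
          Sum_any_scale[OF finite_support_inner(3)[OF vertex_pair_support]])
    finally show "Sum_any (\<lambda>a. Sum_any (\<lambda>b. ?f a b j)) = c j \<cdot> vertex_pair \<alpha> \<beta> (k + j) (l - j) u" .
  qed
  finally show ?thesis .
qed

text \<open>Substitution of \<open>w = z\<close>: creation parts and annihilation parts combine, as \<open>T\<^sub>\<plusminus>(\<alpha>,z)\<close> is additive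
  in \<open>\<alpha>\<close>.\<close>

lemma vertex_pair_diagonal:
  "Sum_any (\<lambda>k. vertex_pair \<alpha> \<beta> k (n - k) u) = vertex_sym (\<alpha> + \<beta>) n u"
proof -
  obtain d where d: "d \<ge> 0" "u \<in> deg_le d" using deg_le_exists by blast
  let ?P = exp_minus and ?Q = exp_plus
  let ?g = "\<lambda>c i a. ?P \<alpha> i (?P \<beta> (n + c - i) (?Q \<alpha> a (?Q \<beta> (c - a) u)))"
  have supp1: "finite {i. ?P \<alpha> i (?P \<beta> (m - i) v) \<noteq> 0}" for m v
    by (rule finite_support_int[of 0 _ m]) (simp_all add: exp_zeros)
  have supp2: "finite {a. ?Q \<alpha> a (?Q \<beta> (m - a) v) \<noteq> 0}" for m v
    by (rule finite_support_int[of 0 _ m]) (simp_all add: exp_zeros)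
  have suppg: "c \<in> {0..d + d} \<and> i \<in> {0..\<bar>n\<bar> + d + d} \<and> a \<in> {0..d}" if "?g c i a \<noteq> 0" for c i a
    using vertex_pair_term_support[OF d(2) that] by auto
  have "vertex_sym (\<alpha> + \<beta>) n u = Sum_any (\<lambda>c. Sum_any (\<lambda>i. Sum_any (\<lambda>a. ?g c i a)))"
    unfolding vertex_sym_def exp_minus_add exp_plus_add
    by (simp only: Sum_any_lin[OF lin_compose[OF lin_exp_minus lin_exp_minus] supp2])
  also have "\<dots> = Sum_any (\<lambda>a. Sum_any (\<lambda>c. Sum_any (\<lambda>i. ?g c i a)))"
    by (rule Sum_any_rotate[OF _ _ _ suppg]) simp_all
  also have "\<dots> = Sum_any (\<lambda>a. Sum_any (\<lambda>b. Sum_any (\<lambda>i. ?g (b + a) i a)))"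
    by (rule arg_cong[where f = Sum_any], rule ext)
      (rule Sum_any_shift[of "\<lambda>c. Sum_any (\<lambda>i. ?g c i a)" a for a, symmetric])
  also have "\<dots> = Sum_any (\<lambda>a. Sum_any (\<lambda>b. Sum_any (\<lambda>k. ?g (b + a) (k + a) a)))"
    by (rule arg_cong[where f = Sum_any], rule ext, rule arg_cong[where f = Sum_any], rule ext)
      (rule Sum_any_shift[of "\<lambda>i. ?g (b + a) i a" a for a b, symmetric])
  also have "\<dots> = Sum_any (\<lambda>a. Sum_any (\<lambda>b. Sum_any (\<lambda>k.
      ?P \<alpha> (k + a) (?P \<beta> (n - k + b) (?Q \<alpha> a (?Q \<beta> b u))))))"
    by (simp add: algebra_simps)
  also have "\<dots> = Sum_any (\<lambda>k. Sum_any (\<lambda>a. Sum_any (\<lambda>b.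
      ?P \<alpha> (k + a) (?P \<beta> (n - k + b) (?Q \<alpha> a (?Q \<beta> b u))))))"
  proof (rule Sum_any_rotate)
    fix a b k assume "?P \<alpha> (k + a) (?P \<beta> (n - k + b) (?Q \<alpha> a (?Q \<beta> b u))) \<noteq> 0"
    from vertex_pair_term_support[OF d(2) this]
    show "a \<in> {0..d} \<and> b \<in> {0..d} \<and> k \<in> {-d..\<bar>n\<bar> + d}" by auto
  qed simp_all
  finally show ?thesis by (simp add: vertex_pair_def)
qed

text \<open>The effect of \<open>z d/dz\<close>, in which \<open>z\<close> appears in one exponential of each kind: the creation modes come out
  on the left, the annihilation modes on the right, in normal order.\<close>

lemma vertex_pair_euler:
  "of_int k \<cdot> vertex_pair \<alpha> \<beta> k l u = Sum_any (\<lambda>m. if m > 0 then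
     heis_sym \<alpha> (- m) (vertex_pair \<alpha> \<beta> (k - m) l u) + vertex_pair \<alpha> \<beta> (k + m) l (heis_sym \<alpha> m u) else 0)"
proof -
  obtain d where d: "d \<ge> 0" "u \<in> deg_le d" using deg_le_exists by blast
  let ?P = exp_minus and ?Q = exp_plus
  define g1 where "g1 a b m = (if m > 0 then
    heis_sym \<alpha> (- m) (?P \<alpha> (k + a - m) (?P \<beta> (l + b) (?Q \<alpha> a (?Q \<beta> b u)))) else 0)" for a b m
  define g2 where "g2 a b m = (if m > 0 then
    ?P \<alpha> (k + a) (?P \<beta> (l + b) (?Q \<alpha> (a - m) (?Q \<beta> b (heis_sym \<alpha> m u)))) else 0)" for a b m
  have supp1: "a \<in> {0..d} \<and> b \<in> {0..d} \<and> m \<in> {0..\<bar>k\<bar> + d}" if "g1 a b m \<noteq> 0" for a b m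
  proof -
    have "m > 0" using that by (auto simp: g1_def split: if_splits)
    moreover have "?P \<alpha> (k + a - m) (?P \<beta> (l + b) (?Q \<alpha> a (?Q \<beta> b u))) \<noteq> 0"
      using that by (auto simp: g1_def exp_zeros split: if_splits)
    from vertex_pair_term_support[OF d(2) this]
    have "0 \<le> k + a - m \<and> 0 \<le> a \<and> a \<le> d \<and> 0 \<le> b \<and> b \<le> d" by blast
    ultimately show ?thesis by auto
  qed
  have supp2: "a \<in> {0..d} \<and> b \<in> {0..d} \<and> m \<in> {0..d}" if "g2 a b m \<noteq> 0" for a b m
  proof -
    have m: "m > 0" using that by (auto simp: g2_def split: if_splits)
    have nz: "?P \<alpha> (k + a) (?P \<beta> (l + b) (?Q \<alpha> (a - m) (?Q \<beta> b (heis_sym \<alpha> m u)))) \<noteq> 0"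
      using that by (auto simp: g2_def split: if_splits)
    from vertex_pair_term_support[OF heis_sym_deg[OF d(2)] this]
    have "0 \<le> a - m \<and> a - m \<le> d - m \<and> 0 \<le> b \<and> b \<le> d - m" by blast
    with m show ?thesis by auto
  qed
  have fin1: "finite {(b, m). g1 a b m \<noteq> 0}" for a
  proof (rule finite_subset)
    show "{(b, m). g1 a b m \<noteq> 0} \<subseteq> {0..d} \<times> {0..\<bar>k\<bar> + d}" using supp1 by blast
  qed simp
  have fin2: "finite {(b, m). g2 a b m \<noteq> 0}" for a
  proof (rule finite_subset)
    show "{(b, m). g2 a b m \<noteq> 0} \<subseteq> {0..d} \<times> {0..d}" using supp2 by blast
  qed simp
  have suppP: "finite {m. (if m > 0 then heis_sym \<alpha> (- m) (?P \<alpha> (n - m) v) else 0) \<noteq> 0}" for n v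
    by (rule finite_support_int[of 0 _ n]) (simp_all add: exp_zeros)
  have suppQ: "finite {m. (if m > 0 then heis_sym \<alpha> m (?Q \<alpha> (n - m) v) else 0) \<noteq> 0}" for n v
    by (rule finite_support_int[of 0 _ n]) (simp_all add: exp_zeros)
  have "of_int k \<cdot> vertex_pair \<alpha> \<beta> k l u = Sum_any (\<lambda>a. Sum_any (\<lambda>b.
      of_int k \<cdot> ?P \<alpha> (k + a) (?P \<beta> (l + b) (?Q \<alpha> a (?Q \<beta> b u)))))"
    unfolding vertex_pair_def
    by (simp only: Sum_any_scale[OF finite_support_inner(1)[OF vertex_pair_support]]
        Sum_any_scale[OF finite_support_inner(3)[OF vertex_pair_support]])
  also have "\<dots> = Sum_any (\<lambda>a. Sum_any (\<lambda>b. Sum_any (\<lambda>m. g1 a b m) + Sum_any (\<lambda>m. g2 a b m)))"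
  proof (rule arg_cong[where f = Sum_any], rule ext, rule arg_cong[where f = Sum_any], rule ext)
    fix a b
    let ?v = "?P \<beta> (l + b) (?Q \<alpha> a (?Q \<beta> b u))"
    have "of_int k \<cdot> ?P \<alpha> (k + a) ?v = of_int (k + a) \<cdot> ?P \<alpha> (k + a) ?v - of_int a \<cdot> ?P \<alpha> (k + a) ?v"
      by (simp flip: cvec.scale_left_diff_distrib)
    also have "of_int (k + a) \<cdot> ?P \<alpha> (k + a) ?v = Sum_any (\<lambda>m. g1 a b m)"
      by (simp only: exp_minus_euler g1_def)
    also have "of_int a \<cdot> ?P \<alpha> (k + a) ?v = ?P \<alpha> (k + a) (?P \<beta> (l + b) (of_int a \<cdot> ?Q \<alpha> a (?Q \<beta> b u)))"
      by (simp only: lin_scale[OF lin_exp_minus])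
    also have "\<dots> = - Sum_any (\<lambda>m. g2 a b m)"
    proof -
      have *: "?P \<alpha> (k + a) (?P \<beta> (l + b) (if m > 0 then heis_sym \<alpha> m (?Q \<alpha> (a - m) (?Q \<beta> b u)) else 0)) = g2 a b m" for m
        by (simp add: g2_def heis_sym_exp_plus exp_zeros)
      show ?thesis
        unfolding exp_plus_euler lin_uminus[OF lin_exp_minus]
          Sum_any_lin[OF lin_compose[OF lin_exp_minus lin_exp_minus] suppQ] * ..
    qed
    finally show "of_int k \<cdot> ?P \<alpha> (k + a) ?v = Sum_any (\<lambda>m. g1 a b m) + Sum_any (\<lambda>m. g2 a b m)"
      by simp
  qed
  also have "\<dots> = Sum_any (\<lambda>a. Sum_any (\<lambda>b. Sum_any (\<lambda>m. g1 a b m)) + Sum_any (\<lambda>b. Sum_any (\<lambda>m. g2 a b m)))"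
    by (simp only: Sum_any.distrib[OF finite_support_inner(3)[OF fin1] finite_support_inner(3)[OF fin2]])
  also have "\<dots> = Sum_any (\<lambda>a. Sum_any (\<lambda>b. Sum_any (\<lambda>m. g1 a b m))) + Sum_any (\<lambda>a. Sum_any (\<lambda>b. Sum_any (\<lambda>m. g2 a b m)))"
  proof (rule Sum_any.distrib)
    have "{a. Sum_any (\<lambda>b. Sum_any (\<lambda>m. g1 a b m)) \<noteq> 0} \<subseteq> {0..d}"
      using supp1 by (blast dest!: Sum_any_nonzero)
    then show "finite {a. Sum_any (\<lambda>b. Sum_any (\<lambda>m. g1 a b m)) \<noteq> 0}"
      by (rule finite_subset) simp
    have "{a. Sum_any (\<lambda>b. Sum_any (\<lambda>m. g2 a b m)) \<noteq> 0} \<subseteq> {0..d}"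
      using supp2 by (blast dest!: Sum_any_nonzero)
    then show "finite {a. Sum_any (\<lambda>b. Sum_any (\<lambda>m. g2 a b m)) \<noteq> 0}"
      by (rule finite_subset) simp
  qed
  also have "Sum_any (\<lambda>a. Sum_any (\<lambda>b. Sum_any (\<lambda>m. g1 a b m))) = Sum_any (\<lambda>m. Sum_any (\<lambda>a. Sum_any (\<lambda>b. g1 a b m)))"
    by (rule Sum_any_rotate[OF _ _ _ supp1]) simp_all
  also have "(\<lambda>m. Sum_any (\<lambda>a. Sum_any (\<lambda>b. g1 a b m))) =
      (\<lambda>m. if m > 0 then heis_sym \<alpha> (- m) (vertex_pair \<alpha> \<beta> (k - m) l u) else 0)"
  proof
    fix m
    have "k + a - m = k - m + a" for a by simp
    then show "Sum_any (\<lambda>a. Sum_any (\<lambda>b. g1 a b m)) =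
        (if m > 0 then heis_sym \<alpha> (- m) (vertex_pair \<alpha> \<beta> (k - m) l u) else 0)"
      unfolding vertex_pair_def g1_def
      by (simp only: Sum_any_lin[OF lin_heis_sym finite_support_inner(1)[OF vertex_pair_support]]
        Sum_any_lin[OF lin_heis_sym finite_support_inner(3)[OF vertex_pair_support]]) auto
  qed
  also have "Sum_any (\<lambda>a. Sum_any (\<lambda>b. Sum_any (\<lambda>m. g2 a b m))) = Sum_any (\<lambda>m. Sum_any (\<lambda>a. Sum_any (\<lambda>b. g2 a b m)))"
    by (rule Sum_any_rotate[OF _ _ _ supp2]) simp_all
  also have "(\<lambda>m. Sum_any (\<lambda>a. Sum_any (\<lambda>b. g2 a b m))) =
      (\<lambda>m. if m > 0 then vertex_pair \<alpha> \<beta> (k + m) l (heis_sym \<alpha> m u) else 0)"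
  proof
    fix m
    have "Sum_any (\<lambda>a. Sum_any (\<lambda>b. g2 a b m)) = Sum_any (\<lambda>a. Sum_any (\<lambda>b. g2 (a + m) b m))"
      by (rule Sum_any_shift[symmetric])
    also have "\<dots> = (if m > 0 then vertex_pair \<alpha> \<beta> (k + m) l (heis_sym \<alpha> m u) else 0)"
      by (simp add: g2_def vertex_pair_def algebra_simps)
    finally show "Sum_any (\<lambda>a. Sum_any (\<lambda>b. g2 a b m)) =
        (if m > 0 then vertex_pair \<alpha> \<beta> (k + m) l (heis_sym \<alpha> m u) else 0)" .
  qed
  also have "Sum_any (\<lambda>m. if m > 0 then heis_sym \<alpha> (- m) (vertex_pair \<alpha> \<beta> (k - m) l u) else 0) +
      Sum_any (\<lambda>m. if m > 0 then vertex_pair \<alpha> \<beta> (k + m) l (heis_sym \<alpha> m u) else 0) =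
      Sum_any (\<lambda>m. (if m > 0 then heis_sym \<alpha> (- m) (vertex_pair \<alpha> \<beta> (k - m) l u) else 0) +
        (if m > 0 then vertex_pair \<alpha> \<beta> (k + m) l (heis_sym \<alpha> m u) else 0))"
  proof (intro Sum_any.distrib[symmetric] finite_support_int[of 0 _ "\<bar>k\<bar> + d"])
    fix m assume m: "\<bar>k\<bar> + d < m"
    then have "k - m < - d" by linarith
    then show "(if m > 0 then heis_sym \<alpha> (- m) (vertex_pair \<alpha> \<beta> (k - m) l u) else 0) = 0"
      using vertex_pair_large[OF d(2), of "k - m" l \<alpha> \<beta>] by (simp add: exp_zeros)
    have "heis_sym \<alpha> m u = 0" using heis_sym_deg[OF d(2), of \<alpha> m] deg_le_negative[of _ "d - m"] m by force
    then show "(if m > 0 then vertex_pair \<alpha> \<beta> (k + m) l (heis_sym \<alpha> m u) else 0) = 0"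
      by (simp add: lin_zero[OF lin_vertex_pair])
  qed simp_all
  finally show ?thesis by (simp add: if_distrib cong: if_cong)
qed

lemma vertex_pair_diagonal_euler:
  "Sum_any (\<lambda>k. of_int k \<cdot> vertex_pair \<alpha> \<beta> k (n - k) u) = Sum_any (\<lambda>m. if m > 0 then
     heis_sym \<alpha> (- m) (vertex_sym (\<alpha> + \<beta>) (n - m) u) + vertex_sym (\<alpha> + \<beta>) (n + m) (heis_sym \<alpha> m u) else 0)"
proof -
  obtain d where d: "d \<ge> 0" "u \<in> deg_le d" using deg_le_exists by blast
  let ?f = "\<lambda>k m. if m > 0 then heis_sym \<alpha> (- m) (vertex_pair \<alpha> \<beta> (k - m) (n - k) u) +
      vertex_pair \<alpha> \<beta> (k + m) (n - k) (heis_sym \<alpha> m u) else 0"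
  have large: "heis_sym \<alpha> m u = 0" if "d < m" for m
    using heis_sym_deg[OF d(2), of \<alpha> m] deg_le_negative[of _ "d - m"] that by force
  have fin: "finite {(k, m). ?f k m \<noteq> 0}"
  proof (rule finite_support_box[of "- d - d" _ "\<bar>n\<bar> + d + d" 0 "d + d + \<bar>n\<bar> + d"])
    fix k m :: int
    have 1: "m > 0 \<Longrightarrow> heis_sym \<alpha> m u \<in> deg_le d"
      using heis_sym_deg[OF d(2), of \<alpha> m] unfolding deg_le_def by (rule spanned_by_mono) auto
    show "?f k m = 0" if "k < - d - d"
      using that d(1) 1 large by (cases "m > d")
        (auto simp: vertex_pair_large[OF d(2)] vertex_pair_large[of _ d] exp_zeros lin_zero[OF lin_vertex_pair])
    show "?f k m = 0" if "\<bar>n\<bar> + d + d < k"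
    proof -
      have "n - k < - d" using that d(1) by linarith
      then have "vertex_pair \<alpha> \<beta> k' (n - k) v = 0" if "v \<in> deg_le d" for k' v
        by (intro vertex_pair_large[OF that]) simp
      then show ?thesis using 1 d(2) by (simp add: exp_zeros)
    qed
    show "?f k m = 0" if "d + d + \<bar>n\<bar> + d < m"
    proof (cases "k - m < - d")
      case True
      then show ?thesis using that d(1) large[of m]
        by (auto simp: vertex_pair_large[OF d(2)] exp_zeros lin_zero[OF lin_vertex_pair])
    next
      case False
      then show ?thesis using that d(1) large[of m]
        by (auto simp: vertex_pair_large[OF d(2)] exp_zeros lin_zero[OF lin_vertex_pair])
    qed
  qed auto
  have supp: "finite {k. vertex_pair \<alpha> \<beta> k (n - k) v \<noteq> 0}" for n v
  proof -
    obtain d where d: "v \<in> deg_le d" using deg_le_exists by blast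
    then show ?thesis
      by (intro finite_support_int[of "- d" _ "n + d"]) (simp_all add: vertex_pair_large)
  qed
  have "Sum_any (\<lambda>k. of_int k \<cdot> vertex_pair \<alpha> \<beta> k (n - k) u) = Sum_any (\<lambda>k. Sum_any (\<lambda>m. ?f k m))"
    by (simp only: vertex_pair_euler)
  also have "\<dots> = Sum_any (\<lambda>m. Sum_any (\<lambda>k. ?f k m))"
    by (rule Sum_any_swap[OF fin])
  also have "(\<lambda>m. Sum_any (\<lambda>k. ?f k m)) = (\<lambda>m. if m > 0 then
     heis_sym \<alpha> (- m) (vertex_sym (\<alpha> + \<beta>) (n - m) u) + vertex_sym (\<alpha> + \<beta>) (n + m) (heis_sym \<alpha> m u) else 0)"
  proof
    fix m :: int
    have s1: "finite {k. heis_sym \<alpha> (- m) (vertex_pair \<alpha> \<beta> (k - m) (n - k) u) \<noteq> 0}"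
      by (rule finite_support_int[of "m - d" _ "n + d"]) (simp_all add: vertex_pair_large[OF d(2)] exp_zeros)
    obtain d' where d': "heis_sym \<alpha> m u \<in> deg_le d'" using deg_le_exists by blast
    have s2: "finite {k. vertex_pair \<alpha> \<beta> (k + m) (n - k) (heis_sym \<alpha> m u) \<noteq> 0}"
      by (rule finite_support_int[of "- m - d'" _ "n + d'"]) (simp_all add: vertex_pair_large[OF d'])
    have "Sum_any (\<lambda>k. heis_sym \<alpha> (- m) (vertex_pair \<alpha> \<beta> (k - m) (n - k) u)) =
        Sum_any (\<lambda>k. heis_sym \<alpha> (- m) (vertex_pair \<alpha> \<beta> k (n - m - k) u))"
      by (subst Sum_any_shift[of _ m, symmetric]) (simp add: algebra_simps)
    moreover have "Sum_any (\<lambda>k. vertex_pair \<alpha> \<beta> (k + m) (n - k) (heis_sym \<alpha> m u)) =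
        Sum_any (\<lambda>k. vertex_pair \<alpha> \<beta> k (n + m - k) (heis_sym \<alpha> m u))"
      by (subst Sum_any_shift[of _ "- m", symmetric]) (simp add: algebra_simps)
    ultimately show "Sum_any (\<lambda>k. ?f k m) = (if m > 0 then
        heis_sym \<alpha> (- m) (vertex_sym (\<alpha> + \<beta>) (n - m) u) + vertex_sym (\<alpha> + \<beta>) (n + m) (heis_sym \<alpha> m u) else 0)"
      by (auto simp: Sum_any.distrib[OF s1 s2] Sum_any_lin[OF lin_heis_sym supp, symmetric] vertex_pair_diagonal)
  qed
  finally show ?thesis .
qed

lemma vertex_sym_of_0: "vertex_sym 0 n u = (if n = 0 then u else 0)"
proof -
  have "exp_minus 0 (n + a) (exp_plus 0 a u) = 0" if "a \<noteq> 0" for a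
    using that by (simp add: exp_plus_of_0 exp_zeros)
  then show ?thesis
    unfolding vertex_sym_def by (subst Sum_any_single[of 0]) (auto simp: exp_plus_of_0 exp_minus_of_0)
qed

section \<open>Vertex operators on the Fock space of the lattice\<close>

text \<open>The element \<open>e\<^sup>\<gamma> \<otimes> u\<close>. On these, the operator \<open>Y(\<alpha>,z)\<close> is \<open>vertex_sym\<close> up to a sign and shifts of indices.\<close>

definition sector :: "lat \<Rightarrow> (gen \<times> int) sym_alg \<Rightarrow> V_index cvec" where
  "sector \<gamma> u = tensor (single \<gamma> 1) u"

lemma lin_sector: "lin (sector \<gamma>)"
  unfolding sector_def by (rule lin_tensor_right)

lemma single_eq_sector: "single b 1 = sector (fst b) (single (snd b) 1)"
  by (simp add: sector_def)

lemma sector_eqI: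
  assumes "lin f" "lin g" "\<And>\<gamma> u. f (sector \<gamma> u) = g (sector \<gamma> u)"
  shows "f v = g v"
  by (rule lin_eqI[OF assms(1,2)]) (unfold single_eq_sector, rule assms(3))

lemma lin_heis: "lin (heis \<alpha> k)"
  by (simp add: heis_def lin_op_tensor lin_lin_ext)

lemma heis_sector:
  "heis \<alpha> k (sector \<gamma> u) =
     (if k = 0 then of_int (lat_form \<alpha> \<gamma>) \<cdot> sector \<gamma> u else sector \<gamma> (heis_sym \<alpha> k u))"
proof (cases "k = 0")
  case True
  have "lin_ext (\<lambda>(\<gamma>, \<mu>). of_int (lat_form \<alpha> \<gamma>) \<cdot> single (\<gamma>, \<mu>) 1) (sector \<gamma> u) =
      of_int (lat_form \<alpha> \<gamma>) \<cdot> sector \<gamma> u"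
    by (rule lin_eqI[where v = u])
      (simp_all add: lin_compose[OF lin_lin_ext lin_sector] lin_smult lin_sector, simp add: sector_def)
  with True show ?thesis by (simp add: heis_def)
next
  case False
  have "heis \<alpha> k = op_tensor id (heis_sym \<alpha> k)" using False by (simp add: heis_def heis_sym_def)
  with False show ?thesis
    by (simp add: sector_def op_tensor_tensor[OF lin_id(1) lin_heis_sym])
qed

lemma lin_e_op: "lin (e_op F \<alpha>)"
  by (simp add: e_op_def lin_lin_ext)

lemma e_op_sector: "e_op F \<alpha> (sector \<gamma> u) = of_int (F \<alpha> \<gamma>) \<cdot> sector (\<alpha> + \<gamma>) u"
  by (rule lin_eqI[where v = u])
    (simp_all add: lin_compose[OF lin_e_op lin_sector] lin_smult lin_sector, simp add: sector_def e_op_def)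

lemma lin_z_op: "lin (z_op \<alpha> n)"
  by (simp add: z_op_def lin_lin_ext)

lemma z_op_sector: "z_op \<alpha> n (sector \<gamma> u) = (if lat_form \<alpha> \<gamma> = n then sector \<gamma> u else 0)"
  by (rule lin_eqI[where v = u])
    (simp_all add: lin_compose[OF lin_z_op lin_sector] lin_if lin_0 lin_sector, simp_all add: sector_def z_op_def)

lemma T_minus_sector: "T_minus \<alpha> k (sector \<gamma> u) = sector \<gamma> (creation \<alpha> k u)"
  by (auto simp: T_minus_def Let_def heis_sector creation_def lin_rules[OF lin_sector])

lemma T_plus_sector: "T_plus \<alpha> (- k) (sector \<gamma> u) = sector \<gamma> (annihilation \<alpha> k u)"
  by (auto simp: T_plus_def Let_def heis_sector annihilation_def lin_rules[OF lin_sector])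

lemma lin_T_minus: "lin (T_minus \<alpha> k)" and lin_T_plus: "lin (T_plus \<alpha> k)"
  unfolding T_minus_def T_plus_def Let_def
  by (intro lin_if lin_minus lin_smult lin_heis lin_0)+

lemma exponent_T_minus: "exponent (T_minus \<alpha>)"
  unfolding exponent_def
proof (intro conjI allI impI lin_T_minus)
  fix k l v
  show "T_minus \<alpha> k (T_minus \<alpha> l v) = T_minus \<alpha> l (T_minus \<alpha> k v)"
    by (rule sector_eqI[where v = v])
      (simp_all add: lin_compose[OF lin_T_minus lin_T_minus] T_minus_sector creation_commute)
qed (simp add: T_minus_def)

lemma exponent_T_plus: "exponent (\<lambda>k. T_plus \<alpha> (- k))"
  unfolding exponent_def
proof (intro conjI allI impI lin_T_plus)
  fix k l v
  show "T_plus \<alpha> (- k) (T_plus \<alpha> (- l) v) = T_plus \<alpha> (- l) (T_plus \<alpha> (- k) v)"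
    by (rule sector_eqI[where v = v])
      (simp_all add: lin_compose[OF lin_T_plus lin_T_plus] T_plus_sector annihilation_commute)
qed (simp add: T_plus_def)

lemma ser_exp_reflect: "ser_exp (\<lambda>k. A (- k)) n v = ser_exp A (- n) v"
proof -
  have "ser_power (\<lambda>k. A (- k)) j n v = ser_power A j (- n) v" for j n
  proof (induction j arbitrary: n)
    case (Suc j)
    have "Sum_any (\<lambda>k. A (- k) (ser_power A j (- (n - k)) v)) = Sum_any (\<lambda>k. A k (ser_power A j (- n - k) v))"
      by (subst Sum_any_reflect[of _ 0, symmetric]) (simp add: algebra_simps)
    then show ?case by (simp add: ser_mult_def Suc)
  qed (simp add: ser_const_def)
  then show ?thesis by (simp add: ser_exp_def)
qed

lemma ser_exp_T_minus_sector: "ser_exp (T_minus \<alpha>) n (sector \<gamma> u) = sector \<gamma> (exp_minus \<alpha> n u)"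
  unfolding exp_minus_def
  by (rule ser_exp_intertwine[symmetric])
    (simp_all add: exponent_creation exponent_T_minus lin_sector T_minus_sector)

lemma ser_exp_T_plus_sector: "ser_exp (T_plus \<alpha>) n (sector \<gamma> u) = sector \<gamma> (exp_plus \<alpha> (- n) u)"
proof -
  have "ser_exp (\<lambda>k. T_plus \<alpha> (- k)) (- n) (sector \<gamma> u) = sector \<gamma> (exp_plus \<alpha> (- n) u)"
    unfolding exp_plus_def
    by (rule ser_exp_intertwine[symmetric])
      (simp_all add: exponent_annihilation exponent_T_plus lin_sector T_plus_sector)
  then show ?thesis by (simp add: ser_exp_reflect)
qed

lemma lin_ser_exp_T_plus: "lin (ser_exp (T_plus \<alpha>) n)"
proof -
  have "ser_exp (T_plus \<alpha>) n = ser_exp (\<lambda>k. T_plus \<alpha> (- k)) (- n)"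
    by (simp add: fun_eq_iff ser_exp_reflect)
  then show ?thesis by (simp add: lin_ser_exp exponent_T_plus)
qed

lemma lin_ser_mult:
  assumes "\<And>k. lin (A k)" "\<And>k. lin (B k)" "\<And>b. finite {k. A k (B (n - k) (single b 1)) \<noteq> 0}"
  shows "lin ((A \<star> B) n)"
proof -
  have l: "lin (\<lambda>v. A k (B (n - k) v))" for k by (rule lin_compose[OF assms(1,2)])
  have "(A \<star> B) n = (\<lambda>v. Sum_any (\<lambda>k. A k (B (n - k) v)))" by (simp add: fun_eq_iff ser_mult_def)
  then show ?thesis
    by (simp only:) (rule lin_Sum_any[OF l], rule finite_support_basis[OF l assms(3)])
qed

lemma exp_exp_sector:
  "(ser_exp (T_minus \<alpha>) \<star> ser_exp (T_plus \<alpha>)) n (sector \<gamma> u) = sector \<gamma> (vertex_sym \<alpha> n u)"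
  and exp_exp_support: "finite {k. ser_exp (T_minus \<alpha>) k (ser_exp (T_plus \<alpha>) (n - k) (sector \<gamma> u)) \<noteq> 0}"
proof -
  obtain d where d: "u \<in> deg_le d" using deg_le_exists by blast
  have supp: "finite {k. exp_minus \<alpha> k (exp_plus \<alpha> (k - n) u) \<noteq> 0}"
    by (rule finite_support_int[of 0 _ "n + d"]) (simp_all add: exp_zeros exp_plus_large[OF d])
  then show "finite {k. ser_exp (T_minus \<alpha>) k (ser_exp (T_plus \<alpha>) (n - k) (sector \<gamma> u)) \<noteq> 0}"
    by (rule rev_finite_subset)
      (auto simp: ser_exp_T_plus_sector ser_exp_T_minus_sector lin_zero[OF lin_sector])
  have "Sum_any (\<lambda>k. exp_minus \<alpha> k (exp_plus \<alpha> (k - n) u)) = vertex_sym \<alpha> n u"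
    unfolding vertex_sym_def by (subst Sum_any_shift[of _ n, symmetric]) (simp add: add.commute)
  then show "(ser_exp (T_minus \<alpha>) \<star> ser_exp (T_plus \<alpha>)) n (sector \<gamma> u) = sector \<gamma> (vertex_sym \<alpha> n u)"
    by (simp add: ser_mult_def ser_exp_T_plus_sector ser_exp_T_minus_sector Sum_any_lin[OF lin_sector supp, symmetric])
qed

lemma lin_exp_exp: "lin ((ser_exp (T_minus \<alpha>) \<star> ser_exp (T_plus \<alpha>)) n)"
  by (rule lin_ser_mult)
    (simp_all only: lin_ser_exp exponent_T_minus lin_ser_exp_T_plus single_eq_sector exp_exp_support)

lemma z_exp_exp_sector:
  "(z_op \<alpha> \<star> ser_exp (T_minus \<alpha>) \<star> ser_exp (T_plus \<alpha>)) n (sector \<gamma> u) =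
     sector \<gamma> (vertex_sym \<alpha> (n - lat_form \<alpha> \<gamma>) u)"
  unfolding ser_mult_def[of "z_op \<alpha>"] exp_exp_sector
  by (subst Sum_any_single[of "lat_form \<alpha> \<gamma>"]) (auto simp: z_op_sector)

lemma lin_z_exp_exp: "lin ((z_op \<alpha> \<star> ser_exp (T_minus \<alpha>) \<star> ser_exp (T_plus \<alpha>)) n)"
proof (rule lin_ser_mult[OF lin_z_op lin_exp_exp])
  fix b
  show "finite {k. z_op \<alpha> k ((ser_exp (T_minus \<alpha>) \<star> ser_exp (T_plus \<alpha>)) (n - k) (single b 1)) \<noteq> 0}"
    unfolding single_eq_sector exp_exp_sector
    by (rule finite_support_int[of "lat_form \<alpha> (fst b)" _ "lat_form \<alpha> (fst b)"]) (auto simp: z_op_sector)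
qed

lemma Y_series_eq: "Y_series F \<alpha> n v = e_op F \<alpha> ((z_op \<alpha> \<star> ser_exp (T_minus \<alpha>) \<star> ser_exp (T_plus \<alpha>)) n v)"
  unfolding Y_series_def ser_mult_def[of "ser_const (e_op F \<alpha>)"]
  by (subst Sum_any_single[of 0]) (auto simp: ser_const_def)

lemma lin_Y_series: "lin (Y_series F \<alpha> n)"
  using lin_compose[OF lin_e_op lin_z_exp_exp] by (simp add: Y_series_eq[abs_def])

lemma Y_series_sector:
  "Y_series F \<alpha> n (sector \<gamma> u) = of_int (F \<alpha> \<gamma>) \<cdot> sector (\<alpha> + \<gamma>) (vertex_sym \<alpha> (n - lat_form \<alpha> \<gamma>) u)"
  by (simp add: Y_series_eq z_exp_exp_sector e_op_sector)

lemma field_Y_series: "field (Y_series F \<alpha>)"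
proof (rule fieldI[OF lin_Y_series])
  fix b :: V_index
  obtain d where d: "single (snd b) (1 :: complex) \<in> deg_le d" using deg_le_exists by blast
  have "Y_series F \<alpha> k (single b 1) = 0" if "k < lat_form \<alpha> (fst b) - d" for k
    unfolding single_eq_sector Y_series_sector
    using that by (simp add: vertex_sym_large[OF d] lin_zero[OF lin_sector])
  then show "\<exists>K. \<forall>k<K. Y_series F \<alpha> k (single b 1) = 0" by blast
qed

lemma vertex_sym_heis_sym:
  assumes "lat_form \<beta> \<alpha> = 0"
  shows "heis_sym \<beta> m (vertex_sym \<alpha> n u) = vertex_sym \<alpha> n (heis_sym \<beta> m u)"
proof -
  have "heis_sym \<beta> m (creation \<alpha> k v) = creation \<alpha> k (heis_sym \<beta> m v)"
    and "heis_sym \<beta> m (annihilation \<alpha> k v) = annihilation \<alpha> k (heis_sym \<beta> m v)" for k v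
    using assms heis_sym_commute[of \<beta> m \<alpha> "- k" v] heis_sym_commute[of \<beta> m \<alpha> k v]
    by (simp_all add: creation_def annihilation_def lin_rules[OF lin_heis_sym])
  then have "heis_sym \<beta> m (exp_minus \<alpha> k v) = exp_minus \<alpha> k (heis_sym \<beta> m v)"
    and "heis_sym \<beta> m (exp_plus \<alpha> k v) = exp_plus \<alpha> k (heis_sym \<beta> m v)" for k v
    unfolding exp_minus_def exp_plus_def
    by (simp_all add: ser_exp_commute exponent_creation exponent_annihilation lin_heis_sym)
  then show ?thesis
    unfolding vertex_sym_def by (simp add: Sum_any_lin[OF lin_heis_sym vertex_sym_support])
qed

subsection \<open>Products of two vertex operators\<close>

lemma vertex_sym_orthogonal:
  "lat_form \<alpha> \<beta> = 0 \<Longrightarrow> vertex_sym \<alpha> k (vertex_sym \<beta> l u) = vertex_pair \<alpha> \<beta> k l u"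
  by (subst vertex_sym_vertex_sym[where c = "\<lambda>j. if j = 0 then 1 else 0"])
    (simp_all add: binomial_coeffs_0, subst Sum_any_single[of 0], auto)

text \<open>Case \<open>(\<alpha>,\<beta>) = 1\<close>: the factor \<open>1 - w/z\<close>.\<close>

lemma vertex_sym_form_1:
  assumes "lat_form \<alpha> \<beta> = 1"
  shows "vertex_sym \<alpha> k (vertex_sym \<beta> l u) = vertex_pair \<alpha> \<beta> k l u - vertex_pair \<alpha> \<beta> (k + 1) (l - 1) u"
proof -
  let ?c = "\<lambda>j :: int. if j = 0 then 1 else if j = 1 then -1 else 0 :: complex"
  have "vertex_sym \<alpha> k (vertex_sym \<beta> l u) = Sum_any (\<lambda>j. ?c j \<cdot> vertex_pair \<alpha> \<beta> (k + j) (l - j) u)"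
    by (rule vertex_sym_vertex_sym) (simp add: assms binomial_coeffs_1)
  also have "\<dots> = (\<Sum>j\<in>{0,1}. ?c j \<cdot> vertex_pair \<alpha> \<beta> (k + j) (l - j) u)"
    by (rule Sum_any.expand_superset) auto
  finally show ?thesis by simp
qed

text \<open>Case \<open>(\<alpha>,\<beta>) = -1\<close>: the geometric series, cut off by the index \<open>k\<close>.\<close>

lemma vertex_sym_form_minus_1:
  assumes "lat_form \<alpha> \<beta> = - 1"
  shows "vertex_sym \<alpha> k (vertex_sym \<beta> l u) =
    Sum_any (\<lambda>p. if p \<ge> k then vertex_pair \<alpha> \<beta> p (k + l - p) u else 0)"
proof -
  have "vertex_sym \<alpha> k (vertex_sym \<beta> l u) =
      Sum_any (\<lambda>j. (if j \<ge> 0 then 1 else 0) \<cdot> vertex_pair \<alpha> \<beta> (k + j) (l - j) u)"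
    by (rule vertex_sym_vertex_sym) (simp add: assms binomial_coeffs_minus_1)
  also have "\<dots> = Sum_any (\<lambda>p. if p \<ge> k then vertex_pair \<alpha> \<beta> p (k + l - p) u else 0)"
    by (subst (2) Sum_any_shift[of _ k, symmetric]) (rule arg_cong[where f = Sum_any], auto simp: fun_eq_iff algebra_simps)
  finally show ?thesis .
qed

lemma vertex_pair_diagonal_support: "finite {k. vertex_pair \<alpha> \<beta> k (n - k) u \<noteq> 0}"
proof -
  obtain d where d: "u \<in> deg_le d" using deg_le_exists by blast
  then show ?thesis
    by (intro finite_support_int[of "- d" _ "n + d"]) (simp_all add: vertex_pair_large)
qed

lemma vertex_pair_diagonal_shifted:
  "Sum_any (\<lambda>k. of_int k \<cdot> vertex_pair \<alpha> \<beta> (k - g) (n - (k - g)) u) =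
     of_int g \<cdot> vertex_sym (\<alpha> + \<beta>) n u + Sum_any (\<lambda>k. of_int k \<cdot> vertex_pair \<alpha> \<beta> k (n - k) u)"
proof -
  have s: "finite {k. of_int k \<cdot> vertex_pair \<alpha> \<beta> k (n - k) u \<noteq> 0}"
    and s': "finite {k. of_int g \<cdot> vertex_pair \<alpha> \<beta> k (n - k) u \<noteq> 0}"
    by (rule finite_subset[OF _ vertex_pair_diagonal_support[of \<alpha> \<beta> n u]]; auto)+
  have "Sum_any (\<lambda>k. of_int k \<cdot> vertex_pair \<alpha> \<beta> (k - g) (n - (k - g)) u) =
      Sum_any (\<lambda>k. of_int g \<cdot> vertex_pair \<alpha> \<beta> k (n - k) u + of_int k \<cdot> vertex_pair \<alpha> \<beta> k (n - k) u)"
    by (subst Sum_any_shift[of _ g, symmetric]) (simp add: algebra_simps)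
  also have "\<dots> = Sum_any (\<lambda>k. of_int g \<cdot> vertex_pair \<alpha> \<beta> k (n - k) u) + Sum_any (\<lambda>k. of_int k \<cdot> vertex_pair \<alpha> \<beta> k (n - k) u)"
    by (rule Sum_any.distrib[OF s' s])
  finally show ?thesis
    by (simp add: Sum_any_scale[OF vertex_pair_diagonal_support, symmetric] vertex_pair_diagonal)
qed

text \<open>Bimultiplicativity is required on the whole group of finitely supported functions, so that no
  membership in a sublattice has to be carried along; the given cocycle is extended accordingly at the end.\<close>

locale bimultiplicative =
  fixes F :: "lat \<Rightarrow> lat \<Rightarrow> int"
  assumes F_add_left: "F (\<alpha> + \<beta>) \<gamma> = F \<alpha> \<gamma> * F \<beta> \<gamma>"
    and F_add_right: "F \<alpha> (\<beta> + \<gamma>) = F \<alpha> \<beta> * F \<alpha> \<gamma>"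
    and F_sign: "F \<alpha> \<beta> = 1 \<or> F \<alpha> \<beta> = - 1"
begin

lemma F_0 [simp]: "F 0 \<gamma> = 1" "F \<gamma> 0 = 1"
  using F_add_left[of 0 0 \<gamma>] F_add_right[of \<gamma> 0 0] F_sign[of 0 \<gamma>] F_sign[of \<gamma> 0] by auto

lemma F_uminus [simp]: "F (- \<alpha>) \<gamma> = F \<alpha> \<gamma>" "F \<alpha> (- \<gamma>) = F \<alpha> \<gamma>"
  using F_add_left[of \<alpha> "- \<alpha>" \<gamma>] F_add_right[of \<alpha> \<gamma> "- \<gamma>"]
    F_sign[of \<alpha> \<gamma>] F_sign[of "- \<alpha>" \<gamma>] F_sign[of \<alpha> "- \<gamma>"] by auto

lemma F_diff: "F (\<alpha> - \<beta>) \<gamma> = F \<alpha> \<gamma> * F \<beta> \<gamma>" "F \<gamma> (\<alpha> - \<beta>) = F \<gamma> \<alpha> * F \<gamma> \<beta>"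
  using F_add_left[of \<alpha> "- \<beta>"] F_add_right[of \<gamma> \<alpha> "- \<beta>"] by simp_all

lemma F_square [simp]: "F \<alpha> \<beta> * F \<alpha> \<beta> = 1"
  using F_sign[of \<alpha> \<beta>] by auto

abbreviation Y :: "lat \<Rightarrow> int \<Rightarrow> V_index cvec \<Rightarrow> V_index cvec" where
  "Y \<equiv> Y_series F"

lemma Y_Y_sector:
  "Y \<alpha> k (Y \<beta> l (sector \<gamma> u)) = of_int (F \<alpha> \<beta> * F (\<alpha> + \<beta>) \<gamma>) \<cdot> sector (\<alpha> + \<beta> + \<gamma>)
     (vertex_sym \<alpha> (k - lat_form \<alpha> \<beta> - lat_form \<alpha> \<gamma>) (vertex_sym \<beta> (l - lat_form \<beta> \<gamma>) u))"
  by (simp add: Y_series_sector lin_scale[OF lin_Y_series] F_add_left F_add_right mult_ac add_ac diff_diff_eq)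

lemma Y_Y_orthogonal_sector:
  "lat_form \<alpha> \<beta> = 0 \<Longrightarrow> Y \<alpha> k (Y \<beta> l (sector \<gamma> u)) =
    of_int (F \<alpha> \<beta> * F (\<alpha> + \<beta>) \<gamma>) \<cdot> sector (\<alpha> + \<beta> + \<gamma>) (vertex_pair \<alpha> \<beta> (k - lat_form \<alpha> \<gamma>) (l - lat_form \<beta> \<gamma>) u)"
  by (simp add: Y_Y_sector vertex_sym_orthogonal)

lemma lin_Y_Y: "lin (\<lambda>v. Y \<alpha> k (Y \<beta> l v))"
  by (rule lin_compose[OF lin_Y_series lin_Y_series])

lemma Y_Y_orthogonal:
  assumes "lat_form \<alpha> \<beta> = 0"
  shows "Y \<alpha> k (Y \<beta> l v) = of_int (F \<alpha> \<beta> * F \<beta> \<alpha>) \<cdot> Y \<beta> l (Y \<alpha> k v)"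
proof (rule sector_eqI[where v = v, OF lin_Y_Y lin_smult[OF lin_Y_Y]])
  fix \<gamma> u
  have *: "F \<beta> \<alpha> * (F \<beta> \<alpha> * x) = x" for x by (simp flip: mult.assoc)
  show "Y \<alpha> k (Y \<beta> l (sector \<gamma> u)) = of_int (F \<alpha> \<beta> * F \<beta> \<alpha>) \<cdot> Y \<beta> l (Y \<alpha> k (sector \<gamma> u))"
    using assms
    by (simp add: Y_Y_orthogonal_sector lat_form_commute[of \<beta> \<alpha>] vertex_pair_commute[of \<beta> \<alpha>] add.commute[of \<beta> \<alpha>]
        del: of_int_mult flip: of_int_mult)
qed

text \<open>For \<open>(\<alpha>,\<beta>) = 1\<close> the product is, up to the cocycle, \<open>z - w\<close> times a symmetric expression, hence
  antisymmetric; this gives the anticommutation \<open>X(e\<^sub>i,z) X(e\<^sub>i,w) = - X(e\<^sub>i,w) X(e\<^sub>i,z)\<close>.\<close>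

lemma Y_Y_form_1:
  assumes "lat_form \<alpha> \<beta> = 1"
  shows "Y \<alpha> k (Y \<beta> l v) = - (of_int (F \<alpha> \<beta> * F \<beta> \<alpha>) \<cdot> Y \<beta> l (Y \<alpha> k v))"
proof (rule sector_eqI[where v = v, OF lin_Y_Y lin_minus[OF lin_smult[OF lin_Y_Y]]])
  fix \<gamma> u
  have *: "F \<beta> \<alpha> * (F \<beta> \<alpha> * x) = x" for x by (simp flip: mult.assoc)
  show "Y \<alpha> k (Y \<beta> l (sector \<gamma> u)) = - (of_int (F \<alpha> \<beta> * F \<beta> \<alpha>) \<cdot> Y \<beta> l (Y \<alpha> k (sector \<gamma> u)))"
    using assms
    by (simp add: Y_Y_sector vertex_sym_form_1 lat_form_commute[of \<beta> \<alpha>] vertex_pair_commute[of \<beta> \<alpha>] add.commute[of \<beta> \<alpha>]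
        del: of_int_mult flip: of_int_mult)
      (simp add: mult.assoc * lin_rules[OF lin_sector] cvec.scale_right_diff_distrib algebra_simps)
qed

lemma field_Y: "field (Y \<alpha>)" by (rule field_Y_series)

lemma Y_Y_orthogonal_support:
  assumes "lat_form \<alpha> \<beta> = 0"
  shows "finite {k. Y \<alpha> k (Y \<beta> (n - k) v) \<noteq> 0}"
proof (rule finite_support_basis[OF lin_Y_Y])
  fix b :: V_index
  let ?g = "lat_form \<alpha> (fst b)" and ?u = "single (snd b) (1::complex)"
  have "{k. Y \<alpha> k (Y \<beta> (n - k) (single b 1)) \<noteq> 0} \<subseteq>
      (\<lambda>k. k + ?g) ` {k. vertex_pair \<alpha> \<beta> k (n - lat_form (\<alpha> + \<beta>) (fst b) - k) ?u \<noteq> 0}"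
  proof
    fix k assume "k \<in> {k. Y \<alpha> k (Y \<beta> (n - k) (single b 1)) \<noteq> 0}"
    then have "vertex_pair \<alpha> \<beta> (k - ?g) (n - lat_form (\<alpha> + \<beta>) (fst b) - (k - ?g)) ?u \<noteq> 0"
      unfolding single_eq_sector Y_Y_orthogonal_sector[OF assms]
      by (auto simp: lin_zero[OF lin_sector] algebra_simps)
    then show "k \<in> (\<lambda>k. k + ?g) ` {k. vertex_pair \<alpha> \<beta> k (n - lat_form (\<alpha> + \<beta>) (fst b) - k) ?u \<noteq> 0}"
      by (intro image_eqI[of _ _ "k - ?g"]) auto
  qed
  then show "finite {k. Y \<alpha> k (Y \<beta> (n - k) (single b 1)) \<noteq> 0}"
    by (rule finite_subset) (intro finite_imageI vertex_pair_diagonal_support)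
qed

text \<open>The product of orthogonal vertex operators at the same point needs no normal ordering and adds the
  lattice vectors.\<close>

lemma Y_Y_diagonal:
  assumes "lat_form \<alpha> \<beta> = 0"
  shows "Sum_any (\<lambda>k. Y \<alpha> k (Y \<beta> (n - k) v)) = of_int (F \<alpha> \<beta>) \<cdot> Y (\<alpha> + \<beta>) n v"
proof (rule sector_eqI[where v = v])
  show "lin (\<lambda>v. Sum_any (\<lambda>k. Y \<alpha> k (Y \<beta> (n - k) v)))"
    by (rule lin_Sum_any[OF lin_Y_Y Y_Y_orthogonal_support[OF assms]])
  show "lin (\<lambda>v. of_int (F \<alpha> \<beta>) \<cdot> Y (\<alpha> + \<beta>) n v)" by (rule lin_smult[OF lin_Y_series])
  fix \<gamma> u
  let ?g = "lat_form \<alpha> \<gamma>" and ?n = "n - lat_form (\<alpha> + \<beta>) \<gamma>"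
  have "Sum_any (\<lambda>k. Y \<alpha> k (Y \<beta> (n - k) (sector \<gamma> u))) =
      Sum_any (\<lambda>k. of_int (F \<alpha> \<beta> * F (\<alpha> + \<beta>) \<gamma>) \<cdot> sector (\<alpha> + \<beta> + \<gamma>) (vertex_pair \<alpha> \<beta> (k - ?g) (?n - (k - ?g)) u))"
    by (simp add: Y_Y_orthogonal_sector[OF assms] algebra_simps)
  also have "\<dots> = Sum_any (\<lambda>k. of_int (F \<alpha> \<beta> * F (\<alpha> + \<beta>) \<gamma>) \<cdot> sector (\<alpha> + \<beta> + \<gamma>) (vertex_pair \<alpha> \<beta> k (?n - k) u))"
    by (subst Sum_any_shift[of _ ?g, symmetric]) simp
  also have "\<dots> = of_int (F \<alpha> \<beta> * F (\<alpha> + \<beta>) \<gamma>) \<cdot> sector (\<alpha> + \<beta> + \<gamma>) (vertex_sym (\<alpha> + \<beta>) ?n u)"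
    by (simp only: Sum_any_lin[OF lin_smult[OF lin_sector] vertex_pair_diagonal_support, symmetric] vertex_pair_diagonal)
  finally show "Sum_any (\<lambda>k. Y \<alpha> k (Y \<beta> (n - k) (sector \<gamma> u))) = of_int (F \<alpha> \<beta>) \<cdot> Y (\<alpha> + \<beta>) n (sector \<gamma> u)"
    by (simp add: Y_series_sector)
qed

lemma heis_Y_support:
  assumes "lat_form \<alpha> \<beta> = 0"
  shows "finite {m. heis \<alpha> m (Y \<beta> (n + m) v) \<noteq> 0}"
proof (rule finite_support_basis[OF lin_compose[OF lin_heis lin_Y_series]])
  fix b :: V_index
  obtain d where d: "d \<ge> 0" "single (snd b) (1::complex) \<in> deg_le d" using deg_le_exists by blast
  let ?u = "single (snd b) (1::complex)" and ?g = "lat_form \<beta> (fst b)"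
  show "finite {m. heis \<alpha> m (Y \<beta> (n + m) (single b 1)) \<noteq> 0}"
  proof (rule finite_support_int[of "?g - n - d" _ d])
    fix m
    show "heis \<alpha> m (Y \<beta> (n + m) (single b 1)) = 0" if "m < ?g - n - d"
      unfolding single_eq_sector Y_series_sector
      using that by (simp add: vertex_sym_large[OF d(2)] lin_zero[OF lin_sector] lin_zero[OF lin_heis])
    assume m: "d < m"
    then have "heis_sym \<alpha> m ?u = 0" using heis_sym_deg[OF d(2), of \<alpha> m] deg_le_negative[of _ "d - m"] by force
    then show "heis \<alpha> m (Y \<beta> (n + m) (single b 1)) = 0"
      unfolding single_eq_sector Y_series_sector
      using m d(1) by (simp add: heis_sector lin_scale[OF lin_heis] vertex_sym_heis_sym[OF assms]
          lin_zero[OF lin_vertex_sym] lin_zero[OF lin_sector])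
  qed
qed

text \<open>\<open>(z d/dz Y(\<alpha>,z)) Y(\<beta>,z) = F(\<alpha>,\<beta>) z \<alpha>(z) Y(\<alpha>+\<beta>,z)\<close>. As \<open>\<alpha>\<close> is orthogonal to
  \<open>\<alpha> + \<beta>\<close>, the modes of \<open>\<alpha>(z)\<close> commute with those of \<open>Y(\<alpha>+\<beta>,z)\<close>, and the normal ordering that
  \<open>vertex_pair_euler\<close> produces may be dropped.\<close>

lemma Y_Y_euler:
  assumes iso: "lat_form \<alpha> \<alpha> = 0" and orth: "lat_form \<alpha> \<beta> = 0"
  shows "Sum_any (\<lambda>k. of_int k \<cdot> Y \<alpha> k (Y \<beta> (n - k) v)) =
    of_int (F \<alpha> \<beta>) \<cdot> Sum_any (\<lambda>m. heis \<alpha> m (Y (\<alpha> + \<beta>) (n + m) v))"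
proof (rule sector_eqI[where v = v])
  have orth': "lat_form \<alpha> (\<alpha> + \<beta>) = 0" using iso orth by simp
  have "finite {k. of_int k \<cdot> Y \<alpha> k (Y \<beta> (n - k) v) \<noteq> 0}" for v
    by (rule finite_subset[OF _ Y_Y_orthogonal_support[OF orth, of n v]]) auto
  then show "lin (\<lambda>v. Sum_any (\<lambda>k. of_int k \<cdot> Y \<alpha> k (Y \<beta> (n - k) v)))"
    by (rule lin_Sum_any[OF lin_smult[OF lin_Y_Y]])
  show "lin (\<lambda>v. of_int (F \<alpha> \<beta>) \<cdot> Sum_any (\<lambda>m. heis \<alpha> m (Y (\<alpha> + \<beta>) (n + m) v)))"
    by (rule lin_smult[OF lin_Sum_any[OF lin_compose[OF lin_heis lin_Y_series] heis_Y_support[OF orth']]])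
  fix \<gamma> u
  let ?g = "lat_form \<alpha> \<gamma>" and ?n = "n - lat_form (\<alpha> + \<beta>) \<gamma>" and ?s = "F \<alpha> \<beta> * F (\<alpha> + \<beta>) \<gamma>"
  let ?VP = "vertex_pair \<alpha> \<beta>" and ?V = "vertex_sym (\<alpha> + \<beta>)"
  obtain d where d: "d \<ge> 0" "u \<in> deg_le d" using deg_le_exists by blast
  have large: "heis_sym \<alpha> m u = 0" if "d < m" for m
    using heis_sym_deg[OF d(2), of \<alpha> m] deg_le_negative[of _ "d - m"] that by force
  \<comment> \<open>the coefficients of \<open>\<alpha>(z) Y(\<alpha>+\<beta>,z)\<close>, the mode \<open>\<alpha>(0)\<close> included as a scalar\<close>
  define h where "h m = (if m = 0 then of_int ?g \<cdot> ?V ?n u else heis_sym \<alpha> m (?V (?n + m) u))" for m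
  have comm: "heis_sym \<alpha> m (?V k u) = ?V k (heis_sym \<alpha> m u)" for m k
    by (rule vertex_sym_heis_sym[OF orth'])
  have neg: "h m = 0" if "m < - \<bar>?n\<bar> - d" for m
    using that d(1) by (simp add: h_def vertex_sym_large[OF d(2)] exp_zeros)
  have pos: "h m = 0" if "d < m" for m
    using that d(1) by (simp add: h_def comm large lin_zero[OF lin_vertex_sym])
  have s: "finite {k. of_int k \<cdot> ?VP (k - ?g) (?n - (k - ?g)) u \<noteq> 0}"
  proof (rule finite_support_int[of "?g - d" _ "?n + ?g + d"])
  qed (simp_all add: vertex_pair_large[OF d(2)])
  have "Sum_any (\<lambda>k. of_int k \<cdot> Y \<alpha> k (Y \<beta> (n - k) (sector \<gamma> u))) =
      Sum_any (\<lambda>k. of_int ?s \<cdot> sector (\<alpha> + \<beta> + \<gamma>) (of_int k \<cdot> ?VP (k - ?g) (?n - (k - ?g)) u))"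
    by (simp add: Y_Y_orthogonal_sector[OF orth] lin_scale[OF lin_sector] algebra_simps)
  also have "\<dots> = of_int ?s \<cdot> sector (\<alpha> + \<beta> + \<gamma>) (Sum_any (\<lambda>k. of_int k \<cdot> ?VP (k - ?g) (?n - (k - ?g)) u))"
    by (simp only: Sum_any_lin[OF lin_smult[OF lin_sector] s])
  also have "Sum_any (\<lambda>k. of_int k \<cdot> ?VP (k - ?g) (?n - (k - ?g)) u) = Sum_any h"
  proof -
    have f1: "finite {m. (if m > 0 then h (- m) else 0) \<noteq> 0}"
      by (rule finite_support_int[of 0 _ "\<bar>?n\<bar> + d"]) (simp_all add: neg)
    have f2: "finite {m. (if m > 0 then h m else 0) \<noteq> 0}"
      by (rule finite_support_int[of 0 _ d]) (simp_all add: pos)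
    have f3: "finite {m. (if m < 0 then h m else 0) \<noteq> 0}"
      by (rule finite_support_int[of "- \<bar>?n\<bar> - d" _ 0]) (simp_all add: neg)
    have f4: "finite {m. (if m = 0 then h 0 else 0) \<noteq> 0}"
      by (rule finite_subset[of _ "{0}"]) auto
    have f5: "finite {m. (if m < 0 then h m else 0) + (if m > 0 then h m else 0) \<noteq> 0}"
      by (rule finite_subset[OF _ finite_UnI[OF f2 f3]]) auto
    have "Sum_any (\<lambda>k. of_int k \<cdot> ?VP (k - ?g) (?n - (k - ?g)) u) =
        h 0 + Sum_any (\<lambda>m. (if m > 0 then h (- m) else 0) + (if m > 0 then h m else 0))"
      unfolding vertex_pair_diagonal_shifted vertex_pair_diagonal_euler
      by (rule arg_cong2[where f = "(+)"], simp add: h_def, rule arg_cong[where f = Sum_any])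
        (auto simp: fun_eq_iff h_def comm)
    also have "\<dots> = h 0 + (Sum_any (\<lambda>m. if m > 0 then h (- m) else 0) + Sum_any (\<lambda>m. if m > 0 then h m else 0))"
      by (simp only: Sum_any.distrib[OF f1 f2])
    also have "Sum_any (\<lambda>m. if m > 0 then h (- m) else 0) = Sum_any (\<lambda>m. if m < 0 then h m else 0)"
      by (subst Sum_any_reflect[of _ 0, symmetric]) (simp cong: if_cong)
    also have "h 0 + (Sum_any (\<lambda>m. if m < 0 then h m else 0) + Sum_any (\<lambda>m. if m > 0 then h m else 0)) =
        Sum_any (\<lambda>m. (if m = 0 then h 0 else 0) + ((if m < 0 then h m else 0) + (if m > 0 then h m else 0)))"
      by (simp only: Sum_any.distrib[OF f4 f5] Sum_any.distrib[OF f3 f2]) simp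
    also have "\<dots> = Sum_any h"
      by (rule arg_cong[where f = Sum_any]) (auto simp: fun_eq_iff)
    finally show ?thesis .
  qed
  also have "of_int ?s \<cdot> sector (\<alpha> + \<beta> + \<gamma>) (Sum_any h) = of_int (F \<alpha> \<beta>) \<cdot>
      Sum_any (\<lambda>m. heis \<alpha> m (Y (\<alpha> + \<beta>) (n + m) (sector \<gamma> u)))"
  proof -
    have fh: "finite {m. h m \<noteq> 0}"
      by (rule finite_support_int[of "- \<bar>?n\<bar> - d" _ d]) (simp_all add: neg pos)
    have *: "heis \<alpha> m (Y (\<alpha> + \<beta>) (n + m) (sector \<gamma> u)) = of_int (F (\<alpha> + \<beta>) \<gamma>) \<cdot> sector (\<alpha> + \<beta> + \<gamma>) (h m)" for m
      using iso orth
      by (simp add: h_def Y_series_sector lin_scale[OF lin_heis] heis_sector lin_scale[OF lin_sector] algebra_simps)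
    show ?thesis
      unfolding * Sum_any_lin[OF lin_smult[OF lin_sector] fh, symmetric] by simp
  qed
  finally show "Sum_any (\<lambda>k. of_int k \<cdot> Y \<alpha> k (Y \<beta> (n - k) (sector \<gamma> u))) =
    of_int (F \<alpha> \<beta>) \<cdot> Sum_any (\<lambda>m. heis \<alpha> m (Y (\<alpha> + \<beta>) (n + m) (sector \<gamma> u)))" .
qed

end

section \<open>Charged fermions from the lattice\<close>

text \<open>The coefficients of the normally ordered product \<open>:A(z) B(w):\<close>, in which those of \<open>A\<close> at negative
  exponents act first, with the sign \<open>\<sigma>\<close> of the exchange.\<close>

definition normal_product :: "complex \<Rightarrow> 'b op_series \<Rightarrow> 'b op_series \<Rightarrow> int \<Rightarrow> int \<Rightarrow> 'b cvec \<Rightarrow> 'b cvec" where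
  "normal_product \<sigma> A B k l v = (if k \<ge> 0 then A k (B l v) else \<sigma> \<cdot> B l (A k v))"

lemma lin_normal_product: "field A \<Longrightarrow> field B \<Longrightarrow> lin (normal_product \<sigma> A B k l)"
  unfolding normal_product_def[abs_def]
  by (intro lin_if lin_smult) (rule lin_compose; simp add: field_lin)+

lemma normal_product_support:
  assumes "field A" "field B"
  shows "finite {k. normal_product \<sigma> A B k (n - k) v \<noteq> 0}"
proof -
  obtain K where K: "\<And>k. k < K \<Longrightarrow> A k v = 0" using field_bound[OF assms(1)] by blast
  obtain L where L: "\<And>k. k < L \<Longrightarrow> B k v = 0" using field_bound[OF assms(2)] by blast
  show ?thesis
    by (rule finite_support_int[of "min K 0" _ "max 0 (n - L)"])
      (auto simp: normal_product_def K L lin_zero[OF field_lin] assms)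
qed

context bimultiplicative
begin

text \<open>Both orders of the product \<open>Y(\<alpha>,z) Y(-\<alpha>,w)\<close> are the expansions of \<open>1/(z-w)\<close> in the two regions
  \<open>|z| > |w|\<close> and \<open>|w| > |z|\<close>, up to sign, times the same symmetric expression. In coefficients: sums over the two
  complementary half-lines of one sequence.\<close>

lemma Y_dual_sector:
  assumes "lat_form \<alpha> \<alpha> = 1" "F \<alpha> \<alpha> = 1"
  shows "Y \<alpha> k (Y (- \<alpha>) l (sector \<gamma> u)) = sector \<gamma> (Sum_any (\<lambda>p. if p > k
     then vertex_pair \<alpha> (- \<alpha>) (p - lat_form \<alpha> \<gamma>) (k + l + 1 - (p - lat_form \<alpha> \<gamma>)) u else 0))" (is ?A)
    and "Y (- \<alpha>) l (Y \<alpha> k (sector \<gamma> u)) = sector \<gamma> (Sum_any (\<lambda>p. if p \<le> k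
     then vertex_pair \<alpha> (- \<alpha>) (p - lat_form \<alpha> \<gamma>) (k + l + 1 - (p - lat_form \<alpha> \<gamma>)) u else 0))" (is ?B)
proof -
  let ?g = "lat_form \<alpha> \<gamma>" and ?VP = "vertex_pair \<alpha> (- \<alpha>)"
  have "Sum_any (\<lambda>p. if p \<ge> k + 1 - ?g then ?VP p (k + 1 - ?g + (l + ?g) - p) u else 0) =
      Sum_any (\<lambda>p. if p > k then ?VP (p - ?g) (k + l + 1 - (p - ?g)) u else 0)"
    by (subst Sum_any_shift[of _ "- ?g", symmetric]) (rule arg_cong[where f = Sum_any], auto simp: fun_eq_iff algebra_simps)
  then show ?A
    using assms by (simp add: Y_Y_sector vertex_sym_form_minus_1)
  have "Sum_any (\<lambda>p. if p \<ge> l + 1 + ?g then vertex_pair (- \<alpha>) \<alpha> p (l + 1 + ?g + (k - ?g) - p) u else 0) =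
      Sum_any (\<lambda>p. if p \<le> k then ?VP (p - ?g) (k + l + 1 - (p - ?g)) u else 0)"
    by (subst Sum_any_reflect[of _ "k + l + 1 + ?g", symmetric])
      (rule arg_cong[where f = Sum_any], auto simp: fun_eq_iff algebra_simps vertex_pair_commute[of "- \<alpha>"])
  then show ?B
    using assms by (simp add: Y_Y_sector vertex_sym_form_minus_1)
qed

text \<open>The two half-lines make up the whole sum, in which \<open>w = z\<close>, and \<open>Y(0,z) = 1\<close>.\<close>

lemma Y_dual_anticommute:
  assumes \<alpha>: "lat_form \<alpha> \<alpha> = 1" "F \<alpha> \<alpha> = 1"
  shows "Y \<alpha> k (Y (- \<alpha>) l v) + Y (- \<alpha>) l (Y \<alpha> k v) = (if k + l = - 1 then v else 0)"
proof (rule sector_eqI[where v = v, OF lin_plus[OF lin_Y_Y lin_Y_Y] lin_if[OF lin_id(2) lin_0]])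
  fix \<gamma> u
  let ?g = "lat_form \<alpha> \<gamma>" and ?VP = "vertex_pair \<alpha> (- \<alpha>)" and ?n = "k + l + 1"
  have s: "finite {p. ?VP (p - ?g) (?n - (p - ?g)) u \<noteq> 0}"
  proof (rule finite_subset[OF _ finite_imageI[OF vertex_pair_diagonal_support[of \<alpha> "- \<alpha>" ?n u], of "\<lambda>p. p + ?g"]], rule subsetI)
    fix p assume "p \<in> {p. ?VP (p - ?g) (?n - (p - ?g)) u \<noteq> 0}"
    then show "p \<in> (\<lambda>p. p + ?g) ` {p. ?VP p (?n - p) u \<noteq> 0}"
      by (intro image_eqI[of _ _ "p - ?g"]) auto
  qed
  have s1: "finite {p. (if p > k then ?VP (p - ?g) (?n - (p - ?g)) u else 0) \<noteq> 0}"
    and s2: "finite {p. (if p \<le> k then ?VP (p - ?g) (?n - (p - ?g)) u else 0) \<noteq> 0}"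
    by (rule finite_subset[OF _ s]; auto)+
  have "Sum_any (\<lambda>p. if p > k then ?VP (p - ?g) (?n - (p - ?g)) u else 0) +
      Sum_any (\<lambda>p. if p \<le> k then ?VP (p - ?g) (?n - (p - ?g)) u else 0) =
      Sum_any (\<lambda>p. ?VP (p - ?g) (?n - (p - ?g)) u)"
    unfolding Sum_any.distrib[OF s1 s2, symmetric] by (rule arg_cong[where f = Sum_any]) auto
  also have "\<dots> = vertex_sym 0 ?n u"
    by (subst Sum_any_shift[of _ ?g, symmetric]) (simp add: vertex_pair_diagonal)
  finally show "Y \<alpha> k (Y (- \<alpha>) l (sector \<gamma> u)) + Y (- \<alpha>) l (Y \<alpha> k (sector \<gamma> u)) =
      (if k + l = - 1 then sector \<gamma> u else 0)"
    unfolding Y_dual_sector[OF \<alpha>] lin_add[OF lin_sector, symmetric]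
    by (auto simp: vertex_sym_of_0 lin_zero[OF lin_sector])
qed

text \<open>\<open>:X(\<alpha>,z) X(-\<alpha>,z): = \<alpha>(z)\<close>. Normal ordering subtracts the pole \<open>1/(z-w)\<close>; the limit \<open>w = z\<close> of the
  rest is the derivative of the symmetric expression, and that is \<open>\<alpha>(z)\<close>, because \<open>Y(0,z) = 1\<close>.\<close>

lemma bosonization:
  assumes \<alpha>: "lat_form \<alpha> \<alpha> = 1" "F \<alpha> \<alpha> = 1"
  shows "Sum_any (\<lambda>k. normal_product (-1) (Y \<alpha>) (Y (- \<alpha>)) k (n - k) v) = heis \<alpha> (- n - 1) v"
proof (rule sector_eqI[where v = v])
  show "lin (\<lambda>v. Sum_any (\<lambda>k. normal_product (-1) (Y \<alpha>) (Y (- \<alpha>)) k (n - k) v))"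
    by (rule lin_Sum_any[OF lin_normal_product[OF field_Y field_Y] normal_product_support[OF field_Y field_Y]])
  show "lin (\<lambda>v. heis \<alpha> (- n - 1) v)" by (rule lin_heis)
  fix \<gamma> u
  let ?g = "lat_form \<alpha> \<gamma>" and ?VP = "vertex_pair \<alpha> (- \<alpha>)" and ?n = "n + 1"
  obtain d where d: "d \<ge> 0" "u \<in> deg_le d" using deg_le_exists by blast
  define N where "N p = ?VP (p - ?g) (?n - (p - ?g)) u" for p
  have N0: "N p = 0" if "p < ?g - d \<or> ?n + ?g + d < p" for p
    unfolding N_def by (rule vertex_pair_large[OF d(2)]) (use that in auto)
  define f where "f k p = (if k \<ge> 0 then (if p > k then N p else 0) else - (if p \<le> k then N p else 0))" for k p
  have fin: "finite {(k, p). f k p \<noteq> 0}"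
    by (rule finite_support_box[of "min 0 (?g - d)" _ "max 0 (?n + ?g + d)" "?g - d" "?n + ?g + d"])
      (auto simp: f_def N0)
  have sN: "finite {p. (if p > k then N p else 0) \<noteq> 0}" "finite {p. (if p \<le> k then N p else 0) \<noteq> 0}" for k
    by (rule finite_support_int[of "?g - d" _ "?n + ?g + d"]; simp add: N0)+
  have "normal_product (-1) (Y \<alpha>) (Y (- \<alpha>)) k (n - k) (sector \<gamma> u) = sector \<gamma> (Sum_any (f k))" for k
    by (simp add: normal_product_def Y_dual_sector[OF \<alpha>] f_def[abs_def] N_def[abs_def] Sum_any_uminus lin_uminus[OF lin_sector] cong: if_cong)
  then have "Sum_any (\<lambda>k. normal_product (-1) (Y \<alpha>) (Y (- \<alpha>)) k (n - k) (sector \<gamma> u)) =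
      sector \<gamma> (Sum_any (\<lambda>k. Sum_any (f k)))"
    by (simp add: Sum_any_lin[OF lin_sector finite_support_inner(3)[OF fin]])
  also have "Sum_any (\<lambda>k. Sum_any (f k)) = Sum_any (\<lambda>p. Sum_any (\<lambda>k. f k p))"
    by (rule Sum_any_swap[OF fin])
  \<comment> \<open>the index \<open>p\<close> is counted once for each \<open>k\<close> between \<open>0\<close> and \<open>p\<close>: this is the derivative\<close>
  also have "(\<lambda>p. Sum_any (\<lambda>k. f k p)) = (\<lambda>p. of_int p \<cdot> N p)"
  proof
    fix p :: int
    show "Sum_any (\<lambda>k. f k p) = of_int p \<cdot> N p"
    proof (cases "p \<ge> 0")
      case True
      have "Sum_any (\<lambda>k. f k p) = (\<Sum>k\<in>{0..p-1}. f k p)"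
        by (rule Sum_any_interval) (use True in \<open>auto simp: f_def\<close>)
      also have "\<dots> = (\<Sum>k\<in>{0..p-1}. N p)" by (rule sum.cong) (auto simp: f_def)
      also have "\<dots> = of_nat (card {0..p-1}) \<cdot> N p" by (rule cvec.sum_constant_scale)
      finally show ?thesis using True by simp
    next
      case False
      have "Sum_any (\<lambda>k. f k p) = (\<Sum>k\<in>{p..-1}. f k p)"
        by (rule Sum_any_interval) (use False in \<open>auto simp: f_def\<close>)
      also have "\<dots> = (\<Sum>k\<in>{p..-1}. - N p)" by (rule sum.cong) (auto simp: f_def)
      also have "\<dots> = of_nat (card {p..-1}) \<cdot> - N p" by (rule cvec.sum_constant_scale)
      finally show ?thesis using False by (simp flip: cvec.scale_minus_left)
    qed
  qed
  also have "Sum_any (\<lambda>p. of_int p \<cdot> N p) = of_int ?g \<cdot> vertex_sym 0 ?n u +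
      Sum_any (\<lambda>m. if m > 0 then heis_sym \<alpha> (- m) (vertex_sym 0 (?n - m) u) + vertex_sym 0 (?n + m) (heis_sym \<alpha> m u) else 0)"
    using vertex_pair_diagonal_shifted[of \<alpha> "- \<alpha>" ?g ?n u] vertex_pair_diagonal_euler[of \<alpha> "- \<alpha>" ?n u]
    by (simp add: N_def cong: if_cong)
  also have "Sum_any (\<lambda>m. if m > 0 then heis_sym \<alpha> (- m) (vertex_sym 0 (?n - m) u) + vertex_sym 0 (?n + m) (heis_sym \<alpha> m u) else 0) =
      (if ?n = 0 then 0 else heis_sym \<alpha> (- ?n) u)"
    by (subst Sum_any_single[of "\<bar>?n\<bar>"]) (auto simp: vertex_sym_of_0 exp_zeros)
  finally show "Sum_any (\<lambda>k. normal_product (-1) (Y \<alpha>) (Y (- \<alpha>)) k (n - k) (sector \<gamma> u)) = heis \<alpha> (- n - 1) (sector \<gamma> u)"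
    by (auto simp: vertex_sym_of_0 heis_sector lin_scale[OF lin_sector])
qed

end

section \<open>The bosons\<close>

lemma lin_phi: "lin (phi j r)" and lin_phi_star: "lin (phi_star j r)"
  unfolding phi_def[abs_def] phi_star_def[abs_def]
  by (intro lin_if lin_mult lin_minus lin_derivation)+

lemma phi_phi: "phi i r (phi j s u) = phi j s (phi i r u)"
  by (auto simp: phi_def derivation_variable_mult derivation_commute lin_rules[OF lin_derivation] mult.left_commute)

lemma phi_star_phi_star: "phi_star i r (phi_star j s u) = phi_star j s (phi_star i r u)"
  by (auto simp: phi_star_def derivation_variable_mult derivation_commute mult.left_commute)

lemma phi_star_phi:
  "phi_star j s (phi i r u) = phi i r (phi_star j s u) + (if i = j \<and> r + s = 1 then u else 0)"
proof -
  consider "r \<le> 0" "s \<le> 0" | "r \<le> 0" "s > 0" | "r > 0" "s \<le> 0" | "r > 0" "s > 0" by linarith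
  then show ?thesis
    by cases (auto simp: phi_def phi_star_def derivation_variable_mult derivation_commute
        lin_rules[OF lin_derivation] mult.left_commute)
qed

lemma derivation_absent:
  assumes "\<And>v. v \<in> keys \<mu> \<Longrightarrow> c v = 0"
  shows "derivation c (single \<mu> 1) = 0"
  using assms by (subst derivation_single[OF finite_keys subset_refl]) simp

text \<open>A monomial involves only finitely many variables, so almost all annihilation operators kill it.\<close>

lemma field_phi: "field (phi_field j)" and field_phi_star: "field (phi_star_field j)"
proof -
  have ex: "\<exists>K. \<forall>k<K. f (1 + k :: int) \<notin> keys (\<mu> :: bos_mono)" if "inj f" for f \<mu>
  proof -
    have "finite (f -` keys \<mu>)" by (rule finite_vimageI[OF finite_keys that])
    then have "bdd_below (f -` keys \<mu>)" by (rule bdd_below_finite)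
    then obtain b where "\<And>x. x \<in> f -` keys \<mu> \<Longrightarrow> b \<le> x"
      unfolding bdd_below_def by blast
    then show ?thesis by (intro exI[of _ "b - 1"]) force
  qed
  show "field (phi_field j)"
  proof (rule fieldI)
    fix \<mu> :: bos_mono
    obtain K where K: "\<And>k. k < K \<Longrightarrow> Phi_star j (1 + k) \<notin> keys \<mu>"
      using ex[of "Phi_star j"] by (auto simp: inj_def)
    have "phi_field j k (single \<mu> 1) = 0" if "k < min K 0" for k
      using that K[of k] by (auto simp: phi_field_def phi_def intro!: derivation_absent)
    then show "\<exists>K. \<forall>k<K. phi_field j k (single \<mu> 1) = 0" by blast
  qed (simp add: phi_field_def lin_phi)
  show "field (phi_star_field j)"
  proof (rule fieldI)
    fix \<mu> :: bos_mono
    obtain K where K: "\<And>k. k < K \<Longrightarrow> Phi j (1 + k) \<notin> keys \<mu>"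
      using ex[of "Phi j"] by (auto simp: inj_def)
    have "phi_star_field j k (single \<mu> 1) = 0" if "k < min K 0" for k
      using that K[of k] by (auto simp: phi_star_field_def phi_star_def intro!: derivation_absent)
    then show "\<exists>K. \<forall>k<K. phi_star_field j k (single \<mu> 1) = 0" by blast
  qed (simp add: phi_star_field_def lin_phi_star)
qed

section \<open>Invariant subspaces\<close>

lemma variable_mult_spanned_by:
  assumes "v \<in> S" "u \<in> spanned_by {\<mu>. keys \<mu> \<subseteq> S}"
  shows "variable v * u \<in> spanned_by {\<mu>. keys \<mu> \<subseteq> S}"
proof (rule lin_spanned_by[OF lin_mult _ assms(2)])
  fix \<mu> :: "'a \<Rightarrow>\<^sub>0 nat" assume "\<mu> \<in> {\<mu>. keys \<mu> \<subseteq> S}"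
  then have "keys (single v 1 + \<mu>) \<subseteq> S" using keys_add[of "single v 1" \<mu>] assms(1) by auto
  then show "variable v * single \<mu> 1 \<in> spanned_by {\<mu>. keys \<mu> \<subseteq> S}"
    unfolding variable_mult_single by (intro spanned_by_single) simp
qed

lemma derivation_spanned_by:
  assumes "u \<in> spanned_by {\<mu>. keys \<mu> \<subseteq> S}"
  shows "derivation c u \<in> spanned_by {\<mu>. keys \<mu> \<subseteq> S}"
proof (rule lin_spanned_by[OF lin_derivation _ assms])
  fix \<mu> :: "'a \<Rightarrow>\<^sub>0 nat" assume "\<mu> \<in> {\<mu>. keys \<mu> \<subseteq> S}"
  then have "keys (\<mu> - single v 1) \<subseteq> S" for v by (auto simp: in_keys_iff lookup_minus)
  then show "derivation c (single \<mu> 1) \<in> spanned_by {\<mu>. keys \<mu> \<subseteq> S}"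
    by (subst derivation_single[OF finite_keys subset_refl]) (intro spanned_by_sum spanned_by_single, simp)
qed

lemma phi_spanned_by:
  assumes "j \<in> {1..N}" "u \<in> spanned_by {\<mu>. keys \<mu> \<subseteq> bos_vars N}"
  shows "phi j r u \<in> spanned_by {\<mu>. keys \<mu> \<subseteq> bos_vars N}"
    "phi_star j r u \<in> spanned_by {\<mu>. keys \<mu> \<subseteq> bos_vars N}"
  using assms
  by (auto simp: phi_def phi_star_def bos_vars_def
      intro!: spanned_by_uminus derivation_spanned_by variable_mult_spanned_by)

lemma heis_sym_spanned_by:
  assumes "keys \<alpha> \<subseteq> G" "u \<in> spanned_by {\<mu>. keys \<mu> \<subseteq> G \<times> {..<0}}"
  shows "heis_sym \<alpha> n u \<in> spanned_by {\<mu>. keys \<mu> \<subseteq> G \<times> {..<0}}"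
proof -
  have "(\<Sum>g\<in>keys \<alpha>. of_int (lookup \<alpha> g) \<cdot> variable (g, n)) * u \<in> spanned_by {\<mu>. keys \<mu> \<subseteq> G \<times> {..<0}}" if "n < 0"
    unfolding sum_distrib_right sym_mult_scale
    by (intro spanned_by_sum spanned_by_scale variable_mult_spanned_by assms(2)) (use assms(1) that in auto)
  then show ?thesis
    using assms(2) by (simp add: heis_sym_def spanned_by_zero derivation_spanned_by)
qed

lemma vertex_sym_spanned_by:
  assumes \<alpha>: "keys \<alpha> \<subseteq> G" and u: "u \<in> spanned_by {\<mu>. keys \<mu> \<subseteq> G \<times> {..<0}}"
  shows "vertex_sym \<alpha> n u \<in> spanned_by {\<mu>. keys \<mu> \<subseteq> G \<times> {..<0}}"
  unfolding vertex_sym_def exp_minus_def exp_plus_def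
proof (intro spanned_by_Sum_any)
  let ?B = "{\<mu> :: heis_mono. keys \<mu> \<subseteq> G \<times> {..<0}}"
  fix a
  have "ser_exp (annihilation \<alpha>) a u \<in> spanned_by ?B"
    by (rule ser_exp_spanned_by[OF exponent_annihilation, where B = "\<lambda>_. ?B" and d = 0])
      (auto simp: annihilation_def intro!: spanned_by_uminus spanned_by_scale heis_sym_spanned_by[OF \<alpha>] u)
  then show "ser_exp (creation \<alpha>) (n + a) (ser_exp (annihilation \<alpha>) a u) \<in> spanned_by ?B"
    by (intro ser_exp_spanned_by[OF exponent_creation, where B = "\<lambda>_. ?B" and d = 0])
      (auto simp: creation_def intro!: spanned_by_scale heis_sym_spanned_by[OF \<alpha>])
qed

definition V_part :: "gen set \<Rightarrow> lat set \<Rightarrow> V_index cvec set" where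
  "V_part G C = spanned_by (C \<times> {\<mu>. keys \<mu> \<subseteq> G \<times> {..<0}})"

lemma Y_series_V_part:
  assumes "keys \<alpha> \<subseteq> G" "v \<in> V_part G C"
  shows "Y_series F \<alpha> n v \<in> V_part G ((+) \<alpha> ` C)"
  unfolding V_part_def
proof (rule lin_spanned_by[OF lin_Y_series _ assms(2)[unfolded V_part_def]])
  fix b :: V_index assume b: "b \<in> C \<times> {\<mu>. keys \<mu> \<subseteq> G \<times> {..<0}}"
  show "Y_series F \<alpha> n (single b 1) \<in> spanned_by ((+) \<alpha> ` C \<times> {\<mu>. keys \<mu> \<subseteq> G \<times> {..<0}})"
    unfolding single_eq_sector Y_series_sector sector_def[of "\<alpha> + fst b"]
    using b by (intro spanned_by_scale spanned_by_tensor vertex_sym_spanned_by assms(1) spanned_by_single) auto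
qed

section \<open>The affine superalgebra generated by free superfields\<close>

definition supersign :: "bool \<Rightarrow> bool \<Rightarrow> complex" where
  "supersign p r = (if p \<and> r then - 1 else 1)"

text \<open>Free fermions and bosons, indexed by \<open>I\<close>, as formal series. The index of a coefficient is the exponent of the
  variable, so that \<open>\<delta>(z-w)\<close> has the coefficients with \<open>k + l = -1\<close>. Fields of different statistics
  commute, which agrees with the supersign here because this sign is \<open>-1\<close> only for two fermions.\<close>

locale free_superfields =
  fixes I :: "nat set" and fermionic :: "nat \<Rightarrow> bool" and c cs :: "nat \<Rightarrow> 'b op_series"
  assumes field_c: "a \<in> I \<Longrightarrow> field (c a)"
    and field_cs: "a \<in> I \<Longrightarrow> field (cs a)"
    and c_c: "a \<in> I \<Longrightarrow> b \<in> I \<Longrightarrow>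
      c a k (c b l v) = supersign (fermionic a) (fermionic b) \<cdot> c b l (c a k v)"
    and cs_cs: "a \<in> I \<Longrightarrow> b \<in> I \<Longrightarrow>
      cs a k (cs b l v) = supersign (fermionic a) (fermionic b) \<cdot> cs b l (cs a k v)"
    and cs_c: "a \<in> I \<Longrightarrow> b \<in> I \<Longrightarrow>
      cs b l (c a k v) = supersign (fermionic a) (fermionic b) \<cdot> c a k (cs b l v) +
        (if a = b \<and> k + l = - 1 then v else 0)"
begin

abbreviation sg :: "nat \<Rightarrow> nat \<Rightarrow> complex" where
  "sg a b \<equiv> supersign (fermionic a) (fermionic b)"

lemma supersign_square [simp]: "sg a b * sg a b = 1" "sg a b * (sg a b * z) = z"
  by (auto simp: supersign_def)

definition npair :: "nat \<Rightarrow> nat \<Rightarrow> int \<Rightarrow> int \<Rightarrow> 'b cvec \<Rightarrow> 'b cvec" where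
  "npair a b = normal_product (sg a b) (c a) (cs b)"

text \<open>The series \<open>:c\<^sub>a(z) c\<^sub>b\<^sup>*(z):\<close>, corresponding to the matrix unit \<open>E\<^sub>a\<^sub>b\<close>.\<close>

definition J :: "nat \<Rightarrow> nat \<Rightarrow> 'b op_series" where
  "J a b n v = Sum_any (\<lambda>k. npair a b k (n - k) v)"

lemma npair_support: "a \<in> I \<Longrightarrow> b \<in> I \<Longrightarrow> finite {k. npair a b k (n - k) v \<noteq> 0}"
  unfolding npair_def by (intro normal_product_support field_c field_cs)

lemma lin_npair: "a \<in> I \<Longrightarrow> b \<in> I \<Longrightarrow> lin (npair a b k l)"
  unfolding npair_def by (intro lin_normal_product field_c field_cs)

lemma lin_J: "a \<in> I \<Longrightarrow> b \<in> I \<Longrightarrow> lin (J a b n)"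
  using lin_Sum_any[OF lin_npair npair_support, of a b n] by (simp add: J_def[abs_def])

lemma lin_c: "a \<in> I \<Longrightarrow> lin (c a k)" and lin_cs: "a \<in> I \<Longrightarrow> lin (cs a k)"
  by (simp_all add: field_lin field_c field_cs)

text \<open>Normal ordering differs from the plain product by a scalar, on half of the indices only.\<close>

lemma npair_eq:
  assumes "a \<in> I" "b \<in> I"
  shows "npair a b k l v = c a k (cs b l v) + (if k < 0 \<and> a = b \<and> k + l = - 1 then sg a a \<cdot> v else 0)"
  using assms by (auto simp: npair_def normal_product_def cs_c cvec.scale_right_distrib)

lemma npair_distinct: "a \<in> I \<Longrightarrow> b \<in> I \<Longrightarrow> a \<noteq> b \<Longrightarrow> npair a b k l v = c a k (cs b l v)"
  by (simp add: npair_eq)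

lemma J_intertwine:
  assumes "a \<in> I" "b \<in> I" "lin A"
    and "\<And>k v. A (c a k v) = c a k (A v)" "\<And>k v. A (cs b k v) = cs b k (A v)"
  shows "A (J a b n v) = J a b n (A v)"
  unfolding J_def Sum_any_lin[OF assms(3) npair_support[OF assms(1,2)]]
  by (simp add: npair_def normal_product_def if_distrib[of A] lin_scale[OF assms(3)] assms(4,5) cong: if_cong)

lemma field_J:
  assumes "a \<in> I" "b \<in> I"
  shows "field (J a b)"
  unfolding field_def
proof (intro conjI allI lin_J assms)
  fix v
  obtain K where K: "\<And>k. k < K \<Longrightarrow> c a k v = 0" using field_bound[OF field_c[OF assms(1)]] by blast
  obtain L where L: "\<And>k. k < L \<Longrightarrow> cs b k v = 0" using field_bound[OF field_cs[OF assms(2)]] by blast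
  have "\<exists>L. \<forall>l<L. cs b l (c a k v) = 0" for k
    using field_bound[OF field_cs[OF assms(2)]] by blast
  then obtain L' where L': "\<And>k l. l < L' k \<Longrightarrow> cs b l (c a k v) = 0" by metis
  define B where "B = Min (insert 0 (L' ` {K..0}))"
  have "J a b n v = 0" if n: "n < min L (B + min K 0)" for n
    unfolding J_def
  proof (rule Sum_any_zero)
    fix k
    show "npair a b k (n - k) v = 0"
    proof (cases "k \<ge> 0")
      case True
      then have "cs b (n - k) v = 0" using n by (intro L) auto
      with True show ?thesis by (simp add: npair_def normal_product_def lin_zero[OF lin_c[OF assms(1)]])
    next
      case False
      show ?thesis
      proof (cases "k < K")
        case True
        with False show ?thesis by (simp add: npair_def normal_product_def K lin_zero[OF lin_cs[OF assms(2)]])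
      next
        case k: False
        then have "B \<le> L' k" unfolding B_def using False by (intro Min_le) auto
        then have "cs b (n - k) (c a k v) = 0" using n k by (intro L') auto
        with False show ?thesis by (simp add: npair_def normal_product_def)
      qed
    qed
  qed
  then show "\<exists>K. \<forall>k<K. J a b k v = 0" by blast
qed

text \<open>\<open>J\<^sub>a\<^sub>b\<close> acts on the fields \<open>c\<^sub>d\<close> as the matrix unit \<open>E\<^sub>a\<^sub>b\<close> on the basis of the natural module, and on
  the \<open>c\<^sub>e\<^sup>*\<close> as on the dual basis (\<open>J_cs\<close>). Since the scalars of the normal ordering are central, they do not
  matter here.\<close>

lemma J_c:
  assumes I: "a \<in> I" "b \<in> I" "d \<in> I"
  shows "J a b n (c d r v) = (sg a d * sg b d) \<cdot> c d r (J a b n v) + (if b = d then c a (n + 1 + r) v else 0)"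
proof -
  have *: "npair a b k (n - k) (c d r v) = (sg a d * sg b d) \<cdot> c d r (npair a b k (n - k) v) +
      (if k = n + 1 + r then (if b = d then c a (n + 1 + r) v else 0) else 0)" for k
  proof -
    let ?ss = "sg a d * sg b d" and ?w = "cs b (n - k) v"
    have "c a k (cs b (n - k) (c d r v)) = sg d b \<cdot> c a k (c d r ?w) + (if b = d \<and> k = n + 1 + r then c a k v else 0)"
      unfolding cs_c[OF I(3,2)] lin_add[OF lin_c[OF I(1)]] lin_scale[OF lin_c[OF I(1)]]
      by (auto simp: lin_zero[OF lin_c[OF I(1)]])
    also have "sg d b \<cdot> c a k (c d r ?w) = ?ss \<cdot> c d r (c a k ?w)"
      unfolding c_c[OF I(1,3)] cvec.scale_scale by (simp add: supersign_def)
    finally have A: "c a k (cs b (n - k) (c d r v)) =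
        ?ss \<cdot> c d r (c a k ?w) + (if b = d \<and> k = n + 1 + r then c a k v else 0)" .
    have R: "c d r (c a k ?w + (if k < 0 \<and> a = b \<and> k + (n - k) = - 1 then sg a a \<cdot> v else 0)) =
        c d r (c a k ?w) + (if k < 0 \<and> a = b \<and> k + (n - k) = - 1 then sg a a \<cdot> c d r v else 0)"
      by (simp add: lin_rules[OF lin_c[OF I(3)]])
    show ?thesis
      unfolding npair_eq[OF I(1,2)] A R
      by (cases "a = b"; cases "k = n + 1 + r") (simp_all add: cvec.scale_right_distrib)
  qed
  have s1: "finite {k. (sg a d * sg b d) \<cdot> c d r (npair a b k (n - k) v) \<noteq> 0}"
    by (rule finite_subset[OF _ npair_support[OF I(1,2), of n v]]) (auto simp: lin_zero[OF lin_c[OF I(3)]])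
  have s2: "finite {k. (if k = n + 1 + r then (if b = d then c a (n + 1 + r) v else 0) else 0) \<noteq> 0}"
    by (rule finite_subset[of _ "{n + 1 + r}"]) auto
  show ?thesis
    unfolding J_def * Sum_any.distrib[OF s1 s2]
    by (simp add: Sum_any_lin[OF lin_smult[OF lin_c[OF I(3)]] npair_support[OF I(1,2)]])
qed

lemma J_cs:
  assumes I: "a \<in> I" "b \<in> I" "e \<in> I"
  shows "J a b n (cs e r v) = (sg a e * sg b e) \<cdot> cs e r (J a b n v) -
    (if a = e then (sg a b * sg a a) \<cdot> cs b (n + 1 + r) v else 0)"
proof -
  have *: "npair a b k (n - k) (cs e r v) = (sg a e * sg b e) \<cdot> cs e r (npair a b k (n - k) v) +
      (if k = - 1 - r then (if a = e then - ((sg a b * sg a a) \<cdot> cs b (n + 1 + r) v) else 0) else 0)" for k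
  proof -
    let ?ss = "sg a e * sg b e" and ?w = "cs b (n - k) v"
    have ccs: "c a k (cs e r w) = sg a e \<cdot> cs e r (c a k w) - (if a = e \<and> k = - 1 - r then sg a e \<cdot> w else 0)" for w
      unfolding cs_c[OF I(1,3)] by (auto simp: cvec.scale_right_distrib)
    have "c a k (cs b (n - k) (cs e r v)) = sg b e \<cdot> c a k (cs e r ?w)"
      unfolding cs_cs[OF I(2,3)] lin_scale[OF lin_c[OF I(1)]] ..
    also have "\<dots> = ?ss \<cdot> cs e r (c a k ?w) - (if k = - 1 - r then (if a = e then (sg a b * sg a a) \<cdot> cs b (n + 1 + r) v else 0) else 0)"
    proof -
      have sg: "sg b e * (sg a e * z) = sg a b * (sg a a * z)" if "a = e" for z
        using that by (simp add: supersign_def)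
      show ?thesis
      proof (cases "k = - 1 - r")
        case True
        then have nk: "n - k = n + 1 + r" by simp
        show ?thesis
          unfolding ccs nk using sg[of 1] True
          by (auto simp: cvec.scale_right_diff_distrib mult.commute simp del: supersign_square)
      qed (simp add: ccs mult.commute)
    qed
    finally have A: "c a k (cs b (n - k) (cs e r v)) = ?ss \<cdot> cs e r (c a k ?w) -
        (if k = - 1 - r then (if a = e then (sg a b * sg a a) \<cdot> cs b (n + 1 + r) v else 0) else 0)" .
    have R: "cs e r (c a k ?w + (if k < 0 \<and> a = b \<and> k + (n - k) = - 1 then sg a a \<cdot> v else 0)) =
        cs e r (c a k ?w) + (if k < 0 \<and> a = b \<and> k + (n - k) = - 1 then sg a a \<cdot> cs e r v else 0)"
      by (simp add: lin_rules[OF lin_cs[OF I(3)]])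
    show ?thesis
      unfolding npair_eq[OF I(1,2)] A R
      by (cases "a = b"; cases "k = - 1 - r") (simp_all add: cvec.scale_right_distrib)
  qed
  have s1: "finite {k. (sg a e * sg b e) \<cdot> cs e r (npair a b k (n - k) v) \<noteq> 0}"
    by (rule finite_subset[OF _ npair_support[OF I(1,2), of n v]]) (auto simp: lin_zero[OF lin_cs[OF I(3)]])
  have s2: "finite {k. (if k = - 1 - r then (if a = e then - ((sg a b * sg a a) \<cdot> cs b (n + 1 + r) v) else 0) else 0) \<noteq> 0}"
    by (rule finite_subset[of _ "{- 1 - r}"]) auto
  show ?thesis
    unfolding J_def * Sum_any.distrib[OF s1 s2]
    by (simp add: Sum_any_lin[OF lin_smult[OF lin_cs[OF I(3)]] npair_support[OF I(1,2)]])
qed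

text \<open>Two step functions differ by an interval of signed length \<open>m\<close>.\<close>

lemma Sum_any_step: "Sum_any (\<lambda>s :: int. (if s < 0 then w else 0) - (if s < - m then w else 0)) = of_int m \<cdot> w"
proof (cases "m \<ge> 0")
  case True
  have "Sum_any (\<lambda>s :: int. (if s < 0 then w else 0) - (if s < - m then w else 0)) = (\<Sum>s\<in>{-m..-1}. w)"
    by (subst Sum_any_interval[of "-m" _ "-1"]) (use True in auto)
  also have "\<dots> = of_nat (card {-m..-1}) \<cdot> w" by (rule cvec.sum_constant_scale)
  finally show ?thesis using True by simp
next
  case False
  have "Sum_any (\<lambda>s :: int. (if s < 0 then w else 0) - (if s < - m then w else 0)) = (\<Sum>s\<in>{0..-m-1}. - w)"
    by (subst Sum_any_interval[of 0 _ "-m-1"]) (use False in auto)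
  also have "\<dots> = of_nat (card {0..-m-1}) \<cdot> - w" by (rule cvec.sum_constant_scale)
  finally show ?thesis using False by (simp flip: cvec.scale_minus_left)
qed

text \<open>The affine superalgebra of \<open>gl(M|N)\<close> at level one. By \<open>J_c\<close> and \<open>J_cs\<close> the series \<open>J\<^sub>a\<^sub>b\<close> acts as a
  superderivation on the products \<open>c\<^sub>d c\<^sub>e\<^sup>*\<close>. It moves the indices by \<open>n + 1\<close>, hence the place at which the normal
  ordering changes; the central term \<open>n + 1\<close> counts the indices passed over.\<close>

lemma J_J:
  assumes I: "a \<in> I" "b \<in> I" "d \<in> I" "e \<in> I"
  defines "S \<equiv> sg a d * sg a e * sg b d * sg b e"
  shows "J a b n (J d e m v) = S \<cdot> J d e m (J a b n v) +
     (if b = d then J a e (n + m + 1) v else 0) - (if a = e then S \<cdot> J d b (n + m + 1) v else 0) +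
     (if b = d \<and> a = e \<and> n + m = - 2 then (sg a a * of_int (n + 1)) \<cdot> v else 0)"
proof -
  define t1 where "t1 s = S \<cdot> npair d e s (m - s) (J a b n v)" for s
  define t2 where "t2 s = (if b = d then npair a e (n + 1 + s) (m - s) v else 0)" for s
  define t3 where "t3 s = (if a = e then S \<cdot> npair d b s (n + m + 1 - s) v else 0)" for s
  define w where "w = (if b = d \<and> a = e \<and> n + m = - 2 then sg a a \<cdot> v else 0)"
  \<comment> \<open>passing between plain and normally ordered products costs \<open>w\<close> below the cut, which lies at
    \<open>0\<close> for \<open>t3\<close> and at \<open>- (n + 1)\<close> for \<open>t2\<close>\<close>
  define t4 where "t4 s = (if s < 0 then w else 0) - (if s < - (n + 1) then w else 0)" for s :: int
  have *: "J a b n (npair d e s (m - s) v) = t1 s + t2 s - t3 s + t4 s" for s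
  proof -
    have cc: "J a b n (c d s (cs e (m - s) v)) = S \<cdot> c d s (cs e (m - s) (J a b n v)) +
        (if b = d then c a (n + 1 + s) (cs e (m - s) v) else 0) -
        (if a = e then S \<cdot> c d s (cs b (n + m + 1 - s) v) else 0)"
    proof -
      have S1: "(sg a d * sg b d) * (sg a e * sg b e) = S" by (simp add: S_def)
      have S2: "(sg a d * sg b d) * (sg a b * sg a a) = S" if "a = e" using that by (simp add: S_def supersign_def)
      have n: "n + 1 + (m - s) = n + m + 1 - s" by simp
      have "(sg a d * sg b d) \<cdot> c d s (J a b n (cs e (m - s) v)) =
          ((sg a d * sg b d) * (sg a e * sg b e)) \<cdot> c d s (cs e (m - s) (J a b n v)) -
          (if a = e then ((sg a d * sg b d) * (sg a b * sg a a)) \<cdot> c d s (cs b (n + m + 1 - s) v) else 0)"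
        unfolding J_cs[OF I(1,2,4)] n
        by (simp add: lin_rules[OF lin_c[OF I(3)]] cvec.scale_right_diff_distrib del: supersign_square)
      also have "\<dots> = S \<cdot> c d s (cs e (m - s) (J a b n v)) - (if a = e then S \<cdot> c d s (cs b (n + m + 1 - s) v) else 0)"
        unfolding S1 using S2 by (simp del: supersign_square)
      finally show ?thesis unfolding J_c[OF I(1-3)] by simp
    qed
    have SS: "S = 1" if "d = e" using that by (simp add: S_def supersign_def)
    have SS': "S * sg d d = sg a a" if "b = d" "a = e" using that by (simp add: S_def supersign_def)
    have t2: "(if b = d then c a (n + 1 + s) (cs e (m - s) v) else 0) = t2 s - (if s < - (n + 1) then w else 0)"
      unfolding t2_def npair_eq[OF I(1,4)] w_def by auto
    have t3: "(if a = e then S \<cdot> c d s (cs b (n + m + 1 - s) v) else 0) = t3 s - (if s < 0 then w else 0)"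
      unfolding t3_def npair_eq[OF I(3,2)] w_def using SS' by (auto simp: cvec.scale_right_distrib simp del: supersign_square)
    have t1: "J a b n (npair d e s (m - s) v) = J a b n (c d s (cs e (m - s) v)) + (t1 s - S \<cdot> c d s (cs e (m - s) (J a b n v)))"
      unfolding t1_def npair_eq[OF I(3,4)] lin_add[OF lin_J[OF I(1,2)]] cvec.scale_right_distrib
      using SS by (auto simp: lin_rules[OF lin_J[OF I(1,2)]] simp del: supersign_square)
    show ?thesis unfolding t1 cc t2 t3 t4_def by simp
  qed
  have s1: "finite {s. t1 s \<noteq> 0}"
    by (rule finite_subset[OF _ npair_support[OF I(3,4), of m "J a b n v"]]) (auto simp: t1_def)
  have s2: "finite {s. t2 s \<noteq> 0}"
  proof (rule finite_subset[OF _ finite_imageI[OF npair_support[OF I(1,4), of "n + m + 1" v], of "\<lambda>k. k - (n + 1)"]], rule subsetI)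
    fix s assume "s \<in> {s. t2 s \<noteq> 0}"
    then show "s \<in> (\<lambda>k. k - (n + 1)) ` {k. npair a e k (n + m + 1 - k) v \<noteq> 0}"
      by (intro image_eqI[of _ _ "s + (n + 1)"]) (auto simp: t2_def algebra_simps split: if_splits)
  qed
  have s3: "finite {s. t3 s \<noteq> 0}"
    by (rule finite_subset[OF _ npair_support[OF I(3,2), of "n + m + 1" v]]) (auto simp: t3_def)
  have s4: "finite {s. t4 s \<noteq> 0}"
    by (rule finite_subset[of _ "{- \<bar>n + 1\<bar>..\<bar>n + 1\<bar>}"]) (auto simp: t4_def split: if_splits)
  have s12: "finite {s. t1 s + t2 s \<noteq> 0}" by (rule finite_subset[OF _ finite_UnI[OF s1 s2]]) auto
  have s123: "finite {s. t1 s + t2 s - t3 s \<noteq> 0}" by (rule finite_subset[OF _ finite_UnI[OF s12 s3]]) auto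
  have "J a b n (J d e m v) = Sum_any (\<lambda>s. t1 s + t2 s - t3 s + t4 s)"
    unfolding J_def[of d e] Sum_any_lin[OF lin_J[OF I(1,2)] npair_support[OF I(3,4)]] * ..
  also have "\<dots> = Sum_any t1 + Sum_any t2 - Sum_any t3 + Sum_any t4"
    by (simp only: Sum_any.distrib[OF s123 s4] Sum_any_diff[OF s12 s3] Sum_any.distrib[OF s1 s2])
  also have "Sum_any t1 = S \<cdot> J d e m (J a b n v)"
    unfolding t1_def J_def[of d e] by (rule Sum_any_scale[symmetric, OF npair_support[OF I(3,4)]])
  also have "Sum_any t2 = (if b = d then J a e (n + m + 1) v else 0)"
    unfolding t2_def[abs_def] J_def
    by (auto, subst (2) Sum_any_shift[of _ "n + 1", symmetric]) (simp add: algebra_simps)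
  also have "Sum_any t3 = (if a = e then S \<cdot> J d b (n + m + 1) v else 0)"
    unfolding t3_def[abs_def] J_def by (simp add: Sum_any_scale[OF npair_support[OF I(3,2)]])
  also have "Sum_any t4 = of_int (n + 1) \<cdot> w"
    unfolding t4_def[abs_def] by (rule Sum_any_step)
  finally show ?thesis by (auto simp: w_def mult.commute)
qed

end

section \<open>Operators on the tensor product\<close>

lemma on_first_on_first:
  "lin (A k) \<Longrightarrow> lin (B l) \<Longrightarrow> on_first A k (on_first B l v) = op_tensor (\<lambda>x. A k (B l x)) id v"
  using op_tensor_compose[of "A k" id "B l" id v] by (simp add: on_first_def lin_id) (simp add: id_def)

lemma on_second_on_second:
  "lin (A k) \<Longrightarrow> lin (B l) \<Longrightarrow> on_second A k (on_second B l v) = op_tensor id (\<lambda>x. A k (B l x)) v"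
  using op_tensor_compose[of id "A k" id "B l" v] by (simp add: on_second_def lin_id) (simp add: id_def)

lemma on_first_on_second:
  assumes "lin (A k)" "lin (B l)"
  shows "on_first A k (on_second B l v) = on_second B l (on_first A k v)"
  using op_tensor_compose[OF assms(1) lin_id(1) lin_id(1) assms(2), of v]
    op_tensor_compose[OF lin_id(1) assms(2) assms(1) lin_id(1), of v]
  by (simp add: on_first_def on_second_def)

lemma op_tensor_first_spanned_by:
  assumes "lin f" "\<And>v. v \<in> spanned_by A \<Longrightarrow> f v \<in> spanned_by B" "w \<in> spanned_by (A \<times> D)"
  shows "op_tensor f id w \<in> spanned_by (B \<times> D)"
proof (rule lin_spanned_by[OF lin_op_tensor _ assms(3)])
  fix b assume "b \<in> A \<times> D"
  then show "op_tensor f id (single b 1) \<in> spanned_by (B \<times> D)"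
    by (auto simp: op_tensor_def intro!: spanned_by_tensor assms(2) spanned_by_single)
qed

lemma op_tensor_second_spanned_by:
  assumes "lin f" "\<And>v. v \<in> spanned_by A \<Longrightarrow> f v \<in> spanned_by B" "w \<in> spanned_by (D \<times> A)"
  shows "op_tensor id f w \<in> spanned_by (D \<times> B)"
proof (rule lin_spanned_by[OF lin_op_tensor _ assms(3)])
  fix b assume "b \<in> D \<times> A"
  then show "op_tensor id f (single b 1) \<in> spanned_by (D \<times> B)"
    by (auto simp: op_tensor_def intro!: spanned_by_tensor assms(2) spanned_by_single)
qed

lemma lat_form_e_e [simp]: "lat_form (e_vec i) (e_vec j) = of_bool (i = j)"
  by (simp add: e_vec_def lat_form_single)

lemma lat_form_delta_of [simp]:
  "lat_form (delta_of q m) (e_vec i) = 0" "lat_form (e_vec i) (delta_of q m) = 0"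
  "lat_form (delta_of q m) (delta_of q n) = 0"
proof -
  have 1: "lat_form (delta_of q m) (e_vec i) = 0" for m i
    by (simp add: delta_of_def lat_form_sum e_vec_def lat_form_single)
  then show "lat_form (delta_of q m) (e_vec i) = 0" "lat_form (e_vec i) (delta_of q m) = 0"
    by (simp_all add: lat_form_commute[of "e_vec i"])
  have "lat_form (single (Gen_delta j) a) (delta_of q n) = 0" for j a
    by (subst lat_form_commute) (simp add: delta_of_def lat_form_sum lat_form_single)
  then show "lat_form (delta_of q m) (delta_of q n) = 0"
    by (simp add: delta_of_def[of q m] lat_form_sum)
qed

lemma delta_of_add: "delta_of q (m + n) = delta_of q m + delta_of q n"
  by (simp add: delta_of_def lookup_add single_add sum.distrib)

lemma delta_of_0 [simp]: "delta_of q 0 = 0"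
  by (simp add: delta_of_def)

lemma additive_int:
  assumes "\<And>a b :: int. f (a + b) = f a + (f b :: 'b cvec)"
  shows "f k = of_int k \<cdot> f 1"
proof -
  have f0: "f 0 = 0" using assms[of 0 0] by simp
  show ?thesis
  proof (induction k rule: int_induct[where k = 0])
    case base
    show ?case by (simp add: f0)
  next
    case (step1 i)
    then show ?case by (simp add: assms cvec.scale_left_distrib)
  next
    case (step2 i)
    have "f (i - 1) = f i - f 1" using assms[of "i - 1" 1] by simp
    with step2(2) show ?case by (simp only: of_int_diff cvec.scale_left_diff_distrib of_int_1 cvec.scale_one)
  qed
qed

lemma heis_add: "heis (\<alpha> + \<beta>) k v = heis \<alpha> k v + heis \<beta> k v"
  by (rule sector_eqI[where v = v, OF lin_heis lin_plus[OF lin_heis lin_heis]])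
    (simp add: heis_sector heis_sym_add lin_add[OF lin_sector] cvec.scale_left_distrib)

lemma heis_0: "heis 0 k v = 0"
  using heis_add[of 0 0 k v] by simp

text \<open>Because \<open>\<delta>\<^sub>m\<close> does not involve the last component of \<open>m\<close>, the summand \<open>i = q\<close> vanishes.\<close>

lemma heis_delta_of:
  assumes "q > 0"
  shows "heis (delta_of q m) k v = (\<Sum>i\<in>{1..q}. of_int (lookup m i) \<cdot> heis (delta_of q (single i 1)) k v)"
proof -
  have 1: "heis (\<Sum>i\<in>A. f i) k v = (\<Sum>i\<in>A. heis (f i) k v)" for A :: "nat set" and f
    by (induction A rule: infinite_finite_induct) (simp_all add: heis_0 heis_add)
  have 2: "heis (single g a) k v = of_int a \<cdot> heis (single g 1) k v" for g a
    by (rule additive_int[where f = "\<lambda>a. heis (single g a) k v"]) (simp add: single_add heis_add)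
  have 3: "delta_of q (single i 1) = (if i \<in> {1..q-1} then single (Gen_delta i) 1 else 0)" for i
  proof -
    have "delta_of q (single i 1) = (\<Sum>j\<in>{1..q-1}. if j = i then single (Gen_delta i) 1 else 0)"
      unfolding delta_of_def by (rule sum.cong) (auto simp: lookup_single when_def)
    then show ?thesis by simp
  qed
  have "heis (delta_of q m) k v = (\<Sum>i\<in>{1..q-1}. of_int (lookup m i) \<cdot> heis (delta_of q (single i 1)) k v)"
    unfolding delta_of_def[of q m] 1 by (intro sum.cong refl) (subst 2, simp add: 3)
  also have "\<dots> = (\<Sum>i\<in>{1..q}. of_int (lookup m i) \<cdot> heis (delta_of q (single i 1)) k v)"
    by (rule sum.mono_neutral_left) (auto simp: 3 heis_0)
  finally show ?thesis .
qed

text \<open>The free fields on the tensor product of the two Fock spaces, for a cocycle that is bimultiplicative everywhere.\<close>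

locale toroidal_fock = bimultiplicative F for F :: "lat \<Rightarrow> lat \<Rightarrow> int" +
  fixes M N q :: nat
  assumes q_pos: "q > 0"
    and F_e_e: "i \<in> {1..M} \<Longrightarrow> j \<in> {1..M} \<Longrightarrow> F (e_vec i) (e_vec j) = (if i \<le> j then 1 else - 1)"
    and F_e_delta: "i \<in> {1..M} \<Longrightarrow> k \<in> {1..q-1} \<Longrightarrow> F (e_vec i) (delta_vec k) = 1"
    and F_delta_e: "i \<in> {1..M} \<Longrightarrow> k \<in> {1..q-1} \<Longrightarrow> F (delta_vec k) (e_vec i) = 1"
    and F_delta_delta: "k \<in> {1..q-1} \<Longrightarrow> l \<in> {1..q-1} \<Longrightarrow> F (delta_vec k) (delta_vec l) = 1"
begin

lemma F_e_same: "i \<in> {1..M} \<Longrightarrow> F (e_vec i) (e_vec i) = 1"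
  by (simp add: F_e_e)

lemma F_e_swap: "i \<in> {1..M} \<Longrightarrow> j \<in> {1..M} \<Longrightarrow> i \<noteq> j \<Longrightarrow> F (e_vec i) (e_vec j) * F (e_vec j) (e_vec i) = - 1"
  by (auto simp: F_e_e)

lemma F_sum_right: "(\<And>i. i \<in> A \<Longrightarrow> F \<alpha> (f i) = 1) \<Longrightarrow> F \<alpha> (\<Sum>i\<in>A. f i) = 1"
  by (induction A rule: infinite_finite_induct) (auto simp: F_add_right)

lemma F_sum_left: "(\<And>i. i \<in> A \<Longrightarrow> F (f i) \<alpha> = 1) \<Longrightarrow> F (\<Sum>i\<in>A. f i) \<alpha> = 1"
  by (induction A rule: infinite_finite_induct) (auto simp: F_add_left)

lemma F_single: "F \<alpha> (single g 1) = 1 \<Longrightarrow> F \<alpha> (single g k) = 1" "F (single g 1) \<alpha> = 1 \<Longrightarrow> F (single g k) \<alpha> = 1"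
proof -
  have 1: "f k = 1" if f: "\<And>a b. f (a + b) = f a * f b" "f 1 = 1" "f 0 = 1" for f :: "int \<Rightarrow> int" and k
  proof (induction k rule: int_induct[where k = 0])
    case (step2 i)
    have "f i = f (i - 1) * f 1" using f(1)[of "i - 1" 1] by simp
    with step2(2) show ?case by (simp only: f(2) mult_1_right)
  qed (simp_all add: f)
  show "F \<alpha> (single g k) = 1" if "F \<alpha> (single g 1) = 1"
    by (rule 1[where f = "\<lambda>k. F \<alpha> (single g k)"], unfold single_add F_add_right single_zero F_0)
      (rule refl that)+
  show "F (single g k) \<alpha> = 1" if "F (single g 1) \<alpha> = 1"
    by (rule 1[where f = "\<lambda>k. F (single g k) \<alpha>"], unfold single_add F_add_left single_zero F_0)
      (rule refl that)+
qed

lemma F_delta_of_right: "(\<And>k. k \<in> {1..q-1} \<Longrightarrow> F \<alpha> (delta_vec k) = 1) \<Longrightarrow> F \<alpha> (delta_of q m) = 1"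
  unfolding delta_of_def delta_vec_def by (rule F_sum_right, rule F_single(1))

lemma F_delta_of_left: "(\<And>k. k \<in> {1..q-1} \<Longrightarrow> F (delta_vec k) \<alpha> = 1) \<Longrightarrow> F (delta_of q m) \<alpha> = 1"
  unfolding delta_of_def delta_vec_def by (rule F_sum_left, rule F_single(2))

lemma F_delta_of:
  "i \<in> {1..M} \<Longrightarrow> F (e_vec i) (delta_of q m) = 1" "i \<in> {1..M} \<Longrightarrow> F (delta_of q m) (e_vec i) = 1"
  "F (delta_of q m) (delta_of q n) = 1"
  by (simp_all only: F_delta_of_right F_delta_of_left F_e_delta F_delta_e F_delta_delta)

definition idx :: "nat set" where "idx = {1..M+N}"

text \<open>The series \<open>Y(\<plusminus>e\<^sub>a,z)\<close> and \<open>X(\<plusminus>e\<^sub>a,z)\<close> agree, \<open>(e\<^sub>a,e\<^sub>a)\<close> being odd. The index \<open>a > M\<close> stands for the boson with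
  number \<open>a - M\<close>. A boson with mode \<open>r - 1/2\<close> has the exponent \<open>-r\<close>.\<close>

definition c :: "nat \<Rightarrow> W_index op_series" where
  "c a = (if a \<le> M then on_first (Y (e_vec a)) else on_second (phi_field (a - M)))"

definition cs :: "nat \<Rightarrow> W_index op_series" where
  "cs a = (if a \<le> M then on_first (Y (- e_vec a)) else on_second (phi_star_field (a - M)))"

lemmas lin_fields = lin_Y_series field_lin[OF field_phi] field_lin[OF field_phi_star]

text \<open>For \<open>i \<noteq> j\<close> the vertex operators themselves commute up to the cocycle, and
  \<open>F(e\<^sub>i,e\<^sub>j) F(e\<^sub>j,e\<^sub>i) = -1\<close> makes them anticommute; for \<open>i = j\<close> the lattice does it.\<close>

lemma Y_e_commute:
  assumes "i \<in> {1..M}" "j \<in> {1..M}" "(\<alpha> = e_vec i \<and> \<beta> = e_vec j) \<or> (\<alpha> = - e_vec i \<and> \<beta> = - e_vec j)"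
  shows "Y \<alpha> k (Y \<beta> l v) = - Y \<beta> l (Y \<alpha> k v)"
proof (cases "i = j")
  case True
  then have "lat_form \<alpha> \<beta> = 1" "F \<alpha> \<beta> * F \<beta> \<alpha> = 1" using assms by (auto simp: F_e_same)
  then show ?thesis using Y_Y_form_1[of \<alpha> \<beta> k l v] by simp
next
  case False
  then have "lat_form \<alpha> \<beta> = 0" "F \<alpha> \<beta> * F \<beta> \<alpha> = - 1" using assms F_e_swap[of i j] by auto
  then show ?thesis using Y_Y_orthogonal[of \<alpha> \<beta> k l v] by (simp del: of_int_mult)
qed

lemma Y_e_dual:
  assumes "i \<in> {1..M}" "j \<in> {1..M}"
  shows "Y (- e_vec j) l (Y (e_vec i) k v) =
    - Y (e_vec i) k (Y (- e_vec j) l v) + (if i = j \<and> k + l = - 1 then v else 0)"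
proof (cases "i = j")
  case True
  have "Y (- e_vec i) l (Y (e_vec i) k v) = (if k + l = - 1 then v else 0) - Y (e_vec i) k (Y (- e_vec i) l v)"
    using Y_dual_anticommute[of "e_vec i" k l v] F_e_same[OF assms(1)]
    by (simp only: eq_diff_eq add.commute lat_form_e_e of_bool_eq simp_thms)
  then show ?thesis using True by simp
next
  case False
  then have "lat_form (- e_vec j) (e_vec i) = 0" "F (- e_vec j) (e_vec i) * F (e_vec i) (- e_vec j) = - 1"
    using assms F_e_swap[of j i] by auto
  then show ?thesis using False Y_Y_orthogonal[of "- e_vec j" "e_vec i" l k v] by (simp del: of_int_mult)
qed

sublocale free_superfields idx "\<lambda>a. a \<le> M" c cs
proof unfold_locales
  fix a b :: nat and k l :: int and v :: "W_index cvec"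
  show "field (c a)" "field (cs a)"
    by (simp_all add: c_def cs_def field_on_first field_on_second field_Y field_phi field_phi_star)
  have s1: "op_tensor (\<lambda>x. - A x) id v = - op_tensor A id v" for A :: "V_index cvec \<Rightarrow> V_index cvec"
    using op_tensor_first_scale[of "-1" A id v] by simp
  assume a: "a \<in> idx" and b: "b \<in> idx"
  show "c a k (c b l v) = supersign (a \<le> M) (b \<le> M) \<cdot> c b l (c a k v)"
  proof (cases "a \<le> M"; cases "b \<le> M")
    assume "a \<le> M" "b \<le> M"
    then have "(\<lambda>x. Y (e_vec a) k (Y (e_vec b) l x)) = (\<lambda>x. - Y (e_vec b) l (Y (e_vec a) k x))"
      using a b by (intro ext Y_e_commute[of a b]) (auto simp: idx_def)
    with \<open>a \<le> M\<close> \<open>b \<le> M\<close> show ?thesis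
      by (simp add: c_def supersign_def on_first_on_first lin_fields s1)
  qed (simp_all add: c_def supersign_def on_first_on_second on_second_on_second lin_fields phi_field_def[abs_def] lin_phi phi_phi[of "a - M"])
  show "cs a k (cs b l v) = supersign (a \<le> M) (b \<le> M) \<cdot> cs b l (cs a k v)"
  proof (cases "a \<le> M"; cases "b \<le> M")
    assume "a \<le> M" "b \<le> M"
    then have "(\<lambda>x. Y (- e_vec a) k (Y (- e_vec b) l x)) = (\<lambda>x. - Y (- e_vec b) l (Y (- e_vec a) k x))"
      using a b by (intro ext Y_e_commute[of a b]) (auto simp: idx_def)
    with \<open>a \<le> M\<close> \<open>b \<le> M\<close> show ?thesis
      by (simp add: cs_def supersign_def on_first_on_first lin_fields s1)
  qed (simp_all add: cs_def supersign_def on_first_on_second on_second_on_second lin_fields phi_star_field_def[abs_def] lin_phi_star phi_star_phi_star[of "a - M"])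
  show "cs b l (c a k v) = supersign (a \<le> M) (b \<le> M) \<cdot> c a k (cs b l v) + (if a = b \<and> k + l = - 1 then v else 0)"
  proof (cases "a \<le> M"; cases "b \<le> M")
    assume "a \<le> M" "b \<le> M"
    then have "(\<lambda>x. Y (- e_vec b) l (Y (e_vec a) k x)) =
        (\<lambda>x. - Y (e_vec a) k (Y (- e_vec b) l x) + (if a = b \<and> k + l = - 1 then x else 0))"
      using a b by (intro ext Y_e_dual) (auto simp: idx_def)
    then have "cs b l (c a k v) =
        op_tensor (\<lambda>x. - Y (e_vec a) k (Y (- e_vec b) l x) + (if a = b \<and> k + l = - 1 then x else 0)) id v"
      using \<open>a \<le> M\<close> \<open>b \<le> M\<close> by (simp only: c_def cs_def if_True on_first_on_first lin_fields)
    also have "\<dots> = - c a k (cs b l v) + (if a = b \<and> k + l = - 1 then v else 0)"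
      using \<open>a \<le> M\<close> \<open>b \<le> M\<close>
      by (simp only: op_tensor_first_plus s1 op_tensor_if c_def cs_def if_True on_first_on_first lin_fields)
    finally show ?thesis using \<open>a \<le> M\<close> \<open>b \<le> M\<close> by (simp add: supersign_def)
  next
    assume ab: "\<not> a \<le> M" "\<not> b \<le> M"
    have "(\<lambda>x. phi_star_field (b - M) l (phi_field (a - M) k x)) =
        (\<lambda>x. phi_field (a - M) k (phi_star_field (b - M) l x) + (if a = b \<and> k + l = - 1 then x else 0))"
      using ab by (auto simp: fun_eq_iff phi_field_def phi_star_field_def phi_star_phi)
    with ab show ?thesis
      by (simp add: c_def cs_def supersign_def on_second_on_second lin_fields op_tensor_second_plus op_tensor_if)
  qed (auto simp: c_def cs_def supersign_def on_first_on_second lin_fields)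
qed

text \<open>The analogue of \<open>t\<^sup>m\<close> without the power of the last variable.\<close>

definition X :: "expo \<Rightarrow> W_index op_series" where
  "X m = on_first (Y (delta_of q m))"

lemma field_X: "field (X m)"
  by (simp add: X_def field_on_first field_Y)

lemma lin_X: "lin (X m k)"
  by (rule field_lin[OF field_X])

lemma Y_delta_commute:
  "F (delta_of q m) \<beta> * F \<beta> (delta_of q m) = 1 \<Longrightarrow> lat_form (delta_of q m) \<beta> = 0 \<Longrightarrow>
    Y (delta_of q m) k (Y \<beta> l x) = Y \<beta> l (Y (delta_of q m) k x)"
  using Y_Y_orthogonal[of "delta_of q m" \<beta> k l x] by (simp del: of_int_mult)

lemma X_X: "X m k (X n l v) = X n l (X m k v)"
proof -
  have "(\<lambda>x. Y (delta_of q m) k (Y (delta_of q n) l x)) = (\<lambda>x. Y (delta_of q n) l (Y (delta_of q m) k x))"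
    by (intro ext Y_delta_commute) (simp_all add: F_delta_of)
  then show ?thesis by (simp add: X_def on_first_on_first lin_fields)
qed

lemma X_c: "a \<in> idx \<Longrightarrow> X m k (c a l v) = c a l (X m k v)"
proof (cases "a \<le> M")
  case True
  assume "a \<in> idx"
  then have "(\<lambda>x. Y (delta_of q m) k (Y (e_vec a) l x)) = (\<lambda>x. Y (e_vec a) l (Y (delta_of q m) k x))"
    using True by (intro ext Y_delta_commute) (simp_all add: F_delta_of idx_def)
  with True show ?thesis by (simp add: X_def c_def on_first_on_first lin_fields)
qed (simp add: X_def c_def on_first_on_second lin_fields)

lemma X_cs: "a \<in> idx \<Longrightarrow> X m k (cs a l v) = cs a l (X m k v)"
proof (cases "a \<le> M")
  case True
  assume "a \<in> idx"
  then have "(\<lambda>x. Y (delta_of q m) k (Y (- e_vec a) l x)) = (\<lambda>x. Y (- e_vec a) l (Y (delta_of q m) k x))"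
    using True by (intro ext Y_delta_commute) (simp_all add: F_delta_of idx_def)
  with True show ?thesis by (simp add: X_def cs_def on_first_on_first lin_fields)
qed (simp add: X_def cs_def on_first_on_second lin_fields)

lemma X_J: "a \<in> idx \<Longrightarrow> b \<in> idx \<Longrightarrow> X m k (J a b l v) = J a b l (X m k v)"
  by (rule J_intertwine) (simp_all add: lin_X X_c X_cs)

lemma X_X_op: "X m k (X n l v) = op_tensor (\<lambda>x. Y (delta_of q m) k (Y (delta_of q n) l x)) id v"
  by (simp add: X_def on_first_on_first lin_fields)

lemma X_X_support: "finite {k. X m k (X n (K - k) v) \<noteq> 0}"
  unfolding X_X_op by (rule op_tensor_Sum_any_support(1)[OF lin_Y_Y Y_Y_orthogonal_support]) simp

lemma X_X_diagonal: "Sum_any (\<lambda>k. X m k (X n (K - k) v)) = X (m + n) K v"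
proof -
  have "Sum_any (\<lambda>k. X m k (X n (K - k) v)) =
      op_tensor (\<lambda>x. Sum_any (\<lambda>k. Y (delta_of q m) k (Y (delta_of q n) (K - k) x))) id v"
    unfolding X_X_op by (rule op_tensor_Sum_any(1)[OF lin_Y_Y Y_Y_orthogonal_support]) simp
  also have "(\<lambda>x. Sum_any (\<lambda>k. Y (delta_of q m) k (Y (delta_of q n) (K - k) x))) = Y (delta_of q (m + n)) K"
    by (rule ext) (simp add: Y_Y_diagonal F_delta_of delta_of_add)
  finally show ?thesis by (simp add: X_def on_first_def id_def)
qed

lemma X_0: "X 0 k v = (if k = 0 then v else 0)"
proof -
  have "Y 0 k x = (if k = 0 then x else 0)" for x
    by (rule sector_eqI[where v = x, OF lin_Y_series lin_if[OF lin_id(2) lin_0]])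
      (simp add: Y_series_sector vertex_sym_of_0 lin_zero[OF lin_sector])
  then have "Y 0 k = (\<lambda>x. if k = 0 then x else 0)" by (rule ext)
  then show ?thesis by (simp add: X_def on_first_def op_tensor_if)
qed

end

context toroidal_fock
begin

section \<open>The currents and their supercommutators\<close>

text \<open>The residue of \<open>J\<^sub>a\<^sub>b(z) z\<^sup>p X(\<delta>\<^sub>m,z)\<close>, where \<open>p\<close> is the last component of \<open>m\<close>.\<close>

definition current :: "nat \<Rightarrow> nat \<Rightarrow> expo \<Rightarrow> W_index cvec \<Rightarrow> W_index cvec" where
  "current a b m v = Sum_any (\<lambda>k. J a b k (X m (- lookup m q - 1 - k) v))"

text \<open>The residue of \<open>f'(z) g(z)\<close> for \<open>f = z\<^sup>p X(\<delta>\<^sub>m,z)\<close> and \<open>g = z\<^sup>r X(\<delta>\<^sub>n,z)\<close>, where \<open>p\<close> and \<open>r\<close> are the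
  last components of \<open>m\<close> and \<open>n\<close>.\<close>

definition central :: "expo \<Rightarrow> expo \<Rightarrow> W_index cvec \<Rightarrow> W_index cvec" where
  "central m n v = Sum_any (\<lambda>p. of_int (lookup m q + p) \<cdot> X m p (X n (- lookup m q - lookup n q - p) v))"

lemma lin_current_term: "a \<in> idx \<Longrightarrow> b \<in> idx \<Longrightarrow> lin (\<lambda>v. J a b k (X m l v))"
  by (rule lin_compose[OF lin_J lin_X])

lemma current_support:
  assumes "a \<in> idx" "b \<in> idx"
  shows "finite {k. J a b k (X m (A - k) v) \<noteq> 0}"
proof -
  obtain K where K: "\<And>k. k < K \<Longrightarrow> J a b k v = 0" using field_bound[OF field_J[OF assms]] by blast
  obtain L where L: "\<And>k. k < L \<Longrightarrow> X m k v = 0" using field_bound[OF field_X] by blast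
  show ?thesis
  proof (rule finite_support_int[of K _ "A - L"])
    fix k
    show "J a b k (X m (A - k) v) = 0" if "k < K"
      using that by (simp add: X_J[OF assms, symmetric] K lin_zero[OF lin_X])
    show "J a b k (X m (A - k) v) = 0" if "A - L < k"
      using that by (simp add: L lin_zero[OF lin_J[OF assms]])
  qed
qed

lemma lin_current: "a \<in> idx \<Longrightarrow> b \<in> idx \<Longrightarrow> lin (current a b m)"
  using lin_Sum_any[OF lin_current_term current_support] by (simp add: current_def[abs_def])

lemma central_support: "finite {p. of_int (k + p) \<cdot> X m p (X n (K - p) v) \<noteq> 0}"
  by (rule finite_subset[OF _ X_X_support[of m n K v]]) auto

lemma lin_X_X: "lin (\<lambda>v. X m k (X n l v))"
  by (rule lin_compose[OF lin_X lin_X])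

lemma lin_central: "lin (central m n)"
  using lin_Sum_any[OF lin_smult[OF lin_X_X] central_support] by (simp add: central_def[abs_def])

lemma central_intertwine:
  assumes "lin A" "\<And>m k v. A (X m k v) = X m k (A v)"
  shows "A (central m n v) = central m n (A v)"
  unfolding central_def Sum_any_lin[OF assms(1) central_support] by (simp add: lin_scale[OF assms(1)] assms(2))

lemma current_intertwine:
  assumes "lin A" "a \<in> idx" "b \<in> idx" "\<And>k v. A (X m k v) = X m k (A v)" "\<And>k v. A (J a b k v) = J a b k (A v)"
  shows "A (current a b m v) = current a b m (A v)"
  unfolding current_def Sum_any_lin[OF assms(1) current_support[OF assms(2,3)]] by (simp add: assms(4,5))

lemma X_current: "a \<in> idx \<Longrightarrow> b \<in> idx \<Longrightarrow> X m k (current a b n v) = current a b n (X m k v)"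
  by (rule current_intertwine) (simp_all add: lin_X X_J X_X[of m])

lemma current_central: "a \<in> idx \<Longrightarrow> b \<in> idx \<Longrightarrow> current a b k (central m n v) = central m n (current a b k v)"
  by (rule central_intertwine) (simp_all add: lin_current X_current)

lemma central_central: "central m n (central m' n' v) = central m' n' (central m n v)"
  by (rule central_intertwine[OF lin_central])
    (rule central_intertwine[symmetric], simp_all add: lin_X X_X)

lemma X_X_bound: "\<exists>P T. \<forall>m' n'. (X m m' (X n n' v) \<noteq> 0 \<longrightarrow> P \<le> m' \<and> T \<le> n')"
proof -
  obtain P where P: "\<And>k. k < P \<Longrightarrow> X m k v = 0" using field_bound[OF field_X] by blast
  obtain T where T: "\<And>k. k < T \<Longrightarrow> X n k v = 0" using field_bound[OF field_X] by blast
  have "P \<le> m' \<and> T \<le> n'" if nz: "X m m' (X n n' v) \<noteq> 0" for m' n'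
  proof
    show "P \<le> m'" using nz P[of m'] by (cases "m' < P") (auto simp: X_X[of m m'] lin_zero[OF lin_X])
    show "T \<le> n'" using nz T[of n'] by (cases "n' < T") (auto simp: lin_zero[OF lin_X])
  qed
  then show ?thesis by blast
qed

lemma J_X_X_support:
  assumes "a \<in> idx" "b \<in> idx"
  shows "finite {(k, l). J a b (k + l + 1) (X m (A - k) (X n (B - l) v)) \<noteq> 0}"
proof -
  obtain K where K: "\<And>k. k < K \<Longrightarrow> J a b k v = 0" using field_bound[OF field_J[OF assms]] by blast
  obtain P T where PT: "\<And>m' n'. X m m' (X n n' v) \<noteq> 0 \<Longrightarrow> P \<le> m' \<and> T \<le> n'" using X_X_bound by metis
  have "k \<le> A - P \<and> l \<le> B - T \<and> K \<le> k + l + 1"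
    if nz: "J a b (k + l + 1) (X m (A - k) (X n (B - l) v)) \<noteq> 0" for k l
  proof -
    have "X m (A - k) (X n (B - l) v) \<noteq> 0" using nz by (rule contrapos_nn) (simp add: lin_zero[OF lin_J[OF assms]])
    then have "P \<le> A - k \<and> T \<le> B - l" by (rule PT)
    moreover have "X m (A - k) (X n (B - l) (J a b (k + l + 1) v)) \<noteq> 0"
      using nz unfolding X_J[OF assms] .
    then have "J a b (k + l + 1) v \<noteq> 0" by (rule contrapos_nn) (simp add: lin_zero[OF lin_X])
    then have "K \<le> k + l + 1" using K[of "k + l + 1"] by linarith
    ultimately show ?thesis by auto
  qed
  then have "{(k, l). J a b (k + l + 1) (X m (A - k) (X n (B - l) v)) \<noteq> 0}
      \<subseteq> {K - 1 - (B - T)..A - P} \<times> {K - 1 - (A - P)..B - T}"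
    by fastforce
  then show ?thesis by (rule finite_subset) simp
qed

text \<open>The two \<open>J\<close> do not commute, so the indices cannot be bounded independently; first \<open>l\<close> is bounded, then
  \<open>k\<close> for each \<open>l\<close>.\<close>

lemma J_J_X_X_support:
  assumes I: "a \<in> idx" "b \<in> idx" "d \<in> idx" "e \<in> idx"
  shows "finite {(k, l). J a b k (J d e l (X m (A - k) (X n (B - l) v))) \<noteq> 0}"
proof -
  obtain K where K: "\<And>k. k < K \<Longrightarrow> J d e k v = 0" using field_bound[OF field_J[OF I(3,4)]] by blast
  obtain P T where PT: "\<And>m' n'. X m m' (X n n' v) \<noteq> 0 \<Longrightarrow> P \<le> m' \<and> T \<le> n'" using X_X_bound by metis
  note zeros = lin_zero[OF lin_J[OF I(1,2)]] lin_zero[OF lin_J[OF I(3,4)]] lin_zero[OF lin_X]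
  note com = X_J[OF I(1,2)] X_J[OF I(3,4)]
  show ?thesis
  proof (rule finite_pairsI[of "{K..B - T}"])
    fix k l assume nz: "J a b k (J d e l (X m (A - k) (X n (B - l) v))) \<noteq> 0"
    then have "X m (A - k) (X n (B - l) v) \<noteq> 0" by (rule contrapos_nn) (simp add: zeros)
    then have "T \<le> B - l" using PT by blast
    moreover have "X m (A - k) (X n (B - l) (J a b k (J d e l v))) \<noteq> 0" using nz unfolding com .
    then have "J d e l v \<noteq> 0" by (rule contrapos_nn) (simp add: zeros)
    then have "K \<le> l" using K[of l] by linarith
    ultimately show "l \<in> {K..B - T}" by auto
  next
    fix l
    have "finite {k. J a b k (X m (A - k) (J d e l (X n (B - l) v))) \<noteq> 0}"
      by (rule current_support[OF I(1,2)])
    then show "finite {k. J a b k (J d e l (X m (A - k) (X n (B - l) v))) \<noteq> 0}"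
      by (simp only: com)
  qed simp
qed

text \<open>Summing over \<open>k\<close> with \<open>r = k + l + 1\<close> fixed evaluates the product of the two \<open>X\<close> at one point.\<close>

lemma J_X_X_sum:
  assumes I: "a \<in> idx" "b \<in> idx"
  shows "Sum_any (\<lambda>k. Sum_any (\<lambda>l. J a b (k + l + 1) (X m (A - k) (X n (B - l) v)))) =
    Sum_any (\<lambda>r. J a b r (X (m + n) (A + B + 1 - r) v))"
proof -
  let ?f = "\<lambda>k l. J a b (k + l + 1) (X m (A - k) (X n (B - l) v))"
  let ?g = "\<lambda>k r. J a b r (X m (A - k) (X n (A + B + 1 - r - (A - k)) v))"
  have "?f k (r + (- k - 1)) = ?g k r" for k r by (simp add: algebra_simps)
  then have g: "Sum_any (\<lambda>l. ?f k l) = Sum_any (\<lambda>r. ?g k r)" for k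
    by (subst Sum_any_shift[of _ "- k - 1", symmetric]) simp
  have fin: "finite {(k, r). ?g k r \<noteq> 0}"
  proof (rule finite_subset[OF _ finite_imageI[OF J_X_X_support[OF I, of m A n B v], of "\<lambda>(k, l). (k, k + l + 1)"]], rule subsetI)
    fix p assume p: "p \<in> {(k, r). ?g k r \<noteq> 0}"
    obtain k r where kr: "p = (k, r)" by (cases p)
    have "?f k (r - k - 1) \<noteq> 0" using p kr by (simp add: algebra_simps)
    then show "p \<in> (\<lambda>(k, l). (k, k + l + 1)) ` {(k, l). ?f k l \<noteq> 0}"
      using kr by (intro image_eqI[of _ _ "(k, r - k - 1)"]) auto
  qed
  have "Sum_any (\<lambda>k. Sum_any (\<lambda>l. ?f k l)) = Sum_any (\<lambda>r. Sum_any (\<lambda>k. ?g k r))"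
    unfolding g by (rule Sum_any_swap[OF fin])
  also have "\<dots> = Sum_any (\<lambda>r. J a b r (X (m + n) (A + B + 1 - r) v))"
  proof (rule arg_cong[where f = Sum_any], rule ext)
    fix r
    have "Sum_any (\<lambda>k. ?g k r) = Sum_any (\<lambda>k. J a b r (X m k (X n (A + B + 1 - r - k) v)))"
      by (rule Sum_any_reflect[of "\<lambda>p. J a b r (X m p (X n (A + B + 1 - r - p) v))" A])
    also have "\<dots> = J a b r (X (m + n) (A + B + 1 - r) v)"
      by (simp only: Sum_any_lin[OF lin_J[OF I] X_X_support, symmetric] X_X_diagonal)
    finally show "Sum_any (\<lambda>k. ?g k r) = J a b r (X (m + n) (A + B + 1 - r) v)" .
  qed
  finally show ?thesis .
qed

text \<open>The bracket of two currents is that of the \<open>J\<close> termwise, as the \<open>X\<close> commute with everything. The terms linear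
  in \<open>J\<close> acquire \<open>X(\<delta>\<^sub>m,z) X(\<delta>\<^sub>n,z) = X(\<delta>\<^sub>m\<^sub>+\<^sub>n,z)\<close>, and the central term of \<open>J_J\<close>, linear in the index, becomes a
  derivative of the first factor.\<close>

lemma current_current:
  assumes I: "a \<in> idx" "b \<in> idx" "d \<in> idx" "e \<in> idx"
  defines "S \<equiv> sg a d * sg a e * sg b d * sg b e"
  shows "current a b m (current d e n v) = S \<cdot> current d e n (current a b m v) +
    (if b = d then current a e (m + n) v else 0) - (if a = e then S \<cdot> current d b (m + n) v else 0) -
    (if b = d \<and> a = e then sg a a \<cdot> central m n v else 0)"
proof -
  define A B where "A = - lookup m q - 1" and "B = - lookup n q - 1"
  define G where "G k l = X m (A - k) (X n (B - l) v)" for k l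
  \<comment> \<open>\<open>f1\<close> to \<open>f4\<close> are the terms of \<open>J_J\<close> applied to \<open>G\<close>\<close>
  define f1 where "f1 k l = S \<cdot> J d e l (J a b k (G k l))" for k l
  define f2 where "f2 k l = (if b = d then J a e (k + l + 1) (G k l) else 0)" for k l
  define f3 where "f3 k l = (if a = e then S \<cdot> J d b (k + l + 1) (G k l) else 0)" for k l
  define f4 where "f4 k l = (if b = d \<and> a = e \<and> k + l = - 2 then (sg a a * of_int (k + 1)) \<cdot> G k l else 0)" for k l
  have fin1': "finite {(k, l). J d e l (J a b k (G k l)) \<noteq> 0}"
    by (rule finite_subset[OF _ finite_imageI[OF J_J_X_X_support[OF I(3,4,1,2), of n B m A v], of prod.swap]])
      (force simp: G_def X_X[of m])
  have fin1: "finite {(k, l). f1 k l \<noteq> 0}" by (rule finite_subset[OF _ fin1']) (auto simp: f1_def)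
  have fin2: "finite {(k, l). f2 k l \<noteq> 0}"
    by (rule finite_subset[OF _ J_X_X_support[OF I(1,4), of m A n B v]]) (auto simp: f2_def G_def)
  have fin3': "finite {(k, l). J d b (k + l + 1) (G k l) \<noteq> 0}"
    unfolding G_def by (rule J_X_X_support[OF I(3,2)])
  have fin3: "finite {(k, l). f3 k l \<noteq> 0}" by (rule finite_subset[OF _ fin3']) (auto simp: f3_def)
  have fin4: "finite {(k, l). f4 k l \<noteq> 0}"
  proof -
    obtain P T where PT: "\<And>m' n'. X m m' (X n n' v) \<noteq> 0 \<Longrightarrow> P \<le> m' \<and> T \<le> n'" using X_X_bound by metis
    have "{(k, l). f4 k l \<noteq> 0} \<subseteq> {- 2 - (B - T)..A - P} \<times> {- 2 - (A - P)..B - T}"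
    proof (rule subsetI)
      fix p assume "p \<in> {(k, l). f4 k l \<noteq> 0}"
      then obtain k l where p: "p = (k, l)" and "f4 k l \<noteq> 0" by blast
      then have kl: "k + l = - 2" and "X m (A - k) (X n (B - l) v) \<noteq> 0"
        by (auto simp: f4_def G_def split: if_splits)
      from PT[OF this(2)] kl show "p \<in> {- 2 - (B - T)..A - P} \<times> {- 2 - (A - P)..B - T}"
        unfolding p by auto
    qed
    then show ?thesis by (rule finite_subset) simp
  qed
  have sum: "current a b m (current d e n v) = Sum_any (\<lambda>k. Sum_any (\<lambda>l. J a b k (J d e l (G k l))))"
    unfolding current_def A_def[symmetric] B_def[symmetric]
    by (simp only: Sum_any_lin[OF lin_current_term[OF I(1,2)] current_support[OF I(3,4)]] X_J[OF I(3,4)] G_def)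
  have sum': "current d e n (current a b m v) = Sum_any (\<lambda>l. Sum_any (\<lambda>k. J d e l (J a b k (G k l))))"
    unfolding current_def A_def[symmetric] B_def[symmetric]
    by (simp only: Sum_any_lin[OF lin_current_term[OF I(3,4)] current_support[OF I(1,2)]] X_J[OF I(1,2)] G_def X_X[of n _ m])
  have "A + B + 1 = - lookup (m + n) q - 1" by (simp add: A_def B_def lookup_add)
  then have current_sum: "current x y (m + n) v = Sum_any (\<lambda>r. J x y r (X (m + n) (A + B + 1 - r) v))" for x y
    by (simp only: current_def)
  have Sum_any_0: "Sum_any (\<lambda>k :: int. 0 :: W_index cvec) = 0" by simp
  have "J a b k (J d e l (G k l)) = f1 k l + f2 k l - f3 k l + f4 k l" for k l
    unfolding f1_def f2_def f3_def f4_def S_def by (rule J_J[OF I])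
  then have "current a b m (current d e n v) = Sum_any (\<lambda>k. Sum_any (\<lambda>l. f1 k l + f2 k l - f3 k l + f4 k l))"
    unfolding sum by simp
  also have "\<dots> = Sum_any (\<lambda>k. Sum_any (f1 k)) + Sum_any (\<lambda>k. Sum_any (f2 k)) - Sum_any (\<lambda>k. Sum_any (f3 k))
      + Sum_any (\<lambda>k. Sum_any (f4 k))"
  proof -
    note i1 = finite_support_inner[OF fin1] and i2 = finite_support_inner[OF fin2]
      and i3 = finite_support_inner[OF fin3] and i4 = finite_support_inner[OF fin4]
    have inner: "Sum_any (\<lambda>l. f1 k l + f2 k l - f3 k l + f4 k l) =
        Sum_any (f1 k) + Sum_any (f2 k) - Sum_any (f3 k) + Sum_any (f4 k)" for k
    proof -
      have s12: "finite {l. f1 k l + f2 k l \<noteq> 0}" by (rule finite_subset[OF _ finite_UnI[OF i1(1)[of k] i2(1)[of k]]]) auto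
      have s123: "finite {l. f1 k l + f2 k l - f3 k l \<noteq> 0}" by (rule finite_subset[OF _ finite_UnI[OF s12 i3(1)[of k]]]) auto
      show ?thesis
        by (simp only: Sum_any.distrib[OF s123 i4(1)] Sum_any_diff[OF s12 i3(1)] Sum_any.distrib[OF i1(1) i2(1)])
    qed
    have s12: "finite {k. Sum_any (f1 k) + Sum_any (f2 k) \<noteq> 0}" by (rule finite_subset[OF _ finite_UnI[OF i1(3) i2(3)]]) auto
    have s123: "finite {k. Sum_any (f1 k) + Sum_any (f2 k) - Sum_any (f3 k) \<noteq> 0}"
      by (rule finite_subset[OF _ finite_UnI[OF s12 i3(3)]]) auto
    show ?thesis
      by (simp only: inner Sum_any.distrib[OF s123 i4(3)] Sum_any_diff[OF s12 i3(3)] Sum_any.distrib[OF i1(3) i2(3)])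
  qed
  also have "Sum_any (\<lambda>k. Sum_any (f1 k)) = S \<cdot> current d e n (current a b m v)"
    unfolding sum' f1_def[abs_def]
    by (simp only: Sum_any_scale[OF finite_support_inner(1)[OF fin1'], symmetric]
      Sum_any_scale[OF finite_support_inner(3)[OF fin1'], symmetric] Sum_any_swap[OF fin1'])
  also have "Sum_any (\<lambda>k. Sum_any (f2 k)) = (if b = d then current a e (m + n) v else 0)"
    unfolding f2_def[abs_def] G_def current_sum by (cases "b = d") (simp_all only: simp_thms if_True if_False J_X_X_sum[OF I(1,4)] Sum_any_0)
  also have "Sum_any (\<lambda>k. Sum_any (f3 k)) = (if a = e then S \<cdot> current d b (m + n) v else 0)"
  proof -
    have "Sum_any (\<lambda>k. Sum_any (\<lambda>l. S \<cdot> J d b (k + l + 1) (G k l))) = S \<cdot> Sum_any (\<lambda>k. Sum_any (\<lambda>l. J d b (k + l + 1) (G k l)))"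
      by (simp only: Sum_any_scale[OF finite_support_inner(1)[OF fin3'], symmetric]
        Sum_any_scale[OF finite_support_inner(3)[OF fin3'], symmetric])
    also have "Sum_any (\<lambda>k. Sum_any (\<lambda>l. J d b (k + l + 1) (G k l))) = current d b (m + n) v"
      unfolding G_def current_sum J_X_X_sum[OF I(3,2)] ..
    finally show ?thesis by (simp add: f3_def[abs_def])
  qed
  also have "Sum_any (\<lambda>k. Sum_any (f4 k)) = - (if b = d \<and> a = e then sg a a \<cdot> central m n v else 0)"
  proof (cases "b = d \<and> a = e")
    case True
    have "Sum_any (f4 k) = (sg a a * of_int (k + 1)) \<cdot> G k (- 2 - k)" for k
    proof -
      have "f4 k l = 0" if "l \<noteq> - 2 - k" for l using that by (auto simp: f4_def)
      then have "Sum_any (f4 k) = f4 k (- 2 - k)" by (rule Sum_any_single)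
      then show ?thesis using True by (simp add: f4_def)
    qed
    then have "Sum_any (\<lambda>k. Sum_any (f4 k)) = Sum_any (\<lambda>k. (sg a a * of_int (k + 1)) \<cdot> G k (- 2 - k))" by simp
    also have "\<dots> = Sum_any (\<lambda>p. (sg a a * of_int (A - p + 1)) \<cdot> G (A - p) (- 2 - (A - p)))"
      by (rule Sum_any_reflect[symmetric])
    also have "\<dots> = Sum_any (\<lambda>p. (- sg a a) \<cdot> of_int (lookup m q + p) \<cdot> X m p (X n (- lookup m q - lookup n q - p) v))"
    proof (rule arg_cong[where f = Sum_any], rule ext)
      fix p
      have "A - (A - p) = p" "B - (- 2 - (A - p)) = - lookup m q - lookup n q - p"
        by (simp_all add: A_def B_def)
      moreover have "sg a a * of_int (A - p + 1) = - sg a a * of_int (lookup m q + p)"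
        by (simp add: A_def algebra_simps)
      ultimately show "(sg a a * of_int (A - p + 1)) \<cdot> G (A - p) (- 2 - (A - p)) =
          (- sg a a) \<cdot> of_int (lookup m q + p) \<cdot> X m p (X n (- lookup m q - lookup n q - p) v)"
        by (simp only: G_def cvec.scale_scale)
    qed
    also have "\<dots> = (- sg a a) \<cdot> central m n v"
      unfolding central_def by (rule Sum_any_scale[symmetric, OF central_support])
    finally show ?thesis using True by simp
  next
    case False
    then have "f4 k l = 0" for k l by (auto simp: f4_def)
    then show ?thesis using False by (auto simp: Sum_any_zero)
  qed
  finally show ?thesis by simp
qed

subsection \<open>The bracket of T in matrix form\<close>

text \<open>With the matrix units \<open>E\<^sub>a\<^sub>b\<close>, the map \<open>T\<^sub>a\<^sub>b \<mapsto> T_sign a b E\<^sub>a\<^sub>b\<close> is an isomorphism of \<open>T\<close> with \<open>gl(M|N)\<close>;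
  it is the sign by which \<open>J\<^sub>a\<^sub>b\<close> and \<open>X(\<alpha>\<^sub>a\<^sub>b,z)\<close> differ.\<close>

definition T_sign :: "nat \<Rightarrow> nat \<Rightarrow> complex" where
  "T_sign a b = (if a \<le> M \<and> b \<le> M then of_int (F (e_vec a) (e_vec b)) else 1)"

lemma F_alpha: "F (alpha a b) (alpha d e) =
    F (e_vec a) (e_vec d) * F (e_vec a) (e_vec e) * F (e_vec b) (e_vec d) * F (e_vec b) (e_vec e)"
  by (simp add: alpha_def F_diff)

lemma form_alpha: "lat_form (alpha a b) (alpha d e) =
    of_bool (a = d) - of_bool (a = e) - of_bool (b = d) + of_bool (b = e)"
  by (simp add: alpha_def)

text \<open>The nonzero cases are those in which at least one matrix product \<open>E\<^sub>a\<^sub>b E\<^sub>d\<^sub>e\<close> or \<open>E\<^sub>d\<^sub>e E\<^sub>a\<^sub>b\<close> is nonzero, which for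
  distinct indices in each pair means that \<open>(\<alpha>\<^sub>a\<^sub>b,\<alpha>\<^sub>d\<^sub>e) < 0\<close>; the signs agree because
  \<open>F(e\<^sub>i,e\<^sub>j) F(e\<^sub>j,e\<^sub>i) = -1\<close> for \<open>i \<noteq> j\<close>.\<close>

lemma T_bracket_even:
  assumes I: "a \<in> {1..M}" "b \<in> {1..M}" "d \<in> {1..M}" "e \<in> {1..M}"
  shows "T_bracket M F (a, b) (d, e) = (of_bool (b = d) * T_sign a b * T_sign d e * T_sign a e) \<cdot> T_basis a e -
    (of_bool (a = e) * T_sign a b * T_sign d e * T_sign d b) \<cdot> T_basis d b"
proof -
  have le: "a \<le> M" "b \<le> M" "d \<le> M" "e \<le> M" using I by auto
  consider "a = b" "d = e" | "a = b" "d \<noteq> e" | "a \<noteq> b" "d = e" | "a \<noteq> b" "d \<noteq> e" by blast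
  then show ?thesis
  proof cases
    case 1
    then show ?thesis by (auto simp: T_bracket_def T_listed_def)
  next
    case 2
    then have "T_bracket M F (a, b) (d, e) = of_int (lat_form (e_vec a) (alpha d e)) \<cdot> T_basis d e"
      using le by (simp add: T_bracket_def T_listed_def)
    also have "lat_form (e_vec a) (alpha d e) = of_bool (a = d) - of_bool (a = e)"
      by (simp add: alpha_def)
    finally show ?thesis
      using 2 le I by (cases "a = d"; cases "a = e") (simp_all add: T_sign_def F_e_same flip: of_int_mult)
  next
    case 3
    then have "T_bracket M F (a, b) (d, e) = - (of_int (lat_form (e_vec d) (alpha a b)) \<cdot> T_basis a b)"
      using le by (simp add: T_bracket_def T_listed_def T_parity_def)
    also have "lat_form (e_vec d) (alpha a b) = of_bool (a = d) - of_bool (b = d)"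
      by (auto simp: alpha_def)
    finally show ?thesis
      using 3 le I by (cases "a = d"; cases "b = d") (simp_all add: T_sign_def F_e_same flip: of_int_mult)
  next
    case 4
    have swap: "F (e_vec x) (e_vec y) = - F (e_vec y) (e_vec x)"
      if "x \<in> {1..M}" "y \<in> {1..M}" "x \<noteq> y" for x y
      using that by (auto simp: F_e_e)
    have br: "T_bracket M F (a, b) (d, e) =
        (if lat_form (alpha a b) (alpha d e) \<ge> 0 then 0
         else if b = d \<and> e \<noteq> a then of_int (F (alpha a b) (alpha d e)) \<cdot> T_basis a e
         else if e = a \<and> b \<noteq> d then of_int (F (alpha a b) (alpha d e)) \<cdot> T_basis d b
         else of_int (F (alpha a b) (alpha d e)) \<cdot> (T_basis a a - T_basis b b))"
      using 4 le by (simp add: T_bracket_def T_listed_def)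
    consider "b = d" "e \<noteq> a" | "e = a" "b \<noteq> d" | "b = d" "e = a" | "b \<noteq> d" "e \<noteq> a" by blast
    then show ?thesis
    proof cases
      case 1
      then have "lat_form (alpha a b) (alpha d e) < 0" using 4 by (auto simp: form_alpha)
      then show ?thesis
        unfolding br using 1 le I by (simp add: F_alpha T_sign_def F_e_same mult_ac)
    next
      case 2
      then have "lat_form (alpha a b) (alpha d e) < 0" using 4 by (auto simp: form_alpha)
      moreover have "F (alpha a b) (alpha d e) = - (F (e_vec a) (e_vec b) * F (e_vec d) (e_vec e) * F (e_vec d) (e_vec b))"
        using 2 4 I swap[of a d] swap[of b d] swap[of b a] by (auto simp: F_alpha F_e_same mult_ac)
      ultimately show ?thesis
        unfolding br using 2 le I by simp (simp add: T_sign_def)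
    next
      case 3
      then have "lat_form (alpha a b) (alpha d e) < 0" using 4 by (auto simp: form_alpha)
      moreover have "F (alpha a b) (alpha d e) = F (e_vec a) (e_vec b) * F (e_vec d) (e_vec e)"
        using 3 I by (simp add: F_alpha F_e_same)
      ultimately show ?thesis
        unfolding br using 3 4 le I by simp (simp add: T_sign_def F_e_same cvec.scale_right_diff_distrib)
    next
      case 4
      then have "lat_form (alpha a b) (alpha d e) \<ge> 0" by (auto simp: form_alpha)
      then show ?thesis unfolding br using 4 by simp
    qed
  qed
qed

lemma T_bracket_matrix:
  assumes I: "a \<in> idx" "b \<in> idx" "d \<in> idx" "e \<in> idx"
  shows "T_bracket M F (a, b) (d, e) = (of_bool (b = d) * T_sign a b * T_sign d e * T_sign a e) \<cdot> T_basis a e -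
    (of_bool (a = e) * (sg a d * sg a e * sg b d * sg b e) * T_sign a b * T_sign d e * T_sign d b) \<cdot> T_basis d b"
proof (cases "a \<le> M \<and> b \<le> M \<and> d \<le> M \<and> e \<le> M")
  case True
  then show ?thesis using I T_bracket_even[of a b d e] by (simp add: supersign_def idx_def)
next
  case False
  have swap: "F (e_vec x) (e_vec y) = - F (e_vec y) (e_vec x)"
    if "x \<in> idx" "y \<in> idx" "x \<le> M" "y \<le> M" "x \<noteq> y" for x y
    using that by (auto simp: F_e_e idx_def)
  have same: "F (e_vec x) (e_vec x) = 1" if "x \<in> idx" "x \<le> M" for x
    using that by (intro F_e_same) (auto simp: idx_def)
  note defs = T_bracket_def T_listed_def T_parity_def T_sign_def supersign_def
  consider "a > M" "b > M" "d > M" "e > M" | "a \<le> M" "b \<le> M" "d > M" "e \<le> M" | "a \<le> M" "b \<le> M" "d \<le> M" "e > M"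
    | "a > M" "b > M" "d > M" "e \<le> M" | "a > M" "b > M" "d \<le> M" "e > M" | "a > M" "b \<le> M" "d \<le> M" "e > M"
    | "a \<le> M" "b \<le> M" "d > M" "e > M" | "a > M" "b \<le> M" "d > M" "e \<le> M" | "a \<le> M" "b > M" "d \<le> M" "e > M"
    | "a > M" "b \<le> M" "d \<le> M" "e \<le> M" | "a \<le> M" "b > M" "d \<le> M" "e \<le> M"
    | "a > M" "b \<le> M" "d > M" "e > M" | "a \<le> M" "b > M" "d > M" "e > M" | "a \<le> M" "b > M" "d > M" "e \<le> M"
    | "a > M" "b > M" "d \<le> M" "e \<le> M"
    unfolding not_le[symmetric] using False by argo
  then show ?thesis
  proof cases
    case 1 then show ?thesis by (simp add: defs)
  next
    case 2 then show ?thesis using I swap[of a b] same[of a] by (cases "a = b"; cases "a = e") (simp_all add: defs)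
  next
    case 3 then show ?thesis using I by (cases "a = e"; cases "b = d") (simp_all add: defs)
  next
    case 4 then show ?thesis by (auto simp: defs)
  next
    case 5 then show ?thesis by (auto simp: defs)
  next
    case 6 then show ?thesis by (cases "a = e"; cases "b = d") (simp_all add: defs)
  next
    case 7 then show ?thesis by (auto simp: defs)
  next
    case 8 then show ?thesis by (auto simp: defs)
  next
    case 9 then show ?thesis by (auto simp: defs)
  next
    case 10 then show ?thesis using I swap[of d e] same[of d] by (cases "d = e"; cases "b = d") (simp_all add: defs)
  next
    case 11 then show ?thesis using I by (cases "a = e"; cases "b = d") (simp_all add: defs)
  next
    case 12 then show ?thesis by (cases "a = e"; cases "b = d") (simp_all add: defs)
  next
    case 13 then show ?thesis by (cases "a = e"; cases "b = d") (simp_all add: defs)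
  next
    case 14 then show ?thesis by (cases "a = e"; cases "b = d") (simp_all add: defs)
  next
    case 15 then show ?thesis by (auto simp: defs)
  qed
qed

text \<open>The supertrace form in the normalisation of level one: \<open>sg a a\<close> is \<open>-1\<close> for fermionic indices.\<close>

lemma T_form_matrix:
  assumes I: "a \<in> idx" "b \<in> idx" "d \<in> idx" "e \<in> idx"
  shows "T_form M F (a, b) (d, e) = - (of_bool (b = d \<and> a = e) * sg a a * T_sign a b * T_sign d e)"
proof -
  have F: "F (e_vec x) (e_vec x) = 1" if "x \<in> idx" "x \<le> M" for x
    using that by (intro F_e_same) (auto simp: idx_def)
  show ?thesis
    using I by (auto simp: T_form_def F_alpha T_sign_def supersign_def F)
qed

end

section \<open>The assigned operators as currents\<close>

lemma X_series_delta: "X_series F (delta_of q m) = Y_series F (delta_of q m)"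
  by (simp add: X_series_def ser_shift_def)

lemma X_series_e: "X_series F (e_vec a) = Y_series F (e_vec a)" "X_series F (- e_vec a) = Y_series F (- e_vec a)"
  by (simp_all add: X_series_def)

text \<open>The norm of \<open>\<alpha>\<^sub>a\<^sub>b + \<delta>\<^sub>m\<close> is \<open>2\<close>, whence the shift by \<open>1\<close>.\<close>

lemma X_series_alpha:
  "a \<noteq> b \<Longrightarrow> X_series F (alpha a b + delta_of q m) n = Y_series F (alpha a b + delta_of q m) (n - 1)"
  by (simp add: X_series_def ser_shift_def alpha_def)

context toroidal_fock
begin

lemma T_sign_square: "T_sign a b * T_sign a b = 1"
  by (simp add: T_sign_def flip: of_int_mult)

lemma J_Y:
  assumes "a \<in> {1..M}" "b \<in> {1..M}" "a \<noteq> b"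
  shows "J a b n v = of_int (F (e_vec a) (e_vec b)) \<cdot> on_first (Y (alpha a b)) n v"
proof -
  have I: "a \<in> idx" "b \<in> idx" using assms by (auto simp: idx_def)
  have orth: "lat_form (e_vec a) (- e_vec b) = 0" using assms by simp
  have alpha: "alpha a b = e_vec a + - e_vec b" by (simp add: alpha_def)
  have "npair a b k (n - k) v = op_tensor (\<lambda>x. Y (e_vec a) k (Y (- e_vec b) (n - k) x)) id v" for k
    using assms I by (simp add: npair_distinct c_def cs_def on_first_on_first lin_fields)
  then have "J a b n v = op_tensor (\<lambda>x. Sum_any (\<lambda>k. Y (e_vec a) k (Y (- e_vec b) (n - k) x))) id v"
    by (simp only: J_def op_tensor_Sum_any(1)[OF lin_Y_Y Y_Y_orthogonal_support[OF orth]])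
  also have "\<dots> = op_tensor (\<lambda>x. of_int (F (e_vec a) (e_vec b)) \<cdot> Y (alpha a b) n x) id v"
    by (simp only: Y_Y_diagonal[OF orth] F_uminus alpha)
  finally show ?thesis by (simp only: op_tensor_first_scale on_first_def)
qed

lemma J_heis:
  assumes "a \<in> {1..M}"
  shows "J a a n v = on_first (heis_field (e_vec a)) n v"
proof -
  let ?npair = "\<lambda>k. normal_product (-1) (Y (e_vec a)) (Y (- e_vec a)) k (n - k)"
  have I: "a \<in> idx" using assms by (auto simp: idx_def)
  have "npair a a k (n - k) v = op_tensor (?npair k) id v" for k
  proof (cases "k \<ge> 0")
    case True
    then have "?npair k = (\<lambda>x. Y (e_vec a) k (Y (- e_vec a) (n - k) x))" by (simp add: fun_eq_iff normal_product_def)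
    moreover have "npair a a k (n - k) v = c a k (cs a (n - k) v)"
      using True by (simp add: npair_def normal_product_def)
    ultimately show ?thesis
      using assms by (simp add: c_def cs_def on_first_on_first lin_fields)
  next
    case False
    then have "?npair k = (\<lambda>x. (-1) \<cdot> Y (- e_vec a) (n - k) (Y (e_vec a) k x))" by (simp add: fun_eq_iff normal_product_def)
    then have "op_tensor (?npair k) id v = (-1) \<cdot> op_tensor (\<lambda>x. Y (- e_vec a) (n - k) (Y (e_vec a) k x)) id v"
      by (simp only: op_tensor_first_scale)
    moreover have "npair a a k (n - k) v = - cs a (n - k) (c a k v)"
      using False assms by (simp add: npair_def normal_product_def supersign_def)
    ultimately show ?thesis
      using assms by (simp add: c_def cs_def on_first_on_first lin_fields)
  qed
  then have "J a a n v = op_tensor (\<lambda>x. Sum_any (\<lambda>k. ?npair k x)) id v"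
    by (simp only: J_def op_tensor_Sum_any(1)[OF lin_normal_product[OF field_Y field_Y] normal_product_support[OF field_Y field_Y]])
  also have "(\<lambda>x. Sum_any (\<lambda>k. ?npair k x)) = heis_field (e_vec a) n"
    using assms by (simp add: fun_eq_iff bosonization F_e_same heis_field_def)
  finally show ?thesis by (simp only: on_first_def)
qed

text \<open>Only the purely bosonic case needs an argument: the two conventions of normal ordering separate the modes at
  different places, but they differ only where the two modes commute.\<close>

lemma S_series_J:
  assumes I: "a \<in> idx" "b \<in> idx" and ab: "a > M \<or> b > M"
  shows "S_series M F a b n v = J a b n v"
proof -
  consider "a \<le> M" "b > M" | "a > M" "b \<le> M" | "a > M" "b > M" using ab by linarith
  then show ?thesis
  proof cases
    case 1
    then have "npair a b k (n - k) v = c a k (cs b (n - k) v)" for k using I by (intro npair_distinct) auto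
    with 1 show ?thesis by (simp add: J_def S_series_def ser_mult_def X_series_e c_def cs_def)
  next
    case 2
    then have "npair a b k (n - k) v = c a k (cs b (n - k) v)" for k using I by (intro npair_distinct) auto
    also have "c a k (cs b (n - k) v) = cs b (n - k) (c a k v)" for k
      using 2 by (simp add: c_def cs_def on_first_on_second lin_fields)
    finally have "J a b n v = Sum_any (\<lambda>k. cs b (n - k) (c a k v))" by (simp add: J_def)
    also have "\<dots> = Sum_any (\<lambda>k. cs b k (c a (n - k) v))"
      by (subst Sum_any_reflect[of _ n, symmetric]) simp
    finally show ?thesis using 2 by (simp add: S_series_def ser_mult_def X_series_e c_def cs_def)
  next
    case 3
    let ?P = "phi_field (a - M)" and ?S = "phi_star_field (b - M)"
    let ?npair = "\<lambda>k. normal_product 1 ?P ?S k (n - k)"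
    have npair: "normal_ordered (a - M) (b - M) r (- n - r) x = ?npair (- r) x" for r x
    proof (cases "r \<le> - n - r \<longleftrightarrow> r \<le> 0")
      case True
      then show ?thesis
        by (auto simp: normal_ordered_def normal_product_def phi_field_def phi_star_field_def algebra_simps)
    next
      case False
      then have "r + (- n - r) \<noteq> 1" by auto
      then show ?thesis
        using phi_star_phi[of "b - M" "- n - r" "a - M" r x]
        by (auto simp: normal_ordered_def normal_product_def phi_field_def phi_star_field_def algebra_simps)
    qed
    have "normal_ordered_field (a - M) (b - M) n = (\<lambda>x. Sum_any (\<lambda>k. ?npair k x))"
    proof
      fix x
      show "normal_ordered_field (a - M) (b - M) n x = Sum_any (\<lambda>k. ?npair k x)"
        unfolding normal_ordered_field_def npair
        using Sum_any_reflect[of "\<lambda>k. ?npair k x" 0] by simp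
    qed
    then have "S_series M F a b n v = op_tensor id (\<lambda>x. Sum_any (\<lambda>k. ?npair k x)) v"
      using 3 by (simp add: S_series_def on_second_def)
    also have "\<dots> = Sum_any (\<lambda>k. op_tensor id (?npair k) v)"
      by (rule op_tensor_Sum_any(2)[OF lin_normal_product[OF field_phi field_phi_star]
            normal_product_support[OF field_phi field_phi_star], symmetric])
    also have "\<dots> = J a b n v"
    proof -
      have "op_tensor id (?npair k) v = npair a b k (n - k) v" for k
      proof (cases "k \<ge> 0")
        case True
        then have "?npair k = (\<lambda>x. ?P k (?S (n - k) x))" by (simp add: fun_eq_iff normal_product_def)
        moreover have "npair a b k (n - k) v = c a k (cs b (n - k) v)"
          using True by (simp add: npair_def normal_product_def)
        ultimately show ?thesis
          using 3 by (simp add: c_def cs_def on_second_on_second lin_fields)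
      next
        case False
        then have "?npair k = (\<lambda>x. ?S (n - k) (?P k x))" by (simp add: fun_eq_iff normal_product_def)
        moreover have "npair a b k (n - k) v = cs b (n - k) (c a k v)"
          using False 3 by (simp add: npair_def normal_product_def supersign_def)
        ultimately show ?thesis
          using 3 by (simp add: c_def cs_def on_second_on_second lin_fields)
      qed
      then show ?thesis by (simp add: J_def)
    qed
    finally show ?thesis .
  qed
qed

lemma X_mode_delta: "X_mode F (delta_of q m) n v = X m (- n) v"
  by (simp add: X_mode_def X_series_delta X_def)

lemma X_mode_alpha:
  assumes "a \<in> {1..M}" "b \<in> {1..M}" "a \<noteq> b"
  shows "X_mode F (alpha a b + delta_of q m) (lookup m q) v = T_sign a b \<cdot> current a b m v"
proof -
  have I: "a \<in> idx" "b \<in> idx" using assms by (auto simp: idx_def)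
  let ?n = "- lookup m q - 1"
  have orth: "lat_form (alpha a b) (delta_of q m) = 0" by (simp add: alpha_def)
  have F1: "F (alpha a b) (delta_of q m) = 1" using assms by (simp add: alpha_def F_diff F_delta_of)
  have J: "T_sign a b \<cdot> J a b k w = on_first (Y (alpha a b)) k w" for k w
    using assms T_sign_square[of a b] by (simp add: J_Y T_sign_def)
  have "T_sign a b \<cdot> current a b m v = Sum_any (\<lambda>k. on_first (Y (alpha a b)) k (X m (?n - k) v))"
    unfolding current_def by (simp only: Sum_any_scale[OF current_support[OF I]] J)
  also have "\<dots> = Sum_any (\<lambda>k. op_tensor (\<lambda>x. Y (alpha a b) k (Y (delta_of q m) (?n - k) x)) id v)"
    by (simp only: X_def on_first_on_first lin_fields)
  also have "\<dots> = op_tensor (\<lambda>x. Sum_any (\<lambda>k. Y (alpha a b) k (Y (delta_of q m) (?n - k) x))) id v"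
    by (rule op_tensor_Sum_any(1)[OF lin_Y_Y Y_Y_orthogonal_support[OF orth]])
  also have "\<dots> = op_tensor (\<lambda>x. Y (alpha a b + delta_of q m) ?n x) id v"
    by (simp only: Y_Y_diagonal[OF orth] F1 of_int_1 cvec.scale_one)
  finally show ?thesis
    using assms by (simp add: X_mode_def on_first_def X_series_alpha)
qed

lemma heis_X_support:
  assumes "lat_form \<alpha> (delta_of q m) = 0"
  shows "finite {k. heis_field \<alpha> k (Y (delta_of q m) (n - k) x) \<noteq> 0}"
proof (rule finite_subset[OF _ finite_imageI[OF heis_Y_support[OF assms, of "n + 1" x], of "\<lambda>i. - i - 1"]], rule subsetI)
  fix k assume "k \<in> {k. heis_field \<alpha> k (Y (delta_of q m) (n - k) x) \<noteq> 0}"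
  then show "k \<in> (\<lambda>i. - i - 1) ` {i. heis \<alpha> i (Y (delta_of q m) (n + 1 + i) x) \<noteq> 0}"
    by (intro image_eqI[of _ _ "- k - 1"]) (auto simp: heis_field_def)
qed

lemma lin_heis_field: "lin (heis_field \<alpha> k)"
  by (simp add: heis_field_def lin_heis)

lemma T_mode_J:
  assumes "a \<in> {1..M}"
  shows "T_mode F (e_vec a) (delta_of q m) (lookup m q) v = current a a m v"
proof -
  have orth: "lat_form (e_vec a) (delta_of q m) = 0" by simp
  have "current a a m v = Sum_any (\<lambda>k. op_tensor (\<lambda>x. heis_field (e_vec a) k (Y (delta_of q m) (- lookup m q - 1 - k) x)) id v)"
    by (simp only: current_def J_heis[OF assms] X_def on_first_on_first lin_fields lin_heis_field)
  also have "\<dots> = op_tensor (\<lambda>x. Sum_any (\<lambda>k. heis_field (e_vec a) k (Y (delta_of q m) (- lookup m q - 1 - k) x))) id v"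
    by (rule op_tensor_Sum_any(1)[OF lin_compose[OF lin_heis_field lin_Y_series] heis_X_support[OF orth]])
  finally show ?thesis
    by (simp add: T_mode_def on_first_def ser_mult_def[abs_def] X_series_delta)
qed

lemma S_mode_J:
  assumes "a \<in> idx" "b \<in> idx" "a > M \<or> b > M"
  shows "S_mode M F (delta_of q m) a b (lookup m q) v = current a b m v"
  by (simp add: S_mode_def current_def ser_mult_def[of "S_series M F a b"] S_series_J[OF assms] X_series_delta X_def)

lemma T_mode_delta:
  "T_mode F (delta_of q m) (delta_of q k) n v =
     op_tensor (\<lambda>x. Sum_any (\<lambda>j. heis_field (delta_of q m) j (Y (delta_of q k) (- n - 1 - j) x))) id v"
  by (simp add: T_mode_def on_first_def ser_mult_def[abs_def] X_series_delta)

text \<open>Splitting the derivative of \<open>z\<^sup>p X(\<delta>\<^sub>m,z)\<close> into that of the power and that of the vertex operator.\<close>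

lemma central_modes:
  "central m n v = of_int (lookup m q) \<cdot> X_mode F (delta_of q (m + n)) (lookup m q + lookup n q) v +
     T_mode F (delta_of q m) (delta_of q (m + n)) (lookup m q + lookup n q) v"
proof -
  let ?K = "- lookup m q - lookup n q" and ?Ym = "Y (delta_of q m)" and ?Yn = "Y (delta_of q n)"
  have f1: "finite {p. of_int (lookup m q) \<cdot> X m p (X n (?K - p) v) \<noteq> 0}"
    and f2: "finite {p. of_int p \<cdot> X m p (X n (?K - p) v) \<noteq> 0}"
    by (rule finite_subset[OF _ X_X_support[of m n ?K v]]; auto)+
  have f3: "finite {p. of_int p \<cdot> ?Ym p (?Yn (?K - p) x) \<noteq> 0}" for x
    by (rule finite_subset[OF _ Y_Y_orthogonal_support[of "delta_of q m" "delta_of q n" ?K x]]) auto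
  have "central m n v = Sum_any (\<lambda>p. of_int (lookup m q) \<cdot> X m p (X n (?K - p) v) + of_int p \<cdot> X m p (X n (?K - p) v))"
    by (simp add: central_def cvec.scale_left_distrib)
  also have "\<dots> = Sum_any (\<lambda>p. of_int (lookup m q) \<cdot> X m p (X n (?K - p) v)) + Sum_any (\<lambda>p. of_int p \<cdot> X m p (X n (?K - p) v))"
    by (rule Sum_any.distrib[OF f1 f2])
  also have "Sum_any (\<lambda>p. of_int (lookup m q) \<cdot> X m p (X n (?K - p) v)) = of_int (lookup m q) \<cdot> X (m + n) ?K v"
    by (simp only: Sum_any_scale[OF X_X_support, symmetric] X_X_diagonal)
  also have "Sum_any (\<lambda>p. of_int p \<cdot> X m p (X n (?K - p) v)) =
      Sum_any (\<lambda>p. op_tensor (\<lambda>x. of_int p \<cdot> ?Ym p (?Yn (?K - p) x)) id v)"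
    by (simp only: op_tensor_first_scale X_X_op)
  also have "\<dots> = op_tensor (\<lambda>x. Sum_any (\<lambda>p. of_int p \<cdot> ?Ym p (?Yn (?K - p) x))) id v"
    by (rule op_tensor_Sum_any(1)[OF lin_smult[OF lin_Y_Y] f3])
  also have "(\<lambda>x. Sum_any (\<lambda>p. of_int p \<cdot> ?Ym p (?Yn (?K - p) x))) =
      (\<lambda>x. Sum_any (\<lambda>j. heis_field (delta_of q m) j (Y (delta_of q (m + n)) (- (lookup m q + lookup n q) - 1 - j) x)))"
  proof
    fix x
    have "Sum_any (\<lambda>p. of_int p \<cdot> ?Ym p (?Yn (?K - p) x)) =
        Sum_any (\<lambda>i. heis (delta_of q m) i (Y (delta_of q (m + n)) (?K + i) x))"
      using Y_Y_euler[of "delta_of q m" "delta_of q n" ?K x] by (simp add: F_delta_of delta_of_add)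
    also have "\<dots> = Sum_any (\<lambda>j. heis (delta_of q m) (- 1 - j) (Y (delta_of q (m + n)) (?K + (- 1 - j)) x))"
      by (rule Sum_any_reflect[symmetric])
    also have "\<dots> = Sum_any (\<lambda>j. heis_field (delta_of q m) j (Y (delta_of q (m + n)) (- (lookup m q + lookup n q) - 1 - j) x))"
    proof (rule arg_cong[where f = Sum_any], rule ext)
      fix j
      have "?K + (- 1 - j) = - (lookup m q + lookup n q) - 1 - j" "- 1 - j = - j - 1" by simp_all
      then show "heis (delta_of q m) (- 1 - j) (Y (delta_of q (m + n)) (?K + (- 1 - j)) x) =
          heis_field (delta_of q m) j (Y (delta_of q (m + n)) (- (lookup m q + lookup n q) - 1 - j) x)"
        by (simp only: heis_field_def)
    qed
    finally show "Sum_any (\<lambda>p. of_int p \<cdot> ?Ym p (?Yn (?K - p) x)) =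
        Sum_any (\<lambda>j. heis_field (delta_of q m) j (Y (delta_of q (m + n)) (- (lookup m q + lookup n q) - 1 - j) x))" .
  qed
  finally show ?thesis by (simp add: T_mode_delta X_mode_delta id_def)
qed

lemma T_mode_expand:
  "T_mode F (delta_of q m) (delta_of q k) n v =
     (\<Sum>i\<in>{1..q}. of_int (lookup m i) \<cdot> T_mode F (delta_of q (single i 1)) (delta_of q k) n v)"
proof -
  let ?h = "\<lambda>i j x. heis_field (delta_of q (single i 1)) j (Y (delta_of q k) (- n - 1 - j) x)"
  have "heis_field (delta_of q m) j w = (\<Sum>i\<in>{1..q}. of_int (lookup m i) \<cdot> heis_field (delta_of q (single i 1)) j w)" for j w
    unfolding heis_field_def by (rule heis_delta_of[OF q_pos])
  moreover have s: "finite {j. of_int (lookup m i) \<cdot> ?h i j x \<noteq> 0}" for i x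
    by (rule finite_subset[OF _ heis_X_support[of "delta_of q (single i 1)" k "- n - 1" x]]) auto
  moreover have "Sum_any (\<lambda>j. of_int (lookup m i) \<cdot> ?h i j x) = of_int (lookup m i) \<cdot> Sum_any (\<lambda>j. ?h i j x)" for i x
    by (rule Sum_any_scale[symmetric, OF heis_X_support]) simp
  ultimately show ?thesis
    unfolding T_mode_delta by (simp only: Sum_any_sum(1) op_tensor_first_sum)
qed

text \<open>The prescribed operator depends on \<open>m\<close> linearly once \<open>m + n\<close> is fixed, as \<open>d(t\<^sup>m) t\<^sup>n\<close> does; this
  makes it the value of a linear map on \<open>\<Omega>\<^sub>A\<close>.\<close>

lemma central_expand:
  "central m n v = (\<Sum>i\<in>{1..q}. of_int (lookup m i) \<cdot> central (single i 1) (m + n - single i 1) v)"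
proof -
  let ?k = "m + n" and ?l = "lookup m q + lookup n q"
  have *: "central (single i 1) (?k - single i 1) v = (if i = q then X_mode F (delta_of q ?k) ?l v else 0) +
      T_mode F (delta_of q (single i 1)) (delta_of q ?k) ?l v" for i
  proof -
    have "single i 1 + (?k - single i 1) = ?k" by simp
    moreover have "lookup (single i (1::int)) q + lookup (?k - single i 1) q = ?l"
      by (simp add: lookup_minus lookup_add)
    moreover have "of_int (lookup (single i 1) q) = (if i = q then 1 else 0 :: complex)"
      by (simp add: lookup_single when_def)
    ultimately show ?thesis unfolding central_modes by (simp only:) simp
  qed
  have "(\<Sum>i\<in>{1..q}. of_int (lookup m i) \<cdot> central (single i 1) (?k - single i 1) v) =
      (\<Sum>i\<in>{1..q}. if i = q then of_int (lookup m q) \<cdot> X_mode F (delta_of q ?k) ?l v else 0) +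
      (\<Sum>i\<in>{1..q}. of_int (lookup m i) \<cdot> T_mode F (delta_of q (single i 1)) (delta_of q ?k) ?l v)"
    unfolding * cvec.scale_right_distrib sum.distrib
    by (intro arg_cong2[where f = "(+)"] sum.cong refl) auto
  also have "\<dots> = central m n v"
    using q_pos by (simp add: central_modes T_mode_expand[of m])
  finally show ?thesis ..
qed

text \<open>\<open>X(0,z) = 1\<close>, and the residue of a derivative vanishes.\<close>

lemma central_closed: "central m 0 v = 0"
proof -
  have "(of_int (lookup m q + p) \<cdot> X m p (X 0 (- lookup m q - p) v) :: W_index cvec) = 0" for p
  proof (cases "p = - lookup m q")
    case False
    then show ?thesis by (simp add: X_0 lin_zero[OF lin_X])
  qed simp
  then show ?thesis by (simp add: central_def Sum_any_zero)
qed

subsection \<open>Invariance and parity\<close>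

text \<open>The span of the \<open>e\<^sup>\<gamma> \<otimes> u \<otimes> v\<close> with \<open>\<gamma> \<in> C\<close>. Both the space of the representation and its homogeneous parts
  are of this form, so that invariance and parity become statements on the shifts of \<open>\<gamma>\<close>.\<close>

definition W_part :: "lat set \<Rightarrow> W_index cvec set" where
  "W_part C = spanned_by ((C \<times> {\<mu>. keys \<mu> \<subseteq> gens M q \<times> {..<0}}) \<times> {\<nu>. keys \<nu> \<subseteq> bos_vars N})"

definition weight :: "nat \<Rightarrow> lat" where
  "weight a = (if a \<le> M then e_vec a else 0)"

lemma keys_e: "a \<in> idx \<Longrightarrow> a \<le> M \<Longrightarrow> keys (e_vec a) \<subseteq> gens M q"
  by (auto simp: idx_def e_vec_def gens_def gens_Q_def)

lemma keys_delta: "keys (delta_of q m) \<subseteq> gens_Q M q"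
  unfolding delta_of_def by (rule order_trans[OF keys_sum]) (auto simp: gens_Q_def split: if_splits)

lemma Y_W_part:
  assumes "keys \<alpha> \<subseteq> gens M q" "w \<in> W_part C"
  shows "on_first (Y \<alpha>) k w \<in> W_part ((+) \<alpha> ` C)"
  using assms(2) unfolding W_part_def on_first_def
  by (rule op_tensor_first_spanned_by[OF lin_Y_series, rotated])
    (use Y_series_V_part[OF assms(1), of _ C F k] in \<open>simp add: V_part_def\<close>)

lemma c_W_part:
  assumes "a \<in> idx" "w \<in> W_part C"
  shows "c a k w \<in> W_part ((+) (weight a) ` C)" "cs a k w \<in> W_part ((+) (- weight a) ` C)"
proof -
  have "on_second (phi_field (a - M)) k w \<in> W_part C" "on_second (phi_star_field (a - M)) k w \<in> W_part C" if "a > M"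
  proof -
    have j: "a - M \<in> {1..N}" using that assms(1) by (auto simp: idx_def)
    show "on_second (phi_field (a - M)) k w \<in> W_part C" "on_second (phi_star_field (a - M)) k w \<in> W_part C"
      using assms(2) unfolding W_part_def on_second_def
      by (auto intro!: op_tensor_second_spanned_by lin_fields phi_spanned_by[OF j] simp: phi_field_def phi_star_field_def lin_phi lin_phi_star)
  qed
  then show "c a k w \<in> W_part ((+) (weight a) ` C)" "cs a k w \<in> W_part ((+) (- weight a) ` C)"
    using assms Y_W_part[of "e_vec a" w C k] Y_W_part[of "- e_vec a" w C k] keys_e[of a]
    by (auto simp: c_def cs_def weight_def)
qed

lemma W_part_mono: "w \<in> W_part C \<Longrightarrow> C \<subseteq> C' \<Longrightarrow> w \<in> W_part C'"
  unfolding W_part_def by (erule spanned_by_mono) auto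

lemma J_W_part:
  assumes "a \<in> idx" "b \<in> idx" "w \<in> W_part C" "\<And>\<gamma>. \<gamma> \<in> C \<Longrightarrow> weight a - weight b + \<gamma> \<in> C'"
  shows "J a b k w \<in> W_part C'"
proof -
  have e: "weight a + (- weight b + \<gamma>) = weight a - weight b + \<gamma>" "- weight b + (weight a + \<gamma>) = weight a - weight b + \<gamma>" for \<gamma>
    by (simp_all add: algebra_simps)
  have "npair a b k l w \<in> W_part C'" for k l
  proof (cases "k \<ge> 0")
    case True
    have "c a k (cs b l w) \<in> W_part ((+) (weight a) ` (+) (- weight b) ` C)"
      by (intro c_W_part assms)
    then have "c a k (cs b l w) \<in> W_part C'"
      by (rule W_part_mono) (unfold image_image e, use assms(4) in blast)
    with True show ?thesis by (simp add: npair_def normal_product_def)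
  next
    case False
    have "cs b l (c a k w) \<in> W_part ((+) (- weight b) ` (+) (weight a) ` C)"
      by (intro c_W_part assms)
    then have "cs b l (c a k w) \<in> W_part C'"
      by (rule W_part_mono) (unfold image_image e, use assms(4) in blast)
    with False show ?thesis by (simp add: npair_def normal_product_def W_part_def spanned_by_scale)
  qed
  then show ?thesis by (simp add: J_def W_part_def spanned_by_Sum_any)
qed

lemma X_W_part: "w \<in> W_part C \<Longrightarrow> X m k w \<in> W_part ((+) (delta_of q m) ` C)"
  unfolding X_def using keys_delta[of m] by (intro Y_W_part) (auto simp: gens_def)

lemma current_W_part:
  assumes "a \<in> idx" "b \<in> idx" "w \<in> W_part C" "\<And>\<gamma>. \<gamma> \<in> C \<Longrightarrow> weight a - weight b + delta_of q m + \<gamma> \<in> C'"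
  shows "current a b m w \<in> W_part C'"
proof -
  have "J a b k (X m l w) \<in> W_part C'" for k l
    by (rule J_W_part[OF assms(1,2) X_W_part[OF assms(3)]]) (use assms(4) in \<open>auto simp: add.assoc\<close>)
  then show ?thesis by (simp add: current_def W_part_def spanned_by_Sum_any)
qed

lemma central_W_part:
  assumes "w \<in> W_part C" "\<And>\<gamma>. \<gamma> \<in> C \<Longrightarrow> delta_of q (m + n) + \<gamma> \<in> C'"
  shows "central m n w \<in> W_part C'"
proof -
  have "X m k (X n l w) \<in> W_part C'" for k l
    by (rule W_part_mono[OF X_W_part[OF X_W_part[OF assms(1)]]])
      (use assms(2) in \<open>auto simp: delta_of_add add.assoc\<close>)
  then show ?thesis
    unfolding central_def W_part_def by (intro spanned_by_Sum_any spanned_by_scale)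
qed

end

section \<open>Cosets\<close>

lemma d_A_closed:
  "0 \<in> d_A q" "x \<in> d_A q \<Longrightarrow> y \<in> d_A q \<Longrightarrow> x + y \<in> d_A q"
  "x \<in> d_A q \<Longrightarrow> c \<cdot> x \<in> d_A q" "x \<in> d_A q \<Longrightarrow> y \<in> d_A q \<Longrightarrow> x - y \<in> d_A q"
  unfolding d_A_def by (simp_all add: cvec.span_zero cvec.span_add cvec.span_scale cvec.span_diff)

lemma coset_add_coset: "coset_add (d_A q) (coset (d_A q) x) (coset (d_A q) y) = coset (d_A q) (x + y)"
proof (rule set_eqI)
  fix z
  have "z - (x + y) = (z - (x' + y')) + ((x' - x) + (y' - y))" for x' y' by simp
  then have "z - (x + y) \<in> d_A q" if "x' - x \<in> d_A q" "y' - y \<in> d_A q" "z - (x' + y') \<in> d_A q" for x' y'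
    using that d_A_closed(2) by metis
  moreover have "x - x \<in> d_A q" "y - y \<in> d_A q" by (simp_all add: d_A_closed)
  ultimately show "z \<in> coset_add (d_A q) (coset (d_A q) x) (coset (d_A q) y) \<longleftrightarrow> z \<in> coset (d_A q) (x + y)"
    unfolding coset_add_def coset_def by blast
qed

lemma coset_scale_coset: "coset_scale (d_A q) c (coset (d_A q) x) = coset (d_A q) (c \<cdot> x)"
proof (rule set_eqI)
  fix z
  have "z - c \<cdot> x = (z - c \<cdot> x') + c \<cdot> (x' - x)" for x' by (simp add: cvec.scale_right_diff_distrib)
  then have "z - c \<cdot> x \<in> d_A q" if "x' - x \<in> d_A q" "z - c \<cdot> x' \<in> d_A q" for x'
    using that d_A_closed(2,3) by metis
  moreover have "x - x \<in> d_A q" by (simp add: d_A_closed)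
  ultimately show "z \<in> coset_scale (d_A q) c (coset (d_A q) x) \<longleftrightarrow> z \<in> coset (d_A q) (c \<cdot> x)"
    unfolding coset_scale_def coset_def by blast
qed

lemma lat_form_square_add: "lat_form (\<alpha> + \<gamma>) (\<alpha> + \<gamma>) = lat_form \<alpha> \<alpha> + lat_form \<gamma> \<gamma> + 2 * lat_form \<alpha> \<gamma>"
  by (simp add: lat_form_commute[of \<gamma> \<alpha>])

section \<open>The representation\<close>

context toroidal_fock
begin

definition T_op :: "T_index \<Rightarrow> expo \<Rightarrow> W_index cvec \<Rightarrow> W_index cvec" where
  "T_op = (\<lambda>(a, b) m v. T_sign a b \<cdot> current a b m v)"

definition TA_op :: "TA \<Rightarrow> W_index cvec \<Rightarrow> W_index cvec" where
  "TA_op x v = lin_ext (\<lambda>(z, m). T_op z m v) x"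

text \<open>Determined by \<open>t\<^sup>k K\<^sub>i = d(t\<^sub>i) t\<^sup>k\<^sup>'\<close>, where \<open>k'\<close> is \<open>k\<close> with the component \<open>i\<close> lowered by one.\<close>

definition Omega_op :: "Omega \<Rightarrow> W_index cvec \<Rightarrow> W_index cvec" where
  "Omega_op y v = lin_ext (\<lambda>(k, i). central (single i 1) (k - single i 1) v) y"

text \<open>The choice of a representative is immaterial, by \<open>rho_coset\<close>.\<close>

definition rho :: "tau \<Rightarrow> W_index cvec \<Rightarrow> W_index cvec" where
  "rho = (\<lambda>(x, Z) v. TA_op x v + Omega_op (SOME y. y \<in> Z) v)"

lemma lin_TA_op_left: "lin (\<lambda>x. TA_op x v)" and lin_Omega_op_left: "lin (\<lambda>y. Omega_op y v)"
  unfolding TA_op_def Omega_op_def by (rule lin_lin_ext)+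

lemma T_indices_idx: "z \<in> T_indices M N \<longleftrightarrow> fst z \<in> idx \<and> snd z \<in> idx"
  by (cases z) (auto simp: T_indices_def idx_def)

lemma lin_T_op: "z \<in> T_indices M N \<Longrightarrow> lin (T_op z m)"
  by (cases z) (auto simp: T_op_def T_indices_idx intro!: lin_smult lin_current)

lemma TA_op_sum: "TA_op x v = (\<Sum>p\<in>keys x. lookup x p \<cdot> T_op (fst p) (snd p) v)"
  unfolding TA_op_def lin_ext_def by (simp add: split_beta)

lemma Omega_op_sum: "Omega_op y v =
    (\<Sum>p\<in>keys y. lookup y p \<cdot> central (single (snd p) 1) (fst p - single (snd p) 1) v)"
  unfolding Omega_op_def lin_ext_def by (simp add: split_beta)

lemma TA_keys: "x \<in> TA_space M N q \<Longrightarrow> p \<in> keys x \<Longrightarrow> fst p \<in> T_indices M N"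
  by (auto simp: TA_space_def spanned_by_def)

lemma lin_TA_op: "x \<in> TA_space M N q \<Longrightarrow> lin (TA_op x)"
  unfolding TA_op_sum[abs_def] by (intro lin_Sum lin_smult lin_T_op TA_keys)

lemma lin_Omega_op: "lin (Omega_op y)"
  unfolding Omega_op_sum[abs_def] by (intro lin_Sum lin_smult lin_central)

lemma Omega_op_dtt: "Omega_op (dtt_rep q m n) v = central m n v"
  unfolding dtt_rep_def lin_sum[OF lin_Omega_op_left]
  by (simp add: Omega_op_def central_expand[of m n] del: One_nat_def)

lemma Omega_op_d_A:
  assumes "y \<in> d_A q"
  shows "Omega_op y v = 0"
proof -
  have "cvec.subspace {y. Omega_op y v = 0}"
    by (auto simp: cvec.subspace_def lin_rules[OF lin_Omega_op_left])
  then have "d_A q \<subseteq> {y. Omega_op y v = 0}"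
    unfolding d_A_def by (intro cvec.span_minimal) (auto simp: Omega_op_dtt central_closed)
  then show ?thesis using assms by blast
qed

lemma rho_coset: "rho (x, coset (d_A q) y) v = TA_op x v + Omega_op y v"
proof -
  have "y \<in> coset (d_A q) y" by (simp add: coset_def d_A_closed)
  then have "(SOME z. z \<in> coset (d_A q) y) \<in> coset (d_A q) y" by (rule someI)
  then have "(SOME z. z \<in> coset (d_A q) y) - y \<in> d_A q" by (simp add: coset_def)
  from Omega_op_d_A[OF this, of v] show ?thesis
    by (simp add: rho_def lin_diff[OF lin_Omega_op_left])
qed

text \<open>The sign \<open>T_sign a e\<close> in the structure constants of \<open>T\<close> cancels against the one in the operator of \<open>T\<^sub>a\<^sub>e\<close>.\<close>

lemma T_op_T_op:
  assumes "x \<in> T_indices M N" "y \<in> T_indices M N"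
  shows "T_op x m (T_op y n v) - (-1) ^ (T_parity M x * T_parity M y) \<cdot> T_op y n (T_op x m v) =
    lin_ext (\<lambda>z. T_op z (m + n) v) (T_bracket M F x y) + T_form M F x y \<cdot> central m n v"
proof -
  obtain a b d e where xy: "x = (a, b)" "y = (d, e)" by (cases x; cases y)
  have I: "a \<in> idx" "b \<in> idx" "d \<in> idx" "e \<in> idx" using assms xy by (auto simp: T_indices_idx)
  define S where "S = sg a d * sg a e * sg b d * sg b e"
  have sign: "(-1) ^ (T_parity M x * T_parity M y) = S"
    by (auto simp: xy S_def T_parity_def supersign_def)
  have "T_op x m (T_op y n v) - S \<cdot> T_op y n (T_op x m v) =
      (T_sign a b * T_sign d e) \<cdot> (current a b m (current d e n v) - S \<cdot> current d e n (current a b m v))"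
    using I by (simp add: xy T_op_def lin_scale[OF lin_current] cvec.scale_right_diff_distrib mult_ac)
  also have "current a b m (current d e n v) - S \<cdot> current d e n (current a b m v) =
      (if b = d then current a e (m + n) v else 0) - (if a = e then S \<cdot> current d b (m + n) v else 0) -
      (if b = d \<and> a = e then sg a a \<cdot> central m n v else 0)"
    unfolding current_current[OF I] S_def by simp
  also have "(T_sign a b * T_sign d e) \<cdot> \<dots> =
      (of_bool (b = d) * T_sign a b * T_sign d e * T_sign a e) \<cdot> (T_sign a e \<cdot> current a e (m + n) v) -
      (of_bool (a = e) * S * T_sign a b * T_sign d e * T_sign d b) \<cdot> (T_sign d b \<cdot> current d b (m + n) v) +
      (- (of_bool (b = d \<and> a = e) * sg a a * T_sign a b * T_sign d e)) \<cdot> central m n v"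
  proof -
    have "T_sign p r * (T_sign p r * z) = z" for z p r by (simp add: T_sign_square flip: mult.assoc)
    then show ?thesis
      by (auto simp: T_sign_square cvec.scale_right_diff_distrib cvec.scale_right_distrib mult_ac)
  qed
  also have "\<dots> = lin_ext (\<lambda>z. T_op z (m + n) v) (T_bracket M F x y) + T_form M F x y \<cdot> central m n v"
    unfolding xy T_bracket_matrix[OF I] T_form_matrix[OF I] S_def
    by (simp only: lin_diff[OF lin_lin_ext] lin_scale[OF lin_lin_ext] T_basis_def lin_ext_single cvec.scale_one)
      (simp add: T_op_def)
  finally show ?thesis by (simp only: sign)
qed

lemma T_op_central: "z \<in> T_indices M N \<Longrightarrow> T_op z k (central m n v) = central m n (T_op z k v)"
  by (cases z) (simp add: T_op_def T_indices_idx current_central lin_scale[OF lin_central])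

lemma TA_op_Omega_op: "x \<in> TA_space M N q \<Longrightarrow> TA_op x (Omega_op y v) = Omega_op y (TA_op x v)"
proof -
  assume x: "x \<in> TA_space M N q"
  have "T_op z k (Omega_op y v) = Omega_op y (T_op z k v)" if "z \<in> T_indices M N" for z k
    using that by (simp add: Omega_op_sum lin_sum[OF lin_T_op] lin_scale[OF lin_T_op] T_op_central)
  then show ?thesis
    unfolding TA_op_sum lin_sum[OF lin_Omega_op] lin_scale[OF lin_Omega_op]
    by (intro sum.cong refl) (simp add: TA_keys[OF x])
qed

lemma Omega_op_Omega_op: "Omega_op x (Omega_op y v) = Omega_op y (Omega_op x v)"
  unfolding Omega_op_sum lin_sum[OF lin_central] lin_scale[OF lin_central] scale_sum
  by (subst sum.swap) (simp add: central_central mult.commute)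

lemma TA_op_TA_op:
  assumes x: "x \<in> TA_space M N q" and y: "y \<in> TA_space M N q"
    and sgn: "\<And>a b. a \<in> keys x \<Longrightarrow> b \<in> keys y \<Longrightarrow> (-1) ^ (T_parity M (fst a) * T_parity M (fst b)) = \<epsilon>"
  shows "TA_op x (TA_op y v) - \<epsilon> \<cdot> TA_op y (TA_op x v) =
    TA_op (bilin_ext (\<lambda>(a, m) (b, n). tensor (T_bracket M F a b) (single (m + n) 1)) x y) v +
    Omega_op (bilin_ext (\<lambda>(a, m) (b, n). T_form M F a b \<cdot> dtt_rep q m n) x y) v"
proof -
  have TA: "TA_op (tensor t (single k 1)) v = lin_ext (\<lambda>z. T_op z k v) t" for t k
    by (rule lin_eqI[where v = t, OF lin_compose[OF lin_TA_op_left lin_tensor_left] lin_lin_ext])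
      (simp add: TA_op_def)
  let ?c = "\<lambda>a b. lookup x a * lookup y b"
  have "TA_op x (TA_op y v) = (\<Sum>a\<in>keys x. \<Sum>b\<in>keys y. ?c a b \<cdot> T_op (fst a) (snd a) (T_op (fst b) (snd b) v))"
    unfolding TA_op_sum[of y] TA_op_sum[of x]
    by (intro sum.cong refl)
      (simp add: lin_sum[OF lin_T_op[OF TA_keys[OF x]]] lin_scale[OF lin_T_op[OF TA_keys[OF x]]] scale_sum)
  moreover have "\<epsilon> \<cdot> TA_op y (TA_op x v) =
      (\<Sum>a\<in>keys x. \<Sum>b\<in>keys y. ?c a b \<cdot> \<epsilon> \<cdot> T_op (fst b) (snd b) (T_op (fst a) (snd a) v))"
    unfolding TA_op_sum[of y] TA_op_sum[of x]
    by (subst sum.swap, unfold scale_sum, intro sum.cong refl)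
      (simp add: lin_sum[OF lin_T_op[OF TA_keys[OF y]]] lin_scale[OF lin_T_op[OF TA_keys[OF y]]] scale_sum mult_ac)
  ultimately have "TA_op x (TA_op y v) - \<epsilon> \<cdot> TA_op y (TA_op x v) = (\<Sum>a\<in>keys x. \<Sum>b\<in>keys y. ?c a b \<cdot>
      (T_op (fst a) (snd a) (T_op (fst b) (snd b) v) - \<epsilon> \<cdot> T_op (fst b) (snd b) (T_op (fst a) (snd a) v)))"
    by (simp only: cvec.scale_right_diff_distrib sum_subtractf)
  also have "\<dots> = (\<Sum>a\<in>keys x. \<Sum>b\<in>keys y. ?c a b \<cdot>
      (lin_ext (\<lambda>z. T_op z (snd a + snd b) v) (T_bracket M F (fst a) (fst b)) +
       T_form M F (fst a) (fst b) \<cdot> central (snd a) (snd b) v))"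
    by (intro sum.cong refl) (simp only: sgn[symmetric] T_op_T_op TA_keys[OF x] TA_keys[OF y])
  also have "\<dots> = TA_op (bilin_ext (\<lambda>(a, m) (b, n). tensor (T_bracket M F a b) (single (m + n) 1)) x y) v +
      Omega_op (bilin_ext (\<lambda>(a, m) (b, n). T_form M F a b \<cdot> dtt_rep q m n) x y) v"
    unfolding bilin_ext_def lin_sum[OF lin_TA_op_left] lin_sum[OF lin_Omega_op_left]
      lin_scale[OF lin_TA_op_left] lin_scale[OF lin_Omega_op_left]
    by (simp add: split_beta TA lin_scale[OF lin_Omega_op_left] Omega_op_dtt cvec.scale_right_distrib sum.distrib)
  finally show ?thesis .
qed

subsection \<open>Invariance of the homogeneous parts\<close>

lemma W_space_eq: "W_space M N q = W_part (Gamma_bar M q)"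
  by (simp add: W_space_def W_part_def V_indices_def)

definition Gamma_parity :: "nat \<Rightarrow> lat set" where
  "Gamma_parity p = {\<gamma> \<in> Gamma_bar M q. lat_form \<gamma> \<gamma> mod 2 = int p}"

lemma W_homogeneous_eq: "W_homogeneous M N q p = W_part (Gamma_parity p)"
proof (rule set_eqI)
  fix w :: "W_index cvec"
  have "(\<forall>((\<gamma>, \<mu>), \<nu>)\<in>keys w. lat_form \<gamma> \<gamma> mod 2 = int p) \<longleftrightarrow> (\<forall>x\<in>keys w. lat_form (fst (fst x)) (fst (fst x)) mod 2 = int p)"
    by (simp add: split_beta)
  moreover have "w \<in> spanned_by B \<longleftrightarrow> (\<forall>x\<in>keys w. x \<in> B)" for B :: "W_index set"
    by (auto simp: spanned_by_def)
  ultimately show "w \<in> W_homogeneous M N q p \<longleftrightarrow> w \<in> W_part (Gamma_parity p)"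
    unfolding W_homogeneous_def W_space_def W_part_def V_indices_def Gamma_parity_def
    by (simp only: mem_Collect_eq mem_Times_iff) blast
qed

lemma Gamma_bar_add: "\<alpha> \<in> Gamma_bar M q \<Longrightarrow> \<beta> \<in> Gamma_bar M q \<Longrightarrow> \<alpha> + \<beta> \<in> Gamma_bar M q"
  using keys_add[of \<alpha> \<beta>] by (auto simp: Gamma_bar_def)

lemma Gamma_bar_uminus: "\<alpha> \<in> Gamma_bar M q \<Longrightarrow> - \<alpha> \<in> Gamma_bar M q"
  by (simp add: Gamma_bar_def)

lemma fermion_weight_Gamma_bar: "a \<in> idx \<Longrightarrow> weight a \<in> Gamma_bar M q"
  using keys_e[of a] by (auto simp: weight_def Gamma_bar_def)

lemma delta_Gamma_bar: "delta_of q m \<in> Gamma_bar M q"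
  using keys_delta by (auto simp: Gamma_bar_def gens_def)

lemma weight_Gamma_bar:
  assumes "a \<in> idx" "b \<in> idx" "\<gamma> \<in> Gamma_bar M q"
  shows "weight a - weight b + delta_of q m + \<gamma> \<in> Gamma_bar M q"
  using assms unfolding diff_conv_add_uminus
  by (intro Gamma_bar_add Gamma_bar_uminus fermion_weight_Gamma_bar delta_Gamma_bar)

text \<open>The weight \<open>\<epsilon>\<^sub>a - \<epsilon>\<^sub>b\<close> of \<open>T\<^sub>a\<^sub>b\<close>, with \<open>\<epsilon>\<^sub>a = e\<^sub>a\<close> for \<open>a \<le> M\<close> and \<open>0\<close> otherwise, has odd norm if and only if
  exactly one index is \<open>\<le> M\<close>.\<close>

lemma weight_parity:
  assumes "a \<in> idx" "b \<in> idx" "\<gamma> \<in> Gamma_parity r"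
  shows "weight a - weight b + delta_of q m + \<gamma> \<in> Gamma_parity ((T_parity M (a, b) + r) mod 2)"
proof -
  let ?\<alpha> = "weight a - weight b + delta_of q m"
  have "lat_form (?\<alpha> + \<gamma>) (?\<alpha> + \<gamma>) = lat_form ?\<alpha> ?\<alpha> + lat_form \<gamma> \<gamma> + 2 * lat_form ?\<alpha> \<gamma>"
    by (rule lat_form_square_add)
  moreover have "lat_form ?\<alpha> ?\<alpha> mod 2 = int (T_parity M (a, b))"
    by (auto simp: weight_def T_parity_def)
  moreover have "lat_form \<gamma> \<gamma> mod 2 = int r" using assms(3) by (simp add: Gamma_parity_def)
  moreover have "(A + B + 2 * C) mod 2 = (A mod 2 + B mod 2) mod 2" for A B C :: int
    by presburger
  ultimately have "lat_form (?\<alpha> + \<gamma>) (?\<alpha> + \<gamma>) mod 2 = (int (T_parity M (a, b)) + int r) mod 2"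
    by (simp only:)
  also have "\<dots> = int ((T_parity M (a, b) + r) mod 2)" by (simp only: zmod_int of_nat_add of_nat_numeral)
  finally have "lat_form (?\<alpha> + \<gamma>) (?\<alpha> + \<gamma>) mod 2 = int ((T_parity M (a, b) + r) mod 2)" .
  then show ?thesis
    using weight_Gamma_bar[OF assms(1,2)] assms(3) by (simp add: Gamma_parity_def)
qed

lemma TA_op_W_part:
  assumes "x \<in> TA_space M N q" "v \<in> W_part C"
    and "\<And>a b m \<gamma>. ((a, b), m) \<in> keys x \<Longrightarrow> \<gamma> \<in> C \<Longrightarrow> weight a - weight b + delta_of q m + \<gamma> \<in> C'"
  shows "TA_op x v \<in> W_part C'"
  unfolding TA_op_sum W_part_def
proof (intro spanned_by_sum spanned_by_scale)
  fix p assume p: "p \<in> keys x"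
  obtain a b m where abm: "p = ((a, b), m)" by (cases p) auto
  have "current a b m v \<in> W_part C'"
    using TA_keys[OF assms(1) p] assms(3)[of a b m] p abm
    by (intro current_W_part[OF _ _ assms(2)]) (auto simp: T_indices_idx)
  then show "T_op (fst p) (snd p) v \<in> spanned_by ((C' \<times> {\<mu>. keys \<mu> \<subseteq> gens M q \<times> {..<0}}) \<times> {\<nu>. keys \<nu> \<subseteq> bos_vars N})"
    by (simp add: abm T_op_def W_part_def spanned_by_scale)
qed

lemma Omega_op_W_part:
  assumes "v \<in> W_part C" "\<And>m \<gamma>. \<gamma> \<in> C \<Longrightarrow> delta_of q m + \<gamma> \<in> C'"
  shows "Omega_op y v \<in> W_part C'"
  unfolding Omega_op_sum W_part_def
  by (intro spanned_by_sum spanned_by_scale, fold W_part_def) (rule central_W_part[OF assms])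

lemma delta_parity: "\<gamma> \<in> Gamma_parity r \<Longrightarrow> delta_of q m + \<gamma> \<in> Gamma_parity r"
proof -
  assume "\<gamma> \<in> Gamma_parity r"
  moreover have "lat_form (delta_of q m + \<gamma>) (delta_of q m + \<gamma>) = lat_form \<gamma> \<gamma> + 2 * lat_form (delta_of q m) \<gamma>"
    by (simp only: lat_form_square_add lat_form_delta_of add_0)
  ultimately show ?thesis by (simp add: Gamma_parity_def Gamma_bar_add delta_Gamma_bar)
qed

end

lemma op_tensor_first_cong:
  assumes "\<And>b. b \<in> B \<Longrightarrow> A (single b 1) = A' (single b 1)" "w \<in> spanned_by (B \<times> D)"
  shows "op_tensor A id w = op_tensor A' id w"
  by (rule lin_eq_on_spanned_by[OF lin_op_tensor lin_op_tensor _ assms(2)])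
    (auto simp: op_tensor_def assms(1))

lemma assignmentsD:
  assumes "assignments M N q F \<rho>" "v \<in> W_space M N q" "m \<in> expos q"
  shows "i \<in> {1..M} \<Longrightarrow> j \<in> {1..M} \<Longrightarrow> i \<noteq> j \<Longrightarrow>
      \<rho> (tau_T q i j m) v = X_mode F (alpha i j + delta_of q m) (lookup m q) v"
    and "i \<in> {1..M} \<Longrightarrow> \<rho> (tau_T q i i m) v = T_mode F (e_vec i) (delta_of q m) (lookup m q) v"
    and "i \<in> {1..M+N} \<Longrightarrow> j \<in> {1..M+N} \<Longrightarrow> i > M \<or> j > M \<Longrightarrow>
      \<rho> (tau_T q i j m) v = S_mode M F (delta_of q m) i j (lookup m q) v"
    and "n \<in> expos q \<Longrightarrow> \<rho> (tau_dtt q m n) v =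
      of_int (lookup m q) \<cdot> X_mode F (delta_of q (m + n)) (lookup m q + lookup n q) v
      + T_mode F (delta_of q m) (delta_of q (m + n)) (lookup m q + lookup n q) v"
  using assms unfolding assignments_def by blast+

text \<open>\<open>F0\<close> is the given cocycle and \<open>F\<close> its bimultiplicative extension; the two yield the same superalgebra and the same
  operators on the space in question.\<close>

locale toroidal_module = toroidal_fock F M N q for F :: "lat \<Rightarrow> lat \<Rightarrow> int" and M N q +
  fixes F0 :: "lat \<Rightarrow> lat \<Rightarrow> int"
  assumes F0_eq: "\<alpha> \<in> Q_lat M q \<Longrightarrow> \<gamma> \<in> Gamma_bar M q \<Longrightarrow> F0 \<alpha> \<gamma> = F \<alpha> \<gamma>"
begin

lemma e_Q: "i \<in> {1..M} \<Longrightarrow> e_vec i \<in> Q_lat M q" and e_Gamma: "i \<in> {1..M} \<Longrightarrow> e_vec i \<in> Gamma_bar M q"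
  by (auto simp: Q_lat_def Gamma_bar_def gens_def gens_Q_def e_vec_def)

lemma alpha_Q: "i \<in> {1..M} \<Longrightarrow> j \<in> {1..M} \<Longrightarrow> alpha i j \<in> Q_lat M q"
  and alpha_Gamma: "i \<in> {1..M} \<Longrightarrow> j \<in> {1..M} \<Longrightarrow> alpha i j \<in> Gamma_bar M q"
  using keys_diff[of "e_vec i" "e_vec j"] e_Q[of i] e_Q[of j] e_Gamma[of i] e_Gamma[of j]
  by (auto simp: alpha_def Q_lat_def Gamma_bar_def)

lemma T_listed_F0:
  assumes "x \<in> T_indices M N" "y \<in> T_indices M N"
  shows "T_listed M F0 x y = T_listed M F x y"
proof -
  obtain i j k l where xy: "x = (i, j)" "y = (k, l)" by (cases x; cases y)
  have pos: "0 < i" "0 < j" "0 < k" "0 < l" using assms by (auto simp: xy T_indices_def)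
  have e: "F0 (e_vec a) (e_vec b) = F (e_vec a) (e_vec b)" if "0 < a" "a \<le> M" "0 < b" "b \<le> M" for a b
    using that by (intro F0_eq e_Q e_Gamma) auto
  have al: "F0 (alpha a b) (alpha d e) = F (alpha a b) (alpha d e)"
    if "0 < a" "a \<le> M" "0 < b" "b \<le> M" "0 < d" "d \<le> M" "0 < e" "e \<le> M" for a b d e
    using that by (intro F0_eq alpha_Q alpha_Gamma) auto
  show ?thesis
    unfolding xy T_listed_def
    by (cases "i \<le> M"; cases "j \<le> M"; cases "k \<le> M"; cases "l \<le> M") (simp_all add: e al pos)
qed

lemma T_bracket_F0:
  assumes "x \<in> T_indices M N" "y \<in> T_indices M N"
  shows "T_bracket M F0 x y = T_bracket M F x y"
  unfolding T_bracket_def T_listed_F0[OF assms] T_listed_F0[OF assms(2,1)] ..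

lemma T_form_F0:
  assumes "x \<in> T_indices M N" "y \<in> T_indices M N"
  shows "T_form M F0 x y = T_form M F x y"
proof -
  obtain i j k l where xy: "x = (i, j)" "y = (k, l)" by (cases x; cases y)
  have "F0 (alpha i j) (alpha k l) = F (alpha i j) (alpha k l)" if "i \<le> M" "j \<le> M" "k \<le> M" "l \<le> M"
    using that assms by (intro F0_eq alpha_Q alpha_Gamma) (auto simp: xy T_indices_def)
  then show ?thesis unfolding xy T_form_def by auto
qed

lemma X_series_F0:
  assumes "\<alpha> \<in> Q_lat M q" "b \<in> Gamma_bar M q \<times> {\<mu>. keys \<mu> \<subseteq> gens M q \<times> {..<0}}"
  shows "X_series F0 \<alpha> n (single b 1) = X_series F \<alpha> n (single b 1)"
proof -
  have "Y_series F0 \<alpha> n (single b 1) = Y_series F \<alpha> n (single b 1)" for n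
    unfolding single_eq_sector Y_series_sector using assms by (auto simp: F0_eq)
  then show ?thesis by (simp add: X_series_def ser_shift_def)
qed

lemma on_first_X_F0:
  assumes "\<alpha> \<in> Q_lat M q" "w \<in> W_space M N q"
  shows "on_first (X_series F0 \<alpha>) n w = on_first (X_series F \<alpha>) n w"
  unfolding on_first_def
  by (rule op_tensor_first_cong[where B = "Gamma_bar M q \<times> {\<mu>. keys \<mu> \<subseteq> gens M q \<times> {..<0}}"],
      erule X_series_F0[OF assms(1)])
    (use assms(2) in \<open>simp add: W_space_eq W_part_def\<close>)

lemma delta_Q: "delta_of q m \<in> Q_lat M q"
  using keys_delta by (auto simp: Q_lat_def)

lemma X_mode_F0: "\<alpha> \<in> Q_lat M q \<Longrightarrow> w \<in> W_space M N q \<Longrightarrow> X_mode F0 \<alpha> n w = X_mode F \<alpha> n w"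
  unfolding X_mode_def by (rule on_first_X_F0)

lemma T_mode_F0:
  assumes "w \<in> W_space M N q"
  shows "T_mode F0 \<alpha> (delta_of q m) n w = T_mode F \<alpha> (delta_of q m) n w"
  unfolding T_mode_def on_first_def
  by (rule op_tensor_first_cong[where B = "Gamma_bar M q \<times> {\<mu>. keys \<mu> \<subseteq> gens M q \<times> {..<0}}"])
    (use assms in \<open>simp_all add: ser_mult_def X_series_F0[OF delta_Q] W_space_eq W_part_def\<close>)

lemma X_W_space: "w \<in> W_space M N q \<Longrightarrow> X m k w \<in> W_space M N q"
  unfolding W_space_eq
  by (rule W_part_mono[OF X_W_part]) (auto intro: Gamma_bar_add delta_Gamma_bar)

lemma S_mode_F0:
  assumes w: "w \<in> W_space M N q" and I: "a \<in> idx" "b \<in> idx"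
  shows "S_mode M F0 (delta_of q m) a b n w = S_mode M F (delta_of q m) a b n w"
proof -
  have S: "S_series M F0 a b k u = S_series M F a b k u" if u: "u \<in> W_space M N q" for k u
  proof -
    have sec: "on_second (phi_star_field (b - M)) l u \<in> W_space M N q" if "b > M" for l
      using c_W_part(2)[OF I(2) u[unfolded W_space_eq], of l] that by (simp add: cs_def weight_def W_space_eq)
    have sec': "on_second (phi_field (a - M)) l u \<in> W_space M N q" if "a > M" for l
      using c_W_part(1)[OF I(1) u[unfolded W_space_eq], of l] that by (simp add: c_def weight_def W_space_eq)
    have eQ: "e_vec a \<in> Q_lat M q" if "a \<le> M" using that I by (intro e_Q) (auto simp: idx_def)
    have eQ': "- e_vec b \<in> Q_lat M q" if "b \<le> M"
      using that I e_Q[of b] by (auto simp: idx_def Q_lat_def)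
    show ?thesis
      by (auto simp: S_series_def ser_mult_def on_first_X_F0 eQ eQ' sec sec')
  qed
  have "on_first (X_series F (delta_of q m)) k w \<in> W_space M N q" for k
    using X_W_space[OF w, of m k] by (simp add: X_def X_series_delta)
  then show ?thesis
    by (simp add: S_mode_def ser_mult_def[of "S_series M _ a b"] on_first_X_F0[OF delta_Q w] S)
qed

subsection \<open>The representation property\<close>

abbreviation "L \<equiv> toroidal M N q F0"

lemma carrier_L: "carrier L = TA_space M N q \<times> coset (d_A q) ` Omega_space q"
  by (simp add: toroidal_def)

lemma add_L: "add L (x, coset (d_A q) y) (x', coset (d_A q) y') = (x + x', coset (d_A q) (y + y'))"
  by (simp add: toroidal_def coset_add_coset)

lemma smult_L: "smult L t (x, coset (d_A q) y) = (t \<cdot> x, coset (d_A q) (t \<cdot> y))"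
  by (simp add: toroidal_def coset_scale_coset)

lemma linear_rho: "linear_to_End L (W_space M N q) rho"
  unfolding linear_to_End_def
proof (intro conjI ballI allI)
  fix z v w t assume z: "z \<in> carrier L" and v: "v \<in> W_space M N q"
  then obtain x y where xy: "z = (x, coset (d_A q) y)" and x: "x \<in> TA_space M N q"
    by (auto simp: carrier_L)
  show "rho z v \<in> W_space M N q"
  proof -
    have "TA_op x v \<in> W_part (Gamma_bar M q)"
      using TA_keys[OF x] v
      by (intro TA_op_W_part[OF x]) (auto simp: W_space_eq T_indices_idx intro!: weight_Gamma_bar)
    moreover have "Omega_op y v \<in> W_part (Gamma_bar M q)"
      using v by (intro Omega_op_W_part[of _ "Gamma_bar M q"]) (auto simp: W_space_eq intro: Gamma_bar_add delta_Gamma_bar)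
    ultimately show ?thesis by (simp add: xy rho_coset W_space_eq W_part_def spanned_by_add)
  qed
  show "rho z (v + w) = rho z v + rho z w"
    by (simp add: xy rho_coset lin_add[OF lin_TA_op[OF x]] lin_add[OF lin_Omega_op])
  show "rho z (t \<cdot> v) = t \<cdot> rho z v"
    by (simp add: xy rho_coset lin_scale[OF lin_TA_op[OF x]] lin_scale[OF lin_Omega_op] cvec.scale_right_distrib)
  show "rho (smult L t z) v = t \<cdot> rho z v"
    by (simp add: xy smult_L rho_coset lin_scale[OF lin_TA_op_left] lin_scale[OF lin_Omega_op_left] cvec.scale_right_distrib)
next
  fix z z' v assume z: "z \<in> carrier L" "z' \<in> carrier L"
  then obtain x y x' y' where "z = (x, coset (d_A q) y)" "z' = (x', coset (d_A q) y')"
    by (auto simp: carrier_L)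
  then show "rho (add L z z') v = rho z v + rho z' v"
    by (simp add: add_L rho_coset lin_add[OF lin_TA_op_left] lin_add[OF lin_Omega_op_left])
qed

lemma homogeneous_L:
  assumes "z \<in> homogeneous L p" "p \<in> {0, 1}"
  obtains x y where "z = (x, coset (d_A q) y)" "x \<in> TA_space M N q"
    "\<And>a m. (a, m) \<in> keys x \<Longrightarrow> T_parity M a = p" "p = 1 \<Longrightarrow> y = 0"
proof -
  obtain x Z where z: "z = (x, Z)" "x \<in> TA_space M N q" "\<forall>(a, m)\<in>keys x. T_parity M a = p"
    and Z: "Z \<in> (if p = 0 then coset (d_A q) ` Omega_space q else {coset (d_A q) 0})"
    using assms(1) by (auto simp: toroidal_def)
  from Z obtain y where "Z = coset (d_A q) y" "p = 1 \<longrightarrow> y = 0"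
    by (auto split: if_splits)
  with z show thesis by (intro that[of x y]) auto
qed

lemma rho_parity:
  assumes "p \<in> {0, 1}" "r \<in> {0, 1}" "z \<in> homogeneous L p" "v \<in> W_homogeneous M N q r"
  shows "rho z v \<in> W_homogeneous M N q ((p + r) mod 2)"
proof -
  obtain x y where z: "z = (x, coset (d_A q) y)" and x: "x \<in> TA_space M N q"
    and p: "\<And>a m. (a, m) \<in> keys x \<Longrightarrow> T_parity M a = p" and y: "p = 1 \<Longrightarrow> y = 0"
    by (rule homogeneous_L[OF assms(3,1)]) (rule that)
  have v: "v \<in> W_part (Gamma_parity r)" using assms(4) by (simp add: W_homogeneous_eq)
  have "TA_op x v \<in> W_part (Gamma_parity ((p + r) mod 2))"
  proof (rule TA_op_W_part[OF x v])
    fix a b m \<gamma> assume ab: "((a, b), m) \<in> keys x" and \<gamma>: "\<gamma> \<in> Gamma_parity r"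
    from TA_keys[OF x ab] have "a \<in> idx" "b \<in> idx" by (simp_all add: T_indices_idx)
    from weight_parity[OF this \<gamma>, of m] p[OF ab]
    show "weight a - weight b + delta_of q m + \<gamma> \<in> Gamma_parity ((p + r) mod 2)" by simp
  qed
  moreover have "Omega_op y v \<in> W_part (Gamma_parity ((p + r) mod 2))"
  proof (cases "p = 1")
    case True
    then show ?thesis using y by (simp add: lin_zero[OF lin_Omega_op_left] W_part_def spanned_by_zero)
  next
    case False
    then have "(p + r) mod 2 = r" using assms(1,2) by auto
    then show ?thesis using Omega_op_W_part[OF v delta_parity] by simp
  qed
  ultimately show ?thesis by (simp add: z rho_coset W_homogeneous_eq W_part_def spanned_by_add)
qed

lemma rho_bracket:
  assumes pr: "p \<in> {0, 1}" "r \<in> {0, 1}" and z: "z \<in> homogeneous L p" "z' \<in> homogeneous L r"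
  shows "rho (bracket L z z') v = rho z (rho z' v) - ((-1) ^ (p * r)) \<cdot> rho z' (rho z v)"
proof -
  let ?\<epsilon> = "(-1) ^ (p * r) :: complex"
  obtain x \<xi> where z1: "z = (x, coset (d_A q) \<xi>)" and x: "x \<in> TA_space M N q"
    and px: "\<And>a m. (a, m) \<in> keys x \<Longrightarrow> T_parity M a = p" and \<xi>: "p = 1 \<Longrightarrow> \<xi> = 0"
    by (rule homogeneous_L[OF z(1) pr(1)]) (rule that)
  obtain y \<eta> where z2: "z' = (y, coset (d_A q) \<eta>)" and y: "y \<in> TA_space M N q"
    and py: "\<And>a m. (a, m) \<in> keys y \<Longrightarrow> T_parity M a = r" and \<eta>: "r = 1 \<Longrightarrow> \<eta> = 0"
    by (rule homogeneous_L[OF z(2) pr(2)]) (rule that)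
  let ?B = "\<lambda>F. bilin_ext (\<lambda>(a, m) (b, n). tensor (T_bracket M F a b) (single (m + n) 1)) x y"
  let ?C = "\<lambda>F. bilin_ext (\<lambda>(a, m) (b, n). T_form M F a b \<cdot> dtt_rep q m n) x y"
  have B: "?B F0 = ?B F"
    unfolding bilin_ext_def
    by (rule sum.cong[OF refl], rule sum.cong[OF refl])
      (simp only: split_beta T_bracket_F0[OF TA_keys[OF x] TA_keys[OF y]])
  have C: "?C F0 = ?C F"
    unfolding bilin_ext_def
    by (rule sum.cong[OF refl], rule sum.cong[OF refl])
      (simp only: split_beta T_form_F0[OF TA_keys[OF x] TA_keys[OF y]])
  have "rho (bracket L z z') v = TA_op (?B F) v + Omega_op (?C F) v"
    by (simp add: toroidal_def tau_bracket_def z1 z2 rho_coset flip: B C)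
  also have "\<dots> = TA_op x (TA_op y v) - ?\<epsilon> \<cdot> TA_op y (TA_op x v)"
    by (rule TA_op_TA_op[OF x y, symmetric]) (use px py in force)
  also have "\<dots> = rho z (rho z' v) - ?\<epsilon> \<cdot> rho z' (rho z v)"
  proof (cases "p = 1 \<and> r = 1")
    case True
    then show ?thesis using \<xi> \<eta> by (simp add: z1 z2 rho_coset lin_zero[OF lin_Omega_op_left])
  next
    case False
    then have "?\<epsilon> = 1" using pr by auto
    then show ?thesis
      by (simp add: z1 z2 rho_coset lin_add[OF lin_TA_op[OF x]] lin_add[OF lin_TA_op[OF y]] lin_add[OF lin_Omega_op]
          TA_op_Omega_op[OF x] TA_op_Omega_op[OF y] Omega_op_Omega_op[of \<xi>])
  qed
  finally show ?thesis .
qed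

lemma superrepresentation_rho: "superrepresentation L (W_space M N q) (W_homogeneous M N q) rho"
  unfolding superrepresentation_def
proof (intro conjI ballI)
  show "linear_to_End L (W_space M N q) rho" by (rule linear_rho)
qed (rule rho_parity rho_bracket; assumption)+

lemma rho_T: "rho (tau_T q i j m) v = T_sign i j \<cdot> current i j m v"
  by (simp add: tau_T_def rho_coset T_basis_def TA_op_def T_op_def lin_zero[OF lin_Omega_op_left])

lemma rho_dtt: "rho (tau_dtt q m n) v = central m n v"
  by (simp add: tau_dtt_def rho_coset Omega_op_dtt lin_zero[OF lin_TA_op_left])

lemma assignments_rho: "assignments M N q F0 rho"
  unfolding assignments_def
proof (intro ballI conjI impI)
  fix v m assume v: "v \<in> W_space M N q"
  show "rho (tau_T q i j m) v = X_mode F0 (alpha i j + delta_of q m) (lookup m q) v"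
    if "i \<in> {1..M}" "j \<in> {1..M}" "i \<noteq> j" for i j
  proof -
    have "alpha i j + delta_of q m \<in> Q_lat M q"
      using alpha_Q[OF that(1,2)] delta_Q[of m] keys_add[of "alpha i j" "delta_of q m"]
      by (auto simp: Q_lat_def)
    then show ?thesis by (simp only: rho_T X_mode_F0 v X_mode_alpha that not_False_eq_True)
  qed
  show "rho (tau_T q i i m) v = T_mode F0 (e_vec i) (delta_of q m) (lookup m q) v" if "i \<in> {1..M}" for i
    using that by (simp add: rho_T T_mode_F0[OF v] T_mode_J T_sign_def F_e_same)
  show "rho (tau_T q i j m) v = S_mode M F0 (delta_of q m) i j (lookup m q) v"
    if "i \<in> {1..M+N}" "j \<in> {1..M+N}" "i > M \<or> j > M" for i j
    using that by (auto simp: rho_T S_mode_F0[OF v] S_mode_J idx_def T_sign_def)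
  show "rho (tau_dtt q m n) v =
      of_int (lookup m q) \<cdot> X_mode F0 (delta_of q (m + n)) (lookup m q + lookup n q) v +
      T_mode F0 (delta_of q m) (delta_of q (m + n)) (lookup m q + lookup n q) v" for n
    by (simp only: rho_dtt central_modes X_mode_F0[OF delta_Q v] T_mode_F0[OF v])
qed

text \<open>The elements \<open>T\<^sub>i\<^sub>j \<otimes> t\<^sup>m\<close> and \<open>d(t\<^sup>m) t\<^sup>n\<close> span the superalgebra: the basis element \<open>t\<^sup>k K\<^sub>i\<close> is
  \<open>d(t\<^sub>i) t\<^sup>k\<^sup>'\<close>.\<close>

lemma unique_rho:
  assumes \<sigma>: "linear_to_End L (W_space M N q) \<sigma>" "assignments M N q F0 \<sigma>"
    and z: "z \<in> carrier L" and v: "v \<in> W_space M N q"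
  shows "\<sigma> z v = rho z v"
proof -
  define P where "P z \<longleftrightarrow> z \<in> carrier L \<and> (\<forall>v\<in>W_space M N q. \<sigma> z v = rho z v)" for z
  have lin: "\<pi> (add L x y) v = \<pi> x v + \<pi> y v" "\<pi> (smult L t x) v = t \<cdot> \<pi> x v"
    if "linear_to_End L (W_space M N q) \<pi>" "x \<in> carrier L" "y \<in> carrier L" "v \<in> W_space M N q" for \<pi> x y v t
    using that unfolding linear_to_End_def by auto
  have closed: "add L x y \<in> carrier L" "smult L t x \<in> carrier L" if "x \<in> carrier L" "y \<in> carrier L" for x y t
    using that
    by (auto simp: carrier_L add_L smult_L TA_space_def Omega_space_def
        intro!: spanned_by_add spanned_by_scale)
  have P_add: "P (add L x y)" and P_smult: "P (smult L t x)" if "P x" "P y" for x y t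
  proof -
    have c: "x \<in> carrier L" "y \<in> carrier L" using that by (simp_all add: P_def)
    show "P (add L x y)"
      using that closed(1)[OF c] lin(1)[OF \<sigma>(1) c] lin(1)[OF linear_rho c] by (simp add: P_def)
    show "P (smult L t x)"
      using that closed(2)[OF c, of t] lin(2)[OF \<sigma>(1) c, of _ t] lin(2)[OF linear_rho c, of _ t] by (simp add: P_def)
  qed
  have zero: "(0, coset (d_A q) 0) \<in> carrier L"
    by (auto simp: carrier_L TA_space_def Omega_space_def spanned_by_zero)
  have P_zero: "P (0, coset (d_A q) 0)"
  proof -
    have z: "\<pi> (0, coset (d_A q) 0) v = 0" if "linear_to_End L (W_space M N q) \<pi>" "v \<in> W_space M N q" for \<pi> v
      using lin(2)[OF that(1) zero zero that(2), of 0] by (simp add: smult_L)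
    show ?thesis using zero z[OF \<sigma>(1)] z[OF linear_rho] by (simp add: P_def)
  qed
  have ass_T: "\<sigma> (tau_T q i j m) v = rho (tau_T q i j m) v"
    if ij: "i \<in> {1..M+N}" "j \<in> {1..M+N}" and m: "m \<in> expos q" and v: "v \<in> W_space M N q" for i j m v
  proof -
    note D = assignmentsD[OF \<sigma>(2) v m] and D' = assignmentsD[OF assignments_rho v m]
    consider "i > M \<or> j > M" | "i \<le> M" "j \<le> M" "i \<noteq> j" | "i \<le> M" "j = i" by linarith
    then show ?thesis
    proof cases
      case 1
      show ?thesis unfolding D(3)[OF ij 1] D'(3)[OF ij 1] ..
    next
      case 2
      then have "i \<in> {1..M}" "j \<in> {1..M}" using ij by auto
      from D(1)[OF this 2(3)] D'(1)[OF this 2(3)] show ?thesis by simp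
    next
      case 3
      then have "i \<in> {1..M}" using ij by auto
      from D(2)[OF this] D'(2)[OF this] 3 show ?thesis by simp
    qed
  qed
  have ass_dtt: "\<sigma> (tau_dtt q m n) v = rho (tau_dtt q m n) v"
    if "m \<in> expos q" "n \<in> expos q" "v \<in> W_space M N q" for m n v
    unfolding assignmentsD(4)[OF \<sigma>(2) that(3,1,2)] assignmentsD(4)[OF assignments_rho that(3,1,2)] ..
  have P_T: "P (single p 1, coset (d_A q) 0)" if p: "p \<in> T_indices M N \<times> expos q" for p
  proof -
    obtain i j m where ijm: "p = ((i, j), m)" by (cases p) auto
    have "(single p 1, coset (d_A q) 0) = tau_T q i j m" by (simp add: tau_T_def T_basis_def ijm)
    moreover have "(single p 1, coset (d_A q) 0) \<in> carrier L"
      using p by (auto simp: carrier_L TA_space_def Omega_space_def spanned_by_single spanned_by_zero)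
    ultimately show ?thesis using p ass_T[of i j m] by (auto simp: P_def ijm T_indices_def)
  qed
  have P_Omega: "P (0, coset (d_A q) (single p 1))" if p: "p \<in> expos q \<times> {1..q}" for p
  proof -
    obtain k i where ki: "p = (k, i)" by (cases p)
    have i: "i \<in> {1..q}" and k: "k \<in> expos q" using p ki by auto
    have "dtt_rep q (single i 1) (k - single i 1) = (\<Sum>j\<in>{1..q}. if j = i then single p 1 else 0)"
      unfolding dtt_rep_def by (rule sum.cong) (auto simp: lookup_single when_def ki)
    then have "(0, coset (d_A q) (single p 1)) = tau_dtt q (single i 1) (k - single i 1)"
      using i by (simp add: tau_dtt_def)
    moreover have "(0, coset (d_A q) (single p 1)) \<in> carrier L"
      using p by (auto simp: carrier_L TA_space_def Omega_space_def spanned_by_single spanned_by_zero)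
    moreover have "single i 1 \<in> expos q" "k - single i 1 \<in> expos q"
      using i k keys_diff[of k "single i 1"] by (auto simp: expos_def)
    ultimately show ?thesis by (simp add: P_def ass_dtt)
  qed
  obtain x y where xy: "z = (x, coset (d_A q) y)" "x \<in> TA_space M N q" "y \<in> Omega_space q"
    using z by (auto simp: carrier_L)
  have "P (\<Sum>p\<in>A. f p \<cdot> single p 1, coset (d_A q) 0)" if "finite A" "A \<subseteq> T_indices M N \<times> expos q" for A f
    using that
  proof (induction A rule: finite_induct)
    case (insert p A)
    then have "P (add L (smult L (f p) (single p 1, coset (d_A q) 0)) (\<Sum>p\<in>A. f p \<cdot> single p 1, coset (d_A q) 0))"
      using P_T[of p] by (intro P_add P_smult) auto
    with insert.hyps show ?case by (simp add: smult_L add_L del: scale_single)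
  qed (simp add: P_zero)
  from this[of "keys x" "lookup x"] have "P (x, coset (d_A q) 0)"
    using xy(2) cvec_expand[of x] by (simp add: TA_space_def spanned_by_def del: scale_single)
  moreover have "P (0, coset (d_A q) (\<Sum>p\<in>A. f p \<cdot> single p 1))" if "finite A" "A \<subseteq> expos q \<times> {1..q}" for A f
    using that
  proof (induction A rule: finite_induct)
    case (insert p A)
    then have "P (add L (smult L (f p) (0, coset (d_A q) (single p 1))) (0, coset (d_A q) (\<Sum>p\<in>A. f p \<cdot> single p 1)))"
      using P_Omega[of p] by (intro P_add P_smult) auto
    with insert.hyps show ?case by (simp add: smult_L add_L del: scale_single)
  qed (simp add: P_zero)
  from this[of "keys y" "lookup y"] have "P (0, coset (d_A q) y)"
    using xy(3) cvec_expand[of y] by (simp add: Omega_space_def spanned_by_def del: scale_single)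
  ultimately have "P (add L (x, coset (d_A q) 0) (0, coset (d_A q) y))" by (rule P_add)
  then show ?thesis using v by (simp add: add_L P_def xy(1))
qed

end

section \<open>Extending the cocycle\<close>

text \<open>The projection of the lattice onto the sublattice generated by \<open>G\<close>; being a homomorphism, it preserves
  bimultiplicativity under composition.\<close>

definition restrict :: "gen set \<Rightarrow> lat \<Rightarrow> lat" where
  "restrict G \<gamma> = (\<Sum>g\<in>G. single g (lookup \<gamma> g))"

lemma restrict_add: "restrict G (\<alpha> + \<beta>) = restrict G \<alpha> + restrict G \<beta>"
  by (simp add: restrict_def lookup_add single_add sum.distrib)

lemma keys_restrict: "keys (restrict G \<gamma>) \<subseteq> G"
  unfolding restrict_def by (rule order_trans[OF keys_sum]) (auto split: if_splits)

lemma restrict_same: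
  assumes "finite G" "keys \<gamma> \<subseteq> G"
  shows "restrict G \<gamma> = \<gamma>"
proof (rule poly_mapping_eqI)
  fix g
  have "lookup (restrict G \<gamma>) g = (\<Sum>h\<in>G. if h = g then lookup \<gamma> g else 0)"
    unfolding restrict_def lookup_sum by (rule sum.cong) (auto simp: lookup_single when_def)
  then show "lookup (restrict G \<gamma>) g = lookup \<gamma> g"
    using assms by (auto simp: in_keys_iff)
qed

theorem mainTheorem1:
  fixes M N q :: nat and F :: "lat \<Rightarrow> lat \<Rightarrow> int"
  assumes "M > 0" and "N > 0" and "q > 0"
    and "cocycle M q F"
  shows "\<exists>\<rho>. superrepresentation (toroidal M N q F) (W_space M N q) (W_homogeneous M N q) \<rho> \<and>
      assignments M N q F \<rho> \<and>
      (\<forall>\<sigma>. linear_to_End (toroidal M N q F) (W_space M N q) \<sigma> \<and> assignments M N q F \<sigma> \<longrightarrow>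
        (\<forall>x\<in>carrier (toroidal M N q F). \<forall>v\<in>W_space M N q. \<sigma> x v = \<rho> x v))"
proof -
  \<comment> \<open>agrees with \<open>F\<close> where \<open>F\<close> is specified, and is bimultiplicative everywhere\<close>
  define F' where "F' \<alpha> \<gamma> = F (restrict (gens_Q M q) \<alpha>) (restrict (gens M q) \<gamma>)" for \<alpha> \<gamma>
  have fin: "finite (gens_Q M q)" "finite (gens M q)" by (simp_all add: gens_def gens_Q_def)
  have Q: "restrict (gens_Q M q) \<alpha> \<in> Q_lat M q" and G: "restrict (gens M q) \<alpha> \<in> Gamma_bar M q" for \<alpha>
    by (simp_all add: Q_lat_def Gamma_bar_def keys_restrict)
  have same: "F \<alpha> \<gamma> = F' \<alpha> \<gamma>" if "\<alpha> \<in> Q_lat M q" "\<gamma> \<in> Gamma_bar M q" for \<alpha> \<gamma>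
    using that fin by (simp add: F'_def Q_lat_def Gamma_bar_def restrict_same)
  have e: "e_vec i \<in> Q_lat M q" "e_vec i \<in> Gamma_bar M q" if "i \<in> {1..M}" for i
    using that by (auto simp: Q_lat_def Gamma_bar_def gens_def gens_Q_def e_vec_def)
  have d: "delta_vec k \<in> Q_lat M q" "delta_vec k \<in> Gamma_bar M q" if "k \<in> {1..q-1}" for k
    using that by (auto simp: Q_lat_def Gamma_bar_def gens_def gens_Q_def delta_vec_def)
  note coc = assms(4)[unfolded cocycle_def]
  interpret toroidal_module F' M N q F
  proof unfold_locales
    show "F' (\<alpha> + \<beta>) \<gamma> = F' \<alpha> \<gamma> * F' \<beta> \<gamma>" "F' \<alpha> (\<beta> + \<gamma>) = F' \<alpha> \<beta> * F' \<alpha> \<gamma>" for \<alpha> \<beta> \<gamma>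
      using coc Q G by (simp_all add: F'_def restrict_add)
    show "F' \<alpha> \<beta> = 1 \<or> F' \<alpha> \<beta> = - 1" for \<alpha> \<beta>
      using coc Q G by (auto simp: F'_def)
    show "i \<in> {1..M} \<Longrightarrow> j \<in> {1..M} \<Longrightarrow> F' (e_vec i) (e_vec j) = (if i \<le> j then 1 else - 1)" for i j
      using coc by (simp only: same[symmetric] e)
    show "i \<in> {1..M} \<Longrightarrow> k \<in> {1..q-1} \<Longrightarrow> F' (e_vec i) (delta_vec k) = 1" for i k
      using coc by (simp only: same[symmetric] e d)
    show "i \<in> {1..M} \<Longrightarrow> k \<in> {1..q-1} \<Longrightarrow> F' (delta_vec k) (e_vec i) = 1" for i k
      using coc by (simp only: same[symmetric] e d)
    show "k \<in> {1..q-1} \<Longrightarrow> l \<in> {1..q-1} \<Longrightarrow> F' (delta_vec k) (delta_vec l) = 1" for k l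
      using coc by (simp only: same[symmetric] d)
    show "\<alpha> \<in> Q_lat M q \<Longrightarrow> \<gamma> \<in> Gamma_bar M q \<Longrightarrow> F \<alpha> \<gamma> = F' \<alpha> \<gamma>" for \<alpha> \<gamma>
      by (rule same)
  qed (rule assms)
  show ?thesis
    using superrepresentation_rho assignments_rho unique_rho by blast
qed

end
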